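(* Let $1<p<+\infty$, $\varepsilon_0>0$, $\lambda>0$, and let $a\in L^\infty(\mathbb{R}_+\times(0,1))$ be such that $a\ge 0$ and $a\ge\lambda>0$ in $\mathbb{R}_+\times(x_0-\varepsilon_0,x_0+\varepsilon_0)\subset\mathbb{R}_+\times(0,1)$ for some $x_0\in(0,1)$. There exist positive constants $C$ and $\gamma$ depending only on $p$, $\|a\|_{L^\infty(\mathbb{R}_+\times(0,1))}$, $\varepsilon_0$, and $\lambda$ such that for all $u_0\in W^{1,p}(0,1)$ and $u_1\in L^p(0,1)$, the unique weak solution $u\in C([0,+\infty);W^{1,p}(0,1))\cap C^1([0,+\infty);L^p(0,1))$ of $$\begin{cases}\partial_{tt}u-\partial_{xx}u+a\,\partial_t u=0 & \text{in }\mathbb{R}_+\times(0,1),\\ \partial_xu(t,0)=\partial_xu(t,1)=0 & \text{for } t\ge 0,\\ u(0,\cdot)=u_0,\quad \partial_t u(0,\cdot)=u_1 & \text{on }(0,1),\end{cases}$$ satisfies $$\|\partial_t u(t,\cdot)\|_{L^p(0,1)}+\|\partial_x u(t,\cdot)\|_{L^p(0,1)}\le C e^{-\gamma t}\Big(\|u_1\|_{L^p(0,1)}+\|\partial_x u_0\|_{L^p(0,1)}\Big),\qquad t\ge 0.$$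
   Context: $\mathbb{R}_+=(0,+\infty)$. Weak solution: for $T>0$, a function $u\in C([0,T];W^{1,p}(0,1))\cap C^1([0,T];L^p(0,1))$ is a weak solution, up to time $T$, of the Neumann problem consisting of the equation $\partial_{tt}u-\partial_{xx}u+a\,\partial_t u=0$ in $(0,T)\times(0,1)$, the boundary condition $\partial_xu(t,0)=\partial_xu(t,1)=0$ for $t\in(0,T)$, and the initial conditions $u(0,\cdot)=u_0$, $\partial_t u(0,\cdot)=u_1$ on $(0,1)$, if $u(0,\cdot)=u_0$ and $\partial_t u(0,\cdot)=u_1$ in $(0,1)$, and for every $v\in C^1([0,1])$, $$\frac{d^2}{dt^2}\int_0^1 u(t,x)v(x)\,dx+\int_0^1 u_x(t,x)v_x(x)\,dx+\int_0^1 a(t,x)u_t(t,x)v(x)\,dx=0$$ in the sense of distributions on $(0,T)$. A weak solution on $[0,+\infty)$ is a function whose restriction to $[0,T]$ is a weak solution up to time $T$ for every $T>0$. *)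

theory Defs
  imports "HOL-Analysis.Analysis" "HOL-Probability.Essential_Supremum"
begin

text \<open>
  Elements of Lebesgue and Sobolev spaces are represented by functions, and equality in these
  spaces is equality almost everywhere. A function \<open>u\<close> of time with values in such
  a space is curried: \<open>u t\<close> is a representative of \<open>u(t,.)\<close>. No
  compatibility between the representatives at different times is required.
\<close>

abbreviation leb01 :: "real measure" where
  "leb01 \<equiv> lebesgue_on {0<..<1}"

definition Lp :: "real \<Rightarrow> (real \<Rightarrow> real) set" where
  "Lp p = {f. f \<in> borel_measurable leb01 \<and> integrable leb01 (\<lambda>x. \<bar>f x\<bar> powr p)}"

text \<open>Only meaningful on \<open>Lp p\<close>: outside of it the Bochner integral may be the default
  value \<open>0\<close>.\<close>

definition Lp_norm :: "real \<Rightarrow> (real \<Rightarrow> real) \<Rightarrow> real" where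
  "Lp_norm p f = (LINT x|leb01. \<bar>f x\<bar> powr p) powr (1 / p)"

definition test_functions :: "real set \<Rightarrow> (real \<Rightarrow> real) set" where
  "test_functions U = {\<phi>. (\<forall>n. (deriv ^^ n) \<phi> differentiable_on UNIV) \<and>
     compact (closure {x. \<phi> x \<noteq> 0}) \<and> closure {x. \<phi> x \<noteq> 0} \<subseteq> U}"

definition loc_integrable01 :: "(real \<Rightarrow> real) \<Rightarrow> bool" where
  "loc_integrable01 f \<longleftrightarrow> (\<forall>K. compact K \<and> K \<subseteq> {0<..<1} \<longrightarrow> integrable (lebesgue_on K) f)"

definition has_weak_dx :: "(real \<Rightarrow> real) \<Rightarrow> (real \<Rightarrow> real) \<Rightarrow> bool" where
  "has_weak_dx f g \<longleftrightarrow> loc_integrable01 f \<and> loc_integrable01 g \<and>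
     (\<forall>\<phi>\<in>test_functions {0<..<1}.
        (LINT x|leb01. f x * deriv \<phi> x) = - (LINT x|leb01. g x * \<phi> x))"

text \<open>A representative of the weak derivative, which is unique up to null sets.\<close>

definition weak_dx :: "(real \<Rightarrow> real) \<Rightarrow> real \<Rightarrow> real" where
  "weak_dx f = (SOME g. has_weak_dx f g)"

definition W1p :: "real \<Rightarrow> (real \<Rightarrow> real) set" where
  "W1p p = {f \<in> Lp p. \<exists>g\<in>Lp p. has_weak_dx f g}"

definition W1p_norm :: "real \<Rightarrow> (real \<Rightarrow> real) \<Rightarrow> real" where
  "W1p_norm p f = Lp_norm p f + Lp_norm p (weak_dx f)"

definition C_W1p :: "real \<Rightarrow> real set \<Rightarrow> (real \<Rightarrow> real \<Rightarrow> real) set" where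
  "C_W1p p I = {u. (\<forall>t\<in>I. u t \<in> W1p p) \<and>
     (\<forall>t\<in>I. ((\<lambda>s. W1p_norm p (\<lambda>x. u s x - u t x)) \<longlongrightarrow> 0) (at t within I))}"

definition C_Lp :: "real \<Rightarrow> real set \<Rightarrow> (real \<Rightarrow> real \<Rightarrow> real) set" where
  "C_Lp p I = {w. (\<forall>t\<in>I. w t \<in> Lp p) \<and>
     (\<forall>t\<in>I. ((\<lambda>s. Lp_norm p (\<lambda>x. w s x - w t x)) \<longlongrightarrow> 0) (at t within I))}"

text \<open>Differentiability at time \<open>t\<close> relative to the time interval \<open>I\<close>, for the
  \<open>L\<^sup>p\<close> norm; at an end point of \<open>I\<close> the derivative is one-sided.\<close>

definition has_Lp_dt ::
  "real \<Rightarrow> real set \<Rightarrow> (real \<Rightarrow> real \<Rightarrow> real) \<Rightarrow> real \<Rightarrow> (real \<Rightarrow> real) \<Rightarrow> bool" where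
  "has_Lp_dt p I u t w \<longleftrightarrow> w \<in> Lp p \<and> (\<forall>s\<in>I. u s \<in> Lp p) \<and>
     ((\<lambda>s. Lp_norm p (\<lambda>x. (u s x - u t x) / (s - t) - w x)) \<longlongrightarrow> 0) (at t within I)"

definition C1_Lp :: "real \<Rightarrow> real set \<Rightarrow> (real \<Rightarrow> real \<Rightarrow> real) set" where
  "C1_Lp p I = {u. \<exists>w\<in>C_Lp p I. \<forall>t\<in>I. has_Lp_dt p I u t (w t)}"

text \<open>A representative of the time derivative, which is unique up to null sets when
  \<open>I\<close> is a non-degenerate interval.\<close>

definition Lp_dt ::
  "real \<Rightarrow> real set \<Rightarrow> (real \<Rightarrow> real \<Rightarrow> real) \<Rightarrow> real \<Rightarrow> real \<Rightarrow> real" where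
  "Lp_dt p I u t = (SOME w. has_Lp_dt p I u t w)"

text \<open>The equation is tested against \<open>\<phi>(t)\<close> and \<open>v(x)\<close>; the distributional second time
  derivative falls on \<open>\<phi>\<close>. The test functions \<open>v\<close> are \<open>C\<^sup>1\<close> up to the boundary and need not
  vanish there, which encodes the Neumann boundary condition.\<close>

definition weak_solution_upto ::
  "real \<Rightarrow> (real \<times> real \<Rightarrow> real) \<Rightarrow> (real \<Rightarrow> real) \<Rightarrow> (real \<Rightarrow> real) \<Rightarrow> real
     \<Rightarrow> (real \<Rightarrow> real \<Rightarrow> real) \<Rightarrow> bool" where
  "weak_solution_upto p a u0 u1 T u \<longleftrightarrow>
     u \<in> C_W1p p {0..T} \<inter> C1_Lp p {0..T} \<and>
     (AE x in leb01. u 0 x = u0 x) \<and>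
     (AE x in leb01. Lp_dt p {0..T} u 0 x = u1 x) \<and>
     (\<forall>v v'. (\<forall>x\<in>{0..1}. (v has_real_derivative v' x) (at x within {0..1})) \<longrightarrow>
        continuous_on {0..1} v' \<longrightarrow>
        (\<forall>\<phi>\<in>test_functions {0<..<T}.
          (LINT t|lebesgue_on {0<..<T}. deriv (deriv \<phi>) t * (LINT x|leb01. u t x * v x))
        + (LINT t|lebesgue_on {0<..<T}. \<phi> t * (LINT x|leb01. weak_dx (u t) x * v' x))
        + (LINT t|lebesgue_on {0<..<T}.
             \<phi> t * (LINT x|leb01. a (t, x) * Lp_dt p {0..T} u t x * v x)) = 0))"

definition weak_solution ::
  "real \<Rightarrow> (real \<times> real \<Rightarrow> real) \<Rightarrow> (real \<Rightarrow> real) \<Rightarrow> (real \<Rightarrow> real)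
     \<Rightarrow> (real \<Rightarrow> real \<Rightarrow> real) \<Rightarrow> bool" where
  "weak_solution p a u0 u1 u \<longleftrightarrow> (\<forall>T>0. weak_solution_upto p a u0 u1 T u)"

definition Linf :: "'a::euclidean_space set \<Rightarrow> ('a \<Rightarrow> real) set" where
  "Linf Q = {a. a \<in> borel_measurable (lebesgue_on Q) \<and>
     esssup (lebesgue_on Q) (\<lambda>z. ereal \<bar>a z\<bar>) < \<infinity>}"

definition Linf_norm :: "'a::euclidean_space set \<Rightarrow> ('a \<Rightarrow> real) \<Rightarrow> real" where
  "Linf_norm Q a = real_of_ereal (esssup (lebesgue_on Q) (\<lambda>z. ereal \<bar>a z\<bar>))"

end

theory Submission imports Defs "HOL-Real_Asymp.Real_Asymp" begin

text \<open>
 The equation is an ordinary differential equation along characteristics. Extend the space variable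
 to the circle of length 2 by reflection, \<open>u\<close> and the damping evenly; this turns the Neumann condition
 into symmetry. With \<open>u\<^sub>x\<close> extended oddly, the function \<open>g(t,y) = (u\<^sub>t + u\<^sub>x)(t, y - t)\<close> carries both
 derivatives, \<open>u\<^sub>t(t,x)\<close> and \<open>u\<^sub>x(t,x)\<close> being half the sum and half the difference of \<open>g(t,t+x)\<close>
 and \<open>g(t,t-x)\<close>, and it solves \<open>\<partial>\<^sub>t g(t,y) = - b(t,y-t) (g(t,y) + g(t,2t-y)) / 2\<close>.
 This system makes sense for every measurable bounded \<open>b\<close>, and all of the decay is proved for it.

 The reflection \<open>y \<mapsto> 2t - y\<close> pairs the two terms of the damping, so by convexity the integral of
 \<open>|g|\<^sup>p\<close> decreases, and what it loses is the work of the damping (\<open>energy_dissipation\<close>). Over one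
 period that work controls the whole energy (\<open>observability\<close>): where the damping acts, the sum
 \<open>g(s,s+x) + g(s,s-x)\<close> is small, and \<open>g\<close> itself changes little in time if the damping does little
 work. Hence \<open>G(z+2x) + G(z)\<close> is small for all \<open>x\<close> in an interval, \<open>G\<close> being \<open>g\<close> at the initial time;
 two such sums give differences of \<open>G\<close> for small shifts, chaining small shifts gives the difference
 for the shift \<open>2x\<close>, and the sum and the difference together bound \<open>G\<close> (\<open>shift_cancellation\<close>).
 So the energy shrinks by a fixed factor in each time interval of length 2 (\<open>energy_contraction\<close>).

 A solution \<open>g\<close> comes from monotone Picard iterations for its two signs (\<open>evolution_exists\<close>); integrating
 \<open>u\<^sub>t\<close> in time gives a function that is a weak solution (\<open>displacement_weak_solution\<close>).
 Uniqueness holds among all weak solutions: the cosine coefficients of a difference of two solutions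
 satisfy Duhamel's formula, whose linear combinations express the propagation of the equation
 for every trigonometric polynomial; the Weierstrass theorem extends the resulting bound to all
 continuous functions, and Gronwall's inequality finishes the proof (\<open>solutions_equal\<close>).
\<close>

section \<open>Notation\<close>

abbreviation borel_fun :: "('a::topological_space => 'b::topological_space) set" where
 "borel_fun \<equiv> borel_measurable borel"

abbreviation joint_borel :: "(real \<times> real => 'b::topological_space) set" where
 "joint_borel \<equiv> borel_measurable (borel \<Otimes>\<^sub>M borel)"

abbreviation I01 :: "real set" where
 "I01 \<equiv> {0<..<1}"

abbreviation circ :: "real set" where
 "circ \<equiv> {0..<2}"

abbreviation epow :: "real => real => ennreal" where
 "epow p z \<equiv> ennreal (\<bar>z\<bar> powr p)"

section \<open>Powers and convexity\<close>

definition spow :: "real => real => real" where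
 "spow p z = sgn z * \<bar>z\<bar> powr (p - 1)"

text \<open>A convex \<open>\<psi>\<close> with a selection \<open>\<phi>\<close> of its subdifferential. This is all that the chain rule needs, so truncated powers require no differentiation.\<close>

definition subgradient :: "(real => real) => (real => real) => bool" where
 "subgradient \<psi> \<phi> \<longleftrightarrow> (\<forall>a b. \<psi> b + \<phi> b * (a - b) <= \<psi> a)"

lemma spow_minus [simp]: "spow p (- z) = - spow p z"
 by (simp add: spow_def sgn_minus)

lemma abs_spow: "\<bar>spow p z\<bar> = \<bar>z\<bar> powr (p - 1)"
 by (cases "z = 0") (auto simp: spow_def abs_mult abs_sgn_eq)

lemma abs_powr_Suc: "1 < p ==> \<bar>z\<bar> powr (p - 1) * \<bar>z\<bar> = \<bar>z::real\<bar> powr p"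
 by (cases "z = 0") (auto simp: powr_mult_base powr_diff)

lemma spow_mult_self: "1 < p ==> spow p z * z = \<bar>z\<bar> powr p"
proof -
 assume "1 < p"
 have "spow p z * z = \<bar>z\<bar> powr (p - 1) * \<bar>z\<bar>"
  by (auto simp: spow_def sgn_if)
 with abs_powr_Suc[OF \<open>1 < p\<close>] show ?thesis by simp
qed

lemma continuous_on_spow: "1 < p ==> continuous_on UNIV (spow p)"
proof -
 assume p: "1 < p"
 have "spow p = (\<lambda>z. max 0 z powr (p - 1) - max 0 (- z) powr (p - 1))"
  by (rule ext) (auto simp: spow_def sgn_if max_def)
 moreover have "continuous_on UNIV (\<lambda>z::real. max 0 z powr (p - 1) - max 0 (- z) powr (p - 1))"
  using p by (intro continuous_intros continuous_on_powr') auto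
 ultimately show ?thesis by simp
qed

lemma borel_measurable_spow [measurable]: "spow p \<in> borel_fun"
 unfolding spow_def [abs_def] by measurable

lemma powr_young:
 fixes a c p :: real assumes p: "1 < p"
 shows "p * (\<bar>c\<bar> powr (p - 1) * \<bar>a\<bar>) <= \<bar>a\<bar> powr p + (p - 1) * \<bar>c\<bar> powr p"
proof -
 define q where "q = p / (p - 1)"
 have q: "1 < q" "1 / p + 1 / q = 1" using p by (auto simp: q_def field_simps)
 have "\<bar>a\<bar> * \<bar>c\<bar> powr (p - 1) <= \<bar>a\<bar> powr p / p + (\<bar>c\<bar> powr (p - 1)) powr q / q"
  by (rule Youngs_inequality) (use p q in auto)
 also have "(\<bar>c\<bar> powr (p - 1)) powr q = \<bar>c\<bar> powr p"
  using p by (simp add: powr_powr q_def)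
 finally have "p * (\<bar>a\<bar> * \<bar>c\<bar> powr (p - 1)) <= p * (\<bar>a\<bar> powr p / p + \<bar>c\<bar> powr p / q)"
  using p by simp
 also have "... = \<bar>a\<bar> powr p + (p - 1) * \<bar>c\<bar> powr p"
  using p by (simp add: q_def field_simps)
 finally show ?thesis by (simp add: mult.commute)
qed

lemma subgradient_powr:
 assumes p: "1 < p"
 shows "subgradient (\<lambda>z. \<bar>z\<bar> powr p) (\<lambda>z. p * spow p z)"
 unfolding subgradient_def
proof (intro allI)
 fix a c :: real
 have "spow p c * a <= \<bar>spow p c\<bar> * \<bar>a\<bar>" by (metis abs_ge_self abs_mult)
 also have "... = \<bar>c\<bar> powr (p - 1) * \<bar>a\<bar>" by (simp add: abs_spow)
 finally have "p * (spow p c * a) <= p * (\<bar>c\<bar> powr (p - 1) * \<bar>a\<bar>)" using p by simp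
 also have "... <= \<bar>a\<bar> powr p + (p - 1) * \<bar>c\<bar> powr p" by (rule powr_young[OF p])
 finally show "\<bar>c\<bar> powr p + p * spow p c * (a - c) <= \<bar>a\<bar> powr p"
  using spow_mult_self[OF p, of c] by (simp add: algebra_simps)
qed

lemma subgradient_square: "subgradient (\<lambda>z. z\<^sup>2) (\<lambda>z. 2 * z)"
 unfolding subgradient_def
proof (intro allI)
 fix a b :: real
 have "0 <= (a - b)\<^sup>2" by simp
 then show "b\<^sup>2 + 2 * b * (a - b) <= a\<^sup>2" by (simp add: power2_eq_square algebra_simps)
qed

lemma subgradient_mono:
 assumes "subgradient \<psi> \<phi>"
 shows "0 <= (\<phi> b - \<phi> a) * (b - a)"
proof -
 have "\<psi> b + \<phi> b * (a - b) <= \<psi> a" "\<psi> a + \<phi> a * (b - a) <= \<psi> b"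
  using assms unfolding subgradient_def by blast+
 then show ?thesis by (simp add: algebra_simps)
qed

lemma subgradient_odd_sum_nonneg:
 assumes "subgradient \<psi> \<phi>" and "!!z. \<phi> (- z) = - \<phi> z"
 shows "0 <= (\<phi> s + \<phi> r) * (s + r)"
 using subgradient_mono[OF assms(1), of s "- r"] assms(2)[of r] by simp

definition cut :: "real => real => real" where
 "cut N z = max (- N) (min N z)"

text \<open>The power \<open>|z|\<^sup>p\<close>, continued affinely outside \<open>[-N,N]\<close>. It is convex with a bounded subgradient, so that its integrals along an \<open>L\<^sup>1\<close> evolution are finite.\<close>

definition cut_powr :: "real => real => real => real" where
 "cut_powr p N z = \<bar>cut N z\<bar> powr p + p * spow p (cut N z) * (z - cut N z)"

lemma cut_minus: "0 <= N ==> cut N (- z) = - cut N z"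
 by (auto simp: cut_def max_def min_def)

lemma abs_cut_le: "0 <= N ==> \<bar>cut N z\<bar> <= N"
 by (auto simp: cut_def)

lemma cut_eq: "\<bar>z\<bar> <= N ==> cut N z = z"
 by (auto simp: cut_def)

lemma borel_measurable_cut [measurable]: "cut N \<in> borel_fun"
 unfolding cut_def [abs_def] by measurable

lemma borel_measurable_cut_powr [measurable]: "cut_powr p N \<in> borel_fun"
 unfolding cut_powr_def [abs_def] by measurable

lemma subgradient_cut_powr:
 assumes p: "1 < p" and N: "0 <= N"
 shows "subgradient (cut_powr p N) (\<lambda>z. p * spow p (cut N z))"
 unfolding subgradient_def
proof (intro allI)
 fix a b :: real
 let ?c = "cut N b" and ?d = "cut N a"
 note sg = subgradient_powr[OF p]
 have 1: "\<bar>?c\<bar> powr p + p * spow p ?c * (?d - ?c) <= \<bar>?d\<bar> powr p"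
  using sg unfolding subgradient_def by blast
 have mono: "0 <= (p * spow p x - p * spow p y) * (x - y)" for x y
  using subgradient_mono[OF sg] by blast
 have 2: "p * spow p ?c * (a - ?d) <= p * spow p ?d * (a - ?d)"
 proof -
  consider "a = ?d" | "a > ?d" "?d = N" | "a < ?d" "?d = - N"
   using N unfolding cut_def by linarith
  then show ?thesis
  proof cases
   case 2
   have "?c <= ?d" using abs_cut_le[OF N, of b] 2 by linarith
   then have "p * spow p ?c <= p * spow p ?d"
    using mono[of ?d ?c] by (cases "?c = ?d") (auto simp: zero_le_mult_iff)
   then show ?thesis using 2 by (intro mult_right_mono) auto
  next
   case 3
   have "?d <= ?c" using abs_cut_le[OF N, of b] 3 by linarith
   then have "p * spow p ?d <= p * spow p ?c"
    using mono[of ?c ?d] by (cases "?c = ?d") (auto simp: zero_le_mult_iff)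
   then show ?thesis using 3 by (intro mult_right_mono_neg) auto
  qed auto
 qed
 show "cut_powr p N b + p * spow p (cut N b) * (a - b) <= cut_powr p N a"
  using 1 2 by (simp add: cut_powr_def algebra_simps)
qed

lemma cut_powr_le:
 assumes p: "1 < p" and N: "0 <= N"
 shows "cut_powr p N z <= \<bar>z\<bar> powr p"
 using subgradient_powr[OF p] unfolding subgradient_def cut_powr_def by blast

lemma cut_powr_nonneg:
 assumes p: "1 < p" and N: "0 <= N"
 shows "0 <= cut_powr p N z"
proof -
 have "cut_powr p N 0 + p * spow p (cut N 0) * (z - 0) <= cut_powr p N z"
  using subgradient_cut_powr[OF p N] unfolding subgradient_def by blast
 moreover have "cut N 0 = 0" using N by (simp add: cut_def)
 ultimately show ?thesis by (simp add: cut_powr_def spow_def)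
qed

lemma cut_powr_eq: "\<bar>z\<bar> <= N ==> cut_powr p N z = \<bar>z\<bar> powr p"
 by (simp add: cut_powr_def cut_eq)

lemma abs_spow_cut_le:
 assumes "1 < p" "0 <= N"
 shows "\<bar>spow p (cut N z)\<bar> <= N powr (p - 1)"
 unfolding abs_spow using abs_cut_le[OF assms(2)] assms by (intro powr_mono2) auto

lemma abs_add_powr_le:
 fixes x y p :: real assumes p: "1 < p"
 shows "\<bar>x + y\<bar> powr p <= 2 powr p * (\<bar>x\<bar> powr p + \<bar>y\<bar> powr p)"
proof -
 let ?m = "max \<bar>x\<bar> \<bar>y\<bar>"
 have "\<bar>x + y\<bar> powr p <= (2 * ?m) powr p" using p by (intro powr_mono2) auto
 also have "... = 2 powr p * ?m powr p" by (simp add: powr_mult)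
 also have "?m powr p <= \<bar>x\<bar> powr p + \<bar>y\<bar> powr p" by (auto simp: max_def)
 finally show ?thesis by (simp add: mult_left_mono)
qed

lemma abs_diff_powr_le:
 fixes x y p :: real assumes p: "1 < p"
 shows "\<bar>x - y\<bar> powr p <= 2 powr p * (\<bar>x\<bar> powr p + \<bar>y\<bar> powr p)"
 using abs_add_powr_le[OF p, of x "- y"] by simp

lemma abs_le_one_plus_powr: "1 < p ==> \<bar>x::real\<bar> <= 1 + \<bar>x\<bar> powr p"
proof (cases "\<bar>x\<bar> <= 1")
 case False
 assume "1 < p"
 then have "\<bar>x\<bar> powr 1 <= \<bar>x\<bar> powr p" using False by (intro powr_mono) auto
 then show ?thesis using False by simp
qed (use powr_ge_zero[of "\<bar>x\<bar>" p] in linarith)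

text \<open>If \<open>s + r\<close> is a small fraction of the larger of \<open>|s|\<close> and \<open>|r|\<close>, the term with \<open>\<eta>\<close> suffices. Otherwise the monotonicity of \<open>spow\<close> is quantitative.\<close>

lemma powr_dissipation_bound:
 fixes p \<eta> :: real assumes p: "1 < p" and \<eta>: "0 < \<eta>"
 shows "\<exists>C>0. \<forall>s r. \<bar>s + r\<bar> powr p
   <= C * ((spow p s + spow p r) * (s + r)) + \<eta> * (\<bar>s\<bar> powr p + \<bar>r\<bar> powr p)"
proof -
 define k where "k = min (\<eta> powr (1 / p)) (1 / 2)"
 define k' where "k' = 1 - (1 - k) powr (p - 1)"
 have k: "0 < k" "k < 1" using \<eta> by (auto simp: k_def)
 have kp: "k powr p <= \<eta>"
 proof -
  have "k powr p <= (\<eta> powr (1 / p)) powr p"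
   using k p by (intro powr_mono2) (auto simp: k_def)
  also have "... = \<eta>" using \<eta> p by (simp add: powr_powr)
  finally show ?thesis .
 qed
 have k': "0 < k'"
 proof -
  have "(1 - k) powr (p - 1) < 1 powr (p - 1)" using k p by (intro powr_less_mono2) auto
  then show ?thesis by (simp add: k'_def)
 qed
 define C where "C = 2 powr p / (k * k')"
 have C: "0 < C" using k k' by (simp add: C_def)
 have nonneg: "0 <= (spow p s + spow p r) * (s + r)" for s r
 proof -
  have "0 <= (p * spow p s + p * spow p r) * (s + r)"
   by (rule subgradient_odd_sum_nonneg[OF subgradient_powr[OF p]]) simp
  also have "... = p * ((spow p s + spow p r) * (s + r))" by (simp add: algebra_simps)
  finally show ?thesis using p by (simp add: zero_le_mult_iff)
 qed
 have main: "\<bar>s + r\<bar> powr p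
   <= C * ((spow p s + spow p r) * (s + r)) + \<eta> * (\<bar>s\<bar> powr p + \<bar>r\<bar> powr p)"
  if sr: "\<bar>r\<bar> <= s" for s r
 proof (cases "s + r <= k * s")
  case True
  have "\<bar>s + r\<bar> powr p <= (k * s) powr p"
   using True sr p by (intro powr_mono2) auto
  also have "... = k powr p * \<bar>s\<bar> powr p" using k sr by (simp add: powr_mult)
  also have "... <= \<eta> * \<bar>s\<bar> powr p" using kp by (intro mult_right_mono) auto
  also have "... <= \<eta> * (\<bar>s\<bar> powr p + \<bar>r\<bar> powr p)" using \<eta> by simp
  finally show ?thesis using mult_nonneg_nonneg[OF less_imp_le[OF C] nonneg[of s r]] by linarith
 next
  case False
  then have s: "0 < s" using sr by (cases "s = 0") auto
  have r: "- r <= (1 - k) * s" using False by (simp add: algebra_simps)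
  have "- spow p r <= ((1 - k) * s) powr (p - 1)"
  proof (cases "0 <= r")
   case True then show ?thesis by (simp add: spow_def order_trans[OF _ powr_ge_zero])
  next
   case False
   then have "- spow p r = (- r) powr (p - 1)" by (simp add: spow_def)
   also have "... <= ((1 - k) * s) powr (p - 1)" using False r p by (intro powr_mono2) auto
   finally show ?thesis .
  qed
  also have "... = (1 - k') * s powr (p - 1)" using k s by (simp add: powr_mult k'_def)
  finally have 1: "k' * s powr (p - 1) <= spow p s + spow p r"
   using s by (simp add: spow_def algebra_simps)
  have "\<bar>s + r\<bar> powr p <= (2 * s) powr p" using sr p by (intro powr_mono2) auto
  also have "... = 2 powr p * (s powr (p - 1) * s)"
   using s abs_powr_Suc[OF p, of s] by (simp add: powr_mult)
  also have "... = C * ((k' * s powr (p - 1)) * (k * s))"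
   using k k' by (simp add: C_def field_simps)
  also have "... <= C * ((spow p s + spow p r) * (s + r))"
  proof (intro mult_left_mono mult_mono 1)
   show "0 <= spow p s + spow p r"
    using 1 k' by (smt (verit) mult_nonneg_nonneg powr_ge_zero)
  qed (use False k s C in auto)
  finally show ?thesis using \<eta> by (smt (verit) mult_nonneg_nonneg powr_ge_zero)
 qed
 have "\<bar>s + r\<bar> powr p
   <= C * ((spow p s + spow p r) * (s + r)) + \<eta> * (\<bar>s\<bar> powr p + \<bar>r\<bar> powr p)" for s r
 proof -
  consider "\<bar>r\<bar> <= s" | "\<bar>r\<bar> <= - s" | "\<bar>s\<bar> <= r" | "\<bar>s\<bar> <= - r" by linarith
  then show ?thesis
  proof cases
   case 2 then show ?thesis using main[of "- r" "- s"]
    by (simp add: algebra_simps abs_minus_commute)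
  next
   case 3 then show ?thesis using main[of s r] by (simp add: add.commute)
  next
   case 4 then show ?thesis using main[of "- s" "- r"]
    by (simp add: algebra_simps abs_minus_commute)
  qed (rule main)
 qed
 with C show ?thesis by blast
qed

section \<open>Lebesgue measure on a set of reals\<close>

text \<open>The density is used instead of a restricted measure space because the \<open>\<sigma>\<close>-algebra then does not depend on the set: functions are Borel functions on the whole line, whatever they are integrated over.\<close>

definition lb :: "real set => real measure" where
 "lb A = density lborel (indicator A)"

text \<open>The nonnegative integral with respect to Lebesgue measure over a set of reals.\<close>

syntax
 "_nn_integral_lb" :: "pttrn => real set => ennreal => ennreal" ("(2NINT _|_./ _)" [0,60,10] 10)
translations
 "NINT x|A. f" \<rightharpoonup> "CONST nn_integral (CONST lb A) (\<lambda>x. f)"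

lemma sets_lb [simp, measurable_cong]: "sets (lb A) = sets borel"
 by (simp add: lb_def)

lemma space_lb [simp]: "space (lb A) = UNIV"
 by (simp add: lb_def)

lemma measurable_lb [simp]: "measurable (lb A) M = measurable borel M" "measurable M (lb A) = measurable M borel"
 by (auto intro!: measurable_cong_sets)

lemma nn_integral_lb:
 assumes [measurable]: "A \<in> sets borel" "f \<in> borel_fun"
 shows "(NINT x|A. f x) = (\<integral>\<^sup>+x. f x * indicator A x \<partial>lborel)"
 unfolding lb_def by (subst nn_integral_density) (auto simp: mult.commute)

lemma emeasure_lb: "A \<in> sets borel ==> emeasure (lb A) UNIV = emeasure lborel A"
 unfolding lb_def by (subst emeasure_density) auto

lemma measure_lb: "A \<in> sets borel ==> measure (lb A) UNIV = measure lborel A"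
 by (simp add: measure_def emeasure_lb)

lemma AE_lb: "A \<in> sets borel ==> (AE x in lb A. P x) \<longleftrightarrow> (AE x in lborel. x \<in> A --> P x)"
 unfolding lb_def by (subst AE_density) (auto simp: indicator_def)

lemma AE_lb_subset:
 assumes "AE x in lb A. P x" "B \<subseteq> A" "A \<in> sets borel" "B \<in> sets borel"
 shows "AE x in lb B. P x"
 using assms by (auto simp: AE_lb elim!: eventually_mono)

lemma finite_measure_lb:
 assumes "A \<in> sets borel" "bounded A"
 shows "finite_measure (lb A)"
 using assms emeasure_bounded_finite[of A]
 by (intro finite_measureI) (auto simp: emeasure_lb)

lemma sigma_finite_lb: "A \<in> sets borel ==> sigma_finite_measure (lb A)"
 unfolding lb_def by (subst sigma_finite_measure.sigma_finite_iff_density_finite[OF sigma_finite_lborel])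
  (auto simp: indicator_def)

lemma pair_sigma_finite_lb:
 "A \<in> sets borel ==> B \<in> sets borel ==> pair_sigma_finite (lb A) (lb B)"
 by (simp add: pair_sigma_finite_def sigma_finite_lb)

lemma sets_lb_pair [measurable_cong]: "sets (lb A \<Otimes>\<^sub>M lb B) = sets (borel \<Otimes>\<^sub>M borel)"
 by (rule sets_pair_measure_cong) auto

lemma nn_integral_lb_measurable [measurable (raw)]:
 assumes "A \<in> sets borel" "case_prod f \<in> borel_measurable (N \<Otimes>\<^sub>M borel)"
 shows "(\<lambda>x. NINT y|A. f x y) \<in> borel_measurable N"
proof -
 interpret sigma_finite_measure "lb A" by (rule sigma_finite_lb) fact
 have "sets (N \<Otimes>\<^sub>M lb A) = sets (N \<Otimes>\<^sub>M borel)" by (rule sets_pair_measure_cong) auto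
 then have "borel_measurable (N \<Otimes>\<^sub>M lb A) = borel_measurable (N \<Otimes>\<^sub>M borel)"
  by (rule measurable_cong_sets) (rule refl)
 with assms(2) have "case_prod f \<in> borel_measurable (N \<Otimes>\<^sub>M lb A)" by metis
 then show ?thesis by (rule borel_measurable_nn_integral)
qed

lemma integral_lb_measurable [measurable (raw)]:
 fixes f :: "_ => _ => real"
 assumes "A \<in> sets borel" "case_prod f \<in> borel_measurable (N \<Otimes>\<^sub>M borel)"
 shows "(\<lambda>x. LINT y|lb A. f x y) \<in> borel_measurable N"
proof -
 interpret sigma_finite_measure "lb A" by (rule sigma_finite_lb) fact
 have "sets (N \<Otimes>\<^sub>M lb A) = sets (N \<Otimes>\<^sub>M borel)" by (rule sets_pair_measure_cong) auto
 then have "borel_measurable (N \<Otimes>\<^sub>M lb A) = borel_measurable (N \<Otimes>\<^sub>M borel)"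
  by (rule measurable_cong_sets) (rule refl)
 with assms(2) have "case_prod f \<in> borel_measurable (N \<Otimes>\<^sub>M lb A)" by metis
 then show ?thesis by (rule borel_measurable_lebesgue_integral)
qed

lemma Fubini_lb_nn:
 assumes "A \<in> sets borel" "B \<in> sets borel" "case_prod f \<in> joint_borel"
 shows "(NINT x|A. (NINT y|B. f x y)) = (NINT y|B. (NINT x|A. f x y))"
proof -
 interpret pair_sigma_finite "lb A" "lb B" using assms by (intro pair_sigma_finite_lb)
 have "case_prod f \<in> borel_measurable (lb A \<Otimes>\<^sub>M lb B)"
  using assms(3) measurable_cong_sets[OF sets_lb_pair refl] by metis
 from Fubini'[OF this] show ?thesis by simp
qed

lemma integrable_lb_pair:
 fixes f :: "real => real => real"
 assumes "A \<in> sets borel" "B \<in> sets borel" "case_prod f \<in> joint_borel"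
  and fin: "(NINT x|A. (NINT y|B. ennreal \<bar>f x y\<bar>)) < \<infinity>"
 shows "integrable (lb A \<Otimes>\<^sub>M lb B) (case_prod f)"
proof (rule integrableI_bounded)
 interpret pair_sigma_finite "lb A" "lb B" using assms by (intro pair_sigma_finite_lb)
 show *: "case_prod f \<in> borel_measurable (lb A \<Otimes>\<^sub>M lb B)"
  using assms(3) measurable_cong_sets[OF sets_lb_pair refl] by metis
 have "(\<integral>\<^sup>+z. ennreal (norm (case_prod f z)) \<partial>(lb A \<Otimes>\<^sub>M lb B))
   = (NINT x|A. (NINT y|B. ennreal \<bar>f x y\<bar>))"
  using * by (subst M2.nn_integral_fst[symmetric]) auto
 then show "(\<integral>\<^sup>+z. ennreal (norm (case_prod f z)) \<partial>(lb A \<Otimes>\<^sub>M lb B)) < \<infinity>"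
  using fin by simp
qed

lemma Fubini_lb:
 fixes f :: "real => real => real"
 assumes "A \<in> sets borel" "B \<in> sets borel" "integrable (lb A \<Otimes>\<^sub>M lb B) (case_prod f)"
 shows "(LINT x|lb A. (LINT y|lb B. f x y)) = (LINT y|lb B. (LINT x|lb A. f x y))"
  and "integrable (lb A) (\<lambda>x. LINT y|lb B. f x y)"
  and "integrable (lb B) (\<lambda>y. LINT x|lb A. f x y)"
  and "AE x in lb A. integrable (lb B) (\<lambda>y. f x y)"
  and "AE y in lb B. integrable (lb A) (\<lambda>x. f x y)"
proof -
 interpret pair_sigma_finite "lb A" "lb B" using assms by (intro pair_sigma_finite_lb)
 show "(LINT x|lb A. (LINT y|lb B. f x y)) = (LINT y|lb B. (LINT x|lb A. f x y))"
  using Fubini_integral[OF assms(3)] by simp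
 show "integrable (lb A) (\<lambda>x. LINT y|lb B. f x y)"
  using integrable_fst'[OF assms(3)] by simp
 show "integrable (lb B) (\<lambda>y. LINT x|lb A. f x y)"
  using integrable_snd[OF assms(3)] by simp
 show "AE x in lb A. integrable (lb B) (\<lambda>y. f x y)"
  using AE_integrable_fst'[OF assms(3)] by simp
 show "AE y in lb B. integrable (lb A) (\<lambda>x. f x y)"
  using AE_integrable_snd[OF assms(3)] by simp
qed

lemma integrable_lb_iff:
 fixes f :: "real => real"
 assumes [measurable]: "A \<in> sets borel" "f \<in> borel_fun"
 shows "integrable (lb A) f \<longleftrightarrow> set_integrable lborel A f"
proof -
 have "lb A = density lborel (\<lambda>x. ennreal (indicator A x))" unfolding lb_def by (rule arg_cong[where f = "density lborel"]) (auto simp: indicator_def)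
 then show ?thesis
  unfolding set_integrable_def by (simp add: integrable_density)
qed

lemma integral_lb:
 fixes f :: "real => real"
 assumes [measurable]: "A \<in> sets borel" "f \<in> borel_fun"
 shows "integral\<^sup>L (lb A) f = (LINT x:A|lborel. f x)"
proof -
 have "lb A = density lborel (\<lambda>x. ennreal (indicator A x))" unfolding lb_def by (rule arg_cong[where f = "density lborel"]) (auto simp: indicator_def)
 then show ?thesis
  unfolding set_lebesgue_integral_def by (simp add: integral_density)
qed

lemma integrable_lb_measurable: "integrable (lb A) f ==> f \<in> borel_fun"
 using borel_measurable_integrable[of "lb A" f] by simp

lemma integrable_lb_subset:
 fixes f :: "real => real"
 assumes f: "integrable (lb A) f" and "A \<in> sets borel" "B \<in> sets borel" "B \<subseteq> A"
 shows "integrable (lb B) f"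
 using assms integrable_lb_measurable[OF f]
 by (auto simp: integrable_lb_iff intro: set_integrable_subset)

lemma integral_lb_HK:
 fixes f :: "real => real"
 assumes f: "integrable (lb {a..b}) f"
 shows "f integrable_on {a..b}" "integral\<^sup>L (lb {a..b}) f = integral {a..b} f"
 using f set_borel_integral_eq_integral[of "{a..b}" f] integrable_lb_measurable[OF f]
 by (auto simp: integrable_lb_iff integral_lb)

lemma integral_lb_split:
 fixes f :: "real => real"
 assumes f: "integrable (lb {a..c}) f" and "a <= b" "b <= c"
 shows "integral\<^sup>L (lb {a..c}) f = integral\<^sup>L (lb {a..b}) f + integral\<^sup>L (lb {b..c}) f"
proof -
 have "integrable (lb {a..b}) f" "integrable (lb {b..c}) f"
  using assms by (auto intro: integrable_lb_subset[OF f])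
 then show ?thesis
  using Henstock_Kurzweil_Integration.integral_combine[of a b c f] assms integral_lb_HK by auto
qed

lemma integral_lb_empty: "a \<ge> b ==> integral\<^sup>L (lb {a..b}) (f :: real => real) = 0"
proof -
 assume "a \<ge> b"
 then have "AE x in lborel. x \<notin> {a..b}"
  using AE_lborel_singleton[of a] by (auto elim!: eventually_mono)
 then have "AE x in lb {a..b}. f x = 0" by (auto simp: AE_lb elim!: eventually_mono)
 then show ?thesis by (simp add: integral_eq_zero_AE)
qed

lemma integrable_lb_bounded:
 fixes f :: "real => real"
 assumes "A \<in> sets borel" "bounded A" "f \<in> borel_fun" "!!x. x \<in> A ==> \<bar>f x\<bar> <= K"
 shows "integrable (lb A) f"
proof -
 interpret finite_measure "lb A" using assms by (intro finite_measure_lb)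
 show ?thesis
  using assms by (intro integrable_const_bound[of f K]) (auto simp: AE_lb)
qed

lemma integrable_lb_mult_bounded:
 fixes f g :: "real => real"
 assumes f: "integrable (lb A) f" and g: "g \<in> borel_fun"
  and A: "A \<in> sets borel" and K: "!!x. x \<in> A ==> \<bar>g x\<bar> <= K"
 shows "integrable (lb A) (\<lambda>x. g x * f x)"
proof (rule Bochner_Integration.integrable_bound)
 show "integrable (lb A) (\<lambda>x. K * \<bar>f x\<bar>)" using f by auto
 show "(\<lambda>x. g x * f x) \<in> borel_measurable (lb A)"
  using g integrable_lb_measurable[OF f] by auto
 have "\<bar>g x\<bar> * \<bar>f x\<bar> <= \<bar>K\<bar> * \<bar>f x\<bar>" if "x \<in> A" for x
  using K[OF that] by (intro mult_right_mono) auto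
 then show "AE x in lb A. norm (g x * f x) <= norm (K * \<bar>f x\<bar>)"
  using A by (simp add: AE_lb abs_mult)
qed

lemma nn_integral_lb_mono_set:
 assumes "A \<subseteq> B" "A \<in> sets borel" "B \<in> sets borel" "f \<in> borel_fun"
 shows "(NINT x|A. f x) <= (NINT x|B. f x)"
 using assms by (auto simp: nn_integral_lb intro!: nn_integral_mono split: split_indicator)

lemma power_integral_le:
 fixes f :: "real => real"
 assumes p: "1 < p" and st: "s <= t" and f: "integrable (lb {s..t}) f"
 shows "epow p (integral\<^sup>L (lb {s..t}) f)
   <= ennreal ((t - s) powr (p - 1)) * (NINT x|{s..t}. epow p (f x))"
proof (cases "s = t")
 case True
 then show ?thesis using p integral_lb_empty[of t t f] by simp
next
 case False
 with st have st: "s < t" by simp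
 interpret finite_measure "lb {s..t}" by (rule finite_measure_lb) auto
 let ?I = "integral\<^sup>L (lb {s..t}) f"
 have [measurable]: "f \<in> borel_fun" by (rule integrable_lb_measurable[OF f])
 define m where "m = ?I / (t - s)"
 show ?thesis
 proof (cases "(NINT x|{s..t}. epow p (f x)) = \<infinity>")
  case True
  then show ?thesis using st by (simp add: ennreal_mult_top)
 next
  case False
  then have int: "integrable (lb {s..t}) (\<lambda>x. \<bar>f x\<bar> powr p)"
   by (intro integrableI_nonneg) (auto simp: less_top)
  have "(LINT x|lb {s..t}. \<bar>m\<bar> powr p + p * spow p m * (f x - m))
    <= (LINT x|lb {s..t}. \<bar>f x\<bar> powr p)"
   using subgradient_powr[OF p] f int
   by (intro integral_mono) (auto simp: subgradient_def)
  also have "(LINT x|lb {s..t}. \<bar>m\<bar> powr p + p * spow p m * (f x - m))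
    = (t - s) * \<bar>m\<bar> powr p + p * spow p m * (?I - (t - s) * m)"
   using f st by (simp add: measure_lb algebra_simps)
  also have "?I - (t - s) * m = 0" using st by (simp add: m_def)
  finally have "(t - s) * \<bar>m\<bar> powr p <= (LINT x|lb {s..t}. \<bar>f x\<bar> powr p)" by simp
  then have "(t - s) powr (p - 1) * ((t - s) * \<bar>m\<bar> powr p)
    <= (t - s) powr (p - 1) * (LINT x|lb {s..t}. \<bar>f x\<bar> powr p)"
   by (rule mult_left_mono) simp
  also have "(t - s) powr (p - 1) * ((t - s) * \<bar>m\<bar> powr p) = \<bar>?I\<bar> powr p"
  proof -
   have "(t - s) powr (p - 1) * (t - s) = (t - s) powr p"
    using abs_powr_Suc[OF p, of "t - s"] st by simp
   then have "(t - s) powr (p - 1) * ((t - s) * \<bar>m\<bar> powr p) = (t - s) powr p * \<bar>m\<bar> powr p"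
    by (metis mult.assoc)
   also have "... = \<bar>(t - s) * m\<bar> powr p" using st by (simp add: powr_mult abs_mult)
   also have "(t - s) * m = ?I" using st by (simp add: m_def)
   finally show ?thesis .
  qed
  finally have "epow p (?I)
    <= ennreal ((t - s) powr (p - 1) * (LINT x|lb {s..t}. \<bar>f x\<bar> powr p))"
   by (rule ennreal_leI)
  then show ?thesis
   using int by (simp add: ennreal_mult nn_integral_eq_integral)
 qed
qed

section \<open>Periodic functions\<close>

lemma nn_integral_lb_shift:
 assumes [measurable]: "F \<in> borel_fun"
 shows "(NINT y|{a..<b}. F (y + c)) = (NINT y|{a + c..<b + c}. F y)"
proof -
 have "(NINT y|{a + c..<b + c}. F y) = (\<integral>\<^sup>+y. F y * indicator {a + c..<b + c} y \<partial>lborel)"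
  by (simp add: nn_integral_lb)
 also have "... = (\<integral>\<^sup>+y. F (c + 1 * y) * indicator {a + c..<b + c} (c + 1 * y) \<partial>lborel)"
  by (subst nn_integral_real_affine[where c = 1 and t = c]) auto
 also have "... = (\<integral>\<^sup>+y. F (y + c) * indicator {a..<b} y \<partial>lborel)"
  by (intro nn_integral_cong) (auto split: split_indicator simp: add.commute)
 finally show ?thesis by (simp add: nn_integral_lb)
qed

lemma nn_integral_lb_reflect:
 assumes [measurable]: "F \<in> borel_fun"
 shows "(NINT y|{a..<b}. F (c - y)) = (NINT y|{c - b..<c - a}. F y)"
proof -
 have "(NINT y|{a..<b}. F (c - y)) = (\<integral>\<^sup>+y. F (c - y) * indicator {a..<b} y \<partial>lborel)"
  by (simp add: nn_integral_lb)
 also have "... = (\<integral>\<^sup>+y. F (c - (c + (-1) * y)) * indicator {a..<b} (c + (-1) * y) \<partial>lborel)"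
  by (subst nn_integral_real_affine[where c = "-1" and t = c]) auto
 also have "... = (\<integral>\<^sup>+y. F y * indicator {c - b..<c - a} y \<partial>lborel)"
 proof (intro nn_integral_cong_AE)
  show "AE y in lborel. F (c - (c + (-1) * y)) * indicator {a..<b} (c + (-1) * y)
    = F y * indicator {c - b..<c - a} y"
   using AE_lborel_singleton[of "c - a"] AE_lborel_singleton[of "c - b"]
   by eventually_elim (auto split: split_indicator)
 qed
 finally show ?thesis by (simp add: nn_integral_lb)
qed

lemma nn_integral_lb_Ico_split:
 assumes [measurable]: "F \<in> borel_fun" and "a <= b" "b <= c"
 shows "(NINT y|{a..<c}. F y) = (NINT y|{a..<b}. F y) + (NINT y|{b..<c}. F y)"
proof -
 have "(\<integral>\<^sup>+y. F y * indicator {a..<c} y \<partial>lborel)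
   = (\<integral>\<^sup>+y. F y * indicator {a..<b} y + F y * indicator {b..<c} y \<partial>lborel)"
  using assms(2,3) by (intro nn_integral_cong) (auto split: split_indicator)
 then show ?thesis by (simp add: nn_integral_lb nn_integral_add)
qed

lemma periodic_int:
 fixes F :: "real => 'a"
 assumes "!!y. F (y + 2) = F y"
 shows "F (y + 2 * of_int k) = F y"
proof (induction k rule: int_induct[where k = 0])
 case (step1 i)
 have "F (y + 2 * of_int (i + 1)) = F ((y + 2 * of_int i) + 2)" by (simp add: algebra_simps)
 then show ?case using assms step1 by metis
next
 case (step2 i)
 have "F (y + 2 * of_int i) = F ((y + 2 * of_int (i - 1)) + 2)" by (simp add: algebra_simps)
 then show ?case using assms step2 by metis
qed simp

lemma circle_shift:
 assumes F [measurable]: "F \<in> borel_fun" and per: "!!y::real. F (y + 2) = F y"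
 shows "(NINT y|circ. F (y + c)) = (NINT y|circ. F y)"
proof -
 define k where "k = \<lfloor>c / 2\<rfloor>"
 define d where "d = c - 2 * of_int k"
 have d: "0 <= d" "d < 2"
  unfolding d_def k_def by linarith+
 have "F (y + c) = F (y + d)" for y
  using periodic_int[of F "y + d" k] per by (simp add: d_def)
 then have "(NINT y|circ. F (y + c)) = (NINT y|{d..<2 + d}. F y)"
  using nn_integral_lb_shift[of F 0 2 d] by simp
 also have "... = (NINT y|{d..<2}. F y) + (NINT y|{2..<2 + d}. F y)"
  using d by (intro nn_integral_lb_Ico_split) auto
 also have "(NINT y|{2..<2 + d}. F y) = (NINT y|{0..<d}. F y)"
  using nn_integral_lb_shift[of F 0 d 2] per by (simp add: add.commute)
 also have "(NINT y|{d..<2}. F y) + ... = (NINT y|circ. F y)"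
  using d nn_integral_lb_Ico_split[of F 0 d 2] by (simp add: add.commute)
 finally show ?thesis .
qed

lemma circle_reflect:
 assumes F [measurable]: "F \<in> borel_fun" and per: "!!y::real. F (y + 2) = F y"
 shows "(NINT y|circ. F (c - y)) = (NINT y|circ. F y)"
 using nn_integral_lb_reflect[of F 0 2 c] nn_integral_lb_shift[of F 0 2 "c - 2"]
  circle_shift[of F "c - 2"] per by simp

lemma circle_split:
 assumes F [measurable]: "F \<in> borel_fun" and per: "!!y::real. F (y + 2) = F y"
 shows "(NINT y|circ. F y) = (NINT y|I01. F y + F (- y))"
proof -
 have eq: "(NINT y|{0..<1}. h y) = (NINT y|I01. h y)"
  if [measurable]: "h \<in> borel_fun" for h :: "real => ennreal"
  unfolding nn_integral_lb[of "{0..<1}" h, simplified] nn_integral_lb[of "I01" h, simplified]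
  using AE_lborel_singleton[of 0]
  by (intro nn_integral_cong_AE) (auto split: split_indicator elim!: eventually_mono)
 have "F (2 - y) = F (- y)" for y using per[of "- y"] by (simp add: algebra_simps)
 then have "(NINT y|{0..<1}. F (- y)) = (NINT y|{1..<2}. F y)"
  using nn_integral_lb_reflect[of F 0 1 2] by simp
 then show ?thesis
  using nn_integral_lb_Ico_split[of F 0 1 2]
  by (simp add: eq[symmetric] nn_integral_add)
qed

lemma circle_integral_split:
 fixes F :: "real => real"
 assumes F: "integrable (lb circ) F" and per: "!!y::real. F (y + 2) = F y"
 shows "integrable (lb I01) (\<lambda>y. F y + F (- y))"
  and "(LINT y|lb circ. F y) = (LINT y|lb I01. F y + F (- y))"
proof -
 have [measurable]: "F \<in> borel_fun" by (rule integrable_lb_measurable[OF F])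
 have 1: "(NINT y|circ. ennreal (\<bar>F y\<bar>))
   = (NINT y|I01. ennreal \<bar>F y\<bar> + ennreal \<bar>F (- y)\<bar>)"
  using circle_split[of "\<lambda>y. ennreal \<bar>F y\<bar>"] per by simp
 have fin: "(NINT y|circ. ennreal (\<bar>F y\<bar>)) < \<infinity>"
  using F by (simp add: integrable_iff_bounded)
 have ints: "integrable (lb I01) F" "integrable (lb I01) (\<lambda>y. F (- y))"
  using fin unfolding 1
  by (auto simp: integrable_iff_bounded nn_integral_add)
 then show "integrable (lb I01) (\<lambda>y. F y + F (- y))" by simp
 have pos: "enn2real (NINT y|circ. ennreal (G y))
   = enn2real (NINT y|I01. ennreal (G y)) + enn2real (NINT y|I01. ennreal (G (- y)))"
  if "G = F \<or> G = (\<lambda>y. - F y)" for G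
 proof -
  have [measurable]: "G \<in> borel_fun" using that by auto
  have "(NINT y|I01. ennreal (G y)) < \<infinity>" "(NINT y|I01. ennreal (G (- y))) < \<infinity>"
   using ints that integrableD(2)[of "lb I01" G] integrableD(2)[of "lb I01" "\<lambda>y. G (- y)"]
   by (auto simp: less_top)
  then show ?thesis
   using circle_split[of "\<lambda>y. ennreal (G y)"] per that
   by (auto simp: nn_integral_add enn2real_plus)
 qed
 show "(LINT y|lb circ. F y) = (LINT y|lb I01. F y + F (- y))"
  using ints F pos[of F] pos[of "\<lambda>y. - F y"]
  by (simp add: real_lebesgue_integral_def)
qed

lemma circle_integral_reflect:
 fixes F :: "real => real"
 assumes F: "F \<in> borel_fun" and per: "!!y::real. F (y + 2) = F y"
 shows "(LINT y|lb circ. F (c - y)) = (LINT y|lb circ. F y)"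
  and "integrable (lb circ) (\<lambda>y. F (c - y)) \<longleftrightarrow> integrable (lb circ) F"
proof -
 have [measurable]: "F \<in> borel_fun" by fact
 have nn: "(NINT y|circ. ennreal (G (c - y))) = (NINT y|circ. ennreal (G y))"
  if "G = F \<or> G = (\<lambda>y. - F y) \<or> G = (\<lambda>y. \<bar>F y\<bar>)" for G
  using that circle_reflect[of "\<lambda>y. ennreal (G y)" c] per by auto
 show iff: "integrable (lb circ) (\<lambda>y. F (c - y)) \<longleftrightarrow> integrable (lb circ) F"
  using nn[of "\<lambda>y. \<bar>F y\<bar>"] by (simp add: integrable_iff_bounded)
 show "(LINT y|lb circ. F (c - y)) = (LINT y|lb circ. F y)"
 proof (cases "integrable (lb circ) F")
  case True
  then show ?thesis using iff nn[of F] nn[of "\<lambda>y. - F y"] by (simp add: real_lebesgue_integral_def)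
 next
  case False
  then show ?thesis using iff by (simp add: not_integrable_integral_eq)
 qed
qed

lemma circle_integral_shift:
 fixes F :: "real => real"
 assumes F: "F \<in> borel_fun" and per: "!!y::real. F (y + 2) = F y"
 shows "(LINT y|lb circ. F (y + c)) = (LINT y|lb circ. F y)"
  and "integrable (lb circ) (\<lambda>y. F (y + c)) \<longleftrightarrow> integrable (lb circ) F"
proof -
 have 1: "F (- (y + 2)) = F (- y)" for y using per[of "- (y + 2)"] by simp
 have 2: "(\<lambda>y. F (- y)) \<in> borel_fun" using F by simp
 have "(LINT y|lb circ. F (- (- c - y))) = (LINT y|lb circ. F (- y))"
  using circle_integral_reflect(1)[of "\<lambda>y. F (- y)" "- c"] 1 2 by blast
 moreover have "(LINT y|lb circ. F (0 - y)) = (LINT y|lb circ. F y)"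
  using circle_integral_reflect(1)[of F 0] per F by blast
 ultimately show "(LINT y|lb circ. F (y + c)) = (LINT y|lb circ. F y)"
  by (simp add: add.commute)
 have "integrable (lb circ) (\<lambda>y. F (- (- c - y))) = integrable (lb circ) (\<lambda>y. F (- y))"
  using circle_integral_reflect(2)[of "\<lambda>y. F (- y)" "- c"] 1 2 by blast
 moreover have "integrable (lb circ) (\<lambda>y. F (0 - y)) = integrable (lb circ) F"
  using circle_integral_reflect(2)[of F 0] per F by blast
 ultimately show "integrable (lb circ) (\<lambda>y. F (y + c)) \<longleftrightarrow> integrable (lb circ) F"
  by (simp add: add.commute)
qed

section \<open>Absolutely continuous functions\<close>

text \<open>The weak derivative \<open>k\<close> is part of the relation. Measurability of \<open>F\<close> on the whole line is included because \<open>F\<close> is integrated in a second variable later.\<close>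

definition AC_on :: "real => real => (real => real) => (real => real) => bool" where
 "AC_on r T F k \<longleftrightarrow> F \<in> borel_fun \<and> integrable (lb {r..T}) k \<and>
   (\<forall>t\<in>{r..T}. F t = F r + (LINT s|lb {r..t}. k s))"

lemma AC_onD:
 assumes "AC_on r T F k"
 shows "F \<in> borel_fun" "integrable (lb {r..T}) k"
  "t \<in> {r..T} ==> F t = F r + (LINT s|lb {r..t}. k s)"
 using assms unfolding AC_on_def by blast+

lemma AC_on_diff:
 assumes AC: "AC_on r T F k" and "r <= s" "s <= t" "t <= T"
 shows "F t - F s = (LINT x|lb {s..t}. k x)" "integrable (lb {s..t}) k"
proof -
 have i: "integrable (lb {r..T}) k" using AC by (simp add: AC_on_def)
 have "integrable (lb {r..t}) k" using assms by (intro integrable_lb_subset[OF i]) auto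
 then have "(LINT x|lb {r..t}. k x) = (LINT x|lb {r..s}. k x) + (LINT x|lb {s..t}. k x)"
  using assms by (intro integral_lb_split) auto
 moreover have "F t = F r + (LINT x|lb {r..t}. k x)" "F s = F r + (LINT x|lb {r..s}. k x)"
  using AC[unfolded AC_on_def, THEN conjunct2, THEN conjunct2, THEN bspec, of t]
   AC[unfolded AC_on_def, THEN conjunct2, THEN conjunct2, THEN bspec, of s] assms(2-4) by simp_all
 ultimately show "F t - F s = (LINT x|lb {s..t}. k x)" by simp
 show "integrable (lb {s..t}) k" using assms by (intro integrable_lb_subset[OF i]) auto
qed

lemma AC_on_continuous:
 assumes AC: "AC_on r T F k"
 shows "continuous_on {r..T} F"
proof -
 have i: "integrable (lb {r..T}) k" using AC by (simp add: AC_on_def)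
 have "continuous_on {r..T} (\<lambda>t. F r + integral {r..t} k)"
  by (intro continuous_intros indefinite_integral_continuous_1 integral_lb_HK(1)[OF i])
 moreover have "F r + integral {r..t} k = F t" if "t \<in> {r..T}" for t
 proof -
  have "integrable (lb {r..t}) k" using that by (intro integrable_lb_subset[OF i]) auto
  then show ?thesis using AC_onD(3)[OF AC that] integral_lb_HK(2)[of r t k] by simp
 qed
 ultimately show ?thesis by (rule continuous_on_eq)
qed

text \<open>On a short interval, the subgradient inequalities at both end points squeeze the increment of \<open>\<psi> \<circ> F\<close>, and uniform continuity of \<open>\<phi> \<circ> F\<close> compares the bounds with the integral, up to a small multiple of the variation of \<open>F\<close>.\<close>

lemma AC_on_chain_rule:
 assumes AC: "AC_on r T F k" and rT: "r <= T"
  and \<phi>: "continuous_on UNIV \<phi>" and sg: "subgradient \<psi> \<phi>"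
 shows "integrable (lb {r..T}) (\<lambda>s. \<phi> (F s) * k s)"
  and "\<psi> (F T) - \<psi> (F r) = (LINT s|lb {r..T}. \<phi> (F s) * k s)"
proof -
 have k: "integrable (lb {r..T}) k" and [measurable]: "F \<in> borel_fun"
  using AC by (auto simp: AC_on_def)
 have [measurable]: "\<phi> \<in> borel_fun" "k \<in> borel_fun"
  using \<phi> integrable_lb_measurable[OF k] by (auto intro: borel_measurable_continuous_onI)
 have cont: "continuous_on {r..T} (\<lambda>s. \<phi> (F s))"
  by (rule continuous_on_compose2[OF \<phi> AC_on_continuous[OF AC]]) auto
 have "compact ((\<lambda>s. \<phi> (F s)) ` {r..T})" by (rule compact_continuous_image[OF cont]) simp
 then have "bounded ((\<lambda>s. \<phi> (F s)) ` {r..T})" by (rule compact_imp_bounded)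
 then obtain K where "\<forall>s\<in>{r..T}. \<bar>\<phi> (F s)\<bar> <= K"
  unfolding bounded_iff by auto
 then have K: "!!s. s \<in> {r..T} ==> \<bar>\<phi> (F s)\<bar> <= K" by blast
 show int: "integrable (lb {r..T}) (\<lambda>s. \<phi> (F s) * k s)"
  by (rule integrable_lb_mult_bounded[OF k _ _ K]) auto
 define g where "g t = \<psi> (F t) - (LINT s|lb {r..t}. \<phi> (F s) * k s)" for t
 define w where "w t = (LINT s|lb {r..t}. \<bar>k s\<bar>)" for t
 have ki: "integrable (lb {r..T}) (\<lambda>s. \<bar>k s\<bar>)" using k by simp
 have w0: "0 <= w T" by (simp add: w_def)
 have small: "\<bar>g T - g r\<bar> <= e * w T" if e: "0 < e" for e
 proof -
  have "uniformly_continuous_on {r..T} (\<lambda>s. \<phi> (F s))"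
   by (rule compact_uniformly_continuous[OF cont]) simp
  then obtain d where d: "d > 0" and dd: "!!s t. s \<in> {r..T} ==> t \<in> {r..T} ==> \<bar>t - s\<bar> < d
    ==> \<bar>\<phi> (F t) - \<phi> (F s)\<bar> < e"
   using e unfolding uniformly_continuous_on_def dist_real_def by metis
  have loc: "\<bar>g t - g s\<bar> <= e * (w t - w s)" if st: "r <= s" "s <= t" "t <= T" "t - s < d" for s t
  proof -
   have ks: "integrable (lb {s..t}) k" using st by (intro integrable_lb_subset[OF k]) auto
   have pk: "integrable (lb {s..t}) (\<lambda>s. \<phi> (F s) * k s)"
    using st by (intro integrable_lb_subset[OF int]) auto
   have ir: "integrable (lb {r..t}) (\<lambda>s. \<phi> (F s) * k s)"
    using st by (intro integrable_lb_subset[OF int]) auto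
   have kr: "integrable (lb {r..t}) (\<lambda>s. \<bar>k s\<bar>)"
    using st by (intro integrable_lb_subset[OF ki]) auto
   have g: "g t - g s = \<psi> (F t) - \<psi> (F s) - (LINT x|lb {s..t}. \<phi> (F x) * k x)"
    using integral_lb_split[OF ir, of s] st by (simp add: g_def)
   have w: "w t - w s = (LINT x|lb {s..t}. \<bar>k x\<bar>)"
    using integral_lb_split[OF kr, of s] st by (simp add: w_def)
   have F: "F t - F s = (LINT x|lb {s..t}. k x)" by (rule AC_on_diff[OF AC]) (use st in auto)
   have est: "\<bar>\<phi> (F u) * (F t - F s) - (LINT x|lb {s..t}. \<phi> (F x) * k x)\<bar> <= e * (w t - w s)"
    if u: "u \<in> {s..t}" for u
   proof -
    have "\<phi> (F u) * (F t - F s) - (LINT x|lb {s..t}. \<phi> (F x) * k x)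
      = (LINT x|lb {s..t}. (\<phi> (F u) - \<phi> (F x)) * k x)"
     using ks pk unfolding F by (simp add: algebra_simps)
    also have "\<bar>...\<bar> <= (LINT x|lb {s..t}. \<bar>(\<phi> (F u) - \<phi> (F x)) * k x\<bar>)"
     using integral_norm_bound[of "lb {s..t}" "\<lambda>x. (\<phi> (F u) - \<phi> (F x)) * k x"] by simp
    also have "... <= (LINT x|lb {s..t}. e * \<bar>k x\<bar>)"
    proof (rule integral_mono_AE)
     have "integrable (lb {s..t}) (\<lambda>x. (\<phi> (F u) - \<phi> (F x)) * k x)"
      using ks pk by (simp add: algebra_simps)
     then show "integrable (lb {s..t}) (\<lambda>x. \<bar>(\<phi> (F u) - \<phi> (F x)) * k x\<bar>)" by simp
     show "AE x in lb {s..t}. \<bar>(\<phi> (F u) - \<phi> (F x)) * k x\<bar> <= e * \<bar>k x\<bar>"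
     proof (subst AE_lb, simp, rule AE_I2, rule impI)
      fix x assume x: "x \<in> {s..t}"
      have "\<bar>\<phi> (F u) - \<phi> (F x)\<bar> < e" using u x st by (intro dd) auto
      then show "\<bar>(\<phi> (F u) - \<phi> (F x)) * k x\<bar> <= e * \<bar>k x\<bar>"
       by (simp add: abs_mult mult_right_mono)
     qed
    qed (use ks in auto)
    also have "... = e * (w t - w s)" by (simp add: w)
    finally show ?thesis .
   qed
   have "\<phi> (F s) * (F t - F s) <= \<psi> (F t) - \<psi> (F s)" "\<psi> (F t) - \<psi> (F s) <= \<phi> (F t) * (F t - F s)"
    using sg[unfolded subgradient_def, rule_format, of "F s" "F t"]
     sg[unfolded subgradient_def, rule_format, of "F t" "F s"] by (auto simp: algebra_simps)
   then show ?thesis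
    using est[of s] est[of t] st unfolding g by (auto simp: abs_le_iff)
  qed
  obtain n :: nat where n: "(T - r) / d < real n" using reals_Archimedean2 by blast
  then have n0: "0 < real n" using rT d by (smt (verit) divide_nonneg_pos)
  define h where "h = (T - r) / real n"
  have h: "0 <= h" "h < d" using n n0 d rT by (auto simp: h_def field_simps)
  have "\<bar>g (r + real i * h) - g r\<bar> <= e * (w (r + real i * h) - w r)" if "i <= n" for i
   using that
  proof (induction i)
   case (Suc i)
   let ?s = "r + real i * h" and ?t = "r + real (Suc i) * h"
   have "real (Suc i) * h <= real n * h" using Suc.prems h by (intro mult_right_mono) auto
   then have "?t <= T" using n0 by (simp add: h_def)
   moreover have "r <= ?s" using h by simp
   moreover have "?t - ?s = h" by (simp add: algebra_simps)
   ultimately have "\<bar>g ?t - g ?s\<bar> <= e * (w ?t - w ?s)" using h by (intro loc) auto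
   moreover have "\<bar>g ?s - g r\<bar> <= e * (w ?s - w r)" using Suc by simp
   ultimately show ?case by (simp add: right_diff_distrib)
  qed simp
  from this[of n] n0 have "\<bar>g T - g r\<bar> <= e * (w T - w r)" by (simp add: h_def)
  moreover have "w r = 0" unfolding w_def by (rule integral_lb_empty) simp
  ultimately show ?thesis by simp
 qed
 have "\<bar>g T - g r\<bar> <= 0"
 proof (rule field_le_epsilon)
  fix e :: real assume e: "0 < e"
  have "\<bar>g T - g r\<bar> <= e / (w T + 1) * w T" using e w0 by (intro small) auto
  also have "... <= e" using e w0 by (simp add: field_simps)
  finally show "\<bar>g T - g r\<bar> <= 0 + e" by simp
 qed
 then show "\<psi> (F T) - \<psi> (F r) = (LINT s|lb {r..T}. \<phi> (F s) * k s)"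
  using integral_lb_empty[of r r "\<lambda>s. \<phi> (F s) * k s"] by (simp add: g_def)
qed

lemma AC_on_add:
 assumes F: "AC_on r T F k" and H: "AC_on r T H h"
 shows "AC_on r T (\<lambda>t. F t + H t) (\<lambda>t. k t + h t)"
 unfolding AC_on_def
proof (intro conjI ballI)
 fix t assume t: "t \<in> {r..T}"
 then have t': "r <= r" "r <= t" "t <= T" by auto
 show "F t + H t = F r + H r + (LINT s|lb {r..t}. k s + h s)"
  using AC_on_diff[OF F t'] AC_on_diff[OF H t'] by simp
qed (use AC_onD(1,2)[OF F] AC_onD(1,2)[OF H] in auto)

lemma AC_on_cmult:
 assumes F: "AC_on r T F k"
 shows "AC_on r T (\<lambda>t. c * F t) (\<lambda>t. c * k t)"
 unfolding AC_on_def
proof (intro conjI ballI)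
 fix t assume t: "t \<in> {r..T}"
 then have t': "r <= r" "r <= t" "t <= T" by auto
 have "c * (F t - F r) = c * (LINT s|lb {r..t}. k s)"
  using AC_on_diff(1)[OF F t'] by simp
 then show "c * F t = c * F r + (LINT s|lb {r..t}. c * k s)" by (simp add: algebra_simps)
qed (use AC_onD(1,2)[OF F] in auto)

lemma AC_on_subinterval:
 assumes F: "AC_on r T F k" and "T' <= T"
 shows "AC_on r T' F k"
proof -
 have "integrable (lb {r..T'}) k" using assms(2) by (intro integrable_lb_subset[OF AC_onD(2)[OF F]]) auto
 moreover have "F t = F r + (LINT s|lb {r..t}. k s)" if "t \<in> {r..T'}" for t
  by (rule AC_onD(3)[OF F]) (use that assms(2) in auto)
 ultimately show ?thesis unfolding AC_on_def using AC_onD(1)[OF F] by blast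
qed

text \<open>Polarization: the product is a combination of squares, and the square has a subgradient.\<close>

lemma AC_on_mult:
 assumes F: "AC_on r T F k" and H: "AC_on r T H h" and rT: "r <= T"
 shows "integrable (lb {r..T}) (\<lambda>s. k s * H s + F s * h s)"
  and "F T * H T - F r * H r = (LINT s|lb {r..T}. k s * H s + F s * h s)"
proof -
 have H': "AC_on r T (\<lambda>t. - 1 * H t) (\<lambda>t. - 1 * h t)" by (rule AC_on_cmult[OF H])
 note s = AC_on_chain_rule[OF AC_on_add[OF F H] rT _ subgradient_square]
 note d = AC_on_chain_rule[OF AC_on_add[OF F H'] rT _ subgradient_square]
 let ?f = "\<lambda>t. (2 * (F t + H t) * (k t + h t) - 2 * (F t + - 1 * H t) * (k t + - 1 * h t)) / 4"
 have e: "?f = (\<lambda>s. k s * H s + F s * h s)" by (rule ext) (simp add: algebra_simps)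
 have c: "continuous_on UNIV (\<lambda>z::real. 2 * z)" by (intro continuous_intros)
 have i: "integrable (lb {r..T}) ?f"
  using s(1)[OF c] d(1)[OF c] by (intro integrable_divide Bochner_Integration.integrable_diff)
 then show "integrable (lb {r..T}) (\<lambda>s. k s * H s + F s * h s)" unfolding e .
 have "(LINT t|lb {r..T}. ?f t)
   = ((LINT t|lb {r..T}. 2 * (F t + H t) * (k t + h t)) - (LINT t|lb {r..T}. 2 * (F t + - 1 * H t) * (k t + - 1 * h t))) / 4"
  using s(1)[OF c] d(1)[OF c] by simp
 also have "... = F T * H T - F r * H r"
  unfolding s(2)[OF c, symmetric] d(2)[OF c, symmetric] by (simp add: power2_eq_square field_simps)
 finally show "F T * H T - F r * H r = (LINT s|lb {r..T}. k s * H s + F s * h s)"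
  unfolding e by simp
qed

lemma AC_on_C1:
 assumes "!!t. t \<in> {r..T} ==> (F has_real_derivative k t) (at t within {r..T})"
  and "continuous_on {r..T} k" "F \<in> borel_fun" "k \<in> borel_fun"
 shows "AC_on r T F k"
 unfolding AC_on_def
proof (intro conjI ballI)
 have "compact (k ` {r..T})" by (rule compact_continuous_image[OF assms(2)]) simp
 then have "bounded (k ` {r..T})" by (rule compact_imp_bounded)
 then obtain K where "\<forall>s\<in>{r..T}. \<bar>k s\<bar> <= K"
  unfolding bounded_iff by auto
 then have "!!s. s \<in> {r..T} ==> \<bar>k s\<bar> <= K" by blast
 then show i: "integrable (lb {r..T}) k" by (intro integrable_lb_bounded[OF _ _ assms(4)]) auto
 fix t assume t: "t \<in> {r..T}"
 have "(k has_integral F t - F r) {r..t}"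
 proof (rule fundamental_theorem_of_calculus)
  fix x assume "x \<in> {r..t}"
  then have "(F has_real_derivative k x) (at x within {r..t})"
   using t by (intro DERIV_subset[OF assms(1)]) auto
  then show "(F has_vector_derivative k x) (at x within {r..t})"
   by (simp add: has_real_derivative_iff_has_vector_derivative)
 qed (use t in auto)
 moreover have "integrable (lb {r..t}) k" using t by (intro integrable_lb_subset[OF i]) auto
 ultimately show "F t = F r + (LINT s|lb {r..t}. k s)"
  by (simp add: integral_lb_HK(2) integral_unique)
qed (rule assms(3))

section \<open>Evolution along characteristics\<close>

lemma measurable_compose2:
 assumes "case_prod F \<in> borel \<Otimes>\<^sub>M borel \<rightarrow>\<^sub>M K" "f \<in> N \<rightarrow>\<^sub>M borel" "g \<in> N \<rightarrow>\<^sub>M borel"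
 shows "(\<lambda>z. F (f z) (g z)) \<in> N \<rightarrow>\<^sub>M K"
 using measurable_compose[OF measurable_Pair[OF assms(2,3)] assms(1)] by simp

lemma nn_integral_lb_upto_measurable:
 assumes [measurable]: "case_prod K \<in> joint_borel"
 shows "(\<lambda>(t, y). NINT s|{0..t::real}. K s y) \<in> borel_measurable (borel \<Otimes>\<^sub>M (borel :: real measure))"
proof -
 note [measurable (raw)] = measurable_compose2[OF assms]
 have "(NINT s|{0..t}. K s y) = (\<integral>\<^sup>+s. (if 0 <= s \<and> s <= t then K s y else 0) \<partial>lborel)" for t y
 proof -
  have "(\<lambda>s. K s y) \<in> borel_fun" by measurable
  then show ?thesis by (subst nn_integral_lb) (auto intro!: nn_integral_cong)
 qed
 then have "(\<lambda>(t, y). NINT s|{0..t}. K s y)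
   = (\<lambda>z. \<integral>\<^sup>+s. (if 0 <= s \<and> s <= fst z then K s (snd z) else 0) \<partial>lborel)"
  by (simp add: fun_eq_iff case_prod_unfold)
 also have "... \<in> joint_borel"
  by measurable
 finally show ?thesis .
qed

text \<open>The unknown is split into a positive part (\<open>\<sigma> = True\<close>) and a negative part. Since the damping enters with a minus sign, each part is driven by the other one, and both iterations increase with \<open>n\<close>. Their limits exist with values in the extended reals before any estimate is known.\<close>

fun picard :: "(real => real => real) => (real => real) => nat => bool => real => real => ennreal" where
 "picard b g0 0 \<sigma> t y = 0"
| "picard b g0 (Suc n) \<sigma> t y = ennreal (if \<sigma> then g0 y else - g0 y) +
   (NINT s|{0..t}. ennreal (b s (y - s) / 2) *
    (picard b g0 n (\<not> \<sigma>) s y + picard b g0 n (\<not> \<sigma>) s (2 * s - y)))"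

text \<open>The damping coefficient on the circle: even, and of period 2.\<close>

locale circle_damping =
 fixes b :: "real => real => real" and M p :: real
 assumes p: "1 < p"
  and b_joint: "case_prod b \<in> joint_borel"
  and b_nonneg: "!!t x. 0 <= b t x" and b_le: "!!t x. b t x <= M"
  and b_periodic: "!!t x. b t (x + 2) = b t x" and b_even: "!!t x. b t (- x) = b t x"
begin

lemma M_nonneg: "0 <= M"
 using b_nonneg[of 0 0] b_le[of 0 0] by linarith

lemma b_measurable [measurable (raw)]:
 "f \<in> borel_measurable N ==> g \<in> borel_measurable N ==> (\<lambda>z. b (f z) (g z)) \<in> borel_measurable N"
 by (rule measurable_compose2[OF b_joint])

text \<open>The point \<open>y - s\<close> is the position at time \<open>s\<close> on the characteristic labelled \<open>y\<close>, and the half sum is the velocity there.\<close>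

definition flux :: "(real => real => real) => real => real => real" where
 "flux g s y = b s (y - s) * ((g s y + g s (2 * s - y)) / 2)"

definition evolution :: "(real => real => real) => bool" where
 "evolution g \<longleftrightarrow> case_prod g \<in> joint_borel \<and>
   (\<forall>t y. g t (y + 2) = g t y) \<and>
   (AE y in lb circ. \<forall>t\<ge>0. AC_on 0 t (\<lambda>s. g s y) (\<lambda>s. - flux g s y)) \<and>
   (\<forall>T\<ge>0. (NINT s|{0..T}. (NINT y|circ. ennreal \<bar>g s y\<bar>)) < \<infinity>)"

lemma picard_joint:
 assumes [measurable]: "g0 \<in> borel_fun"
 shows "case_prod (picard b g0 n \<sigma>) \<in> joint_borel"
proof (induction n arbitrary: \<sigma>)
 case (Suc n)
 note [measurable (raw)] = measurable_compose2[OF Suc]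
 have K: "case_prod (\<lambda>s y. ennreal (b s (y - s) / 2) *
    (picard b g0 n (\<not> \<sigma>) s y + picard b g0 n (\<not> \<sigma>) s (2 * s - y))) \<in> joint_borel"
  by measurable
 note [measurable] = nn_integral_lb_upto_measurable[OF K]
 have "case_prod (picard b g0 (Suc n) \<sigma>) = (\<lambda>z. ennreal (if \<sigma> then g0 (snd z) else - g0 (snd z)) +
   (case z of (t, y) => NINT s|{0..t}. ennreal (b s (y - s) / 2) *
    (picard b g0 n (\<not> \<sigma>) s y + picard b g0 n (\<not> \<sigma>) s (2 * s - y))))"
  by (auto simp: fun_eq_iff)
 also have "... \<in> joint_borel" by measurable
 finally show ?case .
qed (simp add: case_prod_unfold)

lemma picard_measurable:
 assumes "g0 \<in> borel_fun"
  "f \<in> borel_measurable N" "g \<in> borel_measurable N"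
 shows "(\<lambda>z. picard b g0 n \<sigma> (f z) (g z)) \<in> borel_measurable N"
 by (rule measurable_compose2[OF picard_joint]) fact+

lemma picard_mono: "picard b g0 n \<sigma> t y <= picard b g0 (Suc n) \<sigma> t y"
proof (induction n arbitrary: \<sigma> t y)
 case (Suc n)
 show ?case
  unfolding picard.simps(2)[of b g0 "Suc n"] picard.simps(2)[of b g0 n \<sigma> t y]
  by (intro add_left_mono nn_integral_mono mult_left_mono add_mono Suc) auto
qed simp

lemma picard_periodic:
 assumes "!!y. g0 (y + 2) = g0 y"
 shows "picard b g0 n \<sigma> t (y + 2) = picard b g0 n \<sigma> t y"
proof (induction n arbitrary: \<sigma> t y)
 case (Suc n)
 have "b s (y + 2 - s) = b s (y - s)" for s
  using b_periodic[of s "y - s"] by (simp add: algebra_simps)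
 moreover have "picard b g0 n \<sigma> s (2 * s - (y + 2)) = picard b g0 n \<sigma> s (2 * s - y)" for s \<sigma>
  using Suc[of \<sigma> s "2 * s - (y + 2)"] by simp
 ultimately show ?case using Suc assms by simp
qed simp

lemma picard_mono_time:
 assumes "g0 \<in> borel_fun" "t <= t'"
 shows "picard b g0 n \<sigma> t y <= picard b g0 n \<sigma> t' y"
proof (cases n)
 case (Suc m)
 note [measurable] = picard_measurable[OF assms(1)]
 show ?thesis using assms(2) unfolding Suc picard.simps
  by (intro add_left_mono nn_integral_lb_mono_set) auto
qed simp

definition picard_lim :: "(real => real) => bool => real => real => ennreal" where
 "picard_lim g0 \<sigma> t y = (SUP n. picard b g0 n \<sigma> t y)"

lemma picard_lim_measurable:
 assumes "g0 \<in> borel_fun"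
  "f \<in> borel_measurable N" "g \<in> borel_measurable N"
 shows "(\<lambda>z. picard_lim g0 \<sigma> (f z) (g z)) \<in> borel_measurable N"
 unfolding picard_lim_def by (intro borel_measurable_SUP picard_measurable assms) auto

lemma picard_lim_eq:
 assumes [measurable]: "g0 \<in> borel_fun"
 shows "picard_lim g0 \<sigma> t y = ennreal (if \<sigma> then g0 y else - g0 y) +
   (NINT s|{0..t}. ennreal (b s (y - s) / 2) *
    (picard_lim g0 (\<not> \<sigma>) s y + picard_lim g0 (\<not> \<sigma>) s (2 * s - y)))"
proof -
 note [measurable] = picard_measurable[OF assms]
 let ?P = "\<lambda>n. picard b g0 n (\<not> \<sigma>)"
 let ?K = "\<lambda>n s. ennreal (b s (y - s) / 2) * (?P n s y + ?P n s (2 * s - y))"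
 have inc: "incseq (\<lambda>n. ?P n s z)" for s z by (rule incseq_SucI) (rule picard_mono)
 have "picard_lim g0 \<sigma> t y = (SUP n. picard b g0 (Suc n) \<sigma> t y)"
  unfolding picard_lim_def
  by (intro SUP_eq) (use picard_mono in \<open>blast+\<close>)
 also have "... = ennreal (if \<sigma> then g0 y else - g0 y) + (SUP n. NINT s|{0..t}. ?K n s)"
  by (simp only: picard.simps ennreal_SUP_add_right[OF UNIV_not_empty])
 also have "(SUP n. NINT s|{0..t}. ?K n s) = (NINT s|{0..t}. (SUP n. ?K n s))"
 proof (rule nn_integral_monotone_convergence_SUP[symmetric])
  show "incseq ?K"
   by (intro incseq_SucI le_funI mult_left_mono add_mono picard_mono) auto
 qed auto
 also have "(\<lambda>s. SUP n. ?K n s) = (\<lambda>s. ennreal (b s (y - s) / 2) *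
   (picard_lim g0 (\<not> \<sigma>) s y + picard_lim g0 (\<not> \<sigma>) s (2 * s - y)))"
  unfolding picard_lim_def by (intro ext) (simp only: SUP_mult_left_ennreal[symmetric] ennreal_SUP_add[OF inc inc])
 finally show ?thesis .
qed

text \<open>The bound reproduces itself under the iteration, because \<open>A\<close> plus the integral of \<open>M A e\<^sup>M\<^sup>s\<close> up to \<open>t\<close> equals \<open>A e\<^sup>M\<^sup>t\<close>.\<close>

lemma picard_L1_bound:
 assumes [measurable]: "g0 \<in> borel_fun" and per: "!!y. g0 (y + 2) = g0 y"
  and A: "(NINT y|circ. ennreal \<bar>g0 y\<bar>) = ennreal A" "0 <= A" and "0 <= t"
 shows "(NINT y|circ. picard b g0 n True t y + picard b g0 n False t y) <= ennreal (A * exp (M * t))"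
 using \<open>0 <= t\<close>
proof (induction n arbitrary: t)
 case (Suc n)
 note [measurable] = picard_measurable[OF assms(1)]
 let ?S = "\<lambda>s y. picard b g0 n True s y + picard b g0 n False s y"
 let ?K = "\<lambda>\<sigma> s y. ennreal (b s (y - s) / 2) * (picard b g0 n \<sigma> s y + picard b g0 n \<sigma> s (2 * s - y))"
 have Sper: "?S s (y + 2) = ?S s y" for s y using picard_periodic[of g0, OF per] by simp
 have K: "?K True s y + ?K False s y <= ennreal (M / 2) * (?S s y + ?S s (2 * s - y))" for s y
 proof -
  have "?K True s y + ?K False s y = ennreal (b s (y - s) / 2) * (?S s y + ?S s (2 * s - y))"
   by (simp add: distrib_left ac_simps)
  also have "... <= ennreal (M / 2) * (?S s y + ?S s (2 * s - y))"
   using b_le by (intro mult_right_mono ennreal_leI) auto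
  finally show ?thesis .
 qed
 have g0: "ennreal (g0 y) + ennreal (- g0 y) = ennreal \<bar>g0 y\<bar>" for y
  by (cases "0 <= g0 y") (auto simp: ennreal_neg)
 have "(NINT y|circ. picard b g0 (Suc n) True t y + picard b g0 (Suc n) False t y)
   = (NINT y|circ. ennreal \<bar>g0 y\<bar> + (NINT s|{0..t}. ?K True s y + ?K False s y))"
  by (intro nn_integral_cong) (simp add: nn_integral_add g0[symmetric] ac_simps)
 also have "... <= (NINT y|circ. ennreal \<bar>g0 y\<bar> + (NINT s|{0..t}. ennreal (M / 2) * (?S s y + ?S s (2 * s - y))))"
  by (intro nn_integral_mono add_left_mono K)
 also have "... = ennreal A + (NINT s|{0..t}. (NINT y|circ. ennreal (M / 2) * (?S s y + ?S s (2 * s - y))))"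
  by (subst nn_integral_add) (auto simp: A(1) intro!: Fubini_lb_nn)
 also have "... = ennreal A + (NINT s|{0..t}. ennreal M * (NINT y|circ. ?S s y))"
 proof -
  have "(NINT y|circ. ennreal (M / 2) * (?S s y + ?S s (2 * s - y)))
    = ennreal M * (NINT y|circ. ?S s y)" for s
  proof -
   have "(NINT y|circ. ?S s (2 * s - y)) = (NINT y|circ. ?S s y)"
    by (rule circle_reflect[of "?S s", OF _ Sper]) measurable
   moreover have "(NINT y|circ. ?S s y + ?S s (2 * s - y))
     = (NINT y|circ. ?S s y) + (NINT y|circ. ?S s (2 * s - y))"
    by (rule nn_integral_add) measurable
   moreover have "(NINT y|circ. ennreal (M / 2) * (?S s y + ?S s (2 * s - y)))
     = ennreal (M / 2) * (NINT y|circ. ?S s y + ?S s (2 * s - y))"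
    by (rule nn_integral_cmult) measurable
   ultimately have "(NINT y|circ. ennreal (M / 2) * (?S s y + ?S s (2 * s - y)))
     = ennreal (M / 2) * (2 * (NINT y|circ. ?S s y))"
    by (simp only: mult_2)
   also have "... = ennreal (M / 2) * ennreal 2 * (NINT y|circ. ?S s y)"
    by (simp add: mult.assoc)
   also have "ennreal (M / 2) * ennreal 2 = ennreal M"
    using M_nonneg by (subst ennreal_mult[symmetric]) auto
   finally show ?thesis .
  qed
  then show ?thesis by simp
 qed
 also have "... <= ennreal A + (NINT s|{0..t}. ennreal (A * (M * exp (M * s))))"
 proof (intro add_left_mono nn_integral_mono_AE)
  show "AE s in lb {0..t}. ennreal M * (NINT y|circ. ?S s y) <= ennreal (A * (M * exp (M * s)))"
  proof (subst AE_lb, simp, rule AE_I2, rule impI)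
   fix s assume "s \<in> {0..t}"
   then have "ennreal M * (NINT y|circ. ?S s y) <= ennreal M * ennreal (A * exp (M * s))"
    by (intro mult_left_mono Suc.IH) auto
   also have "... = ennreal (A * (M * exp (M * s)))"
    using M_nonneg A(2) by (subst ennreal_mult[symmetric]) (auto simp: ac_simps)
   finally show "ennreal M * (NINT y|circ. ?S s y) <= ennreal (A * (M * exp (M * s)))" .
  qed
 qed
 also have "(NINT s|{0..t}. ennreal (A * (M * exp (M * s)))) = ennreal (A * exp (M * t) - A)"
 proof -
  have AC: "AC_on 0 t (\<lambda>s. A * exp (M * s)) (\<lambda>s. A * (M * exp (M * s)))"
   by (rule AC_on_C1) (auto intro!: derivative_eq_intros continuous_intros)
  have "(NINT s|{0..t}. ennreal (A * (M * exp (M * s)))) = ennreal (LINT s|lb {0..t}. A * (M * exp (M * s)))"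
   using A(2) M_nonneg by (intro nn_integral_eq_integral AC_onD(2)[OF AC]) auto
  also have "(LINT s|lb {0..t}. A * (M * exp (M * s))) = A * exp (M * t) - A"
   using AC_onD(3)[OF AC, of t] Suc.prems by simp
  finally show ?thesis .
 qed
 also have "ennreal A + ennreal (A * exp (M * t) - A) = ennreal (A * exp (M * t))"
  using A(2) Suc.prems M_nonneg
  by (subst ennreal_plus[symmetric]) (auto simp: mult_le_cancel_left1)
 finally show ?case .
qed (use A in simp)

lemma picard_lim_L1_bound:
 assumes g0 [measurable]: "g0 \<in> borel_fun" and per: "!!y. g0 (y + 2) = g0 y"
  and A: "(NINT y|circ. ennreal \<bar>g0 y\<bar>) = ennreal A" "0 <= A" and t: "0 <= t"
 shows "(NINT y|circ. picard_lim g0 True t y + picard_lim g0 False t y) <= ennreal (A * exp (M * t))"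
proof -
 note [measurable] = picard_measurable[OF g0]
 have inc: "incseq (\<lambda>n. picard b g0 n \<sigma> s z)" for \<sigma> s z by (rule incseq_SucI) (rule picard_mono)
 have "(\<lambda>y. picard_lim g0 True t y + picard_lim g0 False t y)
   = (\<lambda>y. SUP n. picard b g0 n True t y + picard b g0 n False t y)"
  unfolding picard_lim_def by (intro ext ennreal_SUP_add[symmetric] inc)
 then have "(NINT y|circ. picard_lim g0 True t y + picard_lim g0 False t y)
   = (SUP n. NINT y|circ. picard b g0 n True t y + picard b g0 n False t y)"
  by (simp only:) (rule nn_integral_monotone_convergence_SUP,
    auto intro!: incseq_SucI le_funI add_mono simp del: picard.simps intro: picard_mono)
 also have "... <= ennreal (A * exp (M * t))"
  by (rule SUP_least) (rule picard_L1_bound[OF g0 per A t])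
 finally show ?thesis .
qed

text \<open>The \<open>L\<^sup>1\<close> bound makes both monotone limits finite along almost every characteristic, and the difference of the limits satisfies the integrated equation there.\<close>

lemma evolution_exists:
 assumes g0 [measurable]: "g0 \<in> borel_fun" and per: "!!y. g0 (y + 2) = g0 y"
  and fin: "(NINT y|circ. ennreal \<bar>g0 y\<bar>) < \<infinity>"
 shows "\<exists>g. evolution g \<and> (\<forall>y. g 0 y = g0 y)"
proof -
 note [measurable] = picard_lim_measurable[OF g0]
 define A where "A = enn2real (NINT y|circ. ennreal \<bar>g0 y\<bar>)"
 have A: "(NINT y|circ. ennreal \<bar>g0 y\<bar>) = ennreal A" "0 <= A"
  using fin by (auto simp: A_def)
 let ?P = "picard_lim g0"
 define g where "g t y = enn2real (?P True t y) - enn2real (?P False t y)" for t y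
 have gj [measurable]: "case_prod g \<in> joint_borel"
  unfolding g_def by measurable
 note gm [measurable (raw)] = measurable_compose2[OF gj]
 have Pmono: "?P \<sigma> t y <= ?P \<sigma> t' y" if "t <= t'" for \<sigma> t t' y
  unfolding picard_lim_def by (intro SUP_mono) (use picard_mono_time[OF g0 that] in blast)
 have abs_g: "ennreal \<bar>g t y\<bar> <= ?P True t y + ?P False t y" for t y
 proof (cases "?P True t y + ?P False t y = top")
  case False
  then have "?P True t y = ennreal (enn2real (?P True t y))" "?P False t y = ennreal (enn2real (?P False t y))"
   by (auto simp: less_top)
  then have "?P True t y + ?P False t y = ennreal (enn2real (?P True t y) + enn2real (?P False t y))"
   by (metis enn2real_nonneg ennreal_plus)
  then show ?thesis unfolding g_def
   by (smt (verit) enn2real_nonneg ennreal_leI)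
 qed (simp only: top_greatest)
 have "AE y in lb circ. \<forall>k::nat. ?P True (real k) y + ?P False (real k) y \<noteq> \<infinity>"
  unfolding AE_all_countable
 proof
  fix k :: nat
  have "(NINT y|circ. ?P True (real k) y + ?P False (real k) y) <= ennreal (A * exp (M * real k))"
   by (rule picard_lim_L1_bound[OF g0 per A]) simp
  also have "... < \<infinity>" by simp
  finally show "AE y in lb circ. ?P True (real k) y + ?P False (real k) y \<noteq> \<infinity>"
   by (intro nn_integral_PInf_AE) auto
 qed
 then have AC: "AE y in lb circ. \<forall>t\<ge>0. AC_on 0 t (\<lambda>s. g s y) (\<lambda>s. - flux g s y)"
 proof eventually_elim
  case (elim y)
  define n where "n \<sigma> s = enn2real (?P \<sigma> s y) " for \<sigma> s
  define m where "m \<sigma> s = enn2real (?P \<sigma> s (2 * s - y))" for \<sigma> s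
  have [measurable]: "n \<sigma> \<in> borel_fun" "m \<sigma> \<in> borel_fun" for \<sigma>
   unfolding n_def m_def by measurable
  have finP: "?P \<sigma> t y < \<infinity>" for \<sigma> t
  proof -
   obtain k :: nat where "t <= real k" using real_arch_simple by blast
   then have "?P \<sigma> t y <= ?P \<sigma> (real k) y" by (rule Pmono)
   also have "... < \<infinity>" using elim[rule_format, of k] by (cases \<sigma>) (auto simp: less_top)
   finally show ?thesis .
  qed
  have step: "integrable (lb {0..t}) (\<lambda>s. b s (y - s) / 2 * (n (\<not> \<sigma>) s + m (\<not> \<sigma>) s)) \<and>
    n \<sigma> t = max 0 (if \<sigma> then g0 y else - g0 y) + (LINT s|lb {0..t}. b s (y - s) / 2 * (n (\<not> \<sigma>) s + m (\<not> \<sigma>) s))"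
   for \<sigma> t
  proof -
   let ?c = "if \<sigma> then g0 y else - g0 y"
   let ?K = "\<lambda>s. ennreal (b s (y - s) / 2) * (?P (\<not> \<sigma>) s y + ?P (\<not> \<sigma>) s (2 * s - y))"
   let ?k = "\<lambda>s. b s (y - s) / 2 * (n (\<not> \<sigma>) s + m (\<not> \<sigma>) s)"
   have eq: "?P \<sigma> t y = ennreal ?c + (NINT s|{0..t}. ?K s)" by (rule picard_lim_eq[OF g0])
   then have fin: "(NINT s|{0..t}. ?K s) \<noteq> \<infinity>" using finP[of \<sigma> t] by auto
   have AE: "AE s in lb {0..t}. ?K s = ennreal (?k s)"
   proof -
    have "AE s in lb {0..t}. ?K s \<noteq> \<infinity>" by (intro nn_integral_PInf_AE fin) auto
    then show ?thesis
    proof eventually_elim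
     case (elim s)
     show ?case
     proof (cases "b s (y - s) = 0")
      case False
      then have "0 < b s (y - s)" using b_nonneg[of s "y - s"] by simp
      then have "?P (\<not> \<sigma>) s y + ?P (\<not> \<sigma>) s (2 * s - y) \<noteq> \<infinity>"
       using elim by (auto simp: ennreal_mult_eq_top_iff)
      then have "?P (\<not> \<sigma>) s y = ennreal (n (\<not> \<sigma>) s)" "?P (\<not> \<sigma>) s (2 * s - y) = ennreal (m (\<not> \<sigma>) s)"
       by (auto simp: n_def m_def less_top)
      then have "?K s = ennreal (b s (y - s) / 2) * (ennreal (n (\<not> \<sigma>) s) + ennreal (m (\<not> \<sigma>) s))"
       by (simp only:)
      also have "... = ennreal (?k s)"
      proof -
       have nm: "0 <= n (\<not> \<sigma>) s" "0 <= m (\<not> \<sigma>) s" by (simp_all add: n_def m_def)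
       have "ennreal (?k s) = ennreal (b s (y - s) / 2) * ennreal (n (\<not> \<sigma>) s + m (\<not> \<sigma>) s)"
        using nm b_nonneg[of s "y - s"] by (intro ennreal_mult) auto
       then show ?thesis using nm by (simp only: ennreal_plus)
      qed
      finally show ?thesis .
     qed simp
    qed
   qed
   have nonneg: "0 <= ?k s" for s using b_nonneg by (simp add: n_def m_def)
   have K: "(NINT s|{0..t}. ?K s) = (NINT s|{0..t}. ennreal (?k s))"
    by (rule nn_integral_cong_AE[OF AE])
   have int: "integrable (lb {0..t}) ?k"
    using fin nonneg unfolding K by (intro integrableI_nonneg) (auto simp: less_top)
   then have "?P \<sigma> t y = ennreal ?c + ennreal (LINT s|lb {0..t}. ?k s)"
    using eq K nonneg by (simp add: nn_integral_eq_integral)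
   then have "ennreal (n \<sigma> t) = ennreal (max 0 ?c) + ennreal (LINT s|lb {0..t}. ?k s)"
    using finP[of \<sigma> t] by (simp only: n_def ennreal_enn2real) (simp add: max_def ennreal_neg)
   also have "... = ennreal (max 0 ?c + (LINT s|lb {0..t}. ?k s))"
    using nonneg by (intro ennreal_plus[symmetric] integral_nonneg) auto
   finally have "n \<sigma> t = max 0 ?c + (LINT s|lb {0..t}. ?k s)"
    using nonneg by (subst (asm) ennreal_inj) (auto simp: n_def intro!: add_nonneg_nonneg integral_nonneg)
   with int show ?thesis by blast
  qed
  show ?case
  proof (intro allI impI)
   fix T :: real assume T: "0 <= T"
   have flux: "- flux g s y = b s (y - s) / 2 * (n False s + m False s) - b s (y - s) / 2 * (n True s + m True s)" for s
    by (simp add: flux_def g_def n_def m_def field_simps)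
   have g: "g t y = g0 y + (LINT s|lb {0..t}. - flux g s y)" for t
    using step[of t True] step[of t False] unfolding flux
    by (simp add: g_def n_def max_def split: if_splits)
   have "g 0 y = g0 y" using g[of 0] integral_lb_empty[of 0 0 "\<lambda>s. - flux g s y"] by simp
   then show "AC_on 0 T (\<lambda>s. g s y) (\<lambda>s. - flux g s y)"
    unfolding AC_on_def
   proof (intro conjI ballI)
    show "(\<lambda>s. g s y) \<in> borel_fun" by measurable
    show "integrable (lb {0..T}) (\<lambda>s. - flux g s y)"
     unfolding flux using step[of T True] step[of T False] by simp
    show "g t y = g 0 y + (LINT s|lb {0..t}. - flux g s y)" for t
     unfolding \<open>g 0 y = g0 y\<close> by (rule g)
   qed
  qed
 qed
 have g_per: "g t (y + 2) = g t y" for t y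
  unfolding g_def picard_lim_def by (simp add: picard_periodic[of g0, OF per])
 have L1: "(NINT s|{0..T}. (NINT y|circ. ennreal \<bar>g s y\<bar>)) < \<infinity>" if T: "0 <= T" for T
 proof -
  have "(NINT s|{0..T}. (NINT y|circ. ennreal \<bar>g s y\<bar>))
   <= (NINT s|{0..T}. ennreal (A * exp (M * T)))"
  proof (intro nn_integral_mono_AE, subst AE_lb, simp, intro AE_I2 impI)
   fix s assume s: "s \<in> {0..T}"
   have "(NINT y|circ. ennreal \<bar>g s y\<bar>) <= (NINT y|circ. ?P True s y + ?P False s y)"
    by (intro nn_integral_mono abs_g)
   also have "... <= ennreal (A * exp (M * s))"
    using s by (intro picard_lim_L1_bound[OF g0 per A]) auto
   also have "... <= ennreal (A * exp (M * T))"
    using s A M_nonneg by (intro ennreal_leI mult_left_mono) (auto simp: mult_left_mono)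
   finally show "(NINT y|circ. ennreal \<bar>g s y\<bar>) <= ennreal (A * exp (M * T))" .
  qed
  also have "... < \<infinity>"
   using T by (simp add: emeasure_lb ennreal_mult_less_top)
  finally show ?thesis .
 qed
 have "g 0 y = g0 y" for y
 proof -
  have "?P \<sigma> 0 y = ennreal (if \<sigma> then g0 y else - g0 y)" for \<sigma>
  proof -
   have "AE s in lborel. s \<noteq> (0::real)" by (rule AE_lborel_singleton)
   then have "AE s in lb {0..0}. False" by (subst AE_lb) (auto elim!: eventually_mono)
   then have "(NINT s|{0..0}. K s) = 0" for K
    by (subst nn_integral_cong_AE[where v = "\<lambda>_. 0"]) (auto elim!: eventually_mono)
   then show ?thesis by (subst picard_lim_eq[OF g0]) simp
  qed
  then show ?thesis by (cases "0 <= g0 y") (auto simp: g_def ennreal_neg)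
 qed
 then show ?thesis using gj g_per AC L1 unfolding evolution_def by blast
qed

end

section \<open>Energy identity\<close>

lemma AE_lbI: "A \<in> sets borel ==> (!!x. x \<in> A ==> P x) ==> AE x in lb A. P x"
 by (simp add: AE_lb)

lemma nn_integral_lb_mono:
 assumes "A \<in> sets borel" "!!x. x \<in> A ==> f x <= g x"
 shows "(NINT x|A. f x) <= (NINT x|A. g x)"
 using assms by (intro nn_integral_mono_AE AE_lbI)

lemma nn_integral_cmult_add:
 assumes [measurable]: "f \<in> borel_fun" "g \<in> borel_fun"
 shows "(NINT y|A. c * (f y + g y)) = c * ((NINT y|A. f y) + (NINT y|A. g y))"
 using nn_integral_cmult[of "\<lambda>y. f y + g y" "lb A" c] nn_integral_add[of f "lb A" g] by simp

context circle_damping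
begin

definition energy :: "(real => real => real) => real => ennreal" where
 "energy g t = (NINT y|circ. epow p (g t y))"

lemma evolutionD:
 assumes "evolution g"
 shows "case_prod g \<in> joint_borel"
  and "g t (y + 2) = g t y"
  and "AE y in lb circ. \<forall>t\<ge>0. AC_on 0 t (\<lambda>s. g s y) (\<lambda>s. - flux g s y)"
  and "0 <= T ==> (NINT s|{0..T}. (NINT y|circ. ennreal \<bar>g s y\<bar>)) < \<infinity>"
 using assms unfolding evolution_def by auto

lemma evolution_measurable:
 assumes "evolution g" "f \<in> borel_measurable N" "h \<in> borel_measurable N"
 shows "(\<lambda>z. g (f z) (h z)) \<in> borel_measurable N"
 by (rule measurable_compose2[OF evolutionD(1)[OF assms(1)]]) fact+

lemma flux_measurable:
 assumes "evolution g" "f \<in> borel_measurable N" "h \<in> borel_measurable N"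
 shows "(\<lambda>z. flux g (f z) (h z)) \<in> borel_measurable N"
proof -
 note [measurable] = evolution_measurable[OF assms(1)] assms(2,3)
 show ?thesis unfolding flux_def by measurable
qed

lemma flux_periodic:
 assumes "evolution g"
 shows "flux g s (y + 2) = flux g s y"
proof -
 have "g s (2 * s - (y + 2)) = g s (2 * s - y)"
  using evolutionD(2)[OF assms, of s "2 * s - (y + 2)"] by simp
 moreover have "b s (y + 2 - s) = b s (y - s)"
  using b_periodic[of s "y - s"] by (simp add: algebra_simps)
 ultimately show ?thesis by (simp add: flux_def evolutionD(2)[OF assms])
qed

lemma b_reflect: "b s (2 * s - y - s) = b s (y - s)"
 using b_even[of s "y - s"] by (simp add: algebra_simps)

lemma flux_reflect: "flux g s (2 * s - y) = flux g s y"
 unfolding flux_def b_reflect by (simp add: add.commute)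

text \<open>The chain rule on each characteristic, integrated over the circle. The flux is invariant under \<open>y \<mapsto> 2s - y\<close>, which symmetrizes the dissipation term; oddness of \<open>\<phi>\<close> makes it nonnegative.\<close>

lemma energy_identity:
 assumes ev: "evolution g"
  and sg: "subgradient \<psi> \<phi>" and \<phi>: "continuous_on UNIV \<phi>" and odd: "!!z. \<phi> (- z) = - \<phi> z"
  and \<psi> [measurable]: "\<psi> \<in> borel_fun" and \<psi>0: "!!z. 0 <= \<psi> z"
  and rT: "0 <= r" "r <= T"
  and fin: "(NINT y|circ. ennreal (\<psi> (g r y))) < \<infinity>"
  and finD: "(NINT s|{r..T}. (NINT y|circ. ennreal \<bar>\<phi> (g s y) * flux g s y\<bar>)) < \<infinity>"
 shows "(NINT y|circ. ennreal (\<psi> (g T y)))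
   + (NINT s|{r..T}. (NINT y|circ. ennreal (b s (y - s) / 4 * ((\<phi> (g s y) + \<phi> (g s (2 * s - y))) * (g s y + g s (2 * s - y))))))
   = (NINT y|circ. ennreal (\<psi> (g r y)))"
proof -
 note [measurable] = evolution_measurable[OF ev] flux_measurable[OF ev]
 have [measurable]: "\<phi> \<in> borel_fun" by (rule borel_measurable_continuous_onI[OF \<phi>])
 define D where "D s y = \<phi> (g s y) * flux g s y" for s y
 define S where "S s y = b s (y - s) / 4 * ((\<phi> (g s y) + \<phi> (g s (2 * s - y))) * (g s y + g s (2 * s - y)))" for s y
 have Dm: "case_prod D \<in> joint_borel" unfolding D_def by measurable
 note [measurable] = measurable_compose2[OF Dm]
 have Sm: "case_prod S \<in> joint_borel" unfolding S_def by measurable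
 note [measurable] = measurable_compose2[OF Sm]
 have Dper: "D s (y + 2) = D s y" for s y
  by (simp add: D_def evolutionD(2)[OF ev] flux_periodic[OF ev])
 have S: "S s y = (D s y + D s (2 * s - y)) / 2" for s y
  unfolding D_def flux_reflect by (simp add: S_def flux_def field_simps)
 have S0: "0 <= S s y" for s y
  unfolding S_def by (intro mult_nonneg_nonneg[OF _ subgradient_odd_sum_nonneg[OF sg odd]]) (simp add: b_nonneg)
 have refl: "(NINT y|circ. ennreal \<bar>D s (2 * s - y)\<bar>) = (NINT y|circ. ennreal \<bar>D s y\<bar>)" for s
  by (rule circle_reflect[of "\<lambda>y. ennreal \<bar>D s y\<bar>"]) (auto simp: Dper)
 have iD: "integrable (lb {r..T} \<Otimes>\<^sub>M lb circ) (case_prod D)"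
  by (rule integrable_lb_pair) (use finD Dm in \<open>auto simp: D_def\<close>)
 have iD': "integrable (lb {r..T} \<Otimes>\<^sub>M lb circ) (case_prod (\<lambda>s y. D s (2 * s - y)))"
 proof (rule integrable_lb_pair)
  show "(\<lambda>(s, y). D s (2 * s - y)) \<in> joint_borel" by measurable
  show "(NINT s|{r..T}. (NINT y|circ. ennreal \<bar>D s (2 * s - y)\<bar>)) < \<infinity>"
   unfolding refl using finD by (simp add: D_def)
 qed auto
 have m: "{r..T} \<in> sets borel" "{0..<2::real} \<in> sets borel" by auto
 have iS: "integrable (lb {r..T} \<Otimes>\<^sub>M lb circ) (case_prod S)"
  using Bochner_Integration.integrable_add[OF iD iD'] unfolding S case_prod_unfold
  by (intro integrable_divide) simp
 have "AE s in lb {r..T}. (LINT y|lb circ. S s y) = (LINT y|lb circ. D s y)"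
  using Fubini_lb(4)[OF m iD] Fubini_lb(4)[OF m iD'] unfolding S
 proof eventually_elim
  case i: (elim s)
  have "(LINT y|lb circ. D s (2 * s - y)) = (LINT y|lb circ. D s y)"
   by (rule circle_integral_reflect(1)) (auto simp: Dper)
  then show "(LINT y|lb circ. (D s y + D s (2 * s - y)) / 2) = (LINT y|lb circ. D s y)"
   using i by simp
 qed
 then have SD: "(LINT s|lb {r..T}. (LINT y|lb circ. S s y)) = (LINT s|lb {r..T}. (LINT y|lb circ. D s y))"
  by (intro integral_cong_AE) auto
 have main: "AE y in lb circ. \<psi> (g T y) = \<psi> (g r y) - (LINT s|lb {r..T}. D s y)"
  using evolutionD(3)[OF ev]
 proof eventually_elim
  case (elim y)
  then have AC: "AC_on 0 T (\<lambda>s. g s y) (\<lambda>s. - flux g s y)" using rT by auto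
  have "AC_on r T (\<lambda>s. g s y) (\<lambda>s. - flux g s y)"
   unfolding AC_on_def
  proof (intro conjI ballI)
   show "(\<lambda>s. g s y) \<in> borel_fun" by measurable
   show "integrable (lb {r..T}) (\<lambda>s. - flux g s y)" using rT by (intro AC_on_diff[OF AC]) auto
   fix t assume "t \<in> {r..T}"
   then show "g t y = g r y + (LINT s|lb {r..t}. - flux g s y)"
    using AC_on_diff(1)[OF AC, of r t] rT by simp
  qed
  from AC_on_chain_rule(2)[OF this rT(2) \<phi> sg] show ?case by (simp add: D_def)
 qed
 have ir: "integrable (lb circ) (\<lambda>y. \<psi> (g r y))"
  using fin \<psi>0 by (intro integrableI_nonneg) auto
 have iI: "integrable (lb circ) (\<lambda>y. LINT s|lb {r..T}. D s y)" by (rule Fubini_lb(3)[OF m iD])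
 have iT: "integrable (lb circ) (\<lambda>y. \<psi> (g T y))"
 proof (subst integrable_cong_AE[OF _ _ main])
  show "(\<lambda>y. \<psi> (g T y)) \<in> borel_measurable (lb circ)" by measurable
  show "(\<lambda>y. \<psi> (g r y) - (LINT s|lb {r..T}. D s y)) \<in> borel_measurable (lb circ)" by measurable
 qed (use ir iI in simp)
 have "(LINT y|lb circ. \<psi> (g T y)) = (LINT y|lb circ. \<psi> (g r y) - (LINT s|lb {r..T}. D s y))"
 proof (rule integral_cong_AE[OF _ _ main])
  show "(\<lambda>y. \<psi> (g T y)) \<in> borel_measurable (lb circ)" by measurable
  show "(\<lambda>y. \<psi> (g r y) - (LINT s|lb {r..T}. D s y)) \<in> borel_measurable (lb circ)" by measurable
 qed
 also have "... = (LINT y|lb circ. \<psi> (g r y)) - (LINT y|lb circ. (LINT s|lb {r..T}. D s y))"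
  using ir iI by simp
 also have "(LINT y|lb circ. (LINT s|lb {r..T}. D s y)) = (LINT s|lb {r..T}. (LINT y|lb circ. S s y))"
  unfolding SD by (rule Fubini_lb(1)[OF m iD, symmetric])
 finally have real: "(LINT y|lb circ. \<psi> (g T y)) + (LINT s|lb {r..T}. (LINT y|lb circ. S s y))
   = (LINT y|lb circ. \<psi> (g r y))" by simp
 have "(NINT s|{r..T}. (NINT y|circ. ennreal (S s y)))
   = (NINT s|{r..T}. ennreal (LINT y|lb circ. S s y))"
 proof (rule nn_integral_cong_AE)
  have "AE s in lb {r..T}. integrable (lb circ) (S s)"
   using Fubini_lb(4)[OF m iS] by simp
  then show "AE s in lb {r..T}. (NINT y|circ. ennreal (S s y)) = ennreal (LINT y|lb circ. S s y)"
   by eventually_elim (intro nn_integral_eq_integral AE_I2 S0)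
 qed
 also have "... = ennreal (LINT s|lb {r..T}. (LINT y|lb circ. S s y))"
  by (intro nn_integral_eq_integral Fubini_lb(2)[OF m iS] AE_I2 Bochner_Integration.integral_nonneg S0)
 finally have nnS: "(NINT s|{r..T}. (NINT y|circ. ennreal (S s y)))
   = ennreal (LINT s|lb {r..T}. (LINT y|lb circ. S s y))" .
 have "(NINT y|circ. ennreal (\<psi> (g T y))) + (NINT s|{r..T}. (NINT y|circ. ennreal (S s y)))
   = ennreal (LINT y|lb circ. \<psi> (g T y)) + ennreal (LINT s|lb {r..T}. (LINT y|lb circ. S s y))"
  unfolding nnS using iT \<psi>0 by (simp add: nn_integral_eq_integral)
 also have "... = ennreal (LINT y|lb circ. \<psi> (g r y))"
  unfolding real[symmetric] using \<psi>0 S0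
  by (intro ennreal_plus[symmetric] Bochner_Integration.integral_nonneg) auto
 also have "... = (NINT y|circ. ennreal (\<psi> (g r y)))"
  using ir \<psi>0 by (simp add: nn_integral_eq_integral)
 finally show ?thesis unfolding S_def .
qed

lemma double_nn_integral_reflect:
 assumes ev: "evolution g" and [measurable]: "f \<in> borel_fun"
 shows "(NINT y|circ. f (g s (2 * s - y))) = (NINT y|circ. f (g s y))"
proof -
 note [measurable] = evolution_measurable[OF ev]
 show ?thesis
  by (rule circle_reflect[of "\<lambda>y. f (g s y)"]) (auto simp: evolutionD(2)[OF ev])
qed

text \<open>For truncated powers the dissipation is integrable a priori, so the identity applies; Fatou's lemma then removes the truncation.\<close>

lemma energy_antimono:
 assumes ev: "evolution g" and rT: "0 <= r" "r <= T"
 shows "energy g T <= energy g r"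
proof (cases "energy g r = \<infinity>")
 case False
 note [measurable] = evolution_measurable[OF ev] flux_measurable[OF ev]
 have abs_m: "(\<lambda>z::real. ennreal \<bar>z\<bar>) \<in> borel_fun" by measurable
 have cutE: "(NINT y|circ. ennreal (cut_powr p (real N) (g T y))) <= energy g r" for N :: nat
 proof -
  let ?\<psi> = "cut_powr p (real N)" and ?\<phi> = "\<lambda>z. p * spow p (cut (real N) z)"
  have le: "(NINT y|circ. ennreal (?\<psi> (g r y))) <= energy g r"
   unfolding energy_def by (intro nn_integral_mono ennreal_leI cut_powr_le p) auto
  have cont: "continuous_on UNIV ?\<phi>"
   unfolding cut_def
   by (intro continuous_intros continuous_on_compose2[OF continuous_on_spow[OF p]]) auto
  define K where "K = p * real N powr (p - 1) * (M / 2)"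
  have K: "0 <= K" using p M_nonneg by (simp add: K_def)
  have "(NINT s|{r..T}. (NINT y|circ. ennreal \<bar>?\<phi> (g s y) * flux g s y\<bar>))
   <= (NINT s|{r..T}. (NINT y|circ. ennreal K * (ennreal \<bar>g s y\<bar> + ennreal \<bar>g s (2 * s - y)\<bar>)))"
  proof (intro nn_integral_mono)
   fix s y
   have "\<bar>?\<phi> (g s y) * flux g s y\<bar> = \<bar>?\<phi> (g s y)\<bar> * \<bar>flux g s y\<bar>" by (rule abs_mult)
   also have "... <= (p * real N powr (p - 1)) * (M / 2 * (\<bar>g s y\<bar> + \<bar>g s (2 * s - y)\<bar>))"
   proof (intro mult_mono)
    show "\<bar>?\<phi> (g s y)\<bar> <= p * real N powr (p - 1)"
     using abs_spow_cut_le[OF p, of "real N" "g s y"] p by (simp add: abs_mult)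
    show "\<bar>flux g s y\<bar> <= M / 2 * (\<bar>g s y\<bar> + \<bar>g s (2 * s - y)\<bar>)"
     using b_nonneg[of s "y - s"] b_le[of s "y - s"]
     by (auto simp: flux_def abs_mult intro!: mult_mono)
   qed (use p in auto)
   finally have "ennreal \<bar>?\<phi> (g s y) * flux g s y\<bar> <= ennreal (K * (\<bar>g s y\<bar> + \<bar>g s (2 * s - y)\<bar>))"
    by (intro ennreal_leI) (simp add: K_def mult.assoc)
   then show "ennreal \<bar>?\<phi> (g s y) * flux g s y\<bar> <= ennreal K * (ennreal \<bar>g s y\<bar> + ennreal \<bar>g s (2 * s - y)\<bar>)"
    using K by (simp add: ennreal_mult ennreal_plus)
  qed
  also have "... = (NINT s|{r..T}. ennreal K * (2 * (NINT y|circ. ennreal \<bar>g s y\<bar>)))"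
  proof (intro nn_integral_cong)
   fix s
   have "(NINT y|circ. ennreal K * (ennreal \<bar>g s y\<bar> + ennreal \<bar>g s (2 * s - y)\<bar>))
    = ennreal K * ((NINT y|circ. ennreal \<bar>g s y\<bar>) + (NINT y|circ. ennreal \<bar>g s (2 * s - y)\<bar>))"
    by (rule nn_integral_cmult_add) measurable
   then show "(NINT y|circ. ennreal K * (ennreal \<bar>g s y\<bar> + ennreal \<bar>g s (2 * s - y)\<bar>))
    = ennreal K * (2 * (NINT y|circ. ennreal \<bar>g s y\<bar>))"
    unfolding double_nn_integral_reflect[OF ev abs_m] by (simp only: mult_2[symmetric])
  qed
  also have "... = ennreal K * (2 * (NINT s|{r..T}. (NINT y|circ. ennreal \<bar>g s y\<bar>)))"
   by (simp add: nn_integral_cmult)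
  also have "... < \<infinity>"
  proof -
   have "(NINT s|{r..T}. (NINT y|circ. ennreal \<bar>g s y\<bar>))
    <= (NINT s|{0..T}. (NINT y|circ. ennreal \<bar>g s y\<bar>))"
    using rT by (intro nn_integral_lb_mono_set) auto
   also have "... < \<infinity>" using rT by (intro evolutionD(4)[OF ev]) auto
   finally show ?thesis by (simp add: ennreal_mult_less_top)
  qed
  finally have finD: "(NINT s|{r..T}. (NINT y|circ. ennreal \<bar>?\<phi> (g s y) * flux g s y\<bar>)) < \<infinity>" .
  have "(NINT y|circ. ennreal (?\<psi> (g T y))) <= (NINT y|circ. ennreal (?\<psi> (g r y)))"
  proof (subst energy_identity[OF ev subgradient_cut_powr[OF p] cont _ _ _ rT _ finD, symmetric])
   show "(NINT y|circ. ennreal (?\<psi> (g r y))) < \<infinity>"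
    using le_less_trans[OF le] False by (simp add: less_top)
  qed (auto simp: cut_minus cut_powr_nonneg p)
  then show ?thesis using le by (rule order_trans)
 qed
 have "energy g T = (NINT y|circ. liminf (\<lambda>N. ennreal (cut_powr p (real N) (g T y))))"
  unfolding energy_def
 proof (intro nn_integral_cong)
  fix y
  have "(\<lambda>N. ennreal (cut_powr p (real N) (g T y))) \<longlonglongrightarrow> epow p (g T y)"
  proof (rule tendsto_eventually)
   show "\<forall>\<^sub>F N in sequentially. ennreal (cut_powr p (real N) (g T y)) = epow p (g T y)"
    using eventually_ge_at_top[of "nat \<lceil>\<bar>g T y\<bar>\<rceil>"]
    by eventually_elim (simp add: cut_powr_eq)
  qed
  then show "epow p (g T y) = liminf (\<lambda>N. ennreal (cut_powr p (real N) (g T y)))"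
   by (simp add: lim_imp_Liminf)
 qed
 also have "... <= liminf (\<lambda>N. NINT y|circ. ennreal (cut_powr p (real N) (g T y)))"
  by (rule nn_integral_liminf) auto
 also have "... <= energy g r"
  by (rule Liminf_le) (auto intro!: always_eventually cutE)
 finally show ?thesis .
qed simp

lemma energy_dissipation:
 assumes ev: "evolution g" and rT: "0 <= r" "r <= T" and fin: "energy g r < \<infinity>"
 shows "energy g T + ennreal (p / 4) *
   (NINT s|{r..T}. (NINT y|circ. ennreal (b s (y - s) * ((spow p (g s y) + spow p (g s (2 * s - y))) * (g s y + g s (2 * s - y)))))) = energy g r"
proof -
 note [measurable] = evolution_measurable[OF ev] flux_measurable[OF ev]
 have pow_m: "(\<lambda>z::real. epow p z) \<in> borel_fun" by measurable
 let ?\<phi> = "\<lambda>z. p * spow p z"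
 have "(NINT s|{r..T}. (NINT y|circ. ennreal \<bar>?\<phi> (g s y) * flux g s y\<bar>))
  <= (NINT s|{r..T}. (NINT y|circ. ennreal (M * p) * (epow p (g s y) + epow p (g s (2 * s - y)))))"
 proof (intro nn_integral_mono)
  fix s y
  let ?x = "g s y" and ?x' = "g s (2 * s - y)"
  have 1: "p * (\<bar>?x\<bar> powr (p - 1) * \<bar>?x\<bar>) = p * \<bar>?x\<bar> powr p" using abs_powr_Suc[OF p] by simp
  have 2: "p * (\<bar>?x\<bar> powr (p - 1) * \<bar>?x'\<bar>) <= \<bar>?x'\<bar> powr p + (p - 1) * \<bar>?x\<bar> powr p" by (rule powr_young[OF p])
  have "\<bar>?\<phi> ?x * flux g s y\<bar> = b s (y - s) / 2 * (p * (\<bar>?x\<bar> powr (p - 1) * \<bar>?x + ?x'\<bar>))"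
   using p b_nonneg[of s "y - s"] by (simp add: flux_def abs_mult abs_spow)
  also have "... <= M / 2 * (p * (\<bar>?x\<bar> powr (p - 1) * (\<bar>?x\<bar> + \<bar>?x'\<bar>)))"
   using p b_nonneg[of s "y - s"] b_le[of s "y - s"] by (intro mult_mono) auto
  also have "p * (\<bar>?x\<bar> powr (p - 1) * (\<bar>?x\<bar> + \<bar>?x'\<bar>)) <= p * \<bar>?x\<bar> powr p + (\<bar>?x'\<bar> powr p + (p - 1) * \<bar>?x\<bar> powr p)"
  proof -
   have "p * (\<bar>?x\<bar> powr (p - 1) * (\<bar>?x\<bar> + \<bar>?x'\<bar>))
    = p * (\<bar>?x\<bar> powr (p - 1) * \<bar>?x\<bar>) + p * (\<bar>?x\<bar> powr (p - 1) * \<bar>?x'\<bar>)" by (simp add: distrib_left)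
   then show ?thesis using 1 2 by linarith
  qed
  also have "... <= 2 * p * (\<bar>?x\<bar> powr p + \<bar>?x'\<bar> powr p)"
  proof -
   have "p * A + (B + (p - 1) * A) <= 2 * p * (A + B)" if "0 <= A" "0 <= B" for A B
   proof -
    have "1 * B <= (2 * p) * B" using p that by (intro mult_right_mono) auto
    then show ?thesis using that by (simp add: algebra_simps)
   qed
   then show ?thesis by simp
  qed
  finally have "\<bar>?\<phi> ?x * flux g s y\<bar> <= M / 2 * (2 * p * (\<bar>?x\<bar> powr p + \<bar>?x'\<bar> powr p))"
   using M_nonneg by (meson divide_nonneg_pos mult_left_mono zero_less_numeral)
  then have "\<bar>?\<phi> ?x * flux g s y\<bar> <= M * p * (\<bar>?x\<bar> powr p + \<bar>?x'\<bar> powr p)"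
   by (simp add: mult.assoc)
  then have "ennreal \<bar>?\<phi> ?x * flux g s y\<bar> <= ennreal (M * p * (\<bar>?x\<bar> powr p + \<bar>?x'\<bar> powr p))"
   by (rule ennreal_leI)
  then show "ennreal \<bar>?\<phi> ?x * flux g s y\<bar> <= ennreal (M * p) * (epow p (?x) + epow p (?x'))"
   using p M_nonneg by (simp add: ennreal_mult ennreal_plus)
 qed
 also have "... = (NINT s|{r..T}. ennreal (M * p) * (2 * energy g s))"
 proof (intro nn_integral_cong)
  fix s
  have "(NINT y|circ. ennreal (M * p) * (epow p (g s y) + epow p (g s (2 * s - y))))
   = ennreal (M * p) * (energy g s + (NINT y|circ. epow p (g s (2 * s - y))))"
   unfolding energy_def by (rule nn_integral_cmult_add) measurable
  then show "(NINT y|circ. ennreal (M * p) * (epow p (g s y) + epow p (g s (2 * s - y))))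
   = ennreal (M * p) * (2 * energy g s)"
   unfolding double_nn_integral_reflect[OF ev pow_m] by (simp only: mult_2[symmetric] energy_def)
 qed
 also have "... <= (NINT s|{r..T}. ennreal (M * p) * (2 * energy g r))"
  using rT by (intro nn_integral_lb_mono mult_left_mono energy_antimono[OF ev]) auto
 also have "... < \<infinity>"
  using fin rT by (simp add: emeasure_lb ennreal_mult_less_top)
 finally have finD: "(NINT s|{r..T}. (NINT y|circ. ennreal \<bar>?\<phi> (g s y) * flux g s y\<bar>)) < \<infinity>" .
 have cont: "continuous_on UNIV ?\<phi>" by (intro continuous_intros continuous_on_spow p)
 have "energy g T + (NINT s|{r..T}. (NINT y|circ. ennreal (b s (y - s) / 4 * ((?\<phi> (g s y) + ?\<phi> (g s (2 * s - y))) * (g s y + g s (2 * s - y)))))) = energy g r"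
  unfolding energy_def
  by (rule energy_identity[OF ev subgradient_powr[OF p] cont _ _ _ rT _ finD])
   (use fin in \<open>auto simp: energy_def\<close>)
 also have "(\<lambda>s y. ennreal (b s (y - s) / 4 * ((?\<phi> (g s y) + ?\<phi> (g s (2 * s - y))) * (g s y + g s (2 * s - y)))))
  = (\<lambda>s y. ennreal (p / 4) * ennreal (b s (y - s) * ((spow p (g s y) + spow p (g s (2 * s - y))) * (g s y + g s (2 * s - y)))))"
  using p by (intro ext) (simp add: ennreal_mult'[symmetric] algebra_simps)
 finally show ?thesis by (simp add: nn_integral_cmult)
qed

end

section \<open>Observability and decay\<close>

lemma nn_integral_lb_Icc:
 assumes [measurable]: "F \<in> borel_fun"
 shows "(NINT y|{a..b}. F y) = (NINT y|{a..<b}. F y)"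
proof -
 have "(\<integral>\<^sup>+y. F y * indicator {a..b} y \<partial>lborel) = (\<integral>\<^sup>+y. F y * indicator {a..<b} y \<partial>lborel)"
  using AE_lborel_singleton[of b]
  by (intro nn_integral_cong_AE) (auto split: split_indicator elim!: eventually_mono)
 then show ?thesis by (simp add: nn_integral_lb)
qed

lemma circle_window:
 assumes F: "F \<in> borel_fun" and per: "!!y::real. F (y + 2) = F y"
 shows "(NINT y|{r..r + 2}. F y) = (NINT y|circ. F y)"
 using nn_integral_lb_shift[OF F, of 0 2 r] circle_shift[of F r] per F
 by (simp add: nn_integral_lb_Icc add.commute)

lemma ennreal_powr_add_le:
 assumes "1 < p"
 shows "epow p (x + y) <= ennreal (2 powr p) * (epow p x + epow p y)"
proof -
 have "epow p (x + y) <= ennreal (2 powr p * (\<bar>x\<bar> powr p + \<bar>y\<bar> powr p))"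
  by (intro ennreal_leI abs_add_powr_le assms)
 then show ?thesis by (simp add: ennreal_mult)
qed

lemma ennreal_powr_diff_le:
 assumes "1 < p"
 shows "epow p (x - y) <= ennreal (2 powr p) * (epow p x + epow p y)"
 using ennreal_powr_add_le[OF assms, of x "- y"] by simp

lemma ennreal_le_divide:
 assumes "0 < c" "ennreal c * X <= Y"
 shows "X <= ennreal (1 / c) * Y"
proof -
 have "X = ennreal (1 / c) * (ennreal c * X)"
  using assms(1) by (simp add: mult.assoc[symmetric] ennreal_mult'[symmetric])
 also have "... <= ennreal (1 / c) * Y" by (rule mult_left_mono[OF assms(2)]) simp
 finally show ?thesis .
qed

text \<open>If \<open>G(z+2x)\<close> is close to \<open>-G(z)\<close> for all \<open>x\<close> in an interval, then \<open>G\<close> is almost invariant under small shifts, hence under the shift \<open>2x\<close>, and is therefore close to \<open>-G\<close>. The constant may depend on the length of the interval but not on its centre.\<close>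

lemma shift_cancellation:
 fixes p \<epsilon> :: real
 assumes p: "1 < p" and \<epsilon>: "0 < \<epsilon>"
 shows "\<exists>C>0. \<forall>G x0. G \<in> borel_fun --> (\<forall>y. G (y + 2) = G y) \<longrightarrow>
   {x0 - \<epsilon><..<x0 + \<epsilon>} \<subseteq> I01 \<longrightarrow>
   (NINT z|circ. epow p (G z))
    <= ennreal C * (NINT x|{x0 - \<epsilon><..<x0 + \<epsilon>}. (NINT z|circ. epow p (G (z + 2 * x) + G z)))"
proof -
 (* each of n equal steps of the shift 2 x is shorter than 2 eps, because x < 1 *)
 define n where "n = nat \<lceil>1 / \<epsilon>\<rceil> + 1"
 have n: "1 <= \<epsilon> * real n"
 proof -
  have "1 / \<epsilon> <= real n" unfolding n_def by linarith
  then show ?thesis using \<epsilon> by (simp add: field_simps)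
 qed
 define K where "K = (2::real) powr p"
 have K: "1 <= K" using p by (simp add: K_def ge_one_powr_ge_zero)
 define c where "c = (2 * K) ^ n * (2 * K / \<epsilon>)"
 define C where "C = 1 / (2 * \<epsilon>) * (K * (1 + 2 * \<epsilon> * c))"
 have C: "0 < C" using \<epsilon> K by (simp add: C_def c_def add_pos_nonneg)
 show ?thesis
 proof (intro exI[of _ C] conjI C allI impI)
  fix G :: "real => real" and x0 :: real
  assume G [measurable]: "G \<in> borel_fun" and per: "\<forall>y. G (y + 2) = G y"
   and sub: "{x0 - \<epsilon><..<x0 + \<epsilon>} \<subseteq> I01"
  define N where "N x = (NINT z|circ. epow p (G (z + 2 * x) + G z))" for x
  define D where "D d = (NINT z|circ. epow p (G (z + d) - G z))" for d
  define A where "A = (NINT x|{x0 - \<epsilon><..<x0 + \<epsilon>}. N x)"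
  have Nm [measurable]: "N \<in> borel_fun" unfolding N_def by measurable
  have perc: "G (z + 2 + c) = G (z + c)" for z c
   using per[rule_format, of "z + c"] by (simp add: algebra_simps)
  have perz: "G (z + 2) = G z" for z using per by blast
  have Nshift: "(NINT z|circ. epow p (G (z + e + 2 * x) + G (z + e))) = N x" for e x
   unfolding N_def
   by (rule circle_shift[of "\<lambda>z. epow p (G (z + 2 * x) + G z)" e]) (auto simp: perc perz)
  have Dshift: "(NINT z|circ. epow p (G (z + e + d) - G (z + e))) = D d" for e d
   unfolding D_def
   by (rule circle_shift[of "\<lambda>z. epow p (G (z + d) - G z)" e]) (auto simp: perc perz)
  have Nneg: "N (- x) = N x" for x
   using Nshift[of "- (2 * x)" x] by (simp add: N_def add.commute)
  have int2: "(NINT z|circ. epow p (u z + v z))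
    <= ennreal K * ((NINT z|circ. epow p (u z)) + (NINT z|circ. epow p (v z)))"
   if [measurable]: "u \<in> borel_fun" "v \<in> borel_fun" for u v
  proof -
   have "(NINT z|circ. epow p (u z + v z))
    <= (NINT z|circ. ennreal K * (epow p (u z) + epow p (v z)))"
    unfolding K_def by (intro nn_integral_mono ennreal_powr_add_le p)
   then show ?thesis by (subst (asm) nn_integral_cmult_add) auto
  qed
  have Dadd: "D (d + d') <= ennreal K * (D d' + D d)" for d d'
  proof -
   have "D (d + d') = (NINT z|circ. epow p ((G (z + d + d') - G (z + d)) + (G (z + d) - G z)))"
    by (simp add: D_def add.assoc)
   also have "... <= ennreal K * ((NINT z|circ. epow p (G (z + d + d') - G (z + d))) + D d)"
    unfolding D_def by (rule int2) auto
   finally show ?thesis unfolding Dshift .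
  qed
  have Dn: "D (real k * d) <= ennreal ((2 * K) ^ k) * D d" for k d
  proof (induction k)
   case (Suc k)
   have "D (real (Suc k) * d) = D (real k * d + d)" by (simp add: algebra_simps)
   also have "... <= ennreal K * (D d + D (real k * d))" by (rule Dadd)
   also have "... <= ennreal K * (ennreal ((2 * K) ^ k) * D d + ennreal ((2 * K) ^ k) * D d)"
   proof (intro mult_left_mono add_mono Suc)
    have "ennreal 1 * D d <= ennreal ((2 * K) ^ k) * D d"
     using K by (intro mult_right_mono ennreal_leI one_le_power) auto
    then show "D d <= ennreal ((2 * K) ^ k) * D d" by simp
   qed auto
   also have "... = (ennreal K * (ennreal ((2 * K) ^ k) * ennreal 2)) * D d"
    unfolding mult_2[symmetric] ennreal_numeral by (simp only: ac_simps)
   also have "ennreal K * (ennreal ((2 * K) ^ k) * ennreal 2) = ennreal ((2 * K) ^ Suc k)"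
    using K by (simp add: ennreal_mult[symmetric] algebra_simps del: ennreal_numeral)
   finally show ?case .
  qed (simp add: D_def)
  (* the two sums share the value G (z + d) up to a translation *)
  have DN: "D d <= ennreal K * (N x + N (x - d / 2))" for d x
  proof -
   have "D d = (NINT z|circ. epow p ((G (z + (d - 2 * x) + 2 * x) + G (z + (d - 2 * x))) + - (G (z + 2 * (- (x - d / 2))) + G z)))"
    by (simp add: D_def algebra_simps)
   also have "... <= ennreal K * ((NINT z|circ. epow p (G (z + (d - 2 * x) + 2 * x) + G (z + (d - 2 * x))))
     + (NINT z|circ. epow p (- (G (z + 2 * (- (x - d / 2))) + G z))))"
    by (rule int2) auto
   also have "(NINT z|circ. epow p (- (G (z + 2 * (- (x - d / 2))) + G z))) = N (- (x - d / 2))"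
    unfolding N_def by (simp only: abs_minus_cancel)
   finally show ?thesis unfolding Nshift Nneg .
  qed
  (* average over the right half of the interval, where x - d / 2 stays inside the interval *)
  have Dsmall: "D d <= ennreal (2 * K / \<epsilon>) * A" if d: "0 <= d" "d < 2 * \<epsilon>" for d
  proof -
   have 1: "(NINT x|{x0..<x0 + \<epsilon>}. N x) <= A"
    unfolding A_def using \<epsilon> by (intro nn_integral_lb_mono_set) auto
   have "(NINT x|{x0..<x0 + \<epsilon>}. N (x + - (d / 2))) = (NINT x|{x0 + - (d / 2)..<x0 + \<epsilon> + - (d / 2)}. N x)"
    by (rule nn_integral_lb_shift) simp
   also have "... <= A"
    unfolding A_def using \<epsilon> d by (intro nn_integral_lb_mono_set) auto
   finally have 2: "(NINT x|{x0..<x0 + \<epsilon>}. N (x - d / 2)) <= A" by simp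
   have "ennreal \<epsilon> * D d = (NINT x|{x0..<x0 + \<epsilon>}. D d)"
    using \<epsilon> by (simp add: emeasure_lb mult.commute)
   also have "... <= (NINT x|{x0..<x0 + \<epsilon>}. ennreal K * (N x + N (x - d / 2)))"
    by (intro nn_integral_mono DN)
   also have "... = ennreal K * ((NINT x|{x0..<x0 + \<epsilon>}. N x) + (NINT x|{x0..<x0 + \<epsilon>}. N (x - d / 2)))"
    by (rule nn_integral_cmult_add) auto
   also have "... <= ennreal K * (A + A)" by (intro mult_left_mono add_mono 1 2) auto
   finally have "D d <= ennreal (1 / \<epsilon>) * (ennreal K * (A + A))" by (rule ennreal_le_divide[OF \<epsilon>])
   also have "... = ennreal (1 / \<epsilon>) * (ennreal K * ennreal 2) * A"
    by (simp add: mult_2[symmetric] mult.assoc)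
   also have "ennreal (1 / \<epsilon>) * (ennreal K * ennreal 2) = ennreal (2 * K / \<epsilon>)"
    using K \<epsilon> by (simp add: ennreal_mult[symmetric] algebra_simps del: ennreal_numeral)
   finally show ?thesis .
  qed
  let ?E = "NINT z|circ. epow p (G z)"
  have EN: "?E <= ennreal K * (N x + ennreal c * A)" if x: "x \<in> {x0 - \<epsilon><..<x0 + \<epsilon>}" for x
  proof -
   have x01: "0 < x" "x < 1" using sub x by auto
   define d where "d = 2 * x / real n"
   have n0: "0 < real n" by (simp add: n_def)
   have "d < 2 * \<epsilon>" using n n0 x01 \<epsilon> by (simp add: d_def field_simps)
   moreover have "0 <= d" using x01 by (simp add: d_def)
   ultimately have "ennreal ((2 * K) ^ n) * D d <= ennreal ((2 * K) ^ n) * (ennreal (2 * K / \<epsilon>) * A)"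
    by (intro mult_left_mono Dsmall) auto
   also have "... = ennreal c * A"
   proof -
    have "ennreal c = ennreal ((2 * K) ^ n) * ennreal (2 * K / \<epsilon>)"
     unfolding c_def using K \<epsilon> by (intro ennreal_mult) auto
    then show ?thesis by (simp only: mult.assoc)
   qed
   finally have "ennreal ((2 * K) ^ n) * D d <= ennreal c * A" .
   moreover have "D (2 * x) <= ennreal ((2 * K) ^ n) * D d"
    using Dn[of n d] n0 by (simp add: d_def)
   ultimately have D2: "D (2 * x) <= ennreal c * A" by (rule order_trans[rotated])
   have "?E <= (NINT z|circ. epow p ((G (z + 2 * x) + G z) + - (G (z + 2 * x) - G z)))"
    using p by (intro nn_integral_mono ennreal_leI powr_mono2) auto
   also have "... <= ennreal K * (N x + (NINT z|circ. epow p (- (G (z + 2 * x) - G z))))"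
    unfolding N_def by (rule int2) auto
   also have "... = ennreal K * (N x + D (2 * x))" unfolding D_def by (simp only: abs_minus_cancel)
   also have "... <= ennreal K * (N x + ennreal c * A)" by (intro mult_left_mono add_left_mono D2) auto
   finally show ?thesis .
  qed
  have "ennreal (2 * \<epsilon>) * ?E = (NINT x|{x0 - \<epsilon><..<x0 + \<epsilon>}. ?E)"
   using \<epsilon> by (simp add: emeasure_lb mult.commute)
  also have "... <= (NINT x|{x0 - \<epsilon><..<x0 + \<epsilon>}. ennreal K * (N x + ennreal c * A))"
   by (intro nn_integral_lb_mono EN) auto
  also have "... = ennreal K * (A + ennreal c * A * ennreal (2 * \<epsilon>))"
   unfolding A_def[symmetric]
   by (subst nn_integral_cmult_add) (use \<epsilon> in \<open>auto simp: emeasure_lb A_def[symmetric]\<close>)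
  also have "... = ennreal (K * (1 + 2 * \<epsilon> * c)) * A"
  proof -
   have "0 <= c" using K \<epsilon> by (simp add: c_def)
   have "ennreal (K * (1 + 2 * \<epsilon> * c)) = ennreal K * ennreal (1 + 2 * \<epsilon> * c)"
    using K \<epsilon> \<open>0 <= c\<close> by (intro ennreal_mult) auto
   also have "ennreal (1 + 2 * \<epsilon> * c) = 1 + ennreal (2 * \<epsilon> * c)"
    using \<epsilon> \<open>0 <= c\<close> by (simp add: ennreal_plus)
   also have "ennreal (2 * \<epsilon> * c) = ennreal (2 * \<epsilon>) * ennreal c"
    using \<epsilon> \<open>0 <= c\<close> by (intro ennreal_mult) auto
   finally show ?thesis by (simp only: distrib_left distrib_right mult_1_left mult_1_right ac_simps)
  qed
  finally have "?E <= ennreal (1 / (2 * \<epsilon>)) * (ennreal (K * (1 + 2 * \<epsilon> * c)) * A)"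
   using \<epsilon> by (intro ennreal_le_divide) auto
  also have "... = ennreal C * A"
   unfolding C_def using \<epsilon> K
   by (subst ennreal_mult) (auto simp: mult.assoc c_def)
  finally show "?E <= ennreal C * (NINT x|{x0 - \<epsilon><..<x0 + \<epsilon>}. (NINT z|circ. epow p (G (z + 2 * x) + G z)))"
   by (simp add: A_def N_def)
 qed
qed

context circle_damping
begin

text \<open>The energy that the damping sees in one period, with \<open>|velocity|\<^sup>p\<close> in place of the true dissipation.\<close>

definition damped_work :: "(real => real => real) => real => ennreal" where
 "damped_work g r = (NINT s|{r..r + 2}. (NINT y|circ. ennreal (b s (y - s) * \<bar>(g s y + g s (2 * s - y)) / 2\<bar> powr p)))"

text \<open>The time derivative of \<open>g\<close> is the flux, so Hoelder in time bounds the drift by the work of the damping; \<open>b\<^sup>p\<close> is at most \<open>M\<^sup>p\<^sup>-\<^sup>1 b\<close>.\<close>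

lemma evolution_drift:
 assumes ev: "evolution g" and r: "0 <= r" and s: "s \<in> {r..r + 2}"
 shows "(NINT y|circ. epow p (g s y - g r y)) <= ennreal (2 powr (p - 1) * M powr (p - 1)) * damped_work g r"
proof -
 note [measurable] = evolution_measurable[OF ev] flux_measurable[OF ev]
 let ?w = "\<lambda>s y. ennreal (b s (y - s) * \<bar>(g s y + g s (2 * s - y)) / 2\<bar> powr p)"
 have flux: "epow p (- flux g s y) <= ennreal (M powr (p - 1)) * ?w s y" for s y
 proof -
  let ?b = "b s (y - s)" and ?h = "(g s y + g s (2 * s - y)) / 2"
  have "\<bar>- flux g s y\<bar> = ?b * \<bar>?h\<bar>"
   using b_nonneg[of s "y - s"] by (simp add: flux_def abs_mult)
  then have "\<bar>- flux g s y\<bar> powr p = ?b powr p * \<bar>?h\<bar> powr p"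
   using b_nonneg[of s "y - s"] by (simp only: powr_mult abs_ge_zero)
  also have "?b powr p = ?b powr (p - 1) * ?b" using abs_powr_Suc[OF p, of ?b] b_nonneg[of s "y - s"] by simp
  also have "?b powr (p - 1) * ?b * \<bar>?h\<bar> powr p <= M powr (p - 1) * ?b * \<bar>?h\<bar> powr p"
   using b_nonneg[of s "y - s"] b_le[of s "y - s"] p by (intro mult_right_mono powr_mono2) auto
  finally have "epow p (- flux g s y) <= ennreal (M powr (p - 1) * (?b * \<bar>?h\<bar> powr p))"
   by (intro ennreal_leI) (simp add: mult.assoc)
  then show ?thesis using b_nonneg[of s "y - s"] by (simp add: ennreal_mult)
 qed
 have "(NINT y|circ. epow p (g s y - g r y))
  <= (NINT y|circ. ennreal (2 powr (p - 1)) * (NINT \<sigma>|{r..r + 2}. ennreal (M powr (p - 1)) * ?w \<sigma> y))"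
 proof (rule nn_integral_mono_AE)
  show "AE y in lb circ. epow p (g s y - g r y)
   <= ennreal (2 powr (p - 1)) * (NINT \<sigma>|{r..r + 2}. ennreal (M powr (p - 1)) * ?w \<sigma> y)"
   using evolutionD(3)[OF ev]
  proof eventually_elim
   case (elim y)
   then have AC: "AC_on 0 s (\<lambda>s. g s y) (\<lambda>s. - flux g s y)" using r s by auto
   have d: "g s y - g r y = (LINT x|lb {r..s}. - flux g x y)" and i: "integrable (lb {r..s}) (\<lambda>x. - flux g x y)"
    using AC_on_diff[OF AC, of r s] r s by auto
   have "epow p (g s y - g r y)
    <= ennreal ((s - r) powr (p - 1)) * (NINT x|{r..s}. epow p (- flux g x y))"
    unfolding d using s by (intro power_integral_le p i) auto
   also have "... <= ennreal (2 powr (p - 1)) * (NINT x|{r..r + 2}. epow p (- flux g x y))"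
    using s p by (intro mult_mono ennreal_leI powr_mono2 nn_integral_lb_mono_set) auto
   also have "... <= ennreal (2 powr (p - 1)) * (NINT \<sigma>|{r..r + 2}. ennreal (M powr (p - 1)) * ?w \<sigma> y)"
    by (intro mult_left_mono nn_integral_mono flux) auto
   finally show ?case .
  qed
 qed
 also have "... = (NINT y|circ. (ennreal (2 powr (p - 1)) * ennreal (M powr (p - 1))) * (NINT \<sigma>|{r..r + 2}. ?w \<sigma> y))"
  by (intro nn_integral_cong) (simp add: nn_integral_cmult mult.assoc)
 also have "... = (ennreal (2 powr (p - 1)) * ennreal (M powr (p - 1))) * (NINT y|circ. (NINT \<sigma>|{r..r + 2}. ?w \<sigma> y))"
  by (rule nn_integral_cmult) measurable
 also have "(NINT y|circ. (NINT \<sigma>|{r..r + 2}. ?w \<sigma> y)) = damped_work g r"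
  unfolding damped_work_def by (rule Fubini_lb_nn) auto
 finally show ?thesis by (simp add: ennreal_mult)
qed

text \<open>On the damped interval the initial sum \<open>g(r,s+x) + g(r,s-x)\<close> equals twice the velocity at time \<open>s\<close> up to drift, and both are bounded by the work.\<close>

lemma observability:
 assumes ev: "evolution g" and r: "0 <= r" and lam: "0 < lam"
  and sub: "{x0 - \<epsilon><..<x0 + \<epsilon>} \<subseteq> I01"
  and low: "!!s x. x \<in> {x0 - \<epsilon><..<x0 + \<epsilon>} ==> lam <= b s x"
  and C: "0 < C" "!!G. G \<in> borel_fun ==> (!!y. G (y + 2) = G y) ==>
   (NINT z|circ. epow p (G z))
    <= ennreal C * (NINT x|{x0 - \<epsilon><..<x0 + \<epsilon>}. (NINT z|circ. epow p (G (z + 2 * x) + G z)))"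
 shows "energy g r <= ennreal (C * (4 powr p * (1 / lam + 4 * (2 powr (p - 1) * M powr (p - 1))))) * damped_work g r"
proof -
 note [measurable] = evolution_measurable[OF ev] flux_measurable[OF ev]
 let ?\<omega> = "{x0 - \<epsilon><..<x0 + \<epsilon>}"
 let ?w = "\<lambda>s y. ennreal (b s (y - s) * \<bar>(g s y + g s (2 * s - y)) / 2\<bar> powr p)"
 let ?d = "\<lambda>s y. epow p (g s y - g r y)"
 define C1 where "C1 = 2 powr (p - 1) * M powr (p - 1)"
 have C1: "0 <= C1" by (simp add: C1_def)
 have wper: "?w s (y + 2) = ?w s y" for s y
 proof -
  have "g s (2 * s - (y + 2)) = g s (2 * s - y)"
   using evolutionD(2)[OF ev, of s "2 * s - (y + 2)"] by simp
  moreover have "b s (y + 2 - s) = b s (y - s)"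
   using b_periodic[of s "y - s"] by (simp add: algebra_simps)
  ultimately show ?thesis by (simp add: evolutionD(2)[OF ev])
 qed
 have dper: "?d s (y + 2) = ?d s y" for s y by (simp add: evolutionD(2)[OF ev])
 (* exchange g r for g s at the price of the drift at both points *)
 have pt: "epow p (g r (x + s) + g r (s - x))
   <= ennreal (4 powr p) * (ennreal (1 / lam) * ?w s (x + s) + (?d s (x + s) + ?d s (s - x)))"
  if x: "x \<in> ?\<omega>" for x s
 proof -
  let ?h = "(g s (x + s) + g s (s - x)) / 2"
  let ?u = "g s (x + s) - g r (x + s)" and ?v = "g s (s - x) - g r (s - x)"
  have K4: "2 powr p * 2 powr p = (4::real) powr p" by (simp add: powr_mult[symmetric])
  have h2: "2 * ?h = g s (x + s) + g s (s - x)" by simp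
  have "\<bar>g r (x + s) + g r (s - x)\<bar> powr p = \<bar>2 * ?h - (?u + ?v)\<bar> powr p"
   unfolding h2 by (simp add: algebra_simps)
  also have "... <= 2 powr p * (\<bar>2 * ?h\<bar> powr p + \<bar>?u + ?v\<bar> powr p)" by (rule abs_diff_powr_le[OF p])
  also have "... <= 2 powr p * (2 powr p * \<bar>?h\<bar> powr p + 2 powr p * (\<bar>?u\<bar> powr p + \<bar>?v\<bar> powr p))"
  proof (intro mult_left_mono add_mono abs_add_powr_le p)
   have "\<bar>2 * z\<bar> powr p <= 2 powr p * \<bar>z\<bar> powr p" for z :: real
    by (simp add: abs_mult powr_mult)
   then show "\<bar>2 * ?h\<bar> powr p <= 2 powr p * \<bar>?h\<bar> powr p" .
  qed auto
  also have "... = 4 powr p * (\<bar>?h\<bar> powr p + (\<bar>?u\<bar> powr p + \<bar>?v\<bar> powr p))"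
   unfolding K4[symmetric] by (simp add: algebra_simps)
  also have "... <= 4 powr p * (1 / lam * (b s x * \<bar>?h\<bar> powr p) + (\<bar>?u\<bar> powr p + \<bar>?v\<bar> powr p))"
  proof (intro mult_left_mono add_right_mono)
   have "lam * \<bar>?h\<bar> powr p <= b s x * \<bar>?h\<bar> powr p" using low[OF x] by (intro mult_right_mono) auto
   then show "\<bar>?h\<bar> powr p <= 1 / lam * (b s x * \<bar>?h\<bar> powr p)" using lam by (simp add: field_simps)
  qed auto
  finally have "epow p (g r (x + s) + g r (s - x))
    <= ennreal (4 powr p * (1 / lam * (b s x * \<bar>?h\<bar> powr p) + (\<bar>?u\<bar> powr p + \<bar>?v\<bar> powr p)))" by (rule ennreal_leI)
  also have "... = ennreal (4 powr p) * (ennreal (1 / lam) * ennreal (b s x * \<bar>?h\<bar> powr p) + (epow p (?u) + epow p (?v)))"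
  proof -
   have nn: "0 <= b s x * \<bar>?h\<bar> powr p" by (intro mult_nonneg_nonneg b_nonneg) simp
   have "ennreal (4 powr p * (1 / lam * (b s x * \<bar>?h\<bar> powr p) + (\<bar>?u\<bar> powr p + \<bar>?v\<bar> powr p)))
     = ennreal (4 powr p) * ennreal (1 / lam * (b s x * \<bar>?h\<bar> powr p) + (\<bar>?u\<bar> powr p + \<bar>?v\<bar> powr p))"
    using nn lam by (intro ennreal_mult add_nonneg_nonneg) auto
   also have "ennreal (1 / lam * (b s x * \<bar>?h\<bar> powr p) + (\<bar>?u\<bar> powr p + \<bar>?v\<bar> powr p))
     = ennreal (1 / lam * (b s x * \<bar>?h\<bar> powr p)) + ennreal (\<bar>?u\<bar> powr p + \<bar>?v\<bar> powr p)"
    using nn lam by (intro ennreal_plus) auto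
   also have "ennreal (1 / lam * (b s x * \<bar>?h\<bar> powr p)) = ennreal (1 / lam) * ennreal (b s x * \<bar>?h\<bar> powr p)"
    using nn lam by (intro ennreal_mult) auto
   also have "ennreal (\<bar>?u\<bar> powr p + \<bar>?v\<bar> powr p) = epow p (?u) + epow p (?v)"
    by (intro ennreal_plus) auto
   finally show ?thesis .
  qed
  finally show ?thesis by (simp add: algebra_simps)
 qed
 have s_est: "(\<integral>\<^sup>+x. epow p (g r (x + s) + g r (s - x)) \<partial>lb ?\<omega>)
   <= ennreal (4 powr p) * (ennreal (1 / lam) * (NINT y|circ. ?w s y) + ennreal (2 * C1) * damped_work g r)"
  if s: "s \<in> {r..r + 2}" for s
 proof -
  have sub2: "?\<omega> \<subseteq> circ" using sub by force
  have "(\<integral>\<^sup>+x. epow p (g r (x + s) + g r (s - x)) \<partial>lb ?\<omega>)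
   <= (\<integral>\<^sup>+x. ennreal (4 powr p) * (ennreal (1 / lam) * ?w s (x + s) + (?d s (x + s) + ?d s (s - x))) \<partial>lb ?\<omega>)"
   by (intro nn_integral_lb_mono pt) auto
  also have "... <= (NINT x|circ. ennreal (4 powr p) * (ennreal (1 / lam) * ?w s (x + s) + (?d s (x + s) + ?d s (s - x))))"
   by (intro nn_integral_lb_mono_set sub2) auto
  also have "... = ennreal (4 powr p) * ((NINT x|circ. ennreal (1 / lam) * ?w s (x + s)) + (NINT x|circ. ?d s (x + s) + ?d s (s - x)))"
   by (rule nn_integral_cmult_add) measurable
  also have "(NINT x|circ. ennreal (1 / lam) * ?w s (x + s)) = ennreal (1 / lam) * (NINT x|circ. ?w s (x + s))"
   by (rule nn_integral_cmult) measurable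
  also have "(NINT x|circ. ?w s (x + s)) = (NINT x|circ. ?w s x)"
   by (rule circle_shift[of "?w s"]) (measurable, rule wper)
  also have "(NINT x|circ. ?d s (x + s) + ?d s (s - x)) = (NINT x|circ. ?d s (x + s)) + (NINT x|circ. ?d s (s - x))"
   by (rule nn_integral_add) measurable
  also have "(NINT x|circ. ?d s (x + s)) = (NINT x|circ. ?d s x)"
   by (rule circle_shift[of "?d s"]) (measurable, rule dper)
  also have "(NINT x|circ. ?d s (s - x)) = (NINT x|circ. ?d s x)"
   by (rule circle_reflect[of "?d s"]) (measurable, rule dper)
  also have "ennreal (4 powr p) * (ennreal (1 / lam) * (NINT y|circ. ?w s y) + ((NINT x|circ. ?d s x) + (NINT x|circ. ?d s x)))
   <= ennreal (4 powr p) * (ennreal (1 / lam) * (NINT y|circ. ?w s y) + (ennreal C1 * damped_work g r + ennreal C1 * damped_work g r))"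
   using evolution_drift[OF ev r s] unfolding C1_def by (intro mult_left_mono add_mono) auto
  also have "ennreal C1 * damped_work g r + ennreal C1 * damped_work g r = ennreal (2 * C1) * damped_work g r"
   using C1 by (simp add: distrib_right[symmetric] ennreal_plus[symmetric] del: ennreal_plus)
  finally show ?thesis .
 qed
 have gper: "g r (y + 2) = g r y" for y by (rule evolutionD(2)[OF ev])
 have "energy g r <= ennreal C * (\<integral>\<^sup>+x. (NINT z|circ. epow p (g r (z + 2 * x) + g r z)) \<partial>lb ?\<omega>)"
  unfolding energy_def by (rule C(2)) (measurable, rule gper)
 also have "(\<integral>\<^sup>+x. (NINT z|circ. epow p (g r (z + 2 * x) + g r z)) \<partial>lb ?\<omega>)
   = (\<integral>\<^sup>+x. (NINT s|{r..r + 2}. epow p (g r (x + s) + g r (s - x))) \<partial>lb ?\<omega>)"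
 proof (intro nn_integral_cong)
  fix x
  let ?F = "\<lambda>s. epow p (g r (x + s) + g r (s - x))"
  have per: "?F (s + 2) = ?F s" for s
   using gper[of "x + s"] gper[of "s - x"] by (simp add: algebra_simps)
  have "(NINT s|{r..r + 2}. ?F s) = (NINT s|circ. ?F s)"
   by (rule circle_window) (measurable, rule per)
  also have "... = (NINT s|circ. ?F (s + x))"
   by (rule circle_shift[symmetric]) (measurable, rule per)
  also have "... = (NINT z|circ. epow p (g r (z + 2 * x) + g r z))"
   by (intro nn_integral_cong) (simp add: algebra_simps)
  finally show "(NINT z|circ. epow p (g r (z + 2 * x) + g r z)) = (NINT s|{r..r + 2}. ?F s)" ..
 qed
 also have "... = (NINT s|{r..r + 2}. (\<integral>\<^sup>+x. epow p (g r (x + s) + g r (s - x)) \<partial>lb ?\<omega>))"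
  by (rule Fubini_lb_nn) auto
 also have "ennreal C * (NINT s|{r..r + 2}. (\<integral>\<^sup>+x. epow p (g r (x + s) + g r (s - x)) \<partial>lb ?\<omega>))
  <= ennreal C * (NINT s|{r..r + 2}. ennreal (4 powr p) * (ennreal (1 / lam) * (NINT y|circ. ?w s y) + ennreal (2 * C1) * damped_work g r))"
  by (intro mult_left_mono nn_integral_lb_mono s_est) auto
 also have "(NINT s|{r..r + 2}. ennreal (4 powr p) * (ennreal (1 / lam) * (NINT y|circ. ?w s y) + ennreal (2 * C1) * damped_work g r)) = ennreal (4 powr p) * ((NINT s|{r..r + 2}. ennreal (1 / lam) * (NINT y|circ. ?w s y))
    + (NINT s|{r..r + 2}. ennreal (2 * C1) * damped_work g r))"
  by (rule nn_integral_cmult_add) measurable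
 also have "(NINT s|{r..r + 2}. ennreal (1 / lam) * (NINT y|circ. ?w s y)) = ennreal (1 / lam) * damped_work g r"
  unfolding damped_work_def by (rule nn_integral_cmult) measurable
 also have "(NINT s|{r..r + 2}. ennreal (2 * C1) * damped_work g r) = ennreal (4 * C1) * damped_work g r"
 proof -
  have "(NINT s|{r..r + 2}. ennreal (2 * C1) * damped_work g r) = ennreal (2 * C1) * ennreal 2 * damped_work g r"
   by (simp add: emeasure_lb ac_simps)
  also have "ennreal (2 * C1) * ennreal 2 = ennreal (4 * C1)"
   using C1 by (subst ennreal_mult[symmetric]) auto
  finally show ?thesis .
 qed
 also have "ennreal C * (ennreal (4 powr p) * (ennreal (1 / lam) * damped_work g r + ennreal (4 * C1) * damped_work g r))
   = ennreal (C * (4 powr p * (1 / lam + 4 * C1))) * damped_work g r"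
 proof -
  have "ennreal (C * (4 powr p * (1 / lam + 4 * C1))) = ennreal C * (ennreal (4 powr p) * (ennreal (1 / lam) + ennreal (4 * C1)))"
  proof -
   have "ennreal (C * (4 powr p * (1 / lam + 4 * C1))) = ennreal C * ennreal (4 powr p * (1 / lam + 4 * C1))"
    using C lam C1 by (intro ennreal_mult) auto
   also have "ennreal (4 powr p * (1 / lam + 4 * C1)) = ennreal (4 powr p) * ennreal (1 / lam + 4 * C1)"
    using lam C1 by (intro ennreal_mult) auto
   also have "ennreal (1 / lam + 4 * C1) = ennreal (1 / lam) + ennreal (4 * C1)"
    using lam C1 by (intro ennreal_plus) auto
   finally show ?thesis .
  qed
  then show ?thesis by (simp add: distrib_left distrib_right mult.assoc)
 qed
 finally show ?thesis unfolding C1_def .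
qed

end

text \<open>The dissipation bounds the work of the damping up to a small multiple of the initial energy. By observability the same work bounds that energy, which is finite, so the small multiple is absorbed.\<close>

lemma energy_contraction:
 fixes p lam \<epsilon> M :: real
 assumes p: "1 < p" and lam: "0 < lam" and \<epsilon>: "0 < \<epsilon>" and M: "0 <= M"
 shows "\<exists>\<theta>>0. \<theta> < 1 \<and> (\<forall>b x0 g r. circle_damping b M p --> {x0 - \<epsilon><..<x0 + \<epsilon>} \<subseteq> I01 \<longrightarrow>
   (\<forall>s. \<forall>x\<in>{x0 - \<epsilon><..<x0 + \<epsilon>}. lam <= b s x) --> circle_damping.evolution b g --> 0 <= r \<longrightarrow>
   circle_damping.energy p g r < \<infinity> \<longrightarrow>
   circle_damping.energy p g (r + 2) <= ennreal \<theta> * circle_damping.energy p g r)"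
proof -
 obtain C where C: "0 < C" "!!G x0. G \<in> borel_fun ==> (!!y. G (y + 2) = G y) ==>
   {x0 - \<epsilon><..<x0 + \<epsilon>} \<subseteq> I01 ==>
   (NINT z|circ. epow p (G z))
    <= ennreal C * (NINT x|{x0 - \<epsilon><..<x0 + \<epsilon>}. (NINT z|circ. epow p (G (z + 2 * x) + G z)))"
  using shift_cancellation[OF p \<epsilon>] by blast
 define K where "K = C * (4 powr p * (1 / lam + 4 * (2 powr (p - 1) * M powr (p - 1))))"
 have K: "0 < K" using C lam by (simp add: K_def add_pos_nonneg)
 (* eta is so small that the error term is at most half of the energy *)
 define \<eta> where "\<eta> = 1 / (8 * K * (M + 1))"
 have \<eta>: "0 < \<eta>" using K M by (simp add: \<eta>_def)
 have K\<eta>: "K * (4 * \<eta> * M) <= 1 / 2"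
 proof -
  have "K * (4 * \<eta> * M) = M / (2 * (M + 1))" using K M by (simp add: \<eta>_def divide_simps)
  also have "... <= 1 / 2" using M by (simp add: divide_simps)
  finally show ?thesis .
 qed
 obtain B where B: "0 < B" "!!s r. \<bar>s + r\<bar> powr p
   <= B * ((spow p s + spow p r) * (s + r)) + \<eta> * (\<bar>s\<bar> powr p + \<bar>r\<bar> powr p)"
  using powr_dissipation_bound[OF p \<eta>] by blast
 define L where "L = 8 * K * B / p"
 have L: "0 < L" using K B p by (simp add: L_def)
 (* the maximum with 1 / 2 keeps the factor positive when L is small *)
 define \<theta> where "\<theta> = max (1 / 2) (1 - 1 / L)"
 have \<theta>: "0 < \<theta>" "\<theta> < 1" using L by (auto simp: \<theta>_def)
 show ?thesis
 proof (intro exI[of _ \<theta>] conjI \<theta> allI impI)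
  fix b x0 g r
  assume cd: "circle_damping b M p" and sub: "{x0 - \<epsilon><..<x0 + \<epsilon>} \<subseteq> I01"
   and low: "\<forall>s. \<forall>x\<in>{x0 - \<epsilon><..<x0 + \<epsilon>}. lam <= b s x"
   and ev: "circle_damping.evolution b g" and r: "0 <= r" and fin: "circle_damping.energy p g r < \<infinity>"
  interpret circle_damping b M p by fact
  note [measurable] = evolution_measurable[OF ev] flux_measurable[OF ev]
  let ?\<Phi> = "\<lambda>s y. (spow p (g s y) + spow p (g s (2 * s - y))) * (g s y + g s (2 * s - y))"
  define X where "X = (NINT s|{r..r + 2}. (NINT y|circ. ennreal (b s (y - s) * ?\<Phi> s y)))"
  have id: "energy g (r + 2) + ennreal (p / 4) * X = energy g r"
   unfolding X_def by (rule energy_dissipation[OF ev r _ fin]) simp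
  have \<Phi>0: "0 <= b s (y - s) * ?\<Phi> s y" for s y
  proof -
   have "0 <= (p * spow p (g s y) + p * spow p (g s (2 * s - y))) * (g s y + g s (2 * s - y))"
    by (rule subgradient_odd_sum_nonneg[OF subgradient_powr[OF p]]) simp
   then have "0 <= p * ?\<Phi> s y" by (simp add: algebra_simps)
   then have "0 <= ?\<Phi> s y" using p by (simp add: zero_le_mult_iff)
   then show ?thesis by (rule mult_nonneg_nonneg[OF b_nonneg])
  qed
  have Es: "energy g s <= energy g r" if "s \<in> {r..r + 2}" for s
   using that r by (intro energy_antimono[OF ev]) auto
  have pow_m: "(\<lambda>z::real. epow p z) \<in> borel_fun" by measurable
  have work: "damped_work g r <= ennreal B * X + ennreal (4 * \<eta> * M) * energy g r"
  proof -
   have "damped_work g r <= (NINT s|{r..r + 2}. (NINT y|circ. ennreal B * ennreal (b s (y - s) * ?\<Phi> s y)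
     + ennreal (\<eta> * M) * (epow p (g s y) + epow p (g s (2 * s - y)))))"
    unfolding damped_work_def
   proof (intro nn_integral_mono)
    fix s y
    let ?S = "\<bar>g s y\<bar> powr p + \<bar>g s (2 * s - y)\<bar> powr p"
    have "\<bar>(g s y + g s (2 * s - y)) / 2\<bar> powr p <= \<bar>g s y + g s (2 * s - y)\<bar> powr p"
     using p by (intro powr_mono2) auto
    also have "... <= B * ?\<Phi> s y + \<eta> * ?S" by (rule B(2))
    finally have "b s (y - s) * \<bar>(g s y + g s (2 * s - y)) / 2\<bar> powr p <= b s (y - s) * (B * ?\<Phi> s y + \<eta> * ?S)"
     by (rule mult_left_mono[OF _ b_nonneg])
    also have "... = B * (b s (y - s) * ?\<Phi> s y) + b s (y - s) * (\<eta> * ?S)" by (simp add: algebra_simps)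
    also have "... <= B * (b s (y - s) * ?\<Phi> s y) + M * (\<eta> * ?S)"
     using \<eta> by (intro add_left_mono mult_right_mono b_le) auto
    finally have "ennreal (b s (y - s) * \<bar>(g s y + g s (2 * s - y)) / 2\<bar> powr p)
     <= ennreal (B * (b s (y - s) * ?\<Phi> s y) + (\<eta> * M) * ?S)"
     by (intro ennreal_leI) (simp add: algebra_simps)
    also have "... = ennreal (B * (b s (y - s) * ?\<Phi> s y)) + ennreal ((\<eta> * M) * ?S)"
     using B(1) \<eta> M by (intro ennreal_plus mult_nonneg_nonneg[OF _ \<Phi>0]) auto
    also have "ennreal (B * (b s (y - s) * ?\<Phi> s y)) = ennreal B * ennreal (b s (y - s) * ?\<Phi> s y)"
     using B(1) by (intro ennreal_mult \<Phi>0) auto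
    also have "ennreal ((\<eta> * M) * ?S) = ennreal (\<eta> * M) * ennreal ?S"
     using \<eta> M by (intro ennreal_mult) auto
    also have "ennreal ?S = epow p (g s y) + epow p (g s (2 * s - y))"
     by (intro ennreal_plus) auto
    finally show "ennreal (b s (y - s) * \<bar>(g s y + g s (2 * s - y)) / 2\<bar> powr p)
     <= ennreal B * ennreal (b s (y - s) * ?\<Phi> s y)
      + ennreal (\<eta> * M) * (epow p (g s y) + epow p (g s (2 * s - y)))" .
   qed
   also have "... = (NINT s|{r..r + 2}. ennreal B * (NINT y|circ. ennreal (b s (y - s) * ?\<Phi> s y))
     + ennreal (\<eta> * M) * (2 * energy g s))"
   proof (intro nn_integral_cong)
    fix s
    have "(NINT y|circ. ennreal (\<eta> * M) * (epow p (g s y) + epow p (g s (2 * s - y))))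
     = ennreal (\<eta> * M) * ((NINT y|circ. epow p (g s y)) + (NINT y|circ. epow p (g s (2 * s - y))))"
     by (rule nn_integral_cmult_add) measurable
    also have "... = ennreal (\<eta> * M) * (2 * energy g s)"
     unfolding double_nn_integral_reflect[OF ev pow_m] by (simp only: mult_2[symmetric] energy_def)
    finally have 1: "(NINT y|circ. ennreal (\<eta> * M) * (epow p (g s y) + epow p (g s (2 * s - y))))
      = ennreal (\<eta> * M) * (2 * energy g s)" .
    have 2: "(NINT y|circ. ennreal B * ennreal (b s (y - s) * ?\<Phi> s y))
      = ennreal B * (NINT y|circ. ennreal (b s (y - s) * ?\<Phi> s y))"
     by (rule nn_integral_cmult) measurable
    show "(NINT y|circ. ennreal B * ennreal (b s (y - s) * ?\<Phi> s y)
     + ennreal (\<eta> * M) * (epow p (g s y) + epow p (g s (2 * s - y))))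
     = ennreal B * (NINT y|circ. ennreal (b s (y - s) * ?\<Phi> s y)) + ennreal (\<eta> * M) * (2 * energy g s)"
     unfolding 1[symmetric] 2[symmetric] by (rule nn_integral_add) measurable
   qed
   also have "... <= (NINT s|{r..r + 2}. ennreal B * (NINT y|circ. ennreal (b s (y - s) * ?\<Phi> s y))
     + ennreal (\<eta> * M) * (2 * energy g r))"
    by (intro nn_integral_lb_mono add_left_mono mult_left_mono Es) auto
   also have "... = (NINT s|{r..r + 2}. ennreal B * (NINT y|circ. ennreal (b s (y - s) * ?\<Phi> s y)))
     + (NINT s|{r..r + 2}. ennreal (\<eta> * M) * (2 * energy g r))"
    by (rule nn_integral_add) measurable
   also have "(NINT s|{r..r + 2}. ennreal B * (NINT y|circ. ennreal (b s (y - s) * ?\<Phi> s y))) = ennreal B * X"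
    unfolding X_def by (rule nn_integral_cmult) measurable
   also have "(NINT s|{r..r + 2}. ennreal (\<eta> * M) * (2 * energy g r)) = ennreal (4 * \<eta> * M) * energy g r"
   proof -
    have "(NINT s|{r..r + 2}. ennreal (\<eta> * M) * (2 * energy g r)) = ennreal (\<eta> * M) * ennreal 4 * energy g r"
     by (simp add: emeasure_lb ac_simps)
    also have "ennreal (\<eta> * M) * ennreal 4 = ennreal (4 * \<eta> * M)"
     using \<eta> M by (subst ennreal_mult[symmetric]) (auto simp: ac_simps)
    finally show ?thesis .
   qed
   finally show ?thesis .
  qed
  have obs: "energy g r <= ennreal K * damped_work g r"
   unfolding K_def
  proof (rule observability[OF ev r lam sub])
   show "lam <= b s x" if "x \<in> {x0 - \<epsilon><..<x0 + \<epsilon>}" for s x using low that by blast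
   show "0 < C" by (rule C(1))
  qed (rule C(2)[OF _ _ sub])
  have le: "energy g r <= ennreal K * (ennreal B * X + ennreal (4 * \<eta> * M) * energy g r)"
   by (rule order_trans[OF obs mult_left_mono[OF work]]) simp
  define e where "e = enn2real (energy g r)"
  define e2 where "e2 = enn2real (energy g (r + 2))"
  define x where "x = enn2real X"
  have e: "energy g r = ennreal e" "0 <= e" using fin by (auto simp: e_def)
  have "energy g (r + 2) < \<infinity>" using Es[of "r + 2"] fin by (auto intro: le_less_trans)
  then have e2: "energy g (r + 2) = ennreal e2" "0 <= e2" by (auto simp: e2_def)
  have "ennreal (p / 4) * X <= energy g r" unfolding id[symmetric] by simp
  then have "X \<noteq> \<infinity>" using fin p by (auto simp: ennreal_mult_top)
  then have x: "X = ennreal x" "0 <= x" by (auto simp: x_def less_top)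
  have "ennreal e <= ennreal (K * (B * x + (4 * \<eta> * M) * e))"
  proof -
   have "ennreal (K * (B * x + (4 * \<eta> * M) * e)) = ennreal K * (ennreal B * ennreal x + ennreal (4 * \<eta> * M) * ennreal e)"
   proof -
    have n1: "0 <= B * x" and n2: "0 <= 4 * \<eta> * M * e" using B x \<eta> M e by auto
    have "ennreal (K * (B * x + (4 * \<eta> * M) * e)) = ennreal K * ennreal (B * x + (4 * \<eta> * M) * e)"
     using K n1 n2 by (intro ennreal_mult) auto
    also have "ennreal (B * x + (4 * \<eta> * M) * e) = ennreal (B * x) + ennreal ((4 * \<eta> * M) * e)"
     by (rule ennreal_plus[OF n1 n2])
    also have "ennreal (B * x) = ennreal B * ennreal x" using B x by (intro ennreal_mult) auto
    also have "ennreal ((4 * \<eta> * M) * e) = ennreal (4 * \<eta> * M) * ennreal e" using \<eta> M e by (intro ennreal_mult) auto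
    finally show ?thesis .
   qed
   then show ?thesis using le unfolding e x by simp
  qed
  moreover have n: "0 <= K * (B * x + (4 * \<eta> * M) * e)"
   using K B x \<eta> M e by (intro mult_nonneg_nonneg add_nonneg_nonneg) auto
  ultimately have "e <= K * (B * x + (4 * \<eta> * M) * e)" by (simp add: ennreal_le_iff)
  also have "... = K * B * x + (K * (4 * \<eta> * M)) * e" by (simp add: algebra_simps)
  also have "... <= K * B * x + 1 / 2 * e" using K\<eta> e by (intro add_left_mono mult_right_mono) auto
  finally have ex: "e <= 2 * K * B * x" by simp
  have "ennreal e2 + ennreal (p / 4) * ennreal x = ennreal e" using id unfolding e e2 x .
  moreover have "ennreal (e2 + p / 4 * x) = ennreal e2 + ennreal (p / 4) * ennreal x"
  proof -
   have "ennreal (e2 + p / 4 * x) = ennreal e2 + ennreal (p / 4 * x)"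
    using e2 x p by (intro ennreal_plus) auto
   also have "ennreal (p / 4 * x) = ennreal (p / 4) * ennreal x" using x p by (intro ennreal_mult) auto
   finally show ?thesis .
  qed
  ultimately have "ennreal (e2 + p / 4 * x) = ennreal e" by simp
  then have xe: "e2 + p / 4 * x = e" using e2 x p e by (subst (asm) ennreal_inj) auto
  have "e <= L * (e - e2)"
  proof -
   have "x = 4 / p * (e - e2)" using xe p by (simp add: field_simps)
   moreover have "2 * K * B * (4 / p * D) = L * D" for D by (simp add: L_def)
   ultimately show ?thesis using ex by metis
  qed
  then have "e2 <= (1 - 1 / L) * e" using L by (simp add: field_simps)
  also have "... <= \<theta> * e" using e by (intro mult_right_mono) (auto simp: \<theta>_def)
  finally show "energy g (r + 2) <= ennreal \<theta> * energy g r"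
   unfolding e e2 using \<theta> e by (simp add: ennreal_mult[symmetric] ennreal_leI)
 qed
qed

lemma energy_decay:
 fixes p lam \<epsilon> M :: real
 assumes p: "1 < p" and lam: "0 < lam" and \<epsilon>: "0 < \<epsilon>" and M: "0 <= M"
 shows "\<exists>C>0. \<exists>\<gamma>>0. \<forall>b x0 g t. circle_damping b M p --> {x0 - \<epsilon><..<x0 + \<epsilon>} \<subseteq> I01 \<longrightarrow>
   (\<forall>s. \<forall>x\<in>{x0 - \<epsilon><..<x0 + \<epsilon>}. lam <= b s x) --> circle_damping.evolution b g --> 0 <= t \<longrightarrow>
   circle_damping.energy p g 0 < \<infinity> \<longrightarrow>
   circle_damping.energy p g t <= ennreal (C * exp (- \<gamma> * t)) * circle_damping.energy p g 0"
proof -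
 obtain \<theta> where \<theta>: "0 < \<theta>" "\<theta> < 1" and step: "!!b x0 g r. circle_damping b M p ==> {x0 - \<epsilon><..<x0 + \<epsilon>} \<subseteq> I01 ==>
   (\<forall>s. \<forall>x\<in>{x0 - \<epsilon><..<x0 + \<epsilon>}. lam <= b s x) ==> circle_damping.evolution b g ==> 0 <= r ==>
   circle_damping.energy p g r < \<infinity> ==>
   circle_damping.energy p g (r + 2) <= ennreal \<theta> * circle_damping.energy p g r"
  using energy_contraction[OF assms] by blast
 define \<gamma> where "\<gamma> = - ln \<theta> / 2"
 have \<gamma>: "0 < \<gamma>" using \<theta> by (simp add: \<gamma>_def ln_less_zero)
 show ?thesis
 proof (rule exI[of _ "1 / \<theta>"], rule conjI, use \<theta> in simp, rule exI[of _ \<gamma>], intro conjI \<gamma> allI impI)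
  fix b x0 g t
  assume cd: "circle_damping b M p" and sub: "{x0 - \<epsilon><..<x0 + \<epsilon>} \<subseteq> I01"
   and low: "\<forall>s. \<forall>x\<in>{x0 - \<epsilon><..<x0 + \<epsilon>}. lam <= b s x"
   and ev: "circle_damping.evolution b g" and t: "0 <= (t::real)" and fin: "circle_damping.energy p g 0 < \<infinity>"
  interpret circle_damping b M p by fact
  have Ek: "energy g (2 * real k) <= ennreal (\<theta> ^ k) * energy g 0" for k
  proof (induction k)
   case (Suc k)
   have "energy g (2 * real k) <= energy g 0" by (intro energy_antimono[OF ev]) auto
   then have f: "energy g (2 * real k) < \<infinity>" using fin by (rule le_less_trans)
   have "energy g (2 * real k + 2) <= ennreal \<theta> * energy g (2 * real k)"
    by (rule step[OF cd sub low ev _ f]) simp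
   also have "... <= ennreal \<theta> * (ennreal (\<theta> ^ k) * energy g 0)" by (rule mult_left_mono[OF Suc]) simp
   also have "... = ennreal (\<theta> ^ Suc k) * energy g 0" using \<theta> by (simp add: ennreal_mult mult.assoc)
   finally show ?case by (simp add: algebra_simps)
  qed simp
  define k where "k = nat \<lfloor>t / 2\<rfloor>"
  have k: "2 * real k <= t" "t / 2 - 1 <= real k"
   using t unfolding k_def by linarith+
  have "energy g t <= energy g (2 * real k)" using k by (intro energy_antimono[OF ev]) auto
  also have "... <= ennreal (\<theta> ^ k) * energy g 0" by (rule Ek)
  also have "... <= ennreal (1 / \<theta> * exp (- \<gamma> * t)) * energy g 0"
  proof (intro mult_right_mono ennreal_leI)
   have "\<theta> ^ k = \<theta> powr real k" using \<theta> by (simp add: powr_realpow)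
   also have "... <= \<theta> powr (t / 2 - 1)" using \<theta> k by (intro powr_mono') auto
   also have "... = 1 / \<theta> * exp (- \<gamma> * t)"
   proof -
    have "\<theta> powr (t / 2 - 1) = exp (- \<gamma> * t - ln \<theta>)"
     using \<theta> by (simp add: powr_def \<gamma>_def field_simps)
    also have "... = exp (- \<gamma> * t) / \<theta>" using \<theta> by (simp add: exp_diff)
    finally show ?thesis by simp
   qed
   finally show "\<theta> ^ k <= 1 / \<theta> * exp (- \<gamma> * t)" .
  qed simp
  finally show "energy g t <= ennreal (1 / \<theta> * exp (- \<gamma> * t)) * energy g 0" .
 qed
qed

section \<open>Smooth bump functions\<close>

definition smooth :: "(real => real) => bool" where
 "smooth f \<longleftrightarrow> (\<forall>n. (deriv ^^ n) f differentiable_on UNIV)"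

text \<open>Smoothness of a function follows if it lies in a class of differentiable functions that is closed under derivatives.\<close>

lemma smooth_coinduct:
 assumes "P f" and step: "!!f. P f ==> f differentiable_on UNIV \<and> P (deriv f)"
 shows "smooth f"
proof -
 have "P ((deriv ^^ n) f)" for n
  by (induction n) (use assms in auto)
 then show ?thesis unfolding smooth_def using step by blast
qed

lemma smooth_differentiable: "smooth f ==> f differentiable_on UNIV"
 unfolding smooth_def by (metis funpow_0)

lemma smooth_deriv: "smooth f ==> smooth (deriv f)"
 unfolding smooth_def by (metis funpow_Suc_right comp_apply)

lemma smooth_DERIV: "smooth f ==> (f has_real_derivative deriv f x) (at x)"
 using smooth_differentiable[of f]
 by (simp add: differentiable_on_def DERIV_deriv_iff_real_differentiable)

lemma differentiable_from_DERIV: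
 "(!!x. (f has_real_derivative f' x) (at x)) ==> f differentiable_on UNIV"
 by (auto simp: differentiable_on_def real_differentiable_def)

lemma smooth_from_DERIV:
 assumes "!!x. (f has_real_derivative f' x) (at x)" and "smooth f'"
 shows "smooth f"
proof -
 have d: "deriv f = f'" by (rule ext) (rule DERIV_imp_deriv[OF assms(1)])
 have "f differentiable_on UNIV"
  by (rule differentiable_from_DERIV[OF assms(1)])
 moreover have "(deriv ^^ n) f' differentiable_on UNIV" for n
  using assms(2) by (simp add: smooth_def)
 ultimately have "(deriv ^^ n) f differentiable_on UNIV" for n
  using d by (cases n) (simp_all add: funpow_Suc_right del: funpow.simps(2))
 then show ?thesis by (simp add: smooth_def)
qed

lemma smooth_continuous: "smooth f ==> continuous_on A f"
 using smooth_DERIV DERIV_continuous_on by (metis has_field_derivative_at_within)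

text \<open>Sums of products of smooth functions form a class closed under derivatives by the product rule.\<close>

inductive smooth_ring :: "(real => real) => bool" where
 mult: "smooth f ==> smooth g ==> smooth_ring (\<lambda>x. f x * g x)"
| add: "smooth_ring f ==> smooth_ring g ==> smooth_ring (\<lambda>x. f x + g x)"

lemma smooth_ring_step:
 "smooth_ring f ==> \<exists>f'. (\<forall>x. (f has_real_derivative f' x) (at x)) \<and> smooth_ring f'"
proof (induction rule: smooth_ring.induct)
 case (mult f g)
 have "smooth_ring (\<lambda>x. deriv f x * g x + f x * deriv g x)"
  by (intro smooth_ring.intros mult smooth_deriv)
 moreover have "((\<lambda>x. f x * g x) has_real_derivative deriv f x * g x + f x * deriv g x) (at x)" for x
  using DERIV_mult[OF smooth_DERIV[OF mult(1)] smooth_DERIV[OF mult(2)], of x]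
  by (simp add: add.commute mult.commute)
 ultimately show ?case by (intro exI[of _ "\<lambda>x. deriv f x * g x + f x * deriv g x"] conjI allI)
next
 case (add f g)
 then obtain f' g' where "\<forall>x. (f has_real_derivative f' x) (at x)" "smooth_ring f'"
  "\<forall>x. (g has_real_derivative g' x) (at x)" "smooth_ring g'" by blast
 then have "\<forall>x. ((\<lambda>x. f x + g x) has_real_derivative f' x + g' x) (at x)" "smooth_ring (\<lambda>x. f' x + g' x)"
  by (auto intro: DERIV_add smooth_ring.add)
 then show ?case by (intro exI[of _ "\<lambda>x. f' x + g' x"]) blast
qed

lemma smooth_ring_smooth: "smooth_ring f ==> smooth f"
proof (rule smooth_coinduct[of smooth_ring])
 fix f assume "smooth_ring f"
 then obtain f' where f': "\<forall>x. (f has_real_derivative f' x) (at x)" "smooth_ring f'"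
  using smooth_ring_step by blast
 then have "deriv f = f'" by (intro ext DERIV_imp_deriv) blast
 with f' show "f differentiable_on UNIV \<and> smooth_ring (deriv f)"
  using differentiable_from_DERIV[of f f'] by simp
qed

lemma smooth_mult:
 assumes "smooth f" "smooth g" shows "smooth (\<lambda>x. f x * g x)"
 by (rule smooth_ring_smooth[OF smooth_ring.mult[OF assms]])

lemma smooth_const: "smooth (\<lambda>x. c)"
proof (rule smooth_coinduct[of "\<lambda>f. \<exists>c. f = (\<lambda>x. c)"])
 fix f :: "real => real" assume "\<exists>c. f = (\<lambda>x. c)"
 then show "f differentiable_on UNIV \<and> (\<exists>c. deriv f = (\<lambda>x. c))" by auto
qed blast

lemma smooth_add:
 assumes f: "smooth f" and g: "smooth g"
 shows "smooth (\<lambda>x. f x + g x)"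
proof -
 have "smooth_ring (\<lambda>x. f x * 1 + g x * 1)"
  by (rule smooth_ring.add[OF smooth_ring.mult[OF f smooth_const] smooth_ring.mult[OF g smooth_const]])
 then have "smooth (\<lambda>x. f x * 1 + g x * 1)" by (rule smooth_ring_smooth)
 then show ?thesis by simp
qed

lemma smooth_diff: "smooth f ==> smooth g ==> smooth (\<lambda>x. f x - g x)"
 using smooth_add[of f "\<lambda>x. -1 * g x"] smooth_mult[OF smooth_const[of "-1"], of g] by simp

lemma smooth_affine: "smooth f ==> smooth (\<lambda>x. f (c * x + d))"
proof (rule smooth_coinduct[of "\<lambda>h. \<exists>f k. smooth f \<and> h = (\<lambda>x. k * f (c * x + d))"])
 show "smooth f ==> \<exists>f' k. smooth f' \<and> (\<lambda>x. f (c * x + d)) = (\<lambda>x. k * f' (c * x + d))"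
  by (intro exI[of _ f] exI[of _ 1]) simp
next
 fix h assume "\<exists>f k. smooth f \<and> h = (\<lambda>x. k * f (c * x + d))"
 then obtain f k where f: "smooth f" and h: "h = (\<lambda>x. k * f (c * x + d))" by blast
 have D: "(h has_real_derivative (k * c) * deriv f (c * x + d)) (at x)" for x
 proof -
  have "((\<lambda>x. f (c * x + d)) has_real_derivative deriv f (c * x + d) * c) (at x)"
   by (rule DERIV_chain2[OF smooth_DERIV[OF f]]) (auto intro!: derivative_eq_intros)
  from DERIV_cmult[OF this, of k] show ?thesis unfolding h by (simp add: ac_simps)
 qed
 then have "deriv h = (\<lambda>x. (k * c) * deriv f (c * x + d))" by (intro ext DERIV_imp_deriv)
 moreover have "h differentiable_on UNIV"
  by (rule differentiable_from_DERIV[OF D])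
 ultimately show "h differentiable_on UNIV \<and> (\<exists>f k. smooth f \<and> deriv h = (\<lambda>x. k * f (c * x + d)))"
  using smooth_deriv[OF f] by blast
qed

text \<open>The functions \<open>P(1/x) e\<^sup>-\<^sup>1\<^sup>/\<^sup>x\<close>, \<open>P\<close> a polynomial, extended by 0 to the left; a class closed under derivatives that contains the classical flat function (\<open>P = 1\<close>).\<close>

definition flat_exp :: "real poly => real => real" where
 "flat_exp P x = (if 0 < x then poly P (1 / x) * exp (- (1 / x)) else 0)"

lemma poly_exp_tendsto_0: "((\<lambda>y::real. poly P y * exp (- y)) \<longlongrightarrow> 0) at_top"
proof -
 have "(\<lambda>y. poly P y * exp (- y)) = (\<lambda>y. \<Sum>i\<le>degree P. coeff P i * (y ^ i / exp y))"
  by (simp add: poly_altdef sum_distrib_right exp_minus divide_inverse mult.assoc)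
 moreover have "((\<lambda>y. \<Sum>i\<le>degree P. coeff P i * (y ^ i / exp y)) \<longlongrightarrow> (\<Sum>i\<le>degree P. coeff P i * 0)) at_top"
  by (intro tendsto_intros tendsto_power_div_exp_0)
 ultimately show ?thesis by simp
qed

lemma flat_exp_tendsto_0: "(flat_exp P \<longlongrightarrow> 0) (at_right 0)"
proof -
 have "((\<lambda>x. poly P (inverse x) * exp (- inverse x)) \<longlongrightarrow> 0) (at_right 0)"
  using filterlim_compose[OF poly_exp_tendsto_0 filterlim_inverse_at_top_right] .
 moreover have "\<forall>\<^sub>F x in at_right (0::real). poly P (inverse x) * exp (- inverse x) = flat_exp P x"
  using eventually_at_right_less[of 0] by eventually_elim (simp add: flat_exp_def inverse_eq_divide)
 ultimately show ?thesis by (rule Lim_transform_eventually)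
qed

lemma flat_exp_DERIV:
 "(flat_exp P has_real_derivative flat_exp ([:0, 0, 1:] * (P - pderiv P)) x) (at x)"
proof -
 consider "x < 0" | "x = 0" | "0 < x" by linarith
 then show ?thesis
 proof cases
  case 1
  have "((\<lambda>_. 0) has_real_derivative 0) (at x)" by simp
  then have "(flat_exp P has_real_derivative 0) (at x)"
   by (rule has_field_derivative_transform_within_open[of _ _ _ "{..<0}"]) (use 1 in \<open>auto simp: flat_exp_def\<close>)
  then show ?thesis using 1 by (simp add: flat_exp_def)
 next
  case 2
  have "((\<lambda>h. flat_exp P h / h) \<longlongrightarrow> 0) (at 0)"
  proof (rule filterlim_split_at)
   have neg: "-1 < (0::real)" by simp
   have "\<forall>\<^sub>F h in at_left (0::real). 0 = flat_exp P h / h"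
    using eventually_at_left_real[of "-1" "0::real", OF neg] by eventually_elim (simp add: flat_exp_def)
   then show "((\<lambda>h. flat_exp P h / h) \<longlongrightarrow> 0) (at_left 0)"
    by (rule Lim_transform_eventually[OF tendsto_const])
   have "\<forall>\<^sub>F h in at_right (0::real). flat_exp (pCons 0 P) h = flat_exp P h / h"
    using eventually_at_right_less[of 0] by eventually_elim (simp add: flat_exp_def)
   then show "((\<lambda>h. flat_exp P h / h) \<longlongrightarrow> 0) (at_right 0)"
    by (rule Lim_transform_eventually[OF flat_exp_tendsto_0])
  qed
  then have "(flat_exp P has_real_derivative 0) (at 0)"
   by (simp add: DERIV_def flat_exp_def)
  then show ?thesis using 2 by (simp add: flat_exp_def)
 next
  case 3
  have "((\<lambda>x. poly P (1 / x) * exp (- (1 / x))) has_real_derivative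
    poly ([:0, 0, 1:] * (P - pderiv P)) (1 / x) * exp (- (1 / x))) (at x)"
   using 3 by (auto intro!: derivative_eq_intros DERIV_chain2[OF poly_DERIV]
     simp: field_simps power2_eq_square)
  then have "(flat_exp P has_real_derivative poly ([:0, 0, 1:] * (P - pderiv P)) (1 / x) * exp (- (1 / x))) (at x)"
   by (rule has_field_derivative_transform_within_open[of _ _ _ "{0<..}"]) (use 3 in \<open>auto simp: flat_exp_def\<close>)
  then show ?thesis using 3 by (simp add: flat_exp_def)
 qed
qed

lemma smooth_flat_exp: "smooth (flat_exp P)"
proof (rule smooth_coinduct[of "\<lambda>f. \<exists>P. f = flat_exp P"])
 fix f assume "\<exists>P. f = flat_exp P"
 then obtain P where f: "f = flat_exp P" by blast
 have "deriv f = flat_exp ([:0, 0, 1:] * (P - pderiv P))"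
  unfolding f by (rule ext) (rule DERIV_imp_deriv[OF flat_exp_DERIV])
 moreover have "f differentiable_on UNIV"
  unfolding f by (rule differentiable_from_DERIV[OF flat_exp_DERIV])
 ultimately show "f differentiable_on UNIV \<and> (\<exists>P. deriv f = flat_exp P)" by blast
qed blast

definition ramp :: "real => real" where
 "ramp = flat_exp 1"

lemma ramp_eq: "ramp x = (if 0 < x then exp (- (1 / x)) else 0)"
 by (simp add: ramp_def flat_exp_def)

lemma ramp_bounds: "0 <= ramp x" "ramp x <= 1"
 by (auto simp: ramp_eq)

lemma smooth_ramp: "smooth ramp"
 unfolding ramp_def by (rule smooth_flat_exp)

lemma ramp_scaled_tendsto: "0 < x ==> (\<lambda>k. ramp (real k * x + c)) \<longlonglongrightarrow> 1"
proof -
 assume x: "0 < x"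
 have lim: "filterlim (\<lambda>k. real k * x + c) at_top sequentially"
  using x by real_asymp
 have "((\<lambda>y::real. exp (- (1 / y))) \<longlongrightarrow> 1) at_top" by real_asymp
 then have "(\<lambda>k. exp (- (1 / (real k * x + c)))) \<longlonglongrightarrow> 1" by (rule filterlim_compose[OF _ lim])
 moreover have "\<forall>\<^sub>F k in sequentially. exp (- (1 / (real k * x + c))) = ramp (real k * x + c)"
  using lim[unfolded filterlim_at_top_dense, rule_format, of 0]
  by eventually_elim (simp add: ramp_eq)
 ultimately show ?thesis by (rule Lim_transform_eventually)
qed

lemma test_functionsI:
 assumes "smooth f" "!!x. x \<notin> {c..d} ==> f x = 0" "{c..d} \<subseteq> U"
 shows "f \<in> test_functions U"
proof -
 have sub: "closure {x. f x \<noteq> 0} \<subseteq> {c..d}"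
 proof (rule closure_minimal)
  show "{x. f x \<noteq> 0} \<subseteq> {c..d}" using assms(2) by blast
 qed simp
 then have "compact (closure {x. f x \<noteq> 0})"
  using compact_Int_closed[of "{c..d}" "closure {x. f x \<noteq> 0}"] by (simp add: Int_absorb1)
 with sub assms show ?thesis unfolding test_functions_def smooth_def by auto
qed

lemma test_function_smooth: "f \<in> test_functions U ==> smooth f"
 by (simp add: test_functions_def smooth_def)

lemma test_function_support:
 assumes f: "f \<in> test_functions {a<..<b}" and ab: "a < b"
 obtains c d where "a < c" "c <= d" "d < b" "!!x. x \<notin> {c..d} ==> f x = 0"
proof -
 let ?S = "closure {x. f x \<noteq> 0}"
 have S: "compact ?S" "?S \<subseteq> {a<..<b}" using f by (auto simp: test_functions_def)
 show ?thesis
 proof (cases "?S = {}")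
  case True
  then have "f x = 0" for x by auto
  then show ?thesis using ab that[of "(a + b) / 2" "(a + b) / 2"] by auto
 next
  case False
  obtain c where c: "c \<in> ?S" "!!x. x \<in> ?S ==> c <= x" using compact_attains_inf[OF S(1) False] by blast
  obtain d where d: "d \<in> ?S" "!!x. x \<in> ?S ==> x <= d" using compact_attains_sup[OF S(1) False] by blast
  show ?thesis
  proof (rule that[of c d])
   show "a < c" "d < b" using S(2) c(1) d(1) by auto
   show "c <= d" using c(2)[OF d(1)] .
   fix x assume "x \<notin> {c..d}"
   then have "x \<notin> ?S" using c d by auto
   then show "f x = 0" using closure_subset[of "{x. f x \<noteq> 0}"] by auto
  qed
 qed
qed

lemma test_function_deriv:
 assumes f: "f \<in> test_functions {a<..<b}" and ab: "a < b"
 shows "deriv f \<in> test_functions {a<..<b}"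
proof -
 obtain c d where cd: "a < c" "c <= d" "d < b" "!!x. x \<notin> {c..d} ==> f x = 0"
  using test_function_support[OF f ab] by blast
 show ?thesis
 proof (rule test_functionsI[of _ c d])
  show "smooth (deriv f)" by (rule smooth_deriv[OF test_function_smooth[OF f]])
  show "{c..d} \<subseteq> {a<..<b}" using cd by auto
  fix x assume x: "x \<notin> {c..d}"
  have "((\<lambda>_. 0) has_real_derivative 0) (at x)" by simp
  then have "(f has_real_derivative 0) (at x)"
   by (rule has_field_derivative_transform_within_open[of _ _ _ "- {c..d}"]) (use x cd(4) in auto)
  then show "deriv f x = 0" by (rule DERIV_imp_deriv)
 qed
qed

lemma test_function_measurable: "f \<in> test_functions U ==> f \<in> borel_fun"
 by (intro borel_measurable_continuous_onI smooth_continuous test_function_smooth)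

lemma test_function_bounded:
 assumes f: "f \<in> test_functions {a<..<b}"
 obtains K where "!!x. \<bar>f x\<bar> <= K"
proof (cases "a < b")
 case True
 obtain c d where cd: "!!x. x \<notin> {c..d} ==> f x = 0" using test_function_support[OF f True] by blast
 have "compact (f ` {c..d})"
  by (intro compact_continuous_image smooth_continuous test_function_smooth[OF f]) simp
 then have "bounded (f ` {c..d})" by (rule compact_imp_bounded)
 then obtain K where K: "\<forall>x\<in>{c..d}. \<bar>f x\<bar> <= K" unfolding bounded_iff by auto
 have "\<bar>f x\<bar> <= max K 0" for x using K[rule_format, of x] cd[of x] by (cases "x \<in> {c..d}") (simp_all add: le_max_iff_disj)
 then show ?thesis by (rule that)
next
 case False
 then have "f x = 0" for x using f closure_subset[of "{x. f x \<noteq> 0}"] by (auto simp: test_functions_def)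
 then show ?thesis using that[of 0] by simp
qed

definition bump :: "real => real => nat => real => real" where
 "bump c d k x = ramp (real k * (x - c)) * ramp (real k * (d - x))"

lemma bump_test: "{c..d} \<subseteq> U ==> bump c d k \<in> test_functions U"
proof (rule test_functionsI[of _ c d])
 have "smooth (\<lambda>x. ramp (real k * x + - (real k * c)) * ramp ((- real k) * x + real k * d))"
  by (intro smooth_mult smooth_affine smooth_ramp)
 then show "smooth (bump c d k)" by (simp add: bump_def [abs_def] algebra_simps)
 show "bump c d k x = 0" if "x \<notin> {c..d}" for x
 proof -
  have "real k * (x - c) <= 0 \<or> real k * (d - x) <= 0"
   using that by (auto simp: mult_le_0_iff)
  then show ?thesis by (auto simp: bump_def ramp_eq)
 qed
qed

lemma bump_bounds: "0 <= bump c d k x" "bump c d k x <= 1"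
 unfolding bump_def using ramp_bounds by (auto intro: mult_nonneg_nonneg mult_le_one)

lemma bump_tendsto: "(\<lambda>k. bump c d k x) \<longlonglongrightarrow> indicator {c<..<d} x"
proof (cases "x \<in> {c<..<d}")
 case True
 have "(\<lambda>k. ramp (real k * (x - c) + 0) * ramp (real k * (d - x) + 0)) \<longlonglongrightarrow> 1 * 1"
  using True by (intro tendsto_mult ramp_scaled_tendsto) auto
 then show ?thesis using True by (simp add: bump_def)
next
 case False
 have "bump c d k x = 0" for k
 proof -
  have "real k * (x - c) <= 0 \<or> real k * (d - x) <= 0"
   using False by (auto simp: mult_le_0_iff)
  then show ?thesis by (auto simp: bump_def ramp_eq)
 qed
 then show ?thesis using False by simp
qed

section \<open>Lebesgue measurable and Borel measurable representatives\<close>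

lemma AE_lebesgue_on_lb: "S \<in> sets borel ==> (AE x in lebesgue_on S. P x) \<longleftrightarrow> (AE x in lb S. P x)"
 by (subst AE_restrict_space_iff) (auto simp: AE_lb AE_completion_iff)

lemma lebesgue_on_lb:
 fixes h :: "real => real"
 assumes [measurable]: "S \<in> sets borel" "h \<in> borel_fun"
 shows "integrable (lebesgue_on S) h \<longleftrightarrow> integrable (lb S) h"
  and "integral\<^sup>L (lebesgue_on S) h = integral\<^sup>L (lb S) h"
proof -
 have m: "(\<lambda>x. indicator S x *\<^sub>R h x) \<in> borel_measurable lborel" by measurable
 have S: "S \<inter> space lebesgue \<in> sets lebesgue" by simp
 show "integrable (lebesgue_on S) h \<longleftrightarrow> integrable (lb S) h"
  unfolding integrable_restrict_space[OF S] integrable_completion[OF m]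
  by (simp add: integrable_lb_iff set_integrable_def)
 show "integral\<^sup>L (lebesgue_on S) h = integral\<^sup>L (lb S) h"
  unfolding integral_restrict_space[OF S] integral_completion[OF m]
  by (simp add: integral_lb set_lebesgue_integral_def)
qed

lemma borel_imp_lebesgue_on:
 "h \<in> borel_fun ==> h \<in> borel_measurable (lebesgue_on S)"
 by (intro measurable_restrict_space1 measurable_completion) simp

text \<open>Arbitrary elements of the Lebesgue spaces are replaced by Borel functions, for which iterated integrals and compositions stay measurable.\<close>

lemma borel_representative:
 fixes f :: "real => real"
 assumes "f \<in> borel_measurable (lebesgue_on S)" "S \<in> sets borel"
 obtains h where "h \<in> borel_fun" "AE x in lb S. f x = h x"
proof -
 have "(\<lambda>x. indicator S x *\<^sub>R f x) \<in> borel_measurable lebesgue"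
  using assms by (subst (asm) borel_measurable_restrict_space_iff) auto
 then obtain h where "h \<in> borel_measurable lborel" "AE x in lborel. indicator S x *\<^sub>R f x = h x"
  using completion_ex_borel_measurable_real[of "\<lambda>x. indicator S x *\<^sub>R f x" lborel] by blast
 then show ?thesis
  using assms(2) by (intro that[of h]) (auto simp: AE_lb elim!: eventually_mono)
qed

lemma lebesgue_on_cong_lb:
 fixes f h :: "real => real"
 assumes "f \<in> borel_measurable (lebesgue_on S)" "h \<in> borel_fun" "S \<in> sets borel"
  "AE x in lb S. f x = h x"
 shows "integrable (lebesgue_on S) f \<longleftrightarrow> integrable (lb S) h"
  and "integral\<^sup>L (lebesgue_on S) f = integral\<^sup>L (lb S) h"
proof -
 have ae: "AE x in lebesgue_on S. f x = h x" using assms by (simp add: AE_lebesgue_on_lb)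
 have h: "h \<in> borel_measurable (lebesgue_on S)" by (rule borel_imp_lebesgue_on) fact
 show "integrable (lebesgue_on S) f \<longleftrightarrow> integrable (lb S) h"
  using integrable_cong_AE[OF assms(1) h ae] lebesgue_on_lb(1)[OF assms(3,2)] by simp
 show "integral\<^sup>L (lebesgue_on S) f = integral\<^sup>L (lb S) h"
  using integral_cong_AE[OF assms(1) h ae] lebesgue_on_lb(2)[OF assms(3,2)] by simp
qed

section \<open>The fundamental lemma of the calculus of variations\<close>

lemma AE_zero_if_interval_integrals_zero:
 fixes h :: "real => real"
 assumes h: "integrable (lb {c..d}) h"
  and zero: "!!s t. c <= s ==> s <= t ==> t <= d ==> (LINT x|lb {s..t}. h x) = 0"
 shows "AE x in lb {c..d}. h x = 0"
proof -
 let ?M = "lb {c..d}"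
 have [measurable]: "h \<in> borel_fun" by (rule integrable_lb_measurable[OF h])
 define \<mu> where "\<mu> = density ?M (\<lambda>x. ennreal (h x))"
 define \<nu> where "\<nu> = density ?M (\<lambda>x. ennreal (- h x))"
 have e\<mu>: "emeasure \<mu> A = (\<integral>\<^sup>+x. ennreal (h x) * indicator A x \<partial>?M)" if [measurable]: "A \<in> sets borel" for A
  unfolding \<mu>_def by (subst emeasure_density) auto
 have e\<nu>: "emeasure \<nu> A = (\<integral>\<^sup>+x. ennreal (- h x) * indicator A x \<partial>?M)" if [measurable]: "A \<in> sets borel" for A
  unfolding \<nu>_def by (subst emeasure_density) auto
 have tail: "emeasure \<mu> {y<..} < \<infinity> \<and> emeasure \<mu> {y<..} = emeasure \<nu> {y<..}" for y
 proof -
  let ?k = "\<lambda>x. h x * indicator {y<..} x"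
  have k: "integrable ?M ?k"
   using integrable_lb_mult_bounded[OF h, of "indicator {y<..}" 1] by (simp add: mult.commute indicator_def)
  have k0: "(LINT x|?M. ?k x) = 0"
  proof (cases "y <= d")
   case True
   have "(LINT x|?M. ?k x) = (LINT x|lb {max c y..d}. h x)"
    unfolding integral_lb[of "{c..d}" ?k, simplified] integral_lb[of "{max c y..d}" h, simplified]
     set_lebesgue_integral_def
   proof (rule integral_cong_AE)
    show "AE x in lborel. indicator {c..d} x *\<^sub>R ?k x = indicator {max c y..d} x *\<^sub>R h x"
     using AE_lborel_singleton[of y] by eventually_elim (auto split: split_indicator)
   qed measurable
   also have "... = 0"
   proof (cases "max c y <= d")
    case True then show ?thesis by (intro zero) auto
   next
    case False then show ?thesis by (intro integral_lb_empty) auto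
   qed
   finally show ?thesis .
  next
   case False
   then have "AE x in ?M. ?k x = 0" by (auto simp: AE_lb)
   then show ?thesis by (rule integral_eq_zero_AE)
  qed
  have e1: "ennreal (h x) * indicator {y<..} x = ennreal (?k x)"
   and e2: "ennreal (- h x) * indicator {y<..} x = ennreal (- ?k x)" for x
   by (auto split: split_indicator)
  have "(\<integral>\<^sup>+x. ennreal (?k x) \<partial>?M) < \<infinity>" "(\<integral>\<^sup>+x. ennreal (- ?k x) \<partial>?M) < \<infinity>"
   using real_integrable_def[of ?M ?k] k by (auto simp: less_top)
  with k0 have "enn2real (\<integral>\<^sup>+x. ennreal (?k x) \<partial>?M) = enn2real (\<integral>\<^sup>+x. ennreal (- ?k x) \<partial>?M)"
   "(\<integral>\<^sup>+x. ennreal (?k x) \<partial>?M) < \<infinity>" "(\<integral>\<^sup>+x. ennreal (- ?k x) \<partial>?M) < \<infinity>"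
   using real_lebesgue_integral_def[OF k] by simp_all
  then have "(\<integral>\<^sup>+x. ennreal (?k x) \<partial>?M) = (\<integral>\<^sup>+x. ennreal (- ?k x) \<partial>?M)"
   by (metis ennreal_enn2real infinity_ennreal_def)
  with \<open>(\<integral>\<^sup>+x. ennreal (?k x) \<partial>?M) < \<infinity>\<close> show ?thesis by (simp only: e\<mu> e\<nu> e1 e2 greaterThan_borel)
 qed
 have eq: "\<mu> = \<nu>"
 proof (rule measure_eqI_lessThan)
  show "emeasure \<mu> {y<..} < \<infinity>" "emeasure \<mu> {y<..} = emeasure \<nu> {y<..}" for y
   using tail by blast+
 qed (simp_all add: \<mu>_def \<nu>_def)
 have z: "ennreal (- h x) * indicator {x. 0 < h x} x = 0" "ennreal (h x) * indicator {x. h x < 0} x = 0" for x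
  by (auto simp: ennreal_neg indicator_def)
 have "emeasure \<nu> {x. 0 < h x} = 0"
  by (subst e\<nu>) (measurable, simp only: z nn_integral_const mult_zero_left)
 then have "emeasure \<mu> {x. 0 < h x} = 0" by (simp add: eq)
 then have "AE x in ?M. ennreal (h x) * indicator {x. 0 < h x} x = 0"
  by (subst (asm) e\<mu>) (auto simp: nn_integral_0_iff_AE)
 moreover have "emeasure \<mu> {x. h x < 0} = 0"
  by (subst e\<mu>) (measurable, simp only: z nn_integral_const mult_zero_left)
 then have "emeasure \<nu> {x. h x < 0} = 0" by (simp add: eq)
 then have "AE x in ?M. ennreal (- h x) * indicator {x. h x < 0} x = 0"
  by (subst (asm) e\<nu>) (auto simp: nn_integral_0_iff_AE)
 ultimately show ?thesis
  by eventually_elim (auto simp: indicator_def ennreal_eq_0_iff split: if_splits)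
qed

lemma integral_lb_support:
 fixes f :: "real => real"
 assumes "f \<in> borel_fun" "A \<in> sets borel" "B \<in> sets borel" "A \<subseteq> B"
  "!!x. x \<in> B ==> x \<notin> A ==> f x = 0"
 shows "integral\<^sup>L (lb B) f = integral\<^sup>L (lb A) f" "integrable (lb B) f \<longleftrightarrow> integrable (lb A) f"
proof -
 have e: "(\<lambda>x. indicator B x *\<^sub>R f x) = (\<lambda>x. indicator A x *\<^sub>R f x)"
  using assms(4,5) by (auto simp: fun_eq_iff split: split_indicator)
 show "integral\<^sup>L (lb B) f = integral\<^sup>L (lb A) f" "integrable (lb B) f \<longleftrightarrow> integrable (lb A) f"
  using assms(1-3) e by (simp_all add: integral_lb integrable_lb_iff set_lebesgue_integral_def set_integrable_def)
qed

text \<open>Bump functions converge boundedly to the indicator of an interval, so all interval integrals of \<open>h\<close> vanish.\<close>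

lemma fundamental_lemma:
 fixes h :: "real => real"
 assumes h [measurable]: "h \<in> borel_fun"
  and loc: "!!c d. a < c ==> d < b ==> integrable (lb {c..d}) h"
  and test: "!!\<phi>. \<phi> \<in> test_functions {a<..<b} ==> (LINT x|lb {a<..<b}. h x * \<phi> x) = 0"
 shows "AE x in lb {a<..<b}. h x = 0"
proof -
 have zero: "(LINT x|lb {s..t}. h x) = 0" if st: "a < s" "s <= t" "t < b" for s t
 proof -
  have hi: "integrable (lb {s..t}) h" using st by (intro loc)
  have bm [measurable]: "bump s t k \<in> borel_fun" for k
   by (rule test_function_measurable[OF bump_test[of s t UNIV]]) simp
  have "(LINT x|lb {s..t}. h x * bump s t k x) = 0" for k
  proof -
   have "bump s t k \<in> test_functions {a<..<b}" using st by (intro bump_test) auto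
   then have "(LINT x|lb {a<..<b}. h x * bump s t k x) = 0" by (rule test)
   moreover have "(LINT x|lb {a<..<b}. h x * bump s t k x) = (LINT x|lb {s..t}. h x * bump s t k x)"
   proof (rule integral_lb_support)
    fix x assume "x \<notin> {s..t}"
    then have "real k * (x - s) <= 0 \<or> real k * (t - x) <= 0" by (auto simp: mult_le_0_iff)
    then show "h x * bump s t k x = 0" by (auto simp: bump_def ramp_eq)
   qed (use st in auto)
   ultimately show ?thesis by simp
  qed
  moreover have "(\<lambda>k. LINT x|lb {s..t}. h x * bump s t k x) \<longlonglongrightarrow> (LINT x|lb {s..t}. h x * indicator {s<..<t} x)"
  proof (rule integral_dominated_convergence[where w = "\<lambda>x. \<bar>h x\<bar>"])
   show "AE x in lb {s..t}. (\<lambda>k. h x * bump s t k x) \<longlonglongrightarrow> h x * indicator {s<..<t} x"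
    by (intro AE_I2 tendsto_intros bump_tendsto)
   show "AE x in lb {s..t}. norm (h x * bump s t k x) <= \<bar>h x\<bar>" for k
    using bump_bounds[of s t k] by (auto simp: abs_mult intro!: AE_I2 mult_left_le)
  qed (use hi in auto)
  ultimately have "(LINT x|lb {s..t}. h x * indicator {s<..<t} x) = 0"
   by (simp add: LIMSEQ_const_iff)
  moreover have "(LINT x|lb {s..t}. h x * indicator {s<..<t} x) = (LINT x|lb {s..t}. h x)"
  proof (rule integral_cong_AE)
   show "AE x in lb {s..t}. h x * indicator {s<..<t} x = h x"
    unfolding AE_lb[of "{s..t}", simplified]
    using AE_lborel_singleton[of s] AE_lborel_singleton[of t] by eventually_elim auto
  qed measurable
  ultimately show ?thesis by simp
 qed
 have "AE x in lborel. \<forall>n::nat. x \<in> {a + 1 / Suc n..b - 1 / Suc n} --> h x = 0"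
  unfolding AE_all_countable
 proof
  fix n :: nat
  have n: "0 < 1 / real (Suc n)" by simp
  have "AE x in lb {a + 1 / Suc n..b - 1 / Suc n}. h x = 0"
  proof (rule AE_zero_if_interval_integrals_zero)
   show "integrable (lb {a + 1 / Suc n..b - 1 / Suc n}) h" using n by (intro loc) linarith+
   fix s t assume "a + 1 / Suc n <= s" "s <= t" "t <= b - 1 / Suc n"
   then show "(LINT x|lb {s..t}. h x) = 0" using n by (intro zero) linarith+
  qed
  then show "AE x in lborel. x \<in> {a + 1 / Suc n..b - 1 / Suc n} --> h x = 0" by (simp add: AE_lb)
 qed
 then show ?thesis
  unfolding AE_lb[of "{a<..<b}", simplified]
 proof eventually_elim
  case (elim x)
  show ?case
  proof
   assume x: "a < x \<and> x < b"
   then have "0 < min (x - a) (b - x)" by simp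
   then obtain n where "1 / real (Suc n) < min (x - a) (b - x)" using nat_approx_posE by blast
   then have "x \<in> {a + 1 / Suc n..b - 1 / Suc n}" by auto
   with elim show "h x = 0" by blast
  qed
 qed
qed

lemma AE_zero_continuous:
 fixes k :: "real => real"
 assumes k: "continuous_on {c..d} k" "k \<in> borel_fun" and "c < d"
  and ae: "AE x in lb {c..d}. k x = 0" and x: "x \<in> {c..d}"
 shows "k x = 0"
proof -
 have c: "continuous_on {c..d} (\<lambda>x. \<bar>k x\<bar>)" by (intro continuous_intros k)
 have "(LINT x|lb {c..d}. \<bar>k x\<bar>) = 0"
  by (rule integral_eq_zero_AE) (use ae in \<open>auto elim!: eventually_mono\<close>)
 then have "integral\<^sup>L (lebesgue_on {c..d}) (\<lambda>x. \<bar>k x\<bar>) = 0"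
  using k by (subst lebesgue_on_lb(2)) auto
 then have "\<forall>x\<in>{c..d}. \<bar>k x\<bar> = 0"
  using integralL_eq_0_iff[OF c \<open>c < d\<close>] by simp
 then show ?thesis using x by simp
qed

lemma lb_Icc: "lb {a..b} = lb {a<..<b}"
 unfolding lb_def
proof (rule density_cong)
 show "AE x in lborel. indicator {a..b} x = (indicator {a<..<b} x :: ennreal)"
  using AE_lborel_singleton[of a] AE_lborel_singleton[of b] by eventually_elim (auto split: split_indicator)
qed auto

lemma mean_zero_antiderivative:
 assumes \<psi>: "\<psi> \<in> test_functions {a<..<b}" and ab: "a < b" and mean: "(LINT x|lb {a<..<b}. \<psi> x) = 0"
 shows "\<exists>G\<in>test_functions {a<..<b}. \<forall>z. deriv G z = \<psi> z"
proof -
 obtain c d where cd: "a < c" "c <= d" "d < b" and supp: "!!x. x \<notin> {c..d} ==> \<psi> x = 0"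
  using test_function_support[OF \<psi> ab] by blast
 obtain B where B: "!!x. \<bar>\<psi> x\<bar> <= B" using test_function_bounded[OF \<psi>] by blast
 note sm = test_function_smooth[OF \<psi>] and [measurable] = test_function_measurable[OF \<psi>]
 (* starting at c - 1 makes G differentiable at c as well *)
 define G where "G z = integral {c - 1..z} \<psi>" for z
 have G0: "G z = 0" if "z < c" for z
 proof -
  have "integral {c - 1..z} \<psi> = integral {c - 1..z} (\<lambda>_. 0)"
   by (rule Henstock_Kurzweil_Integration.integral_cong) (use supp that in auto)
  then show ?thesis by (simp add: G_def)
 qed
 have Gd: "G z = 0" if "d <= z" for z
 proof -
  have "integrable (lb {c - 1..z}) \<psi>" by (rule integrable_lb_bounded[of _ _ B]) (auto simp: B)
  then have "G z = (LINT x|lb {c - 1..z}. \<psi> x)" unfolding G_def by (rule integral_lb_HK(2)[symmetric])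
  also have "... = (LINT x|lb {c..d}. \<psi> x)" by (rule integral_lb_support(1)) (use supp that in auto)
  also have "... = (LINT x|lb {a<..<b}. \<psi> x)" by (rule integral_lb_support(1)[symmetric]) (use supp cd in auto)
  finally show ?thesis by (simp add: mean)
 qed
 have DG: "(G has_real_derivative \<psi> z) (at z)" for z
 proof (cases "z < c")
  case True
  have "((\<lambda>_. 0) has_real_derivative 0) (at z)" by simp
  then have "(G has_real_derivative 0) (at z)"
   by (rule has_field_derivative_transform_within_open[of _ _ _ "{..<c}"]) (use True G0 in auto)
  then show ?thesis using supp[of z] True by simp
 next
  case False
  have "((\<lambda>x. integral {c - 1..x} \<psi>) has_real_derivative \<psi> z) (at z within {c - 1..z + 1})"
   by (rule integral_has_real_derivative) (use smooth_continuous[OF sm] False in auto)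
  moreover have "at z within {c - 1..z + 1} = at z"
   by (rule at_within_interior) (use False in \<open>auto simp: interior_atLeastAtMost_real\<close>)
  ultimately show ?thesis by (simp add: G_def [abs_def])
 qed
 have "G \<in> test_functions {a<..<b}"
 proof (rule test_functionsI[of _ c d])
  show "G z = 0" if "z \<notin> {c..d}" for z using that G0[of z] Gd[of z] by (cases "z < c") auto
 qed (use smooth_from_DERIV[OF DG sm] cd in auto)
 then show ?thesis using DERIV_imp_deriv[OF DG] by blast
qed

lemma test_function_combination:
 assumes \<phi>: "\<phi> \<in> test_functions {a<..<b}" and \<beta>: "\<beta> \<in> test_functions {a<..<b}" and ab: "a < b"
 shows "(\<lambda>x. \<phi> x - k * \<beta> x) \<in> test_functions {a<..<b}"
proof -
 obtain c d where 1: "a < c" "c <= d" "d < b" "!!x. x \<notin> {c..d} ==> \<phi> x = 0"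
  using test_function_support[OF \<phi> ab] by blast
 obtain c' d' where 2: "a < c'" "c' <= d'" "d' < b" "!!x. x \<notin> {c'..d'} ==> \<beta> x = 0"
  using test_function_support[OF \<beta> ab] by blast
 show ?thesis
 proof (rule test_functionsI[of _ "min c c'" "max d d'"])
  show "smooth (\<lambda>x. \<phi> x - k * \<beta> x)"
   by (intro smooth_diff smooth_mult smooth_const test_function_smooth[OF \<phi>] test_function_smooth[OF \<beta>])
  show "{min c c'..max d d'} \<subseteq> {a<..<b}" using 1 2 by auto
  fix x assume "x \<notin> {min c c'..max d d'}"
  then have "x \<notin> {c..d}" "x \<notin> {c'..d'}" by auto
  then show "\<phi> x - k * \<beta> x = 0" using 1(4) 2(4) by simp
 qed
qed

text \<open>Subtracting a multiple of a fixed test function makes every test function mean free, hence a derivative of a test function.\<close>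

lemma weak_derivative_zero_imp_constant:
 fixes h :: "real => real"
 assumes ab: "a < b" and h: "integrable (lb {a<..<b}) h"
  and test: "!!\<phi>. \<phi> \<in> test_functions {a<..<b} ==> (LINT x|lb {a<..<b}. deriv \<phi> x * h x) = 0"
 shows "\<exists>k. AE x in lb {a<..<b}. h x = k"
proof -
 note [measurable] = integrable_lb_measurable[OF h]
 have one: "integrable (lb {a<..<b}) (\<lambda>_. 1 :: real)" by (rule integrable_lb_bounded[of _ _ 1]) auto
 have i: "integrable (lb {a<..<b}) (\<lambda>x. \<phi> x * f x)"
  if \<phi>: "\<phi> \<in> test_functions {a<..<b}" and f: "integrable (lb {a<..<b}) f" for \<phi> f
 proof -
  obtain B where "!!x. \<bar>\<phi> x\<bar> <= B" using test_function_bounded[OF \<phi>] by blast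
  then show ?thesis by (intro integrable_lb_mult_bounded[OF f test_function_measurable[OF \<phi>]]) auto
 qed
 have "\<exists>\<beta>\<in>test_functions {a<..<b}. (LINT x|lb {a<..<b}. \<beta> x) \<noteq> 0"
 (* if all test functions had mean zero, the constant 1 would be orthogonal to all of them *)
 proof (rule ccontr)
  assume "\<not> ?thesis"
  then have "AE x in lb {a<..<b}. (1::real) = 0"
   by (intro fundamental_lemma integrable_lb_bounded[of _ _ 1]) auto
  then have "emeasure (lb {a<..<b}) UNIV = 0" by (subst (asm) AE_iff_measurable[of UNIV]) auto
  then show False using ab by (simp add: emeasure_lb)
 qed
 then obtain \<beta> where \<beta>: "\<beta> \<in> test_functions {a<..<b}" and J: "(LINT x|lb {a<..<b}. \<beta> x) \<noteq> 0" by blast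
 define k where "k = (LINT x|lb {a<..<b}. \<beta> x * h x) / (LINT x|lb {a<..<b}. \<beta> x)"
 have "AE x in lb {a<..<b}. h x - k = 0"
 proof (rule fundamental_lemma)
  show "integrable (lb {c..d}) (\<lambda>x. h x - k)" if "a < c" "d < b" for c d
   by (intro Bochner_Integration.integrable_diff integrable_lb_subset[OF h] integrable_lb_bounded[of _ _ "\<bar>k\<bar>"])
    (use that in auto)
  fix \<phi> assume \<phi>: "\<phi> \<in> test_functions {a<..<b}"
  define r where "r = (LINT x|lb {a<..<b}. \<phi> x) / (LINT x|lb {a<..<b}. \<beta> x)"
  have "(LINT x|lb {a<..<b}. \<phi> x - r * \<beta> x) = 0" using i[OF \<phi> one] i[OF \<beta> one] J by (simp add: r_def)
  from mean_zero_antiderivative[OF test_function_combination[OF \<phi> \<beta> ab] ab this]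
  obtain G where G: "G \<in> test_functions {a<..<b}" "!!z. deriv G z = \<phi> z - r * \<beta> z" by blast
  have "0 = (LINT x|lb {a<..<b}. \<phi> x * h x - r * (\<beta> x * h x))"
   using test[OF G(1)] by (simp add: G(2) left_diff_distrib mult.assoc)
  also have "... = (LINT x|lb {a<..<b}. \<phi> x * h x) - k * (LINT x|lb {a<..<b}. \<phi> x)"
   using i[OF \<phi> h] i[OF \<beta> h] J by (simp add: r_def k_def)
  also have "... = (LINT x|lb {a<..<b}. (h x - k) * \<phi> x)"
   using i[OF \<phi> h] i[OF \<phi> one] by (simp add: algebra_simps)
  finally show "(LINT x|lb {a<..<b}. (h x - k) * \<phi> x) = 0" by simp
 qed simp
 then show ?thesis by (intro exI[of _ k]) (auto elim!: eventually_mono)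
qed

section \<open>Weak derivatives\<close>

lemma loc_integrable01_borel:
 assumes g: "loc_integrable01 g"
 obtains h where "h \<in> borel_fun" "AE x in lb I01. g x = h x"
  "!!c d. 0 < c ==> d < 1 ==> integrable (lb {c..d}) h" "g \<in> borel_measurable leb01"
proof -
 have gi: "integrable (lebesgue_on {c..d}) g" if "0 < c" "d < 1" for c d
 proof -
  have "compact {c..d}" "{c..d} \<subseteq> I01" using that by auto
  then show ?thesis using g unfolding loc_integrable01_def by blast
 qed
 have gm: "g \<in> borel_measurable leb01"
 proof (rule measurable_piecewise_restrict[of "range (\<lambda>n::nat. {1 / Suc n..1 - 1 / Suc n})"])
  show "space leb01 \<subseteq> \<Union> (range (\<lambda>n::nat. {1 / Suc n..1 - 1 / Suc n}))"
  proof
   fix x assume "x \<in> space leb01"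
   then have "0 < min x (1 - x)" by (simp add: space_restrict_space)
   then obtain n where "1 / real (Suc n) < min x (1 - x)" using nat_approx_posE by blast
   then have "x \<in> {1 / Suc n..1 - 1 / Suc n}" by auto
   then show "x \<in> \<Union> (range (\<lambda>n::nat. {1 / Suc n..1 - 1 / Suc n}))" by blast
  qed
  fix \<Omega> assume "\<Omega> \<in> range (\<lambda>n::nat. {1 / real (Suc n)..1 - 1 / real (Suc n)})"
  then obtain n :: nat where \<Omega>: "\<Omega> = {1 / Suc n..1 - 1 / Suc n}" by blast
  have sub: "\<Omega> \<subseteq> I01"
  proof
   fix x assume "x \<in> \<Omega>"
   moreover have "0 < 1 / real (Suc n)" by simp
   ultimately have "0 < x" "x < 1" unfolding \<Omega> atLeastAtMost_iff by linarith+
   then show "x \<in> I01" by simp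
  qed
  have \<Omega>s: "\<Omega> \<in> sets lebesgue" by (simp add: \<Omega>)
  show "\<Omega> \<inter> space leb01 \<in> sets leb01"
   using sub \<Omega>s by (auto simp: sets_restrict_space_iff space_restrict_space Int_absorb1 Int_absorb2)
  have "restrict_space leb01 \<Omega> = lebesgue_on (I01 \<inter> \<Omega>)"
   by (rule restrict_restrict_space) (auto simp: \<Omega>)
  also have "I01 \<inter> \<Omega> = \<Omega>" using sub by auto
  finally show "g \<in> borel_measurable (restrict_space leb01 \<Omega>)"
   using gi[of "1 / Suc n" "1 - 1 / Suc n"] by (auto simp: \<Omega>)
 qed auto
 obtain h where h: "h \<in> borel_fun" "AE x in lb I01. g x = h x"
  using borel_representative[OF gm] by auto
 have "integrable (lb {c..d}) h" if "0 < c" "d < 1" for c d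
 proof -
  have "AE x in lb {c..d}. g x = h x" by (rule AE_lb_subset[OF h(2)]) (use that in auto)
  then show ?thesis
   using lebesgue_on_cong_lb(1)[OF _ h(1), of g "{c..d}"] gi[OF that] by auto
 qed
 with h gm that show ?thesis by blast
qed

lemma has_weak_dx_unique:
 assumes "has_weak_dx f g1" "has_weak_dx f g2"
 shows "AE x in leb01. g1 x = g2 x"
proof -
 obtain h1 where h1: "h1 \<in> borel_fun" "AE x in lb I01. g1 x = h1 x"
  "!!c d. 0 < c ==> d < 1 ==> integrable (lb {c..d}) h1" "g1 \<in> borel_measurable leb01"
  using loc_integrable01_borel assms(1) unfolding has_weak_dx_def by blast
 obtain h2 where h2: "h2 \<in> borel_fun" "AE x in lb I01. g2 x = h2 x"
  "!!c d. 0 < c ==> d < 1 ==> integrable (lb {c..d}) h2" "g2 \<in> borel_measurable leb01"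
  using loc_integrable01_borel assms(2) unfolding has_weak_dx_def by blast
 note [measurable] = h1(1) h2(1)
 have "AE x in lb I01. h1 x - h2 x = 0"
 proof (rule fundamental_lemma)
  show "integrable (lb {c..d}) (\<lambda>x. h1 x - h2 x)" if "0 < c" "d < 1" for c d
   using h1(3)[OF that] h2(3)[OF that] by simp
  fix \<phi> assume \<phi>: "\<phi> \<in> test_functions I01"
  note [measurable] = test_function_measurable[OF \<phi>]
  obtain u v where uv: "0 < u" "u <= v" "v < 1" and supp: "!!x. x \<notin> {u..v} ==> \<phi> x = 0"
   using test_function_support[OF \<phi>] by auto
  obtain B where B: "!!x. \<bar>\<phi> x\<bar> <= B" using test_function_bounded[OF \<phi>] by blast
  have int: "integrable (lb I01) (\<lambda>x. h x * \<phi> x)"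
   if "h \<in> borel_fun" "!!c d. 0 < c ==> d < 1 ==> integrable (lb {c..d}) h" for h
  proof -
   have "integrable (lb {u..v}) (\<lambda>x. \<phi> x * h x)"
    using uv by (intro integrable_lb_mult_bounded[of _ _ _ B] that(2)) (auto simp: B)
   then show ?thesis
    using that(1) uv
    by (subst integral_lb_support(2)[of _ "{u..v}"]) (auto simp: supp mult.commute)
  qed
  have eq: "(LINT x|leb01. g x * \<phi> x) = (LINT x|lb I01. h x * \<phi> x)"
   if "h \<in> borel_fun" "AE x in lb I01. g x = h x" "g \<in> borel_measurable leb01" for g h
  proof (rule lebesgue_on_cong_lb(2))
   have "\<phi> \<in> borel_measurable leb01" by (rule borel_imp_lebesgue_on) simp
   then show "(\<lambda>x. g x * \<phi> x) \<in> borel_measurable leb01" using that(3) by simp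
   show "AE x in lb I01. g x * \<phi> x = h x * \<phi> x" using that(2) by eventually_elim simp
  qed (use that in auto)
  have "(LINT x|leb01. g1 x * \<phi> x) = (LINT x|leb01. g2 x * \<phi> x)"
  proof -
   have "(LINT x|leb01. f x * deriv \<phi> x) = - (LINT x|leb01. g1 x * \<phi> x)"
    "(LINT x|leb01. f x * deriv \<phi> x) = - (LINT x|leb01. g2 x * \<phi> x)"
    using assms \<phi> unfolding has_weak_dx_def by blast+
   then show ?thesis by linarith
  qed
  then have "(LINT x|lb I01. h1 x * \<phi> x) = (LINT x|lb I01. h2 x * \<phi> x)"
   using eq[OF h1(1,2,4)] eq[OF h2(1,2,4)] by simp
  then show "(LINT x|lb I01. (h1 x - h2 x) * \<phi> x) = 0"
   using int[OF h1(1,3)] int[OF h2(1,3)] by (simp add: left_diff_distrib)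
 qed simp
 with h1(2) h2(2) have "AE x in lb I01. g1 x = g2 x" by eventually_elim simp
 then show ?thesis by (simp add: AE_lebesgue_on_lb)
qed

section \<open>Approximation by continuous functions\<close>

lemma continuous_approximation_AE:
 fixes f :: "real => real"
 assumes "f \<in> borel_fun"
 obtains g :: "nat => real => real" where "!!n. continuous_on UNIV (g n)"
  "AE x in lborel. (\<lambda>n. g n x) \<longlonglongrightarrow> f x"
proof -
 have "f \<in> borel_measurable lebesgue" using assms by (intro measurable_completion) simp
 then have "f measurable_on UNIV" by (rule lebesgue_measurable_imp_measurable_on_real) simp
 then obtain N g where N: "negligible N" and g: "!!n. continuous_on UNIV (g n)"
  "!!x. x \<notin> N ==> (\<lambda>n. g n x) \<longlonglongrightarrow> (if x \<in> UNIV then f x else 0)"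
  unfolding measurable_on_def by blast
 have "AE x in lebesgue. x \<notin> N"
  using N by (intro AE_not_in) (simp add: negligible_iff_null_sets)
 then have "AE x in lborel. x \<notin> N" by (simp add: AE_completion_iff)
 then have "AE x in lborel. (\<lambda>n. g n x) \<longlonglongrightarrow> f x" by eventually_elim (use g in auto)
 with g(1) that show ?thesis by blast
qed

lemma abs_cut_diff_le: "0 <= N ==> \<bar>z - cut N z\<bar> <= \<bar>z\<bar>"
 by (auto simp: cut_def)

text \<open>Truncation, then almost everywhere convergence of bounded continuous approximations.\<close>

lemma Lp_dense_continuous:
 fixes f :: "real => real"
 assumes p: "1 < p" and f [measurable]: "f \<in> borel_fun"
  and fin: "(NINT x|{a..b}. epow p (f x)) < \<infinity>" and e: "0 < e"
 shows "\<exists>c. continuous_on UNIV c \<and> (NINT x|{a..b}. epow p (f x - c x)) < ennreal e"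
proof -
 interpret finite_measure "lb {a..b}" by (rule finite_measure_lb) auto
 define e' where "e' = e / (2 * 2 powr p)"
 have e': "0 < e'" using e by (simp add: e'_def)
 have pz: "((\<lambda>n. \<bar>h n\<bar> powr p) \<longlonglongrightarrow> 0)" if "h \<longlonglongrightarrow> 0" for h :: "nat => real"
  using p tendsto_zero_powrI[OF tendsto_rabs_zero[OF that] tendsto_const[of p]] by simp
 have "(\<lambda>N. NINT x|{a..b}. epow p (f x - cut (real N) (f x))) \<longlonglongrightarrow> (NINT x|{a..b}. 0)"
 proof (rule nn_integral_dominated_convergence[where w = "\<lambda>x. epow p (f x)"])
  show "AE x in lb {a..b}. epow p (f x - cut (real N) (f x)) <= epow p (f x)" for N
   using p by (intro AE_I2 ennreal_leI powr_mono2 abs_cut_diff_le) auto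
  have "(\<lambda>N. f x - cut (real N) (f x)) \<longlonglongrightarrow> 0" for x
  proof (rule tendsto_eventually)
   show "\<forall>\<^sub>F N in sequentially. f x - cut (real N) (f x) = 0"
    using eventually_ge_at_top[of "nat \<lceil>\<bar>f x\<bar>\<rceil>"] by eventually_elim (simp add: cut_eq)
  qed
  then show "AE x in lb {a..b}. (\<lambda>N. epow p (f x - cut (real N) (f x))) \<longlonglongrightarrow> 0"
   using pz by (intro AE_I2) (metis ennreal_0 tendsto_ennrealI)
 qed (use fin in auto)
 then have "(\<lambda>N. NINT x|{a..b}. epow p (f x - cut (real N) (f x))) \<longlonglongrightarrow> 0" by simp
 then have "\<forall>\<^sub>F N in sequentially. (NINT x|{a..b}. epow p (f x - cut (real N) (f x))) < ennreal e'"
  by (rule order_tendstoD) (use e' in simp)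
 then obtain N :: nat where N: "(NINT x|{a..b}. epow p (f x - cut (real N) (f x))) < ennreal e'"
  by (meson eventually_happens trivial_limit_sequentially)
 obtain g where g: "!!n. continuous_on UNIV (g n)" "AE x in lborel. (\<lambda>n. g n x) \<longlonglongrightarrow> f x"
  using continuous_approximation_AE[OF f] by blast
 have gm [measurable]: "g n \<in> borel_fun" for n by (rule borel_measurable_continuous_onI[OF g(1)])
 have cc: "continuous_on UNIV (cut (real N))"
  unfolding cut_def [abs_def] by (intro continuous_intros)
 have "(\<lambda>n. NINT x|{a..b}. epow p (cut (real N) (f x) - cut (real N) (g n x))) \<longlonglongrightarrow> (NINT x|{a..b}. 0)"
 proof (rule nn_integral_dominated_convergence[where w = "\<lambda>x. ennreal ((2 * real N) powr p)"])
  show "AE x in lb {a..b}. epow p (cut (real N) (f x) - cut (real N) (g n x)) <= ennreal ((2 * real N) powr p)" for n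
  proof (intro AE_I2 ennreal_leI powr_mono2)
   fix x
   show "\<bar>cut (real N) (f x) - cut (real N) (g n x)\<bar> <= 2 * real N"
    using abs_cut_le[of "real N" "f x"] abs_cut_le[of "real N" "g n x"] by linarith
  qed (use p in auto)
  show "AE x in lb {a..b}. (\<lambda>n. epow p (cut (real N) (f x) - cut (real N) (g n x))) \<longlonglongrightarrow> 0"
   unfolding AE_lb[of "{a..b}", simplified] using g(2)
  proof eventually_elim
   case (elim x)
   have "(\<lambda>n. cut (real N) (g n x)) \<longlonglongrightarrow> cut (real N) (f x)"
    using continuous_on_tendsto_compose[OF cc elim] by simp
   then have "(\<lambda>n. cut (real N) (f x) - cut (real N) (g n x)) \<longlonglongrightarrow> 0"
    using tendsto_diff[OF tendsto_const[of "cut (real N) (f x)"]] by fastforce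
   then have "(\<lambda>n. epow p (cut (real N) (f x) - cut (real N) (g n x))) \<longlonglongrightarrow> ennreal 0"
    by (intro tendsto_ennrealI pz)
   then show ?case by simp
  qed
 qed (auto simp: emeasure_lb ennreal_mult_less_top emeasure_lborel_Icc_eq)
 then have "(\<lambda>n. NINT x|{a..b}. epow p (cut (real N) (f x) - cut (real N) (g n x))) \<longlonglongrightarrow> 0" by simp
 then have "\<forall>\<^sub>F n in sequentially. (NINT x|{a..b}. epow p (cut (real N) (f x) - cut (real N) (g n x))) < ennreal e'"
  by (rule order_tendstoD) (use e' in simp)
 then obtain n where n: "(NINT x|{a..b}. epow p (cut (real N) (f x) - cut (real N) (g n x))) < ennreal e'"
  by (meson eventually_happens trivial_limit_sequentially)
 let ?c = "\<lambda>x. cut (real N) (g n x)"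
 have "continuous_on UNIV ?c" by (rule continuous_on_compose2[OF cc g(1)]) auto
 moreover have "(NINT x|{a..b}. epow p (f x - ?c x)) < ennreal e"
 proof -
  have "(NINT x|{a..b}. epow p (f x - ?c x))
   = (NINT x|{a..b}. epow p ((f x - cut (real N) (f x)) + (cut (real N) (f x) - ?c x)))" by simp
  also have "... <= (NINT x|{a..b}. ennreal (2 powr p) * (epow p (f x - cut (real N) (f x)) + epow p (cut (real N) (f x) - ?c x)))"
   by (intro nn_integral_mono ennreal_powr_add_le p)
  also have "... = ennreal (2 powr p) * ((NINT x|{a..b}. epow p (f x - cut (real N) (f x)))
    + (NINT x|{a..b}. epow p (cut (real N) (f x) - ?c x)))"
   by (rule nn_integral_cmult_add) measurable
  also have "... < ennreal (2 powr p) * (ennreal e' + ennreal e')"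
   by (intro ennreal_mult_strict_left_mono add_strict_mono N n) auto
  also have "ennreal (2 powr p) * (ennreal e' + ennreal e') = ennreal (2 powr p * (e' + e'))"
  proof -
   have "ennreal (e' + e') = ennreal e' + ennreal e'" using e' by (intro ennreal_plus) auto
   moreover have "ennreal (2 powr p * (e' + e')) = ennreal (2 powr p) * ennreal (e' + e')"
    using e' by (intro ennreal_mult) auto
   ultimately show ?thesis by (simp only:)
  qed
  also have "2 powr p * (e' + e') = e" by (simp add: e'_def field_simps)
  finally show ?thesis .
 qed
 ultimately show ?thesis by blast
qed

text \<open>Uniform continuity of a continuous approximation on a window that contains a period and its neighbourhood.\<close>

lemma translation_continuity:
 fixes G :: "real => real"
 assumes p: "1 < p" and G [measurable]: "G \<in> borel_fun" and per: "!!y. G (y + 2) = G y"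
  and fin: "(NINT x|circ. epow p (G x)) < \<infinity>" and e: "0 < e"
 shows "\<exists>d>0. \<forall>h. \<bar>h\<bar> < d --> (NINT y|circ. epow p (G (y + h) - G y)) <= ennreal e"
proof -
 define K where "K = (2::real) powr p"
 have K: "0 < K" by (simp add: K_def)
 define e' where "e' = e / (4 * K * K)"
 have e': "0 < e'" using e K by (simp add: e'_def)
 have win: "(NINT x|{r..r + 2}. epow p (G x)) = (NINT x|circ. epow p (G x))" for r
  by (rule circle_window) (auto simp: per)
 have "(NINT x|{-1..3}. epow p (G x)) = (NINT x|{-1..<1}. epow p (G x)) + (NINT x|{1..<3}. epow p (G x))"
  by (simp add: nn_integral_lb_Icc nn_integral_lb_Ico_split[of _ "-1" 1 3])
 also have "... < \<infinity>"
  using win[of "-1"] win[of 1] fin by (simp add: nn_integral_lb_Icc)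
 finally obtain c where c: "continuous_on UNIV c" and ce: "(NINT x|{-1..3}. epow p (G x - c x)) < ennreal e'"
  using Lp_dense_continuous[OF p G _ e'] by blast
 have [measurable]: "c \<in> borel_fun" by (rule borel_measurable_continuous_onI[OF c])
 define \<eta> where "\<eta> = (e' / 2) powr (1 / p)"
 have \<eta>: "0 < \<eta>" using e' by (simp add: \<eta>_def)
 have "uniformly_continuous_on {-1..3} c"
  by (intro compact_uniformly_continuous continuous_on_subset[OF c]) auto
 then obtain d where d: "0 < d" "!!x y. x \<in> {-1..3} ==> y \<in> {-1..3} ==> \<bar>y - x\<bar> < d ==> \<bar>c y - c x\<bar> < \<eta>"
  using \<eta> unfolding uniformly_continuous_on_def dist_real_def by metis
 show ?thesis
 proof (intro exI[of _ "min d 1"] conjI allI impI)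
  show "0 < min d 1" using d by simp
  fix h :: real assume h: "\<bar>h\<bar> < min d 1"
  have 1: "(NINT y|circ. epow p (G (y + h) - c (y + h))) <= ennreal e'"
  proof -
   have "(NINT y|circ. epow p (G (y + h) - c (y + h))) = (NINT y|{0 + h..<2 + h}. epow p (G y - c y))"
    by (rule nn_integral_lb_shift[of "\<lambda>y. epow p (G y - c y)"]) measurable
   also have "... <= (NINT y|{-1..3}. epow p (G y - c y))"
    using h by (intro nn_integral_lb_mono_set) auto
   finally show ?thesis using ce by simp
  qed
  have 2: "(NINT y|circ. epow p (G y - c y)) <= ennreal e'"
  proof -
   have "(NINT y|circ. epow p (G y - c y)) <= (NINT y|{-1..3}. epow p (G y - c y))"
    by (intro nn_integral_lb_mono_set) auto
   then show ?thesis using ce by simp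
  qed
  have 3: "(NINT y|circ. epow p (c (y + h) - c y)) <= ennreal e'"
  proof -
   have "(NINT y|circ. epow p (c (y + h) - c y)) <= (NINT y|{0..<2::real}. ennreal (e' / 2))"
   proof (rule nn_integral_lb_mono)
    fix y :: real assume "y \<in> circ"
    then have "\<bar>c (y + h) - c y\<bar> < \<eta>" using h by (intro d) auto
    then have "\<bar>c (y + h) - c y\<bar> powr p <= \<eta> powr p" using p by (intro powr_mono2) auto
    also have "\<eta> powr p = e' / 2" using e' p by (simp add: \<eta>_def powr_powr)
    finally show "epow p (c (y + h) - c y) <= ennreal (e' / 2)" by (rule ennreal_leI)
   qed simp
   also have "... = ennreal (e' / 2) * ennreal 2" by (simp add: emeasure_lb)
   also have "... = ennreal e'" using e' by (subst ennreal_mult[symmetric]) auto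
   finally show ?thesis .
  qed
  have "(NINT y|circ. epow p (G (y + h) - G y))
   = (NINT y|circ. epow p ((G (y + h) - c (y + h)) + ((c (y + h) - c y) - (G y - c y))))"
   by simp
  also have "... <= (NINT y|circ. ennreal K * (epow p (G (y + h) - c (y + h))
    + ennreal K * (epow p (c (y + h) - c y) + epow p (G y - c y))))"
  proof (rule nn_integral_mono)
   fix y
   show "epow p ((G (y + h) - c (y + h)) + ((c (y + h) - c y) - (G y - c y)))
    <= ennreal K * (epow p (G (y + h) - c (y + h))
    + ennreal K * (epow p (c (y + h) - c y) + epow p (G y - c y)))"
    unfolding K_def
    by (rule order_trans[OF ennreal_powr_add_le[OF p] mult_left_mono[OF add_left_mono[OF ennreal_powr_diff_le[OF p]]]]) simp
  qed
  also have "... = ennreal K * ((NINT y|circ. epow p (G (y + h) - c (y + h)))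
    + (NINT y|circ. ennreal K * (epow p (c (y + h) - c y) + epow p (G y - c y))))"
   by (rule nn_integral_cmult_add) measurable
  also have "(NINT y|circ. ennreal K * (epow p (c (y + h) - c y) + epow p (G y - c y)))
    = ennreal K * ((NINT y|circ. epow p (c (y + h) - c y)) + (NINT y|circ. epow p (G y - c y)))"
   by (rule nn_integral_cmult_add) measurable
  also have "ennreal K * ((NINT y|circ. epow p (G (y + h) - c (y + h))) + ...)
    <= ennreal K * (ennreal e' + ennreal K * (ennreal e' + ennreal e'))"
   by (intro mult_left_mono add_mono 1 2 3) auto
  also have "... = ennreal (K * (e' + K * (e' + e')))"
  proof -
   have "ennreal K * (ennreal e' + ennreal K * (ennreal e' + ennreal e')) = ennreal K * (ennreal e' + ennreal K * ennreal (e' + e'))"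
   proof -
    have "ennreal (e' + e') = ennreal e' + ennreal e'" using e' by (intro ennreal_plus) auto
    then show ?thesis by (simp only:)
   qed
   also have "ennreal K * ennreal (e' + e') = ennreal (K * (e' + e'))" using K e' by (intro ennreal_mult[symmetric]) auto
   also have "ennreal e' + ennreal (K * (e' + e')) = ennreal (e' + K * (e' + e'))"
    using K e' by (intro ennreal_plus[symmetric]) auto
   also have "ennreal K * ennreal (e' + K * (e' + e')) = ennreal (K * (e' + K * (e' + e')))"
    using K e' by (intro ennreal_mult[symmetric]) auto
   finally show ?thesis .
  qed
  also have "... <= ennreal e"
  proof (rule ennreal_leI)
   have "1 <= K" using p by (simp add: K_def ge_one_powr_ge_zero)
   then have "K * e' <= K * (K * e')" using K e' by (intro mult_left_mono) (auto simp: mult_le_cancel_right1)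
   then have "K * (e' + K * (e' + e')) <= 3 * (K * K * e')" by (simp add: algebra_simps)
   also have "... = 3 / 4 * e" using K by (simp add: e'_def)
   also have "... <= e" using e by simp
   finally show "K * (e' + K * (e' + e')) <= e" .
  qed
  finally show "(NINT y|circ. epow p (G (y + h) - G y)) <= ennreal e" .
 qed
qed

section \<open>Lebesgue and Sobolev spaces on the unit interval\<close>

lemma LpD:
 assumes "f \<in> Lp p"
 shows "f \<in> borel_measurable leb01" "integrable leb01 (\<lambda>x. \<bar>f x\<bar> powr p)"
 using assms by (auto simp: Lp_def)

lemma finite_measure_leb01: "finite_measure leb01"
 by (rule finite_measureI) (simp add: emeasure_restrict_space space_restrict_space)

lemma measure_leb01 [simp]: "measure leb01 (space leb01) = 1"
 by (simp add: measure_restrict_space space_restrict_space)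

lemma measure_leb01' [simp]: "Sigma_Algebra.measure leb01 I01 = 1"
 using measure_leb01 by (simp add: space_restrict_space)

lemma Lp_add:
 assumes p: "1 < p" and f: "f \<in> Lp p" and g: "g \<in> Lp p"
 shows "(\<lambda>x. f x + g x) \<in> Lp p"
  "(LINT x|leb01. \<bar>f x + g x\<bar> powr p) <= 2 powr p * ((LINT x|leb01. \<bar>f x\<bar> powr p) + (LINT x|leb01. \<bar>g x\<bar> powr p))"
proof -
 note fg = LpD[OF f] LpD[OF g]
 have m: "(\<lambda>x. f x + g x) \<in> borel_measurable leb01" using fg by simp
 have i: "integrable leb01 (\<lambda>x. 2 powr p * (\<bar>f x\<bar> powr p + \<bar>g x\<bar> powr p))" using fg by simp
 have i2: "integrable leb01 (\<lambda>x. \<bar>f x + g x\<bar> powr p)"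
 proof (rule Bochner_Integration.integrable_bound[OF i])
  show "(\<lambda>x. \<bar>f x + g x\<bar> powr p) \<in> borel_measurable leb01" using m by measurable
  show "AE x in leb01. norm (\<bar>f x + g x\<bar> powr p) <= norm (2 powr p * (\<bar>f x\<bar> powr p + \<bar>g x\<bar> powr p))"
   using abs_add_powr_le[OF p] by (auto intro!: AE_I2)
 qed
 with m show "(\<lambda>x. f x + g x) \<in> Lp p" by (simp add: Lp_def)
 have "(LINT x|leb01. \<bar>f x + g x\<bar> powr p) <= (LINT x|leb01. 2 powr p * (\<bar>f x\<bar> powr p + \<bar>g x\<bar> powr p))"
  by (intro integral_mono i i2 abs_add_powr_le p)
 then show "(LINT x|leb01. \<bar>f x + g x\<bar> powr p) <= 2 powr p * ((LINT x|leb01. \<bar>f x\<bar> powr p) + (LINT x|leb01. \<bar>g x\<bar> powr p))"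
  using fg by simp
qed

lemma Lp_cmult:
 assumes f: "f \<in> Lp p"
 shows "(\<lambda>x. c * f x) \<in> Lp p"
 using LpD[OF f] by (simp add: Lp_def abs_mult powr_mult)

lemma Lp_diff:
 assumes p: "1 < p" and f: "f \<in> Lp p" and g: "g \<in> Lp p"
 shows "(\<lambda>x. f x - g x) \<in> Lp p"
  "(LINT x|leb01. \<bar>f x - g x\<bar> powr p) <= 2 powr p * ((LINT x|leb01. \<bar>f x\<bar> powr p) + (LINT x|leb01. \<bar>g x\<bar> powr p))"
 using Lp_add[OF p f Lp_cmult[OF g, of "-1"]] by simp_all

lemma Lp_integrable:
 assumes p: "1 < p" and f: "f \<in> Lp p"
 shows "integrable leb01 f" "(LINT x|leb01. \<bar>f x\<bar>) <= Lp_norm p f"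
proof -
 interpret finite_measure leb01 by (rule finite_measure_leb01)
 note fD = LpD[OF f]
 show int: "integrable leb01 f"
 proof (rule Bochner_Integration.integrable_bound[of _ "\<lambda>x. 1 + \<bar>f x\<bar> powr p"])
  show "AE x in leb01. norm (f x) <= norm (1 + \<bar>f x\<bar> powr p)"
   using abs_le_one_plus_powr[OF p] by (auto intro!: AE_I2)
 qed (use fD in auto)
 define m where "m = (LINT x|leb01. \<bar>f x\<bar>)"
 have m0: "0 <= m" by (simp add: m_def)
 have "(LINT x|leb01. \<bar>m\<bar> powr p + p * spow p m * (\<bar>f x\<bar> - m)) <= (LINT x|leb01. \<bar>f x\<bar> powr p)"
 proof (rule integral_mono)
  show "\<bar>m\<bar> powr p + p * spow p m * (\<bar>f x\<bar> - m) <= \<bar>f x\<bar> powr p" for x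
   using subgradient_powr[OF p, unfolded subgradient_def, rule_format, of m "\<bar>f x\<bar>"] by simp
 qed (use int fD in auto)
 also have "(LINT x|leb01. \<bar>m\<bar> powr p + p * spow p m * (\<bar>f x\<bar> - m)) = \<bar>m\<bar> powr p"
  using int by (simp add: m_def[symmetric])
 finally have "m powr p <= (LINT x|leb01. \<bar>f x\<bar> powr p)" using m0 by simp
 then have "(m powr p) powr (1 / p) <= (LINT x|leb01. \<bar>f x\<bar> powr p) powr (1 / p)"
  using p by (intro powr_mono2) auto
 moreover have "(m powr p) powr (1 / p) = m" using p m0 by (simp add: powr_powr)
 ultimately show "(LINT x|leb01. \<bar>f x\<bar>) <= Lp_norm p f" by (simp add: Lp_norm_def m_def)
qed

lemma Lp_norm_nonneg: "0 <= Lp_norm p f"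
 by (simp add: Lp_norm_def)

lemma Lp_norm_powr:
 assumes "1 < p"
 shows "Lp_norm p f powr p = (LINT x|leb01. \<bar>f x\<bar> powr p)"
 using assms by (simp add: Lp_norm_def powr_powr Bochner_Integration.integral_nonneg)

text \<open>Convergence to zero is handled through the \<open>p\<close>-th power, where no triangle inequality with sharp constant is needed.\<close>

lemma Lp_norm_tendsto_iff:
 assumes p: "1 < p"
 shows "((\<lambda>s. Lp_norm p (F s)) \<longlongrightarrow> 0) A \<longleftrightarrow> ((\<lambda>s. LINT x|leb01. \<bar>F s x\<bar> powr p) \<longlongrightarrow> 0) A"
proof
 assume "((\<lambda>s. Lp_norm p (F s)) \<longlongrightarrow> 0) A"
 then have "((\<lambda>s. Lp_norm p (F s) powr p) \<longlongrightarrow> 0) A"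
  by (rule tendsto_zero_powrI[OF _ tendsto_const]) (use p in \<open>auto simp: Lp_norm_nonneg\<close>)
 then show "((\<lambda>s. LINT x|leb01. \<bar>F s x\<bar> powr p) \<longlongrightarrow> 0) A" by (simp add: Lp_norm_powr[OF p])
next
 assume "((\<lambda>s. LINT x|leb01. \<bar>F s x\<bar> powr p) \<longlongrightarrow> 0) A"
 then show "((\<lambda>s. Lp_norm p (F s)) \<longlongrightarrow> 0) A"
  unfolding Lp_norm_def
  by (rule tendsto_zero_powrI[OF _ tendsto_const]) (use p in auto)
qed

lemma Lp_norm_cong_AE:
 assumes "f \<in> borel_measurable leb01" "g \<in> borel_measurable leb01" "AE x in leb01. f x = g x"
 shows "Lp_norm p f = Lp_norm p g" "f \<in> Lp p \<longleftrightarrow> g \<in> Lp p"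
proof -
 have m: "(\<lambda>x. \<bar>f x\<bar> powr p) \<in> borel_measurable leb01" "(\<lambda>x. \<bar>g x\<bar> powr p) \<in> borel_measurable leb01"
  using assms by measurable
 have a: "AE x in leb01. \<bar>f x\<bar> powr p = \<bar>g x\<bar> powr p" using assms(3) by eventually_elim simp
 show "Lp_norm p f = Lp_norm p g" unfolding Lp_norm_def by (simp only: integral_cong_AE[OF m a])
 show "f \<in> Lp p \<longleftrightarrow> g \<in> Lp p" using assms(1,2) integrable_cong_AE[OF m a] by (simp add: Lp_def)
qed

lemma Lp_power_zero_AE:
 assumes f: "f \<in> Lp p" and z: "(LINT x|leb01. \<bar>f x\<bar> powr p) <= 0"
 shows "AE x in leb01. f x = 0"
proof -
 have "(LINT x|leb01. \<bar>f x\<bar> powr p) = 0"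
 proof (rule antisym[OF z])
  show "0 <= (LINT x|leb01. \<bar>f x\<bar> powr p)" by (intro Bochner_Integration.integral_nonneg) simp
 qed
 then have "AE x in leb01. \<bar>f x\<bar> powr p = 0"
  using integral_nonneg_eq_0_iff_AE[OF LpD(2)[OF f]] by simp
 then show ?thesis by eventually_elim simp
qed

lemma has_Lp_dt_unique:
 assumes p: "1 < p" and w: "has_Lp_dt p I u t w1" "has_Lp_dt p I u t w2"
  and t: "t \<in> I" "at t within I \<noteq> bot"
 shows "AE x in leb01. w1 x = w2 x"
proof -
 let ?q = "\<lambda>s x. (u s x - u t x) / (s - t)"
 let ?P = "\<lambda>f. LINT x|leb01. \<bar>f x\<bar> powr p"
 have L: "w1 \<in> Lp p" "w2 \<in> Lp p" "!!s. s \<in> I ==> u s \<in> Lp p" using w by (auto simp: has_Lp_dt_def)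
 have lim: "((\<lambda>s. ?P (\<lambda>x. ?q s x - w1 x)) \<longlongrightarrow> 0) (at t within I)" "((\<lambda>s. ?P (\<lambda>x. ?q s x - w2 x)) \<longlongrightarrow> 0) (at t within I)"
  using w unfolding has_Lp_dt_def Lp_norm_tendsto_iff[OF p] by auto
 have d: "(\<lambda>x. w1 x - w2 x) \<in> Lp p" by (rule Lp_diff(1)[OF p L(1,2)])
 have "?P (\<lambda>x. w1 x - w2 x) <= 2 powr p * (?P (\<lambda>x. ?q s x - w2 x) + ?P (\<lambda>x. ?q s x - w1 x))" if s: "s \<in> I" for s
 proof -
  have "(\<lambda>x. inverse (s - t) * (u s x - u t x)) \<in> Lp p"
   by (intro Lp_cmult Lp_diff(1)[OF p] L s t)
  then have q: "?q s \<in> Lp p" by (simp add: divide_inverse mult.commute)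
  show ?thesis
   using Lp_diff(2)[OF p Lp_diff(1)[OF p q L(2)] Lp_diff(1)[OF p q L(1)]] by simp
 qed
 then have "\<forall>\<^sub>F s in at t within I. ?P (\<lambda>x. w1 x - w2 x) <= 2 powr p * (?P (\<lambda>x. ?q s x - w2 x) + ?P (\<lambda>x. ?q s x - w1 x))"
  by (simp add: eventually_at_filter)
 moreover have "((\<lambda>s. 2 powr p * (?P (\<lambda>x. ?q s x - w2 x) + ?P (\<lambda>x. ?q s x - w1 x))) \<longlongrightarrow> 2 powr p * (0 + 0)) (at t within I)"
  by (intro tendsto_intros lim)
 ultimately have "?P (\<lambda>x. w1 x - w2 x) <= 2 powr p * (0 + 0)"
  by (intro tendsto_lowerbound[OF _ _ t(2)])
 then have "AE x in leb01. w1 x - w2 x = 0" by (intro Lp_power_zero_AE[OF d]) simp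
 then show ?thesis by eventually_elim simp
qed

lemma at_within_interval_nontrivial:
 fixes t :: real
 assumes "0 <= t"
 shows "at t within {0..} \<noteq> bot" "t <= T ==> 0 < T ==> at t within {0..T} \<noteq> bot"
proof -
 show *: "at t within {0..T} \<noteq> bot" if "t <= T" "0 < T" for T
  using islimpt_Icc[of 0 T t] assms that by (simp add: trivial_limit_within)
 have "t islimpt {0..t + 1}" using *[of "t + 1"] assms by (simp add: trivial_limit_within)
 then have "t islimpt {0..}" by (rule islimpt_subset) auto
 then show "at t within {0..} \<noteq> bot" by (simp add: trivial_limit_within)
qed

lemma weak_dx_AE:
 assumes "has_weak_dx f g"
 shows "AE x in leb01. weak_dx f x = g x" "weak_dx f \<in> borel_measurable leb01" "has_weak_dx f (weak_dx f)"
proof -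
 show w: "has_weak_dx f (weak_dx f)" unfolding weak_dx_def by (rule someI[of "has_weak_dx f", OF assms])
 show "AE x in leb01. weak_dx f x = g x" by (rule has_weak_dx_unique[OF w assms])
 have "loc_integrable01 (weak_dx f)" using w by (simp add: has_weak_dx_def)
 then show "weak_dx f \<in> borel_measurable leb01" using loc_integrable01_borel by blast
qed

lemma weak_dx_Lp:
 assumes "has_weak_dx f g" "g \<in> Lp p"
 shows "weak_dx f \<in> Lp p" "Lp_norm p (weak_dx f) = Lp_norm p g"
 using Lp_norm_cong_AE[OF weak_dx_AE(2)[OF assms(1)] LpD(1)[OF assms(2)] weak_dx_AE(1)[OF assms(1)]] assms(2)
 by auto

lemma W1p_weak_dx:
 assumes "f \<in> W1p p"
 shows "f \<in> Lp p" "has_weak_dx f (weak_dx f)" "weak_dx f \<in> Lp p"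
 using assms weak_dx_AE(3) weak_dx_Lp(1) unfolding W1p_def by blast+

lemma Lp_loc_integrable:
 assumes p: "1 < p" and f: "f \<in> Lp p"
 shows "loc_integrable01 f"
 unfolding loc_integrable01_def
proof (intro allI impI)
 fix K :: "real set" assume K: "compact K \<and> K \<subseteq> I01"
 then have Ks: "K \<in> sets lebesgue" using fmeasurableD[OF lmeasurable_compact, of K] by blast
 have "integrable leb01 f" by (rule Lp_integrable(1)[OF p f])
 then have "set_integrable lebesgue I01 f" by (simp add: integrable_restrict_space set_integrable_def)
 then have "set_integrable lebesgue K f" by (rule set_integrable_subset) (use K Ks in auto)
 then show "integrable (lebesgue_on K) f"
  using K Ks by (subst integrable_restrict_space) (auto simp: set_integrable_def)
qed

lemma has_weak_dx_diff:
 assumes p: "1 < p" and f: "f1 \<in> Lp p" "f2 \<in> Lp p" "g1 \<in> Lp p" "g2 \<in> Lp p"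
  and w: "has_weak_dx f1 g1" "has_weak_dx f2 g2"
 shows "has_weak_dx (\<lambda>x. f1 x - f2 x) (\<lambda>x. g1 x - g2 x)"
 unfolding has_weak_dx_def
proof (intro conjI ballI)
 show "loc_integrable01 (\<lambda>x. f1 x - f2 x)" "loc_integrable01 (\<lambda>x. g1 x - g2 x)"
  by (intro Lp_loc_integrable[OF p] Lp_diff(1)[OF p] f)+
 fix \<phi> assume \<phi>: "\<phi> \<in> test_functions I01"
 have d: "deriv \<phi> \<in> test_functions I01" by (rule test_function_deriv[OF \<phi>]) simp
 have int: "integrable leb01 (\<lambda>x. f x * \<psi> x)" if fL: "f \<in> Lp p" and \<psi>T: "\<psi> \<in> test_functions I01" for f \<psi>
 proof -
  obtain B where B: "!!x. \<bar>\<psi> x\<bar> <= B" using test_function_bounded[OF \<psi>T] by blast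
  have fi: "integrable leb01 f" by (rule Lp_integrable(1)[OF p fL])
  show ?thesis
  proof (rule Bochner_Integration.integrable_bound[of _ "\<lambda>x. B * \<bar>f x\<bar>"])
   have "\<psi> \<in> borel_measurable leb01" by (rule borel_imp_lebesgue_on[OF test_function_measurable[OF \<psi>T]])
   then show "(\<lambda>x. f x * \<psi> x) \<in> borel_measurable leb01" using fi by simp
   have "\<bar>f x\<bar> * \<bar>\<psi> x\<bar> <= \<bar>B\<bar> * \<bar>f x\<bar>" for x
    using B[of x] by (subst mult.commute, intro mult_right_mono) auto
   then show "AE x in leb01. norm (f x * \<psi> x) <= norm (B * \<bar>f x\<bar>)"
    by (intro AE_I2) (simp add: abs_mult)
  qed (use fi in simp)
 qed
 have e: "(LINT x|leb01. f1 x * deriv \<phi> x) = - (LINT x|leb01. g1 x * \<phi> x)"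
  "(LINT x|leb01. f2 x * deriv \<phi> x) = - (LINT x|leb01. g2 x * \<phi> x)"
  using w \<phi> unfolding has_weak_dx_def by blast+
 show "(LINT x|leb01. (f1 x - f2 x) * deriv \<phi> x) = - (LINT x|leb01. (g1 x - g2 x) * \<phi> x)"
  using int[OF f(1) d] int[OF f(2) d] int[OF f(3) \<phi>] int[OF f(4) \<phi>] e
  by (simp add: left_diff_distrib)
qed

section \<open>Folding the circle onto the unit interval\<close>

text \<open>The distance to the nearest even integer, which folds the circle onto the unit interval.\<close>

definition tent :: "real => real" where
 "tent z = arccos (cos (pi * z)) / pi"

text \<open>The derivative of \<open>tent\<close> away from the integers: \<open>1\<close> on the original interval and \<open>-1\<close> on its mirror image.\<close>

definition side :: "real => real" where
 "side z = sgn (sin (pi * z))"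

lemma tent_range: "tent z \<in> {0..1}"
 using arccos_lbound[of "cos (pi * z)"] arccos_ubound[of "cos (pi * z)"]
 by (simp add: tent_def)

lemma tent_id: "x \<in> {0..1} ==> tent x = x"
 by (simp add: tent_def arccos_cos mult_left_le)

lemma tent_minus [simp]: "tent (- z) = tent z"
 by (simp add: tent_def)

lemma tent_periodic [simp]: "tent (z + 2) = tent z"
proof -
 have "pi * (z + 2) = pi * z + 2 * pi" by (simp add: algebra_simps)
 then show ?thesis unfolding tent_def by (simp only: cos_periodic)
qed

lemma side_minus [simp]: "side (- z) = - side z"
 by (simp add: side_def sgn_minus)

lemma side_periodic [simp]: "side (z + 2) = side z"
proof -
 have "pi * (z + 2) = pi * z + 2 * pi" by (simp add: algebra_simps)
 then show ?thesis unfolding side_def by (simp only: sin_periodic)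
qed

lemma side_pos: "0 < x ==> x < 1 ==> side x = 1"
 using sin_gt_zero[of "pi * x"] by (simp add: side_def)

lemma abs_side_le: "\<bar>side z\<bar> <= 1"
 by (simp add: side_def sgn_if)

lemma continuous_on_tent: "continuous_on A tent"
 unfolding tent_def
 by (intro continuous_intros) auto

lemma tent_measurable [measurable]: "tent \<in> borel_fun"
 by (rule borel_measurable_continuous_onI[OF continuous_on_tent])

lemma side_measurable [measurable]: "side \<in> borel_fun"
 unfolding side_def [abs_def] by measurable

lemma tent_DERIV:
 assumes "sin (pi * z) \<noteq> 0"
 shows "(tent has_real_derivative side z) (at z)" "tent z \<in> I01" "side z * side z = 1"
proof -
 let ?c = "cos (pi * z)"
 have sc: "(sin (pi * z))\<^sup>2 = 1 - ?c\<^sup>2" by (simp add: sin_squared_eq)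
 have "0 < (sin (pi * z))\<^sup>2" using assms by simp
 then have "?c\<^sup>2 < 1" using sc by simp
 then have c: "- 1 < ?c" "?c < 1" using abs_square_less_1[of ?c] by auto
 have sq: "sqrt (1 - ?c\<^sup>2) = \<bar>sin (pi * z)\<bar>" unfolding sc[symmetric] by simp
 have "((\<lambda>z. cos (pi * z)) has_real_derivative - sin (pi * z) * pi) (at z)"
  by (auto intro!: derivative_eq_intros)
 from DERIV_chain2[OF DERIV_arccos[OF c] this]
 have "((\<lambda>z. arccos (cos (pi * z))) has_real_derivative inverse (- sqrt (1 - ?c\<^sup>2)) * (- sin (pi * z) * pi)) (at z)" .
 from DERIV_cdivide[OF this, of pi]
 have "(tent has_real_derivative inverse (- sqrt (1 - ?c\<^sup>2)) * (- sin (pi * z) * pi) / pi) (at z)"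
  unfolding tent_def [abs_def] .
 also have "inverse (- sqrt (1 - ?c\<^sup>2)) * (- sin (pi * z) * pi) / pi = side z"
  unfolding sq using assms by (auto simp: side_def sgn_if field_simps abs_if)
 finally show "(tent has_real_derivative side z) (at z)" .
 show "side z * side z = 1" using assms by (simp add: side_def sgn_if)
 have "0 < arccos ?c" "arccos ?c < pi" using arccos_lt_bounded[OF c] by auto
 then show "tent z \<in> I01" by (simp add: tent_def)
qed

lemma finite_sin_zeros: "finite {z \<in> {a..b}. sin (pi * z) = 0}"
proof (rule finite_subset)
 show "{z \<in> {a..b}. sin (pi * z) = 0} \<subseteq> of_int ` {\<lfloor>a\<rfloor>..\<lceil>b\<rceil>}"
 proof
  fix z assume z: "z \<in> {z \<in> {a..b}. sin (pi * z) = 0}"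
  then obtain i :: int where "pi * z = of_int i * pi" using sin_zero_iff_int2 by auto
  then have i: "z = of_int i" by simp
  then have "\<lfloor>a\<rfloor> <= i" "i <= \<lceil>b\<rceil>" using z by (auto simp: floor_le_iff le_ceiling_iff)
  then show "z \<in> of_int ` {\<lfloor>a\<rfloor>..\<lceil>b\<rceil>}" using i by auto
 qed
qed simp

lemma AC_on_piecewise:
 assumes "finite S" "continuous_on UNIV W" "W' \<in> borel_fun" "!!z. \<bar>W' z\<bar> <= K"
  and D: "!!z. z \<in> {a..b} - S ==> (W has_real_derivative W' z) (at z)"
 shows "AC_on a b W W'"
 unfolding AC_on_def
proof (intro conjI ballI)
 show "W \<in> borel_fun" by (rule borel_measurable_continuous_onI) fact
 have int: "integrable (lb {c..d}) W'" for c d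
  using assms(3,4) by (intro integrable_lb_bounded) auto
 show "integrable (lb {a..b}) W'" by (rule int)
 fix t assume t: "t \<in> {a..b}"
 have "(W' has_integral W t - W a) {a..t}"
 proof (rule fundamental_theorem_of_calculus_strong[OF assms(1)])
  show "(W has_vector_derivative W' z) (at z)" if "z \<in> {a..t} - S" for z
   using D[of z] that t by (auto simp: has_real_derivative_iff_has_vector_derivative)
  show "continuous_on {a..t} W" by (rule continuous_on_subset[OF assms(2)]) simp
 qed (use t in simp)
 then show "W t = W a + (LINT s|lb {a..t}. W' s)"
  using integral_lb_HK(2)[OF int] by (simp add: integral_unique)
qed

text \<open>Functions that are \<open>C\<^sup>1\<close> up to the boundary extend evenly to Lipschitz functions on the circle, whatever their boundary derivative. This is where the Neumann condition becomes natural.\<close>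

lemma even_extension:
 assumes D: "!!x. x \<in> {0..1} ==> (v has_real_derivative v' x) (at x within {0..1})"
  and c: "continuous_on {0..1} v'"
 shows "continuous_on UNIV (\<lambda>z. v (tent z))" "(\<lambda>z. side z * v' (tent z)) \<in> borel_fun"
  "\<exists>K. \<forall>z. \<bar>v (tent z)\<bar> <= K \<and> \<bar>side z * v' (tent z)\<bar> <= K"
  "AC_on a b (\<lambda>z. v (tent z)) (\<lambda>z. side z * v' (tent z))"
proof -
 have cv: "continuous_on {0..1} v" by (rule DERIV_continuous_on[OF D])
 show cf: "continuous_on UNIV (\<lambda>z. v (tent z))"
  by (rule continuous_on_compose2[OF cv continuous_on_tent]) (use tent_range in auto)
 have cf': "continuous_on UNIV (\<lambda>z. v' (tent z))"
  by (rule continuous_on_compose2[OF c continuous_on_tent]) (use tent_range in auto)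
 have [measurable]: "(\<lambda>z. v' (tent z)) \<in> borel_fun" by (rule borel_measurable_continuous_onI[OF cf'])
 show m: "(\<lambda>z. side z * v' (tent z)) \<in> borel_fun" by measurable
 have "bounded (v ` {0..1})" "bounded (v' ` {0..1})"
  by (intro compact_imp_bounded compact_continuous_image cv c compact_Icc)+
 then obtain K1 K2 where K: "\<forall>x\<in>{0..1}. \<bar>v x\<bar> <= K1" "\<forall>x\<in>{0..1}. \<bar>v' x\<bar> <= K2"
  unfolding bounded_iff by auto
 have K': "\<bar>v (tent z)\<bar> <= max K1 K2" "\<bar>side z * v' (tent z)\<bar> <= max K1 K2" for z
 proof -
  show "\<bar>v (tent z)\<bar> <= max K1 K2" using K(1) tent_range[of z] by (simp add: le_max_iff_disj)
  have "\<bar>side z * v' (tent z)\<bar> <= 1 * \<bar>v' (tent z)\<bar>"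
   unfolding abs_mult by (intro mult_right_mono abs_side_le) simp
  also have "... <= max K1 K2" using K(2) tent_range[of z] by (simp add: le_max_iff_disj)
  finally show "\<bar>side z * v' (tent z)\<bar> <= max K1 K2" .
 qed
 then show "\<exists>K. \<forall>z. \<bar>v (tent z)\<bar> <= K \<and> \<bar>side z * v' (tent z)\<bar> <= K" by blast
 show "AC_on a b (\<lambda>z. v (tent z)) (\<lambda>z. side z * v' (tent z))"
 proof (rule AC_on_piecewise[OF finite_sin_zeros cf m K'(2)])
  fix z assume "z \<in> {a..b} - {z \<in> {a..b}. sin (pi * z) = 0}"
  then have s: "sin (pi * z) \<noteq> 0" by auto
  have "tent z \<in> I01" by (rule tent_DERIV(2)[OF s])
  then have "at (tent z) within {0..1} = at (tent z)"
   by (intro at_within_interior) (simp add: interior_atLeastAtMost_real)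
  then have "(v has_real_derivative v' (tent z)) (at (tent z))"
   using D[of "tent z"] tent_range by simp
  from DERIV_chain2[OF this tent_DERIV(1)[OF s]]
  show "((\<lambda>z. v (tent z)) has_real_derivative side z * v' (tent z)) (at z)" by (simp add: mult.commute)
 qed
qed

text \<open>Oddness is compatible with continuity because test functions vanish near the boundary.\<close>

lemma odd_extension:
 assumes \<psi>: "\<psi> \<in> test_functions I01"
 shows "continuous_on UNIV (\<lambda>z. side z * \<psi> (tent z))" "(\<lambda>z. deriv \<psi> (tent z)) \<in> borel_fun"
  "\<exists>K. \<forall>z. \<bar>side z * \<psi> (tent z)\<bar> <= K \<and> \<bar>deriv \<psi> (tent z)\<bar> <= K"
  "AC_on a b (\<lambda>z. side z * \<psi> (tent z)) (\<lambda>z. deriv \<psi> (tent z))"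
proof -
 have sm: "smooth \<psi>" by (rule test_function_smooth[OF \<psi>])
 obtain c d where cd: "0 < c" "c <= d" "d < 1" and supp: "!!x. x \<notin> {c..d} ==> \<psi> x = 0"
  using test_function_support[OF \<psi>] by auto
 obtain K1 where K1: "!!x. \<bar>\<psi> x\<bar> <= K1" using test_function_bounded[OF \<psi>] by blast
 have d\<psi>: "deriv \<psi> \<in> test_functions I01" by (rule test_function_deriv[OF \<psi>]) simp
 obtain K2 where K2: "!!x. \<bar>deriv \<psi> x\<bar> <= K2" using test_function_bounded[OF d\<psi>] by blast
 note [measurable] = test_function_measurable[OF d\<psi>]
 show m: "(\<lambda>z. deriv \<psi> (tent z)) \<in> borel_fun" by measurable
 have bd: "\<bar>side z * \<psi> (tent z)\<bar> <= max K1 K2" "\<bar>deriv \<psi> (tent z)\<bar> <= max K1 K2" for z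
 proof -
  have "\<bar>side z * \<psi> (tent z)\<bar> <= 1 * \<bar>\<psi> (tent z)\<bar>"
   unfolding abs_mult by (intro mult_right_mono abs_side_le) simp
  then show "\<bar>side z * \<psi> (tent z)\<bar> <= max K1 K2" using K1[of "tent z"] by linarith
  show "\<bar>deriv \<psi> (tent z)\<bar> <= max K1 K2" using K2[of "tent z"] by linarith
 qed
 then show "\<exists>K. \<forall>z. \<bar>side z * \<psi> (tent z)\<bar> <= K \<and> \<bar>deriv \<psi> (tent z)\<bar> <= K" by blast
 have D: "((\<lambda>z. side z * \<psi> (tent z)) has_real_derivative deriv \<psi> (tent z)) (at z)" for z
 proof (cases "sin (pi * z) = 0")
  case False
  have "((\<lambda>z. side z) has_real_derivative 0) (at z)"
  proof (cases "0 < sin (pi * z)")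
   case True
   have o: "open {z. 0 < sin (pi * z)}" by (intro open_Collect_less continuous_intros)
   have "((\<lambda>_. 1) has_real_derivative 0) (at z)" by simp
   then show ?thesis
    by (rule has_field_derivative_transform_within_open[OF _ o]) (use True in \<open>auto simp: side_def\<close>)
  next
   case neg: False
   have o: "open {z. sin (pi * z) < 0}" by (intro open_Collect_less continuous_intros)
   have "((\<lambda>_. -1) has_real_derivative 0) (at z)" by simp
   then show ?thesis
    by (rule has_field_derivative_transform_within_open[OF _ o]) (use False neg in \<open>auto simp: side_def\<close>)
  qed
  from DERIV_mult[OF this DERIV_chain2[OF smooth_DERIV[OF sm] tent_DERIV(1)[OF False]]]
  have "((\<lambda>z. side z * \<psi> (tent z)) has_real_derivative side z * side z * deriv \<psi> (tent z)) (at z)"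
   by (simp add: mult_ac)
  then show ?thesis using tent_DERIV(3)[OF False] by simp
 next
  case True
  have z01: "tent z \<notin> {c..d}"
  proof -
   have "cos (pi * z) = 1 \<or> cos (pi * z) = -1"
    using True sin_cos_squared_add[of "pi * z"] by (simp add: power2_eq_1_iff)
   then have "tent z = 0 \<or> tent z = 1" by (auto simp: tent_def)
   then show ?thesis using cd by auto
  qed
  have "open (- {c..d})" by auto
  then have o: "open (tent -` (- {c..d}))"
   using continuous_open_vimage[of "- {c..d}" tent] continuous_on_tent[of UNIV]
   by (simp add: continuous_on_eq_continuous_at)
  have "((\<lambda>_. 0) has_real_derivative 0) (at z)" by simp
  then have "((\<lambda>z. side z * \<psi> (tent z)) has_real_derivative 0) (at z)"
   by (rule has_field_derivative_transform_within_open[OF _ o]) (use z01 supp in auto)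
  moreover have "deriv \<psi> (tent z) = 0"
  proof -
   have "((\<lambda>_. 0) has_real_derivative 0) (at (tent z))" by simp
   then have "(\<psi> has_real_derivative 0) (at (tent z))"
    by (rule has_field_derivative_transform_within_open[of _ _ _ "- {c..d}"]) (use z01 supp in auto)
   then show ?thesis by (rule DERIV_imp_deriv)
  qed
  ultimately show ?thesis by simp
 qed
 show cont: "continuous_on UNIV (\<lambda>z. side z * \<psi> (tent z))"
  by (rule DERIV_continuous_on[OF has_field_derivative_at_within[OF D]])
 show "AC_on a b (\<lambda>z. side z * \<psi> (tent z)) (\<lambda>z. deriv \<psi> (tent z))"
  by (rule AC_on_piecewise[of "{}", OF _ cont m bd(2) D]) simp
qed

lemma AC_on_reflect:
 assumes AC: "AC_on (y - T) y W W'"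
 shows "AC_on 0 T (\<lambda>s. W (y - s)) (\<lambda>s. - W' (y - s))"
 unfolding AC_on_def
proof (intro conjI ballI)
 have i: "integrable (lb {y - T..y}) W'" and [measurable]: "W \<in> borel_fun"
  using AC_onD[OF AC] by auto
 have [measurable]: "W' \<in> borel_fun" by (rule integrable_lb_measurable[OF i])
 show "(\<lambda>s. W (y - s)) \<in> borel_fun" by measurable
 have e: "(\<lambda>s. indicator {y - t..y} (y + -1 * s) *\<^sub>R W' (y + -1 * s)) = (\<lambda>s. indicator {0..t} s *\<^sub>R W' (y - s))" for t
  by (auto simp: fun_eq_iff split: split_indicator)
 have r: "integrable (lb {0..t}) (\<lambda>s. W' (y - s)) \<longleftrightarrow> integrable (lb {y - t..y}) W'"
  "(LINT s|lb {0..t}. W' (y - s)) = (LINT s|lb {y - t..y}. W' s)" for t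
 proof -
  show "integrable (lb {0..t}) (\<lambda>s. W' (y - s)) \<longleftrightarrow> integrable (lb {y - t..y}) W'"
   using lborel_integrable_real_affine_iff[of "-1" "\<lambda>x. indicator {y - t..y} x *\<^sub>R W' x" y] e[of t]
   by (simp add: integrable_lb_iff set_integrable_def)
  show "(LINT s|lb {0..t}. W' (y - s)) = (LINT s|lb {y - t..y}. W' s)"
   using lborel_integral_real_affine[of "-1" "\<lambda>x. indicator {y - t..y} x *\<^sub>R W' x" y] e[of t]
   by (simp add: integral_lb set_lebesgue_integral_def)
 qed
 show "integrable (lb {0..T}) (\<lambda>s. - W' (y - s))" using r(1) i by simp
 fix t assume t: "t \<in> {0..T}"
 have "W y - W (y - t) = (LINT x|lb {y - t..y}. W' x)"
  by (rule AC_on_diff(1)[OF AC]) (use t in auto)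
 then show "W (y - t) = W (y - 0) + (LINT s|lb {0..t}. - W' (y - s))"
  using r(2)[of t] by simp
qed

section \<open>Regularity and weak form of the evolution\<close>

lemma half_sum_powr_le:
 fixes a b p :: real assumes "1 < p"
 shows "\<bar>(a + b) / 2\<bar> powr p <= \<bar>a\<bar> powr p + \<bar>b\<bar> powr p" "\<bar>(a - b) / 2\<bar> powr p <= \<bar>a\<bar> powr p + \<bar>b\<bar> powr p"
proof -
 have *: "z powr p <= \<bar>a\<bar> powr p + \<bar>b\<bar> powr p" if "0 <= z" "z <= max \<bar>a\<bar> \<bar>b\<bar>" for z
 proof -
  have "z powr p <= (max \<bar>a\<bar> \<bar>b\<bar>) powr p" using that assms by (intro powr_mono2) auto
  also have "... <= \<bar>a\<bar> powr p + \<bar>b\<bar> powr p" by (auto simp: max_def)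
  finally show ?thesis .
 qed
 show "\<bar>(a + b) / 2\<bar> powr p <= \<bar>a\<bar> powr p + \<bar>b\<bar> powr p" "\<bar>(a - b) / 2\<bar> powr p <= \<bar>a\<bar> powr p + \<bar>b\<bar> powr p"
  by (intro *; auto simp: max_def)+
qed

lemma integrable_pair_mult_bounded:
 fixes f h :: "real => real => real"
 assumes f: "integrable (lb A \<Otimes>\<^sub>M lb B) (case_prod f)"
  and h: "case_prod h \<in> joint_borel" and K: "!!s y. \<bar>h s y\<bar> <= K"
 shows "integrable (lb A \<Otimes>\<^sub>M lb B) (case_prod (\<lambda>s y. f s y * h s y))"
proof (rule Bochner_Integration.integrable_bound)
 show "integrable (lb A \<Otimes>\<^sub>M lb B) (\<lambda>z. K * \<bar>case_prod f z\<bar>)" using f by auto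
 have hm: "case_prod h \<in> borel_measurable (lb A \<Otimes>\<^sub>M lb B)"
  using h measurable_cong_sets[OF sets_lb_pair[of A B] refl[of "sets (borel :: real measure)"]] by metis
 have "(\<lambda>z. case_prod f z * case_prod h z) \<in> borel_measurable (lb A \<Otimes>\<^sub>M lb B)"
  by (rule borel_measurable_times[OF borel_measurable_integrable[OF f] hm])
 then show "case_prod (\<lambda>s y. f s y * h s y) \<in> borel_measurable (lb A \<Otimes>\<^sub>M lb B)"
  by (simp add: case_prod_unfold)
 have "\<bar>f s y\<bar> * \<bar>h s y\<bar> <= \<bar>K\<bar> * \<bar>f s y\<bar>" for s y
  using K[of s y] by (subst mult.commute, intro mult_right_mono) auto
 then show "AE z in lb A \<Otimes>\<^sub>M lb B. norm (case_prod (\<lambda>s y. f s y * h s y) z) <= norm (K * \<bar>case_prod f z\<bar>)"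
  by (auto simp: abs_mult)
qed

lemma integrable_lb_of_powr:
 fixes f :: "real => real"
 assumes p: "1 < p" and A: "A \<in> sets borel" "bounded A" and [measurable]: "f \<in> borel_fun"
  and fin: "(NINT x|A. epow p (f x)) < \<infinity>"
 shows "integrable (lb A) (\<lambda>x. \<bar>f x\<bar> powr p)" "integrable (lb A) f"
proof -
 interpret finite_measure "lb A" by (rule finite_measure_lb) fact+
 show i: "integrable (lb A) (\<lambda>x. \<bar>f x\<bar> powr p)"
  using fin by (intro integrableI_nonneg) auto
 show "integrable (lb A) f"
 proof (rule Bochner_Integration.integrable_bound[of _ "\<lambda>x. 1 + \<bar>f x\<bar> powr p"])
  show "AE x in lb A. norm (f x) <= norm (1 + \<bar>f x\<bar> powr p)"
   using abs_le_one_plus_powr[OF p] by (auto intro!: AE_I2)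
 qed (use i in auto)
qed

context circle_damping
begin

definition vel :: "(real => real => real) => real => real => real" where
 "vel g t x = (g t (x + t) + g t (t - x)) / 2"

definition slope :: "(real => real => real) => real => real => real" where
 "slope g t x = (g t (x + t) - g t (t - x)) / 2"

lemma vel_measurable:
 assumes "evolution g" "f \<in> borel_measurable N" "h \<in> borel_measurable N"
 shows "(\<lambda>z. vel g (f z) (h z)) \<in> borel_measurable N" "(\<lambda>z. slope g (f z) (h z)) \<in> borel_measurable N"
proof -
 note [measurable] = evolution_measurable[OF assms(1)] assms(2,3)
 show "(\<lambda>z. vel g (f z) (h z)) \<in> borel_measurable N" "(\<lambda>z. slope g (f z) (h z)) \<in> borel_measurable N"
  unfolding vel_def slope_def by measurable
qed

lemma flux_vel: "flux g s (x + s) = b s x * vel g s x" "flux g s (s - x) = b s x * vel g s x"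
proof -
 show 1: "flux g s (x + s) = b s x * vel g s x" by (simp add: flux_def vel_def algebra_simps)
 have "flux g s (s - x) = flux g s (2 * s - (x + s))" by (simp add: algebra_simps)
 then show "flux g s (s - x) = b s x * vel g s x" unfolding flux_reflect 1 .
qed

lemma energy_split:
 assumes ev: "evolution g"
 shows "(NINT x|I01. epow p (g s (x + s)) + epow p (g s (s - x))) = energy g s"
proof -
 note [measurable] = evolution_measurable[OF ev]
 let ?F = "\<lambda>y. epow p (g s (y + s))"
 have per: "?F (y + 2) = ?F y" for y using evolutionD(2)[OF ev, of s "y + s"] by (simp add: algebra_simps)
 have "(NINT x|I01. ?F x + ?F (- x)) = (NINT y|circ. ?F y)"
  by (rule circle_split[symmetric]) (measurable, rule per)
 also have "... = energy g s"
  unfolding energy_def by (rule circle_shift[of "\<lambda>y. epow p (g s y)"]) (auto simp: evolutionD(2)[OF ev])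
 finally show ?thesis by (simp add: algebra_simps)
qed

lemma vel_slope_energy:
 assumes ev: "evolution g"
 shows "(NINT x|I01. epow p (vel g s x)) <= energy g s"
  and "(NINT x|I01. epow p (slope g s x)) <= energy g s"
 unfolding energy_split[OF ev, of s, symmetric] vel_def slope_def
 by (intro nn_integral_mono, subst ennreal_plus[symmetric], simp, simp, intro ennreal_leI half_sum_powr_le p)+

text \<open>The bound on the flux by the energy, again by Hoelder in time.\<close>

lemma drift_time:
 assumes ev: "evolution g" and rs: "0 <= r" "r <= s"
 shows "(NINT y|circ. epow p (g s y - g r y)) <= ennreal ((s - r) powr p) * (ennreal (M powr p) * (2 * energy g 0))"
proof -
 note [measurable] = evolution_measurable[OF ev] flux_measurable[OF ev]
 have pow_m: "(\<lambda>z::real. epow p z) \<in> borel_fun" by measurable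
 have fl: "(NINT y|circ. epow p (- flux g \<sigma> y)) <= ennreal (M powr p) * (2 * energy g 0)" if "0 <= \<sigma>" for \<sigma>
 proof -
  have "(NINT y|circ. epow p (- flux g \<sigma> y))
   <= (NINT y|circ. ennreal (M powr p) * (epow p (g \<sigma> y) + epow p (g \<sigma> (2 * \<sigma> - y))))"
  proof (rule nn_integral_mono)
   fix y
   let ?h = "(g \<sigma> y + g \<sigma> (2 * \<sigma> - y)) / 2"
   have "\<bar>- flux g \<sigma> y\<bar> <= M * \<bar>?h\<bar>"
    unfolding flux_def abs_minus_cancel abs_mult[of "b \<sigma> (y - \<sigma>)"] using b_nonneg[of \<sigma> "y - \<sigma>"] b_le[of \<sigma> "y - \<sigma>"]
    by (intro mult_right_mono) auto
   then have "\<bar>- flux g \<sigma> y\<bar> powr p <= (M * \<bar>?h\<bar>) powr p" using p by (intro powr_mono2) auto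
   also have "... = M powr p * \<bar>?h\<bar> powr p" using M_nonneg by (simp only: powr_mult abs_ge_zero)
   also have "... <= M powr p * (\<bar>g \<sigma> y\<bar> powr p + \<bar>g \<sigma> (2 * \<sigma> - y)\<bar> powr p)"
    by (intro mult_left_mono half_sum_powr_le p) simp
   finally have "epow p (- flux g \<sigma> y) <= ennreal (M powr p * (\<bar>g \<sigma> y\<bar> powr p + \<bar>g \<sigma> (2 * \<sigma> - y)\<bar> powr p))"
    by (rule ennreal_leI)
   then show "epow p (- flux g \<sigma> y) <= ennreal (M powr p) * (epow p (g \<sigma> y) + epow p (g \<sigma> (2 * \<sigma> - y)))"
    by (simp add: ennreal_mult)
  qed
  also have "... = ennreal (M powr p) * ((NINT y|circ. epow p (g \<sigma> y)) + (NINT y|circ. epow p (g \<sigma> (2 * \<sigma> - y))))"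
   by (rule nn_integral_cmult_add) measurable
  also have "... = ennreal (M powr p) * (2 * energy g \<sigma>)"
   unfolding double_nn_integral_reflect[OF ev pow_m] by (simp only: mult_2[symmetric] energy_def)
  also have "... <= ennreal (M powr p) * (2 * energy g 0)"
   using that by (intro mult_left_mono energy_antimono[OF ev]) auto
  finally show ?thesis .
 qed
 have "(NINT y|circ. epow p (g s y - g r y))
  <= (NINT y|circ. ennreal ((s - r) powr (p - 1)) * (NINT \<sigma>|{r..s}. epow p (- flux g \<sigma> y)))"
 proof (rule nn_integral_mono_AE)
  show "AE y in lb circ. epow p (g s y - g r y)
   <= ennreal ((s - r) powr (p - 1)) * (NINT \<sigma>|{r..s}. epow p (- flux g \<sigma> y))"
   using evolutionD(3)[OF ev]
  proof eventually_elim
   case (elim y)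
   then have AC: "AC_on 0 s (\<lambda>s. g s y) (\<lambda>s. - flux g s y)" using rs by auto
   have d: "g s y - g r y = (LINT x|lb {r..s}. - flux g x y)" and i: "integrable (lb {r..s}) (\<lambda>x. - flux g x y)"
    using AC_on_diff[OF AC, of r s] rs by auto
   show ?case unfolding d by (rule power_integral_le[OF p rs(2) i])
  qed
 qed
 also have "... = ennreal ((s - r) powr (p - 1)) * (NINT y|circ. (NINT \<sigma>|{r..s}. epow p (- flux g \<sigma> y)))"
  by (rule nn_integral_cmult) measurable
 also have "(NINT y|circ. (NINT \<sigma>|{r..s}. epow p (- flux g \<sigma> y)))
   = (NINT \<sigma>|{r..s}. (NINT y|circ. epow p (- flux g \<sigma> y)))"
  by (rule Fubini_lb_nn) auto
 also have "ennreal ((s - r) powr (p - 1)) * ... <= ennreal ((s - r) powr (p - 1)) * (NINT \<sigma>|{r..s}. ennreal (M powr p) * (2 * energy g 0))"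
  using rs by (intro mult_left_mono nn_integral_lb_mono fl) auto
 also have "... = (ennreal ((s - r) powr (p - 1)) * ennreal (s - r)) * (ennreal (M powr p) * (2 * energy g 0))"
  using rs by (simp add: emeasure_lb ac_simps)
 also have "ennreal ((s - r) powr (p - 1)) * ennreal (s - r) = ennreal ((s - r) powr p)"
  using abs_powr_Suc[OF p, of "s - r"] rs by (simp add: ennreal_mult[symmetric])
 finally show ?thesis .
qed

text \<open>Drift in the time variable plus continuity of translations.\<close>

lemma evolution_continuity:
 assumes ev: "evolution g" and fin: "energy g 0 < \<infinity>" and t: "0 <= t" and e: "0 < e"
 shows "\<exists>d>0. \<forall>s\<ge>0. \<bar>s - t\<bar> < d \<longrightarrow>
  (NINT y|circ. epow p (g s (y + s) - g t (y + t))) <= ennreal e"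
proof -
 note [measurable] = evolution_measurable[OF ev] flux_measurable[OF ev]
 note per = evolutionD(2)[OF ev]
 define K where "K = (2::real) powr p"
 have K: "0 < K" by (simp add: K_def)
 define e' where "e' = e / (2 * K)"
 have e': "0 < e'" using e K by (simp add: e'_def)
 have "energy g t <= energy g 0" using t by (intro energy_antimono[OF ev]) auto
 then have "(NINT y|circ. epow p (g t y)) < \<infinity>"
  using fin unfolding energy_def by (rule le_less_trans)
 then have "\<exists>d>0. \<forall>h. \<bar>h\<bar> < d --> (NINT y|circ. epow p (g t (y + h) - g t y)) <= ennreal e'"
  by (intro translation_continuity[OF p _ _ _ e'] per) auto
 then obtain d1 where d1: "0 < d1" "!!h. \<bar>h\<bar> < d1 ==> (NINT y|circ. epow p (g t (y + h) - g t y)) <= ennreal e'"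
  by blast
 define E where "E = enn2real (energy g 0)"
 have E: "energy g 0 = ennreal E" "0 <= E" using fin by (auto simp: E_def)
 define B where "B = M powr p * (2 * E) + 1"
 have B: "0 < B" using E by (simp add: B_def add_nonneg_pos)
 define d2 where "d2 = (e' / B) powr (1 / p)"
 have d2: "0 < d2" using e' B by (simp add: d2_def)
 have drift: "(NINT y|circ. epow p (g s y - g t y)) <= ennreal e'" if s: "0 <= s" "\<bar>s - t\<bar> < d2" for s
 proof -
  have "(NINT y|circ. epow p (g s y - g t y)) <= epow p (s - t) * (ennreal (M powr p) * (2 * energy g 0))"
  proof (cases "t <= s")
   case True then show ?thesis using drift_time[OF ev t True] by simp
  next
   case False
   then show ?thesis using drift_time[OF ev s(1), of t] by (simp add: abs_minus_commute)
  qed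
  also have "ennreal (M powr p) * (2 * energy g 0) = ennreal (M powr p * (2 * E))"
  proof -
   have "ennreal (M powr p * (2 * E)) = ennreal (M powr p) * ennreal (2 * E)" using E by (intro ennreal_mult) auto
   also have "ennreal (2 * E) = ennreal 2 * ennreal E" using E by (intro ennreal_mult) auto
   finally show ?thesis by (simp add: E)
  qed
  also have "epow p (s - t) * ... = ennreal (\<bar>s - t\<bar> powr p * (M powr p * (2 * E)))"
   using E by (intro ennreal_mult[symmetric]) auto
  also have "... <= ennreal e'"
  proof (rule ennreal_leI)
   have "\<bar>s - t\<bar> powr p <= d2 powr p" using s p by (intro powr_mono2) auto
   also have "d2 powr p = e' / B" using e' B p by (simp add: d2_def powr_powr)
   finally have "\<bar>s - t\<bar> powr p * (M powr p * (2 * E)) <= e' / B * B"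
    using E e' B by (intro mult_mono) (auto simp: B_def)
   then show "\<bar>s - t\<bar> powr p * (M powr p * (2 * E)) <= e'" using B by simp
  qed
  finally show ?thesis .
 qed
 show ?thesis
 proof (intro exI[of _ "min d1 d2"] conjI allI impI)
  show "0 < min d1 d2" using d1 d2 by simp
  fix s :: real assume s: "0 <= s" "\<bar>s - t\<bar> < min d1 d2"
  have 1: "(NINT y|circ. epow p (g s (y + s) - g t (y + s))) <= ennreal e'"
  proof -
   have "(NINT y|circ. epow p (g s (y + s) - g t (y + s))) = (NINT y|circ. epow p (g s y - g t y))"
    by (rule circle_shift[of "\<lambda>y. epow p (g s y - g t y)"]) (auto simp: per)
   then show ?thesis using drift[of s] s by simp
  qed
  have 2: "(NINT y|circ. epow p (g t (y + s) - g t (y + t))) <= ennreal e'"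
  proof -
   let ?F = "\<lambda>y. epow p (g t (y + (s - t)) - g t y)"
   have perc: "?F (y + 2) = ?F y" for y using per[of t "y + (s - t)"] per[of t y] by (simp add: algebra_simps)
   have "(NINT y|circ. ?F (y + t)) = (NINT y|circ. ?F y)"
    by (rule circle_shift) (measurable, rule perc)
   also have "... <= ennreal e'" using d1(2)[of "s - t"] s by simp
   finally show ?thesis by (simp add: algebra_simps)
  qed
  have "(NINT y|circ. epow p (g s (y + s) - g t (y + t)))
   = (NINT y|circ. epow p ((g s (y + s) - g t (y + s)) + (g t (y + s) - g t (y + t))))" by simp
  also have "... <= (NINT y|circ. ennreal K * (epow p (g s (y + s) - g t (y + s)) + epow p (g t (y + s) - g t (y + t))))"
   unfolding K_def by (intro nn_integral_mono ennreal_powr_add_le p)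
  also have "... = ennreal K * ((NINT y|circ. epow p (g s (y + s) - g t (y + s))) + (NINT y|circ. epow p (g t (y + s) - g t (y + t))))"
   by (rule nn_integral_cmult_add) measurable
  also have "... <= ennreal K * (ennreal e' + ennreal e')" by (intro mult_left_mono add_mono 1 2) auto
  also have "... = ennreal e"
  proof -
   have "ennreal (e' + e') = ennreal e' + ennreal e'" using e' by (intro ennreal_plus) auto
   moreover have "ennreal (K * (e' + e')) = ennreal K * ennreal (e' + e')" using e' K by (intro ennreal_mult) auto
   moreover have "K * (e' + e') = e" using K by (simp add: e'_def)
   ultimately show ?thesis by simp
  qed
  finally show "(NINT y|circ. epow p (g s (y + s) - g t (y + t))) <= ennreal e" .
 qed
qed

lemma vel_slope_continuity:
 assumes ev: "evolution g" and fin: "energy g 0 < \<infinity>" and t: "0 <= t" and e: "0 < e"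
 shows "\<exists>d>0. \<forall>s\<ge>0. \<bar>s - t\<bar> < d \<longrightarrow>
  (NINT x|I01. epow p (vel g s x - vel g t x)) <= ennreal e \<and>
  (NINT x|I01. epow p (slope g s x - slope g t x)) <= ennreal e"
proof -
 note [measurable] = evolution_measurable[OF ev]
 note per = evolutionD(2)[OF ev]
 obtain d where d: "0 < d" "!!s. 0 <= s ==> \<bar>s - t\<bar> < d ==>
  (NINT y|circ. epow p (g s (y + s) - g t (y + t))) <= ennreal e"
  using evolution_continuity[OF assms] by auto
 show ?thesis
 proof (intro exI[of _ d] conjI allI impI d)
  fix s :: real assume s: "0 <= s" "\<bar>s - t\<bar> < d"
  let ?F = "\<lambda>y. epow p (g s (y + s) - g t (y + t))"
  have perF: "?F (y + 2) = ?F y" for y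
   using per[of s "y + s"] per[of t "y + t"] by (simp add: algebra_simps)
  have split: "(NINT x|I01. ?F x + ?F (- x)) <= ennreal e"
   using d(2)[OF s] by (subst circle_split[symmetric]) (measurable, rule perF, simp)
  show "(NINT x|I01. epow p (vel g s x - vel g t x)) <= ennreal e"
  proof (rule order_trans[OF nn_integral_mono split])
   fix x
   have "vel g s x - vel g t x = ((g s (x + s) - g t (x + t)) + (g s (- x + s) - g t (- x + t))) / 2"
    by (simp add: vel_def field_simps)
   then show "epow p (vel g s x - vel g t x) <= ?F x + ?F (- x)"
    using half_sum_powr_le(1)[OF p] by (simp only: ennreal_plus[symmetric] powr_ge_zero ennreal_leI)
  qed
  show "(NINT x|I01. epow p (slope g s x - slope g t x)) <= ennreal e"
  proof (rule order_trans[OF nn_integral_mono split])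
   fix x
   have "slope g s x - slope g t x = ((g s (x + s) - g t (x + t)) - (g s (- x + s) - g t (- x + t))) / 2"
    by (simp add: slope_def field_simps)
   then show "epow p (slope g s x - slope g t x) <= ?F x + ?F (- x)"
    using half_sum_powr_le(2)[OF p] by (simp only: ennreal_plus[symmetric] powr_ge_zero ennreal_leI)
  qed
 qed
qed

lemma evolution_integrable:
 assumes ev: "evolution g" and fin: "energy g 0 < \<infinity>" and t: "0 <= t"
 shows "integrable (lb circ) (g t)" "integrable (lb circ) (flux g t)"
proof -
 note [measurable] = evolution_measurable[OF ev] flux_measurable[OF ev]
 have "energy g t < \<infinity>" using energy_antimono[OF ev order_refl t] fin by (rule le_less_trans)
 then show i: "integrable (lb circ) (g t)"
  unfolding energy_def by (intro integrable_lb_of_powr(2)[OF p]) auto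
 have i': "integrable (lb circ) (\<lambda>y. g t (2 * t - y))"
  using circle_integral_reflect(2)[of "g t" "2 * t"] evolutionD(2)[OF ev] i by auto
 have "integrable (lb circ) (\<lambda>y. b t (y - t) * ((g t y + g t (2 * t - y)) / 2))"
  using i i' b_nonneg b_le by (intro integrable_lb_mult_bounded[of _ _ _ M]) (auto simp: abs_le_iff)
 then show "integrable (lb circ) (flux g t)" unfolding flux_def [abs_def] .
qed

lemma evolution_pair_integrable:
 assumes ev: "evolution g" and T: "0 <= T"
 shows "integrable (lb {0..T} \<Otimes>\<^sub>M lb circ) (case_prod g)"
  "integrable (lb {0..T} \<Otimes>\<^sub>M lb circ) (case_prod (flux g))"
proof -
 note [measurable] = evolution_measurable[OF ev] flux_measurable[OF ev]
 show i: "integrable (lb {0..T} \<Otimes>\<^sub>M lb circ) (case_prod g)"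
  by (rule integrable_lb_pair) (use evolutionD(1,4)[OF ev] T in auto)
 have "integrable (lb {0..T} \<Otimes>\<^sub>M lb circ) (case_prod (\<lambda>s y. g s (2 * s - y)))"
 proof (rule integrable_lb_pair)
  show "(\<lambda>(s, y). g s (2 * s - y)) \<in> joint_borel" by measurable
  have abs_m: "(\<lambda>z::real. ennreal \<bar>z\<bar>) \<in> borel_fun" by measurable
  show "(NINT s|{0..T}. (NINT y|circ. ennreal \<bar>g s (2 * s - y)\<bar>)) < \<infinity>"
   unfolding double_nn_integral_reflect[OF ev abs_m] by (rule evolutionD(4)[OF ev T])
 qed auto
 from Bochner_Integration.integrable_add[OF i this]
 have "integrable (lb {0..T} \<Otimes>\<^sub>M lb circ) (case_prod (\<lambda>s y. (g s y + g s (2 * s - y)) / 2))"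
  by (simp add: case_prod_unfold)
 from integrable_pair_mult_bounded[OF this, of "\<lambda>s y. b s (y - s)" M]
 have "integrable (lb {0..T} \<Otimes>\<^sub>M lb circ) (case_prod (\<lambda>s y. (g s y + g s (2 * s - y)) / 2 * b s (y - s)))"
  using b_nonneg b_le by (auto simp: abs_le_iff)
 then show "integrable (lb {0..T} \<Otimes>\<^sub>M lb circ) (case_prod (flux g))"
  by (simp add: flux_def [abs_def] mult.commute)
qed

text \<open>The product rule on each characteristic for the moving weight \<open>W(y - s)\<close>, then Fubini.\<close>

lemma evolution_test:
 assumes ev: "evolution g" and fin: "energy g 0 < \<infinity>" and T: "0 <= T"
  and W [measurable]: "W \<in> borel_fun" "W' \<in> borel_fun"
  and K: "!!z. \<bar>W z\<bar> <= K" "!!z. \<bar>W' z\<bar> <= K"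
  and AC: "!!a b. AC_on a b W W'"
  and \<eta> [measurable]: "\<eta>' \<in> borel_fun" and AC\<eta>: "AC_on 0 T \<eta> \<eta>'"
  and L: "!!s. \<bar>\<eta> s\<bar> <= L" "!!s. \<bar>\<eta>' s\<bar> <= L"
 shows "\<eta> T * (LINT y|lb circ. g T y * W (y - T)) - \<eta> 0 * (LINT y|lb circ. g 0 y * W y)
  = (LINT s|lb {0..T}. \<eta>' s * (LINT y|lb circ. g s y * W (y - s))
    - \<eta> s * ((LINT y|lb circ. g s y * W' (y - s)) + (LINT y|lb circ. flux g s y * W (y - s))))"
proof -
 note [measurable] = evolution_measurable[OF ev] flux_measurable[OF ev]
 have [measurable]: "\<eta> \<in> borel_fun" by (rule AC_onD(1)[OF AC\<eta>])
 have K0: "0 <= K" using K(1)[of 0] by linarith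
 have L0: "0 <= L" using L(1)[of 0] by linarith
 have m: "{0..T} \<in> sets borel" "{0..<2::real} \<in> sets borel" by auto
 define H where "H s y = \<eta>' s * W (y - s) - \<eta> s * W' (y - s)" for s y
 define J where "J s y = \<eta> s * W (y - s)" for s y
 define D where "D s y = - flux g s y * J s y + g s y * H s y" for s y
 have LK: "\<bar>x\<bar> * \<bar>z\<bar> <= L * K" if "\<bar>x\<bar> <= L" "\<bar>z\<bar> <= K" for x z
  using that L0 by (intro mult_mono) auto
 have HB: "\<bar>H s y\<bar> <= 2 * (L * K)" for s y
 proof -
  have "\<bar>H s y\<bar> <= \<bar>\<eta>' s * W (y - s)\<bar> + \<bar>\<eta> s * W' (y - s)\<bar>" unfolding H_def by (rule abs_triangle_ineq4)
  also have "... <= L * K + L * K" unfolding abs_mult by (intro add_mono LK L K)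
  also have "L * K + L * K = 2 * (L * K)" by simp
  finally show ?thesis .
 qed
 have JB: "\<bar>J s y\<bar> <= L * K" for s y unfolding J_def abs_mult by (intro LK L K)
 have Hm: "case_prod H \<in> joint_borel" "case_prod J \<in> joint_borel"
  unfolding H_def J_def by measurable
 note pi = evolution_pair_integrable[OF ev T]
 have iD: "integrable (lb {0..T} \<Otimes>\<^sub>M lb circ) (case_prod D)"
  using Bochner_Integration.integrable_add[OF integrable_minus[OF integrable_pair_mult_bounded[OF pi(2) Hm(2) JB]]
    integrable_pair_mult_bounded[OF pi(1) Hm(1) HB]]
  by (simp add: D_def [abs_def] case_prod_unfold)
 have main: "AE y in lb circ. g T y * J T y - g 0 y * J 0 y = (LINT s|lb {0..T}. D s y)"
  using evolutionD(3)[OF ev]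
 proof eventually_elim
  case (elim y)
  then have ACg: "AC_on 0 T (\<lambda>s. g s y) (\<lambda>s. - flux g s y)" using T by auto
  have ACW: "AC_on 0 T (\<lambda>s. W (y - s)) (\<lambda>s. - W' (y - s))" by (rule AC_on_reflect[OF AC])
  have "AC_on 0 T (\<lambda>s. J s y) (\<lambda>s. H s y)"
   unfolding AC_on_def
  proof (intro conjI ballI)
   show "(\<lambda>s. J s y) \<in> borel_fun" unfolding J_def by measurable
   show "integrable (lb {0..T}) (\<lambda>s. H s y)"
    using AC_on_mult(1)[OF AC\<eta> ACW T] by (simp add: H_def)
   fix t assume t: "t \<in> {0..T}"
   show "J t y = J 0 y + (LINT s|lb {0..t}. H s y)"
    using AC_on_mult(2)[OF AC_on_subinterval[OF AC\<eta>, of t] AC_on_subinterval[OF ACW, of t]] t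
    by (simp add: H_def J_def)
  qed
  from AC_on_mult(2)[OF ACg this T] show ?case by (simp add: D_def)
 qed
 have ig: "integrable (lb circ) (\<lambda>y. g t y * J t y)" if "0 <= t" for t
 proof -
  have "integrable (lb circ) (\<lambda>y. J t y * g t y)"
   by (rule integrable_lb_mult_bounded[OF evolution_integrable(1)[OF ev fin that], of _ "L * K"])
    (use JB in \<open>auto simp: J_def\<close>)
  then show ?thesis by (simp add: mult.commute)
 qed
 have pair: "integrable (lb circ) (\<lambda>y. f y * V (y - t))"
  if f: "integrable (lb circ) f" and V: "V \<in> borel_fun" "!!z. \<bar>V z\<bar> <= K" for f V t
 proof -
  have [measurable]: "V \<in> borel_fun" by (rule V)
  have "integrable (lb circ) (\<lambda>y. V (y - t) * f y)"
   by (rule integrable_lb_mult_bounded[OF f, of _ K]) (auto simp: V)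
  then show ?thesis by (simp add: mult.commute)
 qed
 have "\<eta> T * (LINT y|lb circ. g T y * W (y - T)) - \<eta> 0 * (LINT y|lb circ. g 0 y * W y)
   = (LINT y|lb circ. g T y * J T y) - (LINT y|lb circ. g 0 y * J 0 y)"
  by (simp add: J_def mult.left_commute)
 also have "... = (LINT y|lb circ. g T y * J T y - g 0 y * J 0 y)"
  using ig[OF T] ig[of 0] by simp
 also have "... = (LINT y|lb circ. (LINT s|lb {0..T}. D s y))"
 proof (rule integral_cong_AE[OF _ _ main])
  show "(\<lambda>y. g T y * J T y - g 0 y * J 0 y) \<in> borel_measurable (lb circ)" unfolding J_def by measurable
  show "(\<lambda>y. LINT s|lb {0..T}. D s y) \<in> borel_measurable (lb circ)"
   unfolding D_def H_def J_def by measurable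
 qed
 also have "... = (LINT s|lb {0..T}. (LINT y|lb circ. D s y))"
  by (rule Fubini_lb(1)[OF m iD, symmetric])
 also have "... = (LINT s|lb {0..T}. \<eta>' s * (LINT y|lb circ. g s y * W (y - s))
    - \<eta> s * ((LINT y|lb circ. g s y * W' (y - s)) + (LINT y|lb circ. flux g s y * W (y - s))))"
 proof (rule integral_cong_AE)
  show "(\<lambda>s. LINT y|lb circ. D s y) \<in> borel_measurable (lb {0..T})"
   unfolding D_def H_def J_def by measurable
  show "AE s in lb {0..T}. (LINT y|lb circ. D s y) = \<eta>' s * (LINT y|lb circ. g s y * W (y - s))
    - \<eta> s * ((LINT y|lb circ. g s y * W' (y - s)) + (LINT y|lb circ. flux g s y * W (y - s)))"
  proof (rule AE_lbI)
   fix s assume "s \<in> {0..T}"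
   then have s: "0 <= s" by simp
   note i = evolution_integrable[OF ev fin s]
   have "D s y = \<eta>' s * (g s y * W (y - s)) - \<eta> s * (g s y * W' (y - s) + flux g s y * W (y - s))" for y
    by (simp add: D_def H_def J_def algebra_simps)
   then show "(LINT y|lb circ. D s y) = \<eta>' s * (LINT y|lb circ. g s y * W (y - s))
    - \<eta> s * ((LINT y|lb circ. g s y * W' (y - s)) + (LINT y|lb circ. flux g s y * W (y - s)))"
    using pair[OF i(1) W(1) K(1), of s] pair[OF i(1) W(2) K(2), of s] pair[OF i(2) W(1) K(1), of s] by simp
  qed simp
 qed measurable
 finally show ?thesis .
qed

text \<open>Even weights see only the velocity and odd weights only the slope.\<close>

lemma pairing_halves:
 assumes ev: "evolution g" and fin: "energy g 0 < \<infinity>" and s: "0 <= s"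
  and V [measurable]: "V \<in> borel_fun" and K: "!!z. \<bar>V z\<bar> <= K" and per: "!!z. V (z + 2) = V z"
 shows "(!!z. V (- z) = V z) ==> (LINT y|lb circ. g s y * V (y - s)) = 2 * (LINT x|lb I01. vel g s x * V x)"
  and "(!!z. V (- z) = - V z) ==> (LINT y|lb circ. g s y * V (y - s)) = 2 * (LINT x|lb I01. slope g s x * V x)"
  and "(!!z. V (- z) = V z) ==> (LINT y|lb circ. flux g s y * V (y - s)) = 2 * (LINT x|lb I01. b s x * vel g s x * V x)"
  and "(!!z. V (- z) = - V z) ==> (LINT y|lb circ. flux g s y * V (y - s)) = 0"
proof -
 note [measurable] = evolution_measurable[OF ev] flux_measurable[OF ev]
 have gen: "(LINT y|lb circ. f y * V (y - s)) = (LINT x|lb I01. f (x + s) * V x + f (s - x) * V (- x))"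
  if f: "integrable (lb circ) f" and fper: "!!y. f (y + 2) = f y" for f
 proof -
  have [measurable]: "f \<in> borel_fun" by (rule integrable_lb_measurable[OF f])
  have perF: "f (y + 2) * V (y + 2 - s) = f y * V (y - s)" for y
   using per[of "y - s"] fper[of y] by (simp add: algebra_simps)
  have i: "integrable (lb circ) (\<lambda>y. f y * V (y - s))"
   using integrable_lb_mult_bounded[OF f, of "\<lambda>y. V (y - s)" K] K by (simp add: mult.commute)
  have i2: "integrable (lb circ) (\<lambda>x. f (x + s) * V x)"
   using circle_integral_shift(2)[of "\<lambda>y. f y * V (y - s)" s] perF i by simp
  have "(LINT y|lb circ. f y * V (y - s)) = (LINT x|lb circ. f (x + s) * V x)"
   using circle_integral_shift(1)[of "\<lambda>y. f y * V (y - s)" s] perF by simp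
  also have "... = (LINT x|lb I01. f (x + s) * V x + f (- x + s) * V (- x))"
  proof (rule circle_integral_split(2)[OF i2])
   show "f (y + 2 + s) * V (y + 2) = f (y + s) * V y" for y
    using per[of y] fper[of "y + s"] by (simp add: algebra_simps)
  qed
  finally show ?thesis by (simp add: algebra_simps)
 qed
 note i = evolution_integrable[OF ev fin s]
 note g = gen[OF i(1) evolutionD(2)[OF ev]]
 note fl = gen[OF i(2) flux_periodic[OF ev]]
 show "(LINT y|lb circ. g s y * V (y - s)) = 2 * (LINT x|lb I01. vel g s x * V x)" if "!!z. V (- z) = V z"
  unfolding g that integral_mult_right_zero[symmetric] by (intro Bochner_Integration.integral_cong) (simp_all add: vel_def algebra_simps)
 show "(LINT y|lb circ. g s y * V (y - s)) = 2 * (LINT x|lb I01. slope g s x * V x)" if "!!z. V (- z) = - V z"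
  unfolding g that integral_mult_right_zero[symmetric] by (intro Bochner_Integration.integral_cong) (simp_all add: slope_def algebra_simps)
 show "(LINT y|lb circ. flux g s y * V (y - s)) = 2 * (LINT x|lb I01. b s x * vel g s x * V x)" if "!!z. V (- z) = V z"
  unfolding fl that integral_mult_right_zero[symmetric] flux_vel by (intro Bochner_Integration.integral_cong) simp_all
 show "(LINT y|lb circ. flux g s y * V (y - s)) = 0" if "!!z. V (- z) = - V z"
  unfolding fl that flux_vel by simp
qed

end

section \<open>The displacement\<close>

lemma integral_lb_upto_measurable:
 fixes K :: "real => real => real"
 assumes [measurable]: "case_prod K \<in> joint_borel"
 shows "(\<lambda>(t, y). LINT s|lb {0..t::real}. K s y) \<in> borel_measurable (borel \<Otimes>\<^sub>M (borel :: real measure))"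
proof -
 note [measurable (raw)] = measurable_compose2[OF assms]
 have "(LINT s|lb {0..t}. K s y) = (LINT s|lborel. (if 0 <= s \<and> s <= t then K s y else 0))" for t y
 proof -
  have "(\<lambda>s. K s y) \<in> borel_fun" by measurable
  then show ?thesis
   by (subst integral_lb) (auto simp: set_lebesgue_integral_def intro!: Bochner_Integration.integral_cong)
 qed
 then have "(\<lambda>(t, y). LINT s|lb {0..t}. K s y)
   = (\<lambda>z. LINT s|lborel. (if 0 <= s \<and> s <= fst z then K s (snd z) else 0))"
  by (simp add: fun_eq_iff case_prod_unfold)
 also have "... \<in> joint_borel"
  by (rule lborel.borel_measurable_lebesgue_integral) measurable
 finally show ?thesis .
qed

lemma nn_integral_abs_le_one_plus:
 assumes p: "1 < p" and [measurable]: "f \<in> borel_fun"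
 shows "(NINT x|I01. ennreal \<bar>f x\<bar>) <= 1 + (NINT x|I01. epow p (f x))"
proof -
 have "(NINT x|I01. ennreal \<bar>f x\<bar>) <= (NINT x|I01. 1 + epow p (f x))"
 proof (rule nn_integral_mono)
  fix x
  have "ennreal \<bar>f x\<bar> <= ennreal (1 + \<bar>f x\<bar> powr p)" by (rule ennreal_leI[OF abs_le_one_plus_powr[OF p]])
  then show "ennreal \<bar>f x\<bar> <= 1 + epow p (f x)" by (simp add: ennreal_plus)
 qed
 also have "... = 1 + (NINT x|I01. epow p (f x))"
  by (subst nn_integral_add) (auto simp: emeasure_lb)
 finally show ?thesis .
qed

locale damped_evolution = circle_damping +
 fixes g :: "real => real => real" and u0 :: "real => real"
 assumes ev: "evolution g" and fin: "energy g 0 < \<infinity>"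
  and u0_measurable [measurable]: "u0 \<in> borel_fun"
  and u0_fin: "(NINT x|I01. epow p (u0 x)) < \<infinity>"
begin

lemma vel_measurable' [measurable (raw)]:
 assumes "f \<in> borel_measurable N" "h \<in> borel_measurable N"
 shows "(\<lambda>z. vel g (f z) (h z)) \<in> borel_measurable N"
 by (rule vel_measurable(1)[OF ev assms])

lemma slope_measurable' [measurable (raw)]:
 assumes "f \<in> borel_measurable N" "h \<in> borel_measurable N"
 shows "(\<lambda>z. slope g (f z) (h z)) \<in> borel_measurable N"
 by (rule vel_measurable(2)[OF ev assms])

definition displacement :: "real => real => real" where
 "displacement t x = u0 x + (LINT s|lb {0..t}. vel g s x)"

lemma displacement_joint: "case_prod displacement \<in> joint_borel"
proof -
 have "case_prod (vel g) \<in> joint_borel" by measurable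
 note [measurable] = integral_lb_upto_measurable[OF this]
 have "case_prod displacement = (\<lambda>z. u0 (snd z) + (case z of (t, x) => LINT s|lb {0..t}. vel g s x))"
  by (auto simp: displacement_def fun_eq_iff)
 also have "... \<in> joint_borel" by measurable
 finally show ?thesis .
qed

lemma displacement_measurable [measurable (raw)]:
 assumes "f \<in> borel_measurable N" "h \<in> borel_measurable N"
 shows "(\<lambda>z. displacement (f z) (h z)) \<in> borel_measurable N"
 by (rule measurable_compose2[OF displacement_joint assms])

lemma vel_energy: "0 <= s ==> (NINT x|I01. epow p (vel g s x)) <= energy g 0"
 using vel_slope_energy(1)[OF ev, of s] energy_antimono[OF ev, of 0 s] by auto

lemma slope_energy: "0 <= s ==> (NINT x|I01. epow p (slope g s x)) <= energy g 0"
 using vel_slope_energy(2)[OF ev, of s] energy_antimono[OF ev, of 0 s] by auto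

lemma vel_pair_integrable:
 shows "integrable (lb {0..T} \<Otimes>\<^sub>M lb I01) (case_prod (vel g))"
proof (rule integrable_lb_pair)
 show "case_prod (vel g) \<in> joint_borel" by measurable
 have "(NINT s|{0..T}. (NINT x|I01. ennreal \<bar>vel g s x\<bar>)) <= (NINT s|{0..T}. 1 + energy g 0)"
 proof (rule nn_integral_lb_mono)
  fix s assume "s \<in> {0..T}"
  then have "(NINT x|I01. epow p (vel g s x)) <= energy g 0" by (intro vel_energy) auto
  then have le: "1 + (NINT x|I01. epow p (vel g s x)) <= 1 + energy g 0" by (rule add_left_mono)
  have "vel g s \<in> borel_fun" by measurable
  from order_trans[OF nn_integral_abs_le_one_plus[OF p this] le]
  show "(NINT x|I01. ennreal \<bar>vel g s x\<bar>) <= 1 + energy g 0" .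
 qed simp
 also have "... < \<infinity>"
  using fin by (cases "0 <= T") (auto simp: emeasure_lb ennreal_mult_less_top)
 finally show "(NINT s|{0..T}. (NINT x|I01. ennreal \<bar>vel g s x\<bar>)) < \<infinity>" .
qed auto

lemma displacement_AC:
 "AE x in lb I01. \<forall>T. AC_on 0 T (\<lambda>t. displacement t x) (\<lambda>t. vel g t x)"
proof -
 have "AE x in lb I01. \<forall>n::nat. integrable (lb {0..real n}) (\<lambda>s. vel g s x)"
  unfolding AE_all_countable by (intro allI Fubini_lb(5)[OF _ _ vel_pair_integrable]) auto
 then show ?thesis
 proof eventually_elim
  case (elim x)
  have i: "integrable (lb {0..T}) (\<lambda>s. vel g s x)" for T
  proof -
   obtain n :: nat where "T <= real n" using real_arch_simple by blast
   then show ?thesis by (intro integrable_lb_subset[OF elim[rule_format, of n]]) auto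
  qed
  have m: "(\<lambda>t. displacement t x) \<in> borel_fun" by measurable
  have z: "(LINT s|lb {0..0}. vel g s x) = 0" by (rule integral_lb_empty) simp
  show ?case
   unfolding AC_on_def using i m z by (auto simp: displacement_def)
 qed
qed

lemma displacement_fin:
 assumes t: "0 <= t"
 shows "(NINT x|I01. epow p (displacement t x)) < \<infinity>"
proof -
 have "(NINT x|I01. epow p (displacement t x))
   <= (NINT x|I01. ennreal (2 powr p) * (epow p (u0 x) + ennreal ((t - 0) powr (p - 1)) * (NINT s|{0..t}. epow p (vel g s x))))"
 proof (rule nn_integral_mono_AE)
  have "AE x in lb I01. integrable (lb {0..t}) (\<lambda>s. vel g s x)"
   by (rule Fubini_lb(5)[OF _ _ vel_pair_integrable]) auto
  then show "AE x in lb I01. epow p (displacement t x)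
    <= ennreal (2 powr p) * (epow p (u0 x) + ennreal ((t - 0) powr (p - 1)) * (NINT s|{0..t}. epow p (vel g s x)))"
  proof eventually_elim
   case (elim x)
   show ?case unfolding displacement_def
    by (rule order_trans[OF ennreal_powr_add_le[OF p] mult_left_mono[OF add_left_mono[OF power_integral_le[OF p t elim]]]]) simp
  qed
 qed
 also have "... = ennreal (2 powr p) * ((NINT x|I01. epow p (u0 x))
   + (NINT x|I01. ennreal ((t - 0) powr (p - 1)) * (NINT s|{0..t}. epow p (vel g s x))))"
  by (rule nn_integral_cmult_add) measurable
 also have "(NINT x|I01. ennreal ((t - 0) powr (p - 1)) * (NINT s|{0..t}. epow p (vel g s x)))
   = ennreal ((t - 0) powr (p - 1)) * (NINT x|I01. (NINT s|{0..t}. epow p (vel g s x)))"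
  by (rule nn_integral_cmult) measurable
 also have "(NINT x|I01. (NINT s|{0..t}. epow p (vel g s x)))
   = (NINT s|{0..t}. (NINT x|I01. epow p (vel g s x)))"
  by (rule Fubini_lb_nn) auto
 also have "ennreal (2 powr p) * ((NINT x|I01. epow p (u0 x)) + ennreal ((t - 0) powr (p - 1)) * ...) < \<infinity>"
 proof -
  have "(NINT s|{0..t}. (NINT x|I01. epow p (vel g s x))) <= (NINT s|{0..t}. energy g 0)"
   by (intro nn_integral_lb_mono vel_energy) auto
  also have "... < \<infinity>" using fin t by (simp add: emeasure_lb ennreal_mult_less_top)
  finally show ?thesis using u0_fin by (simp add: ennreal_mult_less_top)
 qed
 finally show ?thesis .
qed

text \<open>A difference quotient is a time average of the velocity; Jensen in the form of Hoelder.\<close>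

lemma displacement_quotient:
 assumes st: "0 <= s" "0 <= t" "s \<noteq> t"
  and e: "!!\<sigma>. \<sigma> \<in> {min s t..max s t} ==> (NINT x|I01. epow p (vel g \<sigma> x - vel g t x)) <= ennreal e"
 shows "(NINT x|I01. epow p ((displacement s x - displacement t x) / (s - t) - vel g t x)) <= ennreal e"
proof -
 define r where "r = min s t"
 define q where "q = max s t"
 have rq: "0 <= r" "r < q" using st by (auto simp: r_def q_def)
 have "(NINT x|I01. epow p ((displacement s x - displacement t x) / (s - t) - vel g t x))
  <= (NINT x|I01. ennreal (1 / (q - r)) * (NINT \<sigma>|{r..q}. epow p (vel g \<sigma> x - vel g t x)))"
 proof (rule nn_integral_mono_AE)
  show "AE x in lb I01. epow p ((displacement s x - displacement t x) / (s - t) - vel g t x)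
   <= ennreal (1 / (q - r)) * (NINT \<sigma>|{r..q}. epow p (vel g \<sigma> x - vel g t x))"
   using displacement_AC
  proof eventually_elim
   case (elim x)
   interpret finite_measure "lb {r..q}" by (rule finite_measure_lb) auto
   have d: "displacement q x - displacement r x = (LINT \<sigma>|lb {r..q}. vel g \<sigma> x)"
    and i: "integrable (lb {r..q}) (\<lambda>\<sigma>. vel g \<sigma> x)"
    using AC_on_diff[OF elim[rule_format, of q], of r q] rq by auto
   have i': "integrable (lb {r..q}) (\<lambda>\<sigma>. vel g \<sigma> x - vel g t x)" using i by simp
   let ?I = "LINT \<sigma>|lb {r..q}. vel g \<sigma> x - vel g t x"
   have I: "?I = (displacement q x - displacement r x) - (q - r) * vel g t x"
    using i rq by (simp add: d measure_lb)
   have "(displacement s x - displacement t x) / (s - t) = (displacement q x - displacement r x) / (q - r)"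
   proof (cases "s < t")
    case True
    then have "r = s" "q = t" by (auto simp: r_def q_def)
    then show ?thesis by (metis minus_diff_eq minus_divide_divide)
   next
    case False
    then have "r = t" "q = s" using st by (auto simp: r_def q_def)
    then show ?thesis by simp
   qed
   then have "(displacement s x - displacement t x) / (s - t) - vel g t x = ?I / (q - r)"
    using rq unfolding I by (simp add: field_simps)
   then have "\<bar>(displacement s x - displacement t x) / (s - t) - vel g t x\<bar> powr p = (1 / (q - r)) powr p * \<bar>?I\<bar> powr p"
    using rq by (simp add: abs_divide powr_divide)
   then have "epow p ((displacement s x - displacement t x) / (s - t) - vel g t x)
    = ennreal ((1 / (q - r)) powr p) * epow p (?I)" by (simp add: ennreal_mult)
   also have "... <= ennreal ((1 / (q - r)) powr p) * (ennreal ((q - r) powr (p - 1)) * (NINT \<sigma>|{r..q}. epow p (vel g \<sigma> x - vel g t x)))"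
    using rq by (intro mult_left_mono power_integral_le p i') auto
   also have "... = ennreal ((1 / (q - r)) powr p * (q - r) powr (p - 1)) * (NINT \<sigma>|{r..q}. epow p (vel g \<sigma> x - vel g t x))"
    by (simp add: ennreal_mult mult.assoc)
   also have "(1 / (q - r)) powr p * (q - r) powr (p - 1) = 1 / (q - r)"
    using rq by (simp add: powr_divide powr_diff)
   finally show ?case .
  qed
 qed
 also have "... = ennreal (1 / (q - r)) * (NINT x|I01. (NINT \<sigma>|{r..q}. epow p (vel g \<sigma> x - vel g t x)))"
  by (rule nn_integral_cmult) measurable
 also have "(NINT x|I01. (NINT \<sigma>|{r..q}. epow p (vel g \<sigma> x - vel g t x)))
   = (NINT \<sigma>|{r..q}. (NINT x|I01. epow p (vel g \<sigma> x - vel g t x)))"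
  by (rule Fubini_lb_nn) auto
 also have "ennreal (1 / (q - r)) * ... <= ennreal (1 / (q - r)) * (NINT \<sigma>|{r..q}. ennreal e)"
  unfolding r_def q_def by (intro mult_left_mono nn_integral_lb_mono e) auto
 also have "... = ennreal e"
  using rq by (simp add: emeasure_lb mult.left_commute[of _ "ennreal e"] ennreal_mult[symmetric])
 finally show ?thesis .
qed

text \<open>Testing the evolution against the odd extension of \<open>\<psi>\<close> moves the space derivative of \<open>\<psi>\<close> to a time derivative of the slope pairing, which integrates to the claim.\<close>

lemma displacement_weak_dx:
 assumes t: "0 <= t" and \<psi>: "\<psi> \<in> test_functions I01"
  and init: "(LINT x|lb I01. u0 x * deriv \<psi> x) = - (LINT x|lb I01. slope g 0 x * \<psi> x)"
 shows "(LINT x|lb I01. displacement t x * deriv \<psi> x) = - (LINT x|lb I01. slope g t x * \<psi> x)"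
proof -
 have d\<psi>: "deriv \<psi> \<in> test_functions I01" by (rule test_function_deriv[OF \<psi>]) simp
 note [measurable] = test_function_measurable[OF \<psi>] test_function_measurable[OF d\<psi>]
 let ?W = "\<lambda>z. side z * \<psi> (tent z)" and ?W' = "\<lambda>z. deriv \<psi> (tent z)"
 obtain K where K: "!!z. \<bar>?W z\<bar> <= K" "!!z. \<bar>?W' z\<bar> <= K" using odd_extension(3)[OF \<psi>] by blast
 have Wm: "?W \<in> borel_fun" "?W' \<in> borel_fun" by measurable
 have on: "(LINT x|lb I01. f x * ?W x) = (LINT x|lb I01. f x * \<psi> x)"
  "(LINT x|lb I01. f x * ?W' x) = (LINT x|lb I01. f x * deriv \<psi> x)"
  if [measurable]: "f \<in> borel_fun" for f
  by (rule integral_cong_AE; (measurable; fail)?; (rule AE_lbI; simp add: tent_id side_pos; fail)?)+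
 have "1 * (LINT y|lb circ. g t y * ?W (y - t)) - 1 * (LINT y|lb circ. g 0 y * ?W y)
  = (LINT s|lb {0..t}. 0 * (LINT y|lb circ. g s y * ?W (y - s))
    - 1 * ((LINT y|lb circ. g s y * ?W' (y - s)) + (LINT y|lb circ. flux g s y * ?W (y - s))))"
 proof (rule evolution_test[OF ev fin t Wm K])
  show "AC_on a b ?W ?W'" for a b by (rule odd_extension(4)[OF \<psi>])
  show "AC_on 0 t (\<lambda>_. 1) (\<lambda>_. 0)" by (simp add: AC_on_def)
  show "\<bar>1\<bar> <= (1::real)" "\<bar>0\<bar> <= (1::real)" by auto
 qed simp
 also have "... = (LINT s|lb {0..t}. - (2 * (LINT x|lb I01. vel g s x * deriv \<psi> x)))"
 proof (rule integral_cong_AE)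
  show "AE s in lb {0..t}. 0 * (LINT y|lb circ. g s y * ?W (y - s))
    - 1 * ((LINT y|lb circ. g s y * ?W' (y - s)) + (LINT y|lb circ. flux g s y * ?W (y - s)))
    = - (2 * (LINT x|lb I01. vel g s x * deriv \<psi> x))"
  proof (rule AE_lbI)
   fix s assume "s \<in> {0..t}"
   then have s: "0 <= s" by simp
   have "(LINT y|lb circ. g s y * ?W' (y - s)) = 2 * (LINT x|lb I01. vel g s x * ?W' x)"
    by (rule pairing_halves(1)[OF ev fin s Wm(2) K(2)]) simp_all
   moreover have "(LINT y|lb circ. flux g s y * ?W (y - s)) = 0"
    by (rule pairing_halves(4)[OF ev fin s Wm(1) K(1)]) simp_all
   ultimately show "0 * (LINT y|lb circ. g s y * ?W (y - s))
    - 1 * ((LINT y|lb circ. g s y * ?W' (y - s)) + (LINT y|lb circ. flux g s y * ?W (y - s)))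
    = - (2 * (LINT x|lb I01. vel g s x * deriv \<psi> x))"
    using on(2)[of "vel g s"] by simp
  qed simp
  note [measurable] = evolution_measurable[OF ev] flux_measurable[OF ev]
  show "(\<lambda>s. 0 * (LINT y|lb circ. g s y * ?W (y - s))
    - 1 * ((LINT y|lb circ. g s y * ?W' (y - s)) + (LINT y|lb circ. flux g s y * ?W (y - s)))) \<in> borel_measurable (lb {0..t})"
   by measurable
 qed measurable
 also have "(LINT y|lb circ. g t y * ?W (y - t)) = 2 * (LINT x|lb I01. slope g t x * ?W x)"
  by (rule pairing_halves(2)[OF ev fin t Wm(1) K(1)]) simp_all
 also have "(LINT y|lb circ. g 0 y * ?W y) = 2 * (LINT x|lb I01. slope g 0 x * ?W x)"
  using pairing_halves(2)[OF ev fin order_refl Wm(1) K(1)] by simp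
 finally have main: "(LINT x|lb I01. slope g t x * \<psi> x) - (LINT x|lb I01. slope g 0 x * \<psi> x)
   = - (LINT s|lb {0..t}. (LINT x|lb I01. vel g s x * deriv \<psi> x))"
  using on(1)[of "slope g t"] on(1)[of "slope g 0"] by simp
 obtain B where B: "!!x. \<bar>deriv \<psi> x\<bar> <= B" using test_function_bounded[OF d\<psi>] by blast
 have iv: "integrable (lb {0..t} \<Otimes>\<^sub>M lb I01) (case_prod (\<lambda>s x. vel g s x * deriv \<psi> x))"
  by (rule integrable_pair_mult_bounded[OF vel_pair_integrable, of _ B]) (measurable, rule B)
 have sets: "{0..t} \<in> sets borel" "I01 \<in> sets borel" by auto
 have iu: "integrable (lb I01) (\<lambda>x. u0 x * deriv \<psi> x)"
  using integrable_lb_mult_bounded[OF integrable_lb_of_powr(2)[OF p _ _ u0_measurable u0_fin], of "deriv \<psi>" B] B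
  by (simp add: mult.commute)
 have "(LINT x|lb I01. displacement t x * deriv \<psi> x)
   = (LINT x|lb I01. u0 x * deriv \<psi> x + (LINT s|lb {0..t}. vel g s x * deriv \<psi> x))"
  by (intro Bochner_Integration.integral_cong) (simp_all add: displacement_def distrib_right)
 also have "... = (LINT x|lb I01. u0 x * deriv \<psi> x) + (LINT x|lb I01. (LINT s|lb {0..t}. vel g s x * deriv \<psi> x))"
  by (rule Bochner_Integration.integral_add[OF iu Fubini_lb(3)[OF sets iv]])
 also have "(LINT x|lb I01. (LINT s|lb {0..t}. vel g s x * deriv \<psi> x)) = (LINT s|lb {0..t}. (LINT x|lb I01. vel g s x * deriv \<psi> x))"
  by (rule Fubini_lb(1)[OF sets iv, symmetric])
 finally show ?thesis using main init by linarith
qed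

lemma displacement_pair_integrable:
 assumes T: "0 <= T"
 shows "integrable (lb {0..T} \<Otimes>\<^sub>M lb I01) (case_prod displacement)"
proof (rule integrable_lb_pair)
 show "case_prod displacement \<in> joint_borel" by measurable
 let ?c = "(NINT x|I01. ennreal \<bar>u0 x\<bar>) + (NINT x|I01. (NINT s|{0..T}. ennreal \<bar>vel g s x\<bar>))"
 have "(NINT t|{0..T}. (NINT x|I01. ennreal \<bar>displacement t x\<bar>)) <= (NINT t|{0..T}. ?c)"
 proof (rule nn_integral_lb_mono)
  fix t assume t: "t \<in> {0..T}"
  have "(NINT x|I01. ennreal \<bar>displacement t x\<bar>)
   <= (NINT x|I01. ennreal \<bar>u0 x\<bar> + (NINT s|{0..T}. ennreal \<bar>vel g s x\<bar>))"
  proof (rule nn_integral_mono)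
   fix x
   have "ennreal \<bar>displacement t x\<bar> <= ennreal (\<bar>u0 x\<bar> + \<bar>LINT s|lb {0..t}. vel g s x\<bar>)"
    unfolding displacement_def by (intro ennreal_leI abs_triangle_ineq)
   also have "... = ennreal \<bar>u0 x\<bar> + ennreal \<bar>LINT s|lb {0..t}. vel g s x\<bar>" by (rule ennreal_plus) auto
   also have "ennreal \<bar>LINT s|lb {0..t}. vel g s x\<bar> <= (NINT s|{0..t}. ennreal \<bar>vel g s x\<bar>)"
    using integral_norm_bound_ennreal[of "lb {0..t}" "\<lambda>s. vel g s x"]
    by (cases "integrable (lb {0..t}) (\<lambda>s. vel g s x)") (simp_all add: not_integrable_integral_eq)
   also have "... <= (NINT s|{0..T}. ennreal \<bar>vel g s x\<bar>)"
    using t by (intro nn_integral_lb_mono_set) auto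
   finally show "ennreal \<bar>displacement t x\<bar> <= ennreal \<bar>u0 x\<bar> + (NINT s|{0..T}. ennreal \<bar>vel g s x\<bar>)"
    by (simp add: add_left_mono)
  qed
  also have "... = ?c" by (rule nn_integral_add) measurable
  finally show "(NINT x|I01. ennreal \<bar>displacement t x\<bar>) <= ?c" .
 qed simp
 also have "... = ?c * emeasure (lb {0..T}) UNIV" by simp
 also have "... < \<infinity>"
 proof -
  have "(NINT x|I01. ennreal \<bar>u0 x\<bar>) < \<infinity>"
   using nn_integral_abs_le_one_plus[OF p u0_measurable] u0_fin by (auto intro: le_less_trans)
  moreover have "(NINT x|I01. (NINT s|{0..T}. ennreal \<bar>vel g s x\<bar>)) = (\<integral>\<^sup>+z. ennreal \<bar>case_prod (vel g) z\<bar> \<partial>(lb {0..T} \<Otimes>\<^sub>M lb I01))"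
  proof -
   interpret pair_sigma_finite "lb {0..T}" "lb I01" by (rule pair_sigma_finite_lb) auto
   have "(\<lambda>z. ennreal \<bar>case_prod (vel g) z\<bar>) \<in> borel_measurable (lb {0..T} \<Otimes>\<^sub>M lb I01)"
    using borel_measurable_integrable[OF vel_pair_integrable[of T]] by simp
   from nn_integral_snd[OF this] show ?thesis by simp
  qed
  moreover have "(\<integral>\<^sup>+z. ennreal \<bar>case_prod (vel g) z\<bar> \<partial>(lb {0..T} \<Otimes>\<^sub>M lb I01)) < \<infinity>"
   using vel_pair_integrable[of T] by (simp add: integrable_iff_bounded)
  ultimately show ?thesis using T by (simp add: emeasure_lb ennreal_mult_less_top)
 qed
 finally show "(NINT t|{0..T}. (NINT x|I01. ennreal \<bar>displacement t x\<bar>)) < \<infinity>" .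
qed auto

text \<open>The evolution is tested against the even extension of \<open>v\<close> and against \<open>\<phi>\<close>; a second integration by parts in time replaces the velocity by the displacement.\<close>

lemma displacement_weak_form:
 assumes T: "0 < T"
  and v: "!!x. x \<in> {0..1} ==> (v has_real_derivative v' x) (at x within {0..1})" "continuous_on {0..1} v'"
  and \<phi>: "\<phi> \<in> test_functions {0<..<T}"
 shows "(LINT t|lb {0<..<T}. deriv (deriv \<phi>) t * (LINT x|lb I01. displacement t x * v (tent x)))
  + (LINT t|lb {0<..<T}. \<phi> t * (LINT x|lb I01. slope g t x * (side x * v' (tent x))))
  + (LINT t|lb {0<..<T}. \<phi> t * (LINT x|lb I01. b t x * vel g t x * v (tent x))) = 0"
proof -
 have d\<phi>: "deriv \<phi> \<in> test_functions {0<..<T}" by (rule test_function_deriv[OF \<phi> T])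
 have dd\<phi>: "deriv (deriv \<phi>) \<in> test_functions {0<..<T}" by (rule test_function_deriv[OF d\<phi> T])
 note [measurable] = test_function_measurable[OF \<phi>] test_function_measurable[OF d\<phi>] test_function_measurable[OF dd\<phi>]
 have supp: "\<psi> t = 0" if "\<psi> \<in> test_functions {0<..<T}" "t \<notin> {0<..<T}" for \<psi> t
  using test_function_support[OF that(1) T] that(2)
  by (metis atLeastAtMost_iff greaterThanLessThan_iff le_less_trans less_le_trans)
 have closed: "(LINT t|lb {0<..<T}. \<psi> t * F t) = (LINT t|lb {0..T}. \<psi> t * F t)"
  if \<psi>: "\<psi> \<in> test_functions {0<..<T}" and [measurable]: "F \<in> borel_fun" for \<psi> F
 proof (rule integral_lb_support(1)[symmetric])
  have [measurable]: "\<psi> \<in> borel_fun" by (rule test_function_measurable[OF \<psi>])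
  show "(\<lambda>t. \<psi> t * F t) \<in> borel_fun" by measurable
  show "\<psi> t * F t = 0" if "t \<notin> {0<..<T}" for t using supp[OF \<psi> that] by simp
 qed auto
 let ?W = "\<lambda>z. v (tent z)" and ?W' = "\<lambda>z. side z * v' (tent z)"
 note ext = even_extension[OF v]
 have Wm [measurable]: "?W \<in> borel_fun" "?W' \<in> borel_fun"
  using borel_measurable_continuous_onI[OF ext(1)] ext(2) by auto
 obtain K where K: "!!z. \<bar>?W z\<bar> <= K" "!!z. \<bar>?W' z\<bar> <= K" using ext(3) by blast
 obtain L0 where L0: "!!t. \<bar>\<phi> t\<bar> <= L0" using test_function_bounded[OF \<phi>] by blast
 obtain L1 where L1: "!!t. \<bar>deriv \<phi> t\<bar> <= L1" using test_function_bounded[OF d\<phi>] by blast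
 obtain L2 where L2: "!!t. \<bar>deriv (deriv \<phi>) t\<bar> <= L2" using test_function_bounded[OF dd\<phi>] by blast
 have AC\<phi>: "AC_on 0 T \<psi> (deriv \<psi>)" if "\<psi> \<in> test_functions {0<..<T}" for \<psi>
 proof (rule AC_on_C1)
  have sm: "smooth \<psi>" by (rule test_function_smooth[OF that])
  show "(\<psi> has_real_derivative deriv \<psi> t) (at t within {0..T})" for t
   by (rule has_field_derivative_at_within[OF smooth_DERIV[OF sm]])
  show "continuous_on {0..T} (deriv \<psi>)" by (rule smooth_continuous[OF smooth_deriv[OF sm]])
  show "\<psi> \<in> borel_fun" by (rule test_function_measurable[OF that])
  show "deriv \<psi> \<in> borel_fun" by (rule test_function_measurable[OF test_function_deriv[OF that T]])
 qed
 have ends: "\<phi> T = 0" "\<phi> 0 = 0" "deriv \<phi> T = 0" "deriv \<phi> 0 = 0"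
  using supp[OF \<phi>] supp[OF d\<phi>] by auto
 define P where "P t = (LINT x|lb I01. vel g t x * ?W x)" for t
 define Q where "Q t = (LINT x|lb I01. slope g t x * ?W' x)" for t
 define R where "R t = (LINT x|lb I01. b t x * vel g t x * ?W x)" for t
 define Z where "Z t = (LINT x|lb I01. displacement t x * ?W x)" for t
 have [measurable]: "P \<in> borel_fun" "Q \<in> borel_fun" "R \<in> borel_fun" "Z \<in> borel_fun"
  unfolding P_def Q_def R_def Z_def by measurable
 have T0: "0 <= T" using T by simp
 have bound: "\<bar>LINT x|lb I01. f x\<bar> <= enn2real ((1 + energy g 0)) * C"
  if f: "!!x. \<bar>f x\<bar> <= C * \<bar>h x\<bar>" "0 <= C" "h \<in> borel_fun" "f \<in> borel_fun"
   "(NINT x|I01. epow p (h x)) <= energy g 0" for f h C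
 proof -
  have [measurable]: "h \<in> borel_fun" "f \<in> borel_fun" by (rule f)+
  have hh: "(NINT x|I01. ennreal \<bar>h x\<bar>) <= 1 + energy g 0"
   by (rule order_trans[OF nn_integral_abs_le_one_plus[OF p f(3)] add_left_mono[OF f(5)]])
  have "ennreal \<bar>LINT x|lb I01. f x\<bar> <= (NINT x|I01. ennreal \<bar>f x\<bar>)"
   using integral_norm_bound_ennreal[of "lb I01" f]
   by (cases "integrable (lb I01) f") (simp_all add: not_integrable_integral_eq)
  also have "... <= (NINT x|I01. ennreal C * ennreal \<bar>h x\<bar>)"
   using f(1,2) by (intro nn_integral_mono) (simp add: ennreal_mult[symmetric] ennreal_leI)
  also have "... = ennreal C * (NINT x|I01. ennreal \<bar>h x\<bar>)" by (rule nn_integral_cmult) measurable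
  also have "... <= ennreal C * (1 + energy g 0)" by (rule mult_left_mono[OF hh]) simp
  also have "... = ennreal C * ennreal (enn2real (1 + energy g 0))"
   using fin by simp
  also have "... = ennreal (enn2real (1 + energy g 0) * C)"
   using f(2) by (simp add: ennreal_mult mult.commute)
  finally show ?thesis using f(2) by (subst (asm) ennreal_le_iff) auto
 qed
 have K0: "0 <= K" using K(1)[of 0] by linarith
 have ibd: "integrable (lb {0..T}) (\<lambda>t. \<psi> t * F t)"
  if \<psi>: "\<psi> \<in> borel_fun" "!!t. \<bar>\<psi> t\<bar> <= L" and F: "F \<in> borel_fun" "!!t. 0 <= t ==> \<bar>F t\<bar> <= B" for \<psi> F :: "real => real" and L B
 proof (rule integrable_lb_bounded)
  show "(\<lambda>t. \<psi> t * F t) \<in> borel_fun" using \<psi> F by simp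
  fix t assume "t \<in> {0..T}"
  then show "\<bar>\<psi> t * F t\<bar> <= L * B" unfolding abs_mult using \<psi>(2)[of t] F(2)[of t] by (intro mult_mono) auto
 qed auto
 have PB: "\<bar>P t\<bar> <= enn2real (1 + energy g 0) * K" if "0 <= t" for t
  unfolding P_def
 proof (rule bound[of _ _ "vel g t"])
  show "\<bar>vel g t x * ?W x\<bar> <= K * \<bar>vel g t x\<bar>" for x
   unfolding abs_mult using K(1)[of x] by (subst mult.commute, intro mult_right_mono) auto
 qed (use K0 vel_energy[OF that] in auto)
 have QB: "\<bar>Q t\<bar> <= enn2real (1 + energy g 0) * K" if "0 <= t" for t
  unfolding Q_def
 proof (rule bound[of _ _ "slope g t"])
  show "\<bar>slope g t x * ?W' x\<bar> <= K * \<bar>slope g t x\<bar>" for x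
   unfolding abs_mult[of "slope g t x"] using K(2)[of x] by (subst mult.commute, intro mult_right_mono) auto
 qed (use K0 slope_energy[OF that] in auto)
 have RB: "\<bar>R t\<bar> <= enn2real (1 + energy g 0) * (M * K)" if "0 <= t" for t
  unfolding R_def
 proof (rule bound[of _ _ "vel g t"])
  fix x
  have "\<bar>b t x * vel g t x * ?W x\<bar> = (b t x * \<bar>?W x\<bar>) * \<bar>vel g t x\<bar>"
   using b_nonneg[of t x] by (simp add: abs_mult)
  also have "... <= (M * K) * \<bar>vel g t x\<bar>"
   using b_nonneg[of t x] b_le[of t x] K(1)[of x] M_nonneg by (intro mult_right_mono mult_mono) auto
  finally show "\<bar>b t x * vel g t x * ?W x\<bar> <= (M * K) * \<bar>vel g t x\<bar>" .
 qed (use K0 M_nonneg vel_energy[OF that] in auto)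
 have "\<phi> T * (LINT y|lb circ. g T y * ?W (y - T)) - \<phi> 0 * (LINT y|lb circ. g 0 y * ?W y)
  = (LINT s|lb {0..T}. deriv \<phi> s * (LINT y|lb circ. g s y * ?W (y - s))
    - \<phi> s * ((LINT y|lb circ. g s y * ?W' (y - s)) + (LINT y|lb circ. flux g s y * ?W (y - s))))"
 proof (rule evolution_test[OF ev fin T0 Wm K _ _ AC\<phi>[OF \<phi>]])
  show "AC_on a b ?W ?W'" for a b by (rule ext(4))
  show "\<bar>\<phi> s\<bar> <= max L0 L1" "\<bar>deriv \<phi> s\<bar> <= max L0 L1" for s using L0[of s] L1[of s] by linarith+
 qed simp
 also have "... = (LINT s|lb {0..T}. 2 * (deriv \<phi> s * P s) - 2 * (\<phi> s * Q s + \<phi> s * R s))"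
 proof (rule integral_cong_AE)
  show "AE s in lb {0..T}. deriv \<phi> s * (LINT y|lb circ. g s y * ?W (y - s))
    - \<phi> s * ((LINT y|lb circ. g s y * ?W' (y - s)) + (LINT y|lb circ. flux g s y * ?W (y - s)))
    = 2 * (deriv \<phi> s * P s) - 2 * (\<phi> s * Q s + \<phi> s * R s)"
  proof (rule AE_lbI)
   fix s assume "s \<in> {0..T}"
   then have s: "0 <= s" by simp
   have "(LINT y|lb circ. g s y * ?W (y - s)) = 2 * P s"
    unfolding P_def by (rule pairing_halves(1)[OF ev fin s Wm(1) K(1)]) simp_all
   moreover have "(LINT y|lb circ. g s y * ?W' (y - s)) = 2 * Q s"
    unfolding Q_def by (rule pairing_halves(2)[OF ev fin s Wm(2) K(2)]) simp_all
   moreover have "(LINT y|lb circ. flux g s y * ?W (y - s)) = 2 * R s"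
    unfolding R_def by (rule pairing_halves(3)[OF ev fin s Wm(1) K(1)]) simp_all
   ultimately show "deriv \<phi> s * (LINT y|lb circ. g s y * ?W (y - s))
    - \<phi> s * ((LINT y|lb circ. g s y * ?W' (y - s)) + (LINT y|lb circ. flux g s y * ?W (y - s)))
    = 2 * (deriv \<phi> s * P s) - 2 * (\<phi> s * Q s + \<phi> s * R s)" by (simp add: algebra_simps)
  qed simp
  note [measurable] = evolution_measurable[OF ev] flux_measurable[OF ev]
  show "(\<lambda>s. deriv \<phi> s * (LINT y|lb circ. g s y * ?W (y - s))
    - \<phi> s * ((LINT y|lb circ. g s y * ?W' (y - s)) + (LINT y|lb circ. flux g s y * ?W (y - s)))) \<in> borel_measurable (lb {0..T})"
   by measurable
 qed measurable
 also have "... = 2 * (LINT s|lb {0..T}. deriv \<phi> s * P s) - 2 * ((LINT s|lb {0..T}. \<phi> s * Q s) + (LINT s|lb {0..T}. \<phi> s * R s))"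
  using ibd[OF test_function_measurable[OF d\<phi>] L1 _ PB] ibd[OF test_function_measurable[OF \<phi>] L0 _ QB]
   ibd[OF test_function_measurable[OF \<phi>] L0 _ RB] by simp
 finally have 1: "(LINT s|lb {0..T}. deriv \<phi> s * P s) = (LINT s|lb {0..T}. \<phi> s * Q s) + (LINT s|lb {0..T}. \<phi> s * R s)"
  by (simp add: ends)
 have sets: "{0..T} \<in> sets borel" "I01 \<in> sets borel" by auto
 have i1: "integrable (lb {0..T} \<Otimes>\<^sub>M lb I01) (case_prod (\<lambda>t x. displacement t x * (deriv (deriv \<phi>) t * ?W x)))"
 proof (rule integrable_pair_mult_bounded[OF displacement_pair_integrable[OF T0]])
  show "\<bar>deriv (deriv \<phi>) t * ?W x\<bar> <= L2 * K" for t x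
   unfolding abs_mult using L2[of t] K(1)[of x] by (intro mult_mono) auto
 qed measurable
 have i2: "integrable (lb {0..T} \<Otimes>\<^sub>M lb I01) (case_prod (\<lambda>t x. vel g t x * (deriv \<phi> t * ?W x)))"
 proof (rule integrable_pair_mult_bounded[OF vel_pair_integrable])
  show "\<bar>deriv \<phi> t * ?W x\<bar> <= L1 * K" for t x
   unfolding abs_mult using L1[of t] K(1)[of x] by (intro mult_mono) auto
 qed measurable
 define S where "S t x = displacement t x * (deriv (deriv \<phi>) t * ?W x) + vel g t x * (deriv \<phi> t * ?W x)" for t x
 have iS: "integrable (lb {0..T} \<Otimes>\<^sub>M lb I01) (case_prod S)"
  using Bochner_Integration.integrable_add[OF i1 i2] by (simp add: S_def [abs_def] case_prod_unfold)
 have "AE x in lb I01. (LINT t|lb {0..T}. S t x) = 0"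
  using displacement_AC
 proof eventually_elim
  case (elim x)
  have "deriv \<phi> T * displacement T x - deriv \<phi> 0 * displacement 0 x
    = (LINT s|lb {0..T}. deriv (deriv \<phi>) s * displacement s x + deriv \<phi> s * vel g s x)"
   by (rule AC_on_mult(2)[OF AC\<phi>[OF d\<phi>] elim[rule_format] T0])
  then have "(LINT s|lb {0..T}. (deriv (deriv \<phi>) s * displacement s x + deriv \<phi> s * vel g s x)) * ?W x = 0"
   by (simp add: ends)
  then have "(LINT s|lb {0..T}. (deriv (deriv \<phi>) s * displacement s x + deriv \<phi> s * vel g s x) * ?W x) = 0" by simp
  then show ?case by (simp add: S_def algebra_simps)
 qed
 then have "(LINT x|lb I01. (LINT t|lb {0..T}. S t x)) = 0" by (rule integral_eq_zero_AE)
 then have "(LINT t|lb {0..T}. (LINT x|lb I01. S t x)) = 0" using Fubini_lb(1)[OF sets iS] by simp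
 moreover have "(LINT t|lb {0..T}. (LINT x|lb I01. S t x))
   = (LINT t|lb {0..T}. (LINT x|lb I01. displacement t x * (deriv (deriv \<phi>) t * ?W x)) + (LINT x|lb I01. vel g t x * (deriv \<phi> t * ?W x)))"
 proof (rule integral_cong_AE)
  show "AE t in lb {0..T}. (LINT x|lb I01. S t x)
   = (LINT x|lb I01. displacement t x * (deriv (deriv \<phi>) t * ?W x)) + (LINT x|lb I01. vel g t x * (deriv \<phi> t * ?W x))"
   using Fubini_lb(4)[OF sets i1] Fubini_lb(4)[OF sets i2] by eventually_elim (simp add: S_def)
  show "(\<lambda>t. LINT x|lb I01. S t x) \<in> borel_measurable (lb {0..T})" unfolding S_def by measurable
 qed measurable
 moreover have "... = (LINT t|lb {0..T}. (LINT x|lb I01. displacement t x * (deriv (deriv \<phi>) t * ?W x))) + (LINT t|lb {0..T}. (LINT x|lb I01. vel g t x * (deriv \<phi> t * ?W x)))"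
  by (rule Bochner_Integration.integral_add[OF Fubini_lb(2)[OF sets i1] Fubini_lb(2)[OF sets i2]])
 moreover have "(LINT x|lb I01. displacement t x * (deriv (deriv \<phi>) t * ?W x)) = deriv (deriv \<phi>) t * Z t"
  "(LINT x|lb I01. vel g t x * (deriv \<phi> t * ?W x)) = deriv \<phi> t * P t" for t
  unfolding Z_def P_def integral_mult_right_zero[symmetric]
  by (intro Bochner_Integration.integral_cong; simp add: mult_ac)+
 ultimately have 2: "(LINT t|lb {0..T}. deriv (deriv \<phi>) t * Z t) + (LINT t|lb {0..T}. deriv \<phi> t * P t) = 0" by simp
 show ?thesis
  unfolding Z_def[symmetric] Q_def[symmetric] R_def[symmetric]
  using 1 2 closed[OF dd\<phi>, of Z] closed[OF \<phi>, of Q] closed[OF \<phi>, of R] by simp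
qed

end

section \<open>Uniqueness of weak solutions\<close>

lemma lebesgue_on_AE_measurable:
 fixes f h :: "real => real"
 assumes S [measurable]: "S \<in> sets borel" and h [measurable]: "h \<in> borel_fun"
  and ae: "AE x in lb S. f x = h x"
 shows "f \<in> borel_measurable (lebesgue_on S)"
proof (subst borel_measurable_restrict_space_iff)
 show "S \<inter> space lebesgue \<in> sets lebesgue" by simp
 let ?F = "\<lambda>x. indicator S x *\<^sub>R f x" and ?G = "\<lambda>x. indicator S x *\<^sub>R h x"
 have G: "?G \<in> borel_measurable lebesgue" by (intro measurable_completion) measurable
 have "AE x in lborel. ?F x = ?G x"
  using ae unfolding AE_lb[OF S] by eventually_elim (auto split: split_indicator)
 then have aeFG: "AE x in lebesgue. ?F x = ?G x" by (rule AE_completion)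
 show "?F \<in> borel_measurable lebesgue"
 proof (rule measurableI)
  fix B :: "real set" assume B: "B \<in> sets borel"
  have "?G -` B \<inter> space lebesgue \<in> sets lebesgue" by (rule measurable_sets[OF G B])
  moreover have "AE x in lebesgue. (x \<in> ?G -` B \<inter> space lebesgue) = (x \<in> ?F -` B \<inter> space lebesgue)"
   using aeFG by eventually_elim auto
  ultimately show "?F -` B \<inter> space lebesgue \<in> sets lebesgue"
   by (subst completion.in_sets_AE[of "?G -` B \<inter> space lebesgue"]) auto
 qed simp
qed

lemma lebesgue_on_AE_eq:
 fixes f h :: "real => real"
 assumes "S \<in> sets borel" "h \<in> borel_fun" "AE x in lb S. f x = h x"
 shows "integral\<^sup>L (lebesgue_on S) f = integral\<^sup>L (lb S) h"
 by (rule lebesgue_on_cong_lb(2)[OF lebesgue_on_AE_measurable[OF assms] assms(2,1,3)])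

lemma integral_mult_bound_leb01:
 fixes f c :: "real => real"
 assumes f: "integrable leb01 f" and c: "c \<in> borel_measurable leb01" "AE x in leb01. \<bar>c x\<bar> <= K"
 shows "integrable leb01 (\<lambda>x. f x * c x)" "\<bar>LINT x|leb01. f x * c x\<bar> <= K * (LINT x|leb01. \<bar>f x\<bar>)"
proof -
 have le: "AE x in leb01. \<bar>f x * c x\<bar> <= K * \<bar>f x\<bar>"
  using c(2)
 proof eventually_elim
  case (elim x)
  have "\<bar>c x\<bar> * \<bar>f x\<bar> <= K * \<bar>f x\<bar>" by (rule mult_right_mono[OF elim]) simp
  then show ?case by (simp only: abs_mult mult.commute)
 qed
 show i: "integrable leb01 (\<lambda>x. f x * c x)"
 proof (rule Bochner_Integration.integrable_bound[of _ "\<lambda>x. K * \<bar>f x\<bar>"])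
  show "AE x in leb01. norm (f x * c x) <= norm (K * \<bar>f x\<bar>)" using le by eventually_elim simp
 qed (use f c in auto)
 have "\<bar>LINT x|leb01. f x * c x\<bar> <= (LINT x|leb01. \<bar>f x * c x\<bar>)"
  using integral_norm_bound[of leb01 "\<lambda>x. f x * c x"] by simp
 also have "... <= (LINT x|leb01. K * \<bar>f x\<bar>)"
  using i f by (intro integral_mono_AE le) auto
 finally show "\<bar>LINT x|leb01. f x * c x\<bar> <= K * (LINT x|leb01. \<bar>f x\<bar>)" by simp
qed

lemma has_Lp_dtD:
 assumes "has_Lp_dt p I u t w"
 shows "w \<in> Lp p" "s \<in> I ==> u s \<in> Lp p"
  "((\<lambda>s. Lp_norm p (\<lambda>x. (u s x - u t x) / (s - t) - w x)) \<longlongrightarrow> 0) (at t within I)"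
 using assms by (auto simp: has_Lp_dt_def)

text \<open>Pairing with a bounded function is continuous on \<open>L\<^sup>p\<close>, so it commutes with the time derivative.\<close>

lemma pairing_DERIV:
 assumes p: "1 < p" and w: "has_Lp_dt p I u t w" and t: "t \<in> I"
  and c: "c \<in> borel_measurable leb01" "!!x. \<bar>c x\<bar> <= K"
 shows "((\<lambda>s. LINT x|leb01. u s x * c x) has_real_derivative (LINT x|leb01. w x * c x)) (at t within I)"
 unfolding has_field_derivative_iff
proof (rule LIM_zero_cancel, rule Lim_null_comparison)
 let ?N = "\<lambda>s. Lp_norm p (\<lambda>x. (u s x - u t x) / (s - t) - w x)"
 show "((\<lambda>s. K * ?N s) \<longlongrightarrow> 0) (at t within I)"
  using tendsto_mult[OF tendsto_const has_Lp_dtD(3)[OF w], of K] by simp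
 have K0: "0 <= K" using c(2)[of 0] by linarith
 show "\<forall>\<^sub>F s in at t within I. norm (((LINT x|leb01. u s x * c x) - (LINT x|leb01. u t x * c x)) / (s - t) - (LINT x|leb01. w x * c x)) <= K * ?N s"
 proof (subst eventually_at_filter, rule always_eventually, intro allI impI)
  fix s assume s: "s \<noteq> t" "s \<in> I"
  have us: "u s \<in> Lp p" and ut: "u t \<in> Lp p" and wL: "w \<in> Lp p"
   using has_Lp_dtD(1,2)[OF w] s t by auto
  let ?q = "\<lambda>x. (u s x - u t x) / (s - t) - w x"
  have "(\<lambda>x. inverse (s - t) * (u s x - u t x)) \<in> Lp p" by (intro Lp_cmult Lp_diff(1)[OF p us ut])
  then have "(\<lambda>x. inverse (s - t) * (u s x - u t x) - w x) \<in> Lp p" by (intro Lp_diff(1)[OF p] wL)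
  then have qL: "?q \<in> Lp p" by (simp add: divide_inverse mult.commute)
  have cK: "AE x in leb01. \<bar>c x\<bar> <= K" using c(2) by simp
  note i = integral_mult_bound_leb01(1)[OF Lp_integrable(1)[OF p _] c(1) cK]
  have "((LINT x|leb01. u s x * c x) - (LINT x|leb01. u t x * c x)) / (s - t) - (LINT x|leb01. w x * c x)
   = (LINT x|leb01. (u s x * c x - u t x * c x) / (s - t) - w x * c x)"
   using i[OF us] i[OF ut] i[OF wL] by simp
  also have "... = (LINT x|leb01. ?q x * c x)"
   by (intro Bochner_Integration.integral_cong) (simp_all add: field_simps diff_divide_distrib)
  also have "\<bar>...\<bar> <= K * (LINT x|leb01. \<bar>?q x\<bar>)"
   by (rule integral_mult_bound_leb01(2)[OF Lp_integrable(1)[OF p qL] c(1) cK])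
  also have "... <= K * ?N s" by (intro mult_left_mono K0 Lp_integrable(2)[OF p qL])
  finally show "norm (((LINT x|leb01. u s x * c x) - (LINT x|leb01. u t x * c x)) / (s - t) - (LINT x|leb01. w x * c x)) <= K * ?N s"
   by simp
 qed
qed

lemma pairing_continuous:
 assumes p: "1 < p" and h: "h \<in> C_Lp p I"
  and c: "c \<in> borel_measurable leb01" "!!x. \<bar>c x\<bar> <= K"
 shows "continuous_on I (\<lambda>s. LINT x|leb01. h s x * c x)"
 unfolding continuous_on_def
proof (intro ballI, rule LIM_zero_cancel, rule Lim_null_comparison)
 fix t assume t: "t \<in> I"
 let ?N = "\<lambda>s. Lp_norm p (\<lambda>x. h s x - h t x)"
 have K0: "0 <= K" using c(2)[of 0] by linarith
 show "((\<lambda>s. K * ?N s) \<longlongrightarrow> 0) (at t within I)"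
  using h t tendsto_mult[OF tendsto_const, of ?N 0 "at t within I" K] by (auto simp: C_Lp_def)
 show "\<forall>\<^sub>F s in at t within I. norm ((LINT x|leb01. h s x * c x) - (LINT x|leb01. h t x * c x)) <= K * ?N s"
 proof (subst eventually_at_filter, rule always_eventually, intro allI impI)
  fix s assume s: "s \<noteq> t" "s \<in> I"
  have hs: "h s \<in> Lp p" and ht: "h t \<in> Lp p" using h s t by (auto simp: C_Lp_def)
  have cK: "AE x in leb01. \<bar>c x\<bar> <= K" using c(2) by simp
  note i = integral_mult_bound_leb01(1)[OF Lp_integrable(1)[OF p _] c(1) cK]
  have d: "(\<lambda>x. h s x - h t x) \<in> Lp p" by (rule Lp_diff(1)[OF p hs ht])
  have "(LINT x|leb01. h s x * c x) - (LINT x|leb01. h t x * c x) = (LINT x|leb01. (h s x - h t x) * c x)"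
   using i[OF hs] i[OF ht] by (simp add: left_diff_distrib)
  also have "\<bar>...\<bar> <= K * (LINT x|leb01. \<bar>h s x - h t x\<bar>)"
   by (rule integral_mult_bound_leb01(2)[OF Lp_integrable(1)[OF p d] c(1) cK])
  also have "... <= K * ?N s" by (intro mult_left_mono K0 Lp_integrable(2)[OF p d])
  finally show "norm ((LINT x|leb01. h s x * c x) - (LINT x|leb01. h t x * c x)) <= K * ?N s" by simp
 qed
qed

lemma L1_norm_continuous:
 assumes p: "1 < p" and h: "h \<in> C_Lp p I"
 shows "continuous_on I (\<lambda>s. LINT x|leb01. \<bar>h s x\<bar>)"
 unfolding continuous_on_def
proof (intro ballI, rule LIM_zero_cancel, rule Lim_null_comparison)
 fix t assume t: "t \<in> I"
 let ?N = "\<lambda>s. Lp_norm p (\<lambda>x. h s x - h t x)"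
 show "(?N \<longlongrightarrow> 0) (at t within I)" using h t by (auto simp: C_Lp_def)
 show "\<forall>\<^sub>F s in at t within I. norm ((LINT x|leb01. \<bar>h s x\<bar>) - (LINT x|leb01. \<bar>h t x\<bar>)) <= ?N s"
 proof (subst eventually_at_filter, rule always_eventually, intro allI impI)
  fix s assume s: "s \<noteq> t" "s \<in> I"
  have hs: "h s \<in> Lp p" and ht: "h t \<in> Lp p" using h s t by (auto simp: C_Lp_def)
  have d: "(\<lambda>x. h s x - h t x) \<in> Lp p" by (rule Lp_diff(1)[OF p hs ht])
  note i = Lp_integrable(1)[OF p hs] Lp_integrable(1)[OF p ht]
  have "(LINT x|leb01. \<bar>h s x\<bar>) - (LINT x|leb01. \<bar>h t x\<bar>) = (LINT x|leb01. \<bar>h s x\<bar> - \<bar>h t x\<bar>)"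
   using i by simp
  also have "\<bar>...\<bar> <= (LINT x|leb01. \<bar>\<bar>h s x\<bar> - \<bar>h t x\<bar>\<bar>)"
   using integral_norm_bound[of leb01 "\<lambda>x. \<bar>h s x\<bar> - \<bar>h t x\<bar>"] by simp
  also have "... <= (LINT x|leb01. \<bar>h s x - h t x\<bar>)"
   using i by (intro integral_mono) (auto simp: abs_triangle_ineq3)
  also have "... <= ?N s" by (rule Lp_integrable(2)[OF p d])
  finally show "norm ((LINT x|leb01. \<bar>h s x\<bar>) - (LINT x|leb01. \<bar>h t x\<bar>)) <= ?N s" by simp
 qed
qed

definition clamp_time :: "real => real => real" where
 "clamp_time T t = max 0 (min T t)"

lemma clamp_time: "0 <= T ==> clamp_time T t \<in> {0..T}" "t \<in> {0..T} ==> clamp_time T t = t"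
 by (auto simp: clamp_time_def)

lemma clamped_continuous:
 assumes "continuous_on {0..T} f" "0 <= T"
 shows "continuous_on UNIV (\<lambda>t. f (clamp_time T t))"
proof (rule continuous_on_compose2[OF assms(1)])
 show "continuous_on UNIV (clamp_time T)" unfolding clamp_time_def by (intro continuous_intros)
qed (use clamp_time(1)[OF assms(2)] in auto)

text \<open>No joint measurability of \<open>h\<close> is known. It is approximated by functions that are piecewise constant in time, for which the pairing is a countable case distinction between measurable functions.\<close>

lemma damping_pairing_measurable:
 fixes a' :: "real => real => real"
 assumes p: "1 < p" and T: "0 < T" and h: "h \<in> C_Lp p {0..T}"
  and a': "case_prod a' \<in> joint_borel" "!!t x. \<bar>a' t x\<bar> <= M"
  and c: "c \<in> borel_fun" "!!x. \<bar>c x\<bar> <= K"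
 shows "\<exists>Q. Q \<in> borel_fun \<and> (\<exists>B. \<forall>t. \<bar>Q t\<bar> <= B) \<and>
  (\<forall>t\<in>{0<..<T}. Q t = (LINT x|leb01. h t x * (a' t x * c x)))"
proof -
 note a'm [measurable (raw)] = measurable_compose2[OF a'(1)]
 note [measurable] = c(1)
 have K0: "0 <= K" using c(2)[of 0] by linarith
 have M0: "0 <= M" using a'(2)[of 0 0] by linarith
 have hL: "h t \<in> Lp p" if "t \<in> {0..T}" for t using h that by (auto simp: C_Lp_def)
 have "\<exists>k. k \<in> borel_fun \<and> (AE x in lb I01. h t x = k x)" if "t \<in> {0..T}" for t
  using borel_representative[OF LpD(1)[OF hL[OF that]]] by auto
 then obtain hb where hb: "!!t. t \<in> {0..T} ==> hb t \<in> borel_fun"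
  "!!t. t \<in> {0..T} ==> AE x in lb I01. h t x = hb t x" by metis
 have T0: "0 <= T" using T by simp
 (* the grid of mesh 1 / (k + 1), confined to the time interval *)
 define node where "node k j = clamp_time T (real_of_int j / real (Suc k))" for k :: nat and j :: int
 have node: "node k j \<in> {0..T}" for k j unfolding node_def by (rule clamp_time(1)[OF T0])
 have nodem [measurable]: "hb (node k j) \<in> borel_fun" for k j by (rule hb(1)[OF node])
 define P where "P s t = (LINT x|leb01. h s x * (a' t x * c x))" for s t
 have acm: "(\<lambda>x. a' t x * c x) \<in> borel_measurable leb01" for t by (rule borel_imp_lebesgue_on) measurable
 have acK: "\<bar>a' t x * c x\<bar> <= M * K" for t x
  unfolding abs_mult using a'(2)[of t x] c(2)[of x] M0 by (intro mult_mono) auto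
 then have acAE: "AE x in leb01. \<bar>a' t x * c x\<bar> <= M * K" for t by simp
 have Pb: "P (node k j) t = (LINT x|lb I01. hb (node k j) x * (a' t x * c x))" for k j t
  unfolding P_def
 proof (rule lebesgue_on_AE_eq)
  show "AE x in lb I01. h (node k j) x * (a' t x * c x) = hb (node k j) x * (a' t x * c x)"
   using hb(2)[OF node, of k j] by eventually_elim simp
 qed measurable
 define Qk where "Qk k t = (if t \<in> {0<..<T} then P (node k \<lfloor>real (Suc k) * t\<rfloor>) t else 0)" for k t
 have Qkm: "Qk k \<in> borel_fun" for k
 proof -
  have "(\<lambda>t. LINT x|lb I01. hb (node k j) x * (a' t x * c x)) \<in> borel_fun" for j
   by measurable
  then have "(\<lambda>t. P (node k \<lfloor>real (Suc k) * t\<rfloor>) t) \<in> borel_fun"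
   unfolding Pb by (rule measurable_compose_countable) measurable
  then show ?thesis unfolding Qk_def by measurable
 qed
 define Q where "Q t = (if t \<in> {0<..<T} then P t t else 0)" for t
 have lim: "(\<lambda>k. Qk k t) \<longlonglongrightarrow> Q t" for t
 proof (cases "t \<in> {0<..<T}")
  case True
  then have t: "t \<in> {0..T}" by auto
  define s where "s k = node k \<lfloor>real (Suc k) * t\<rfloor>" for k
  have s: "s k \<in> {0..T}" for k unfolding s_def by (rule node)
  have close: "\<bar>s k - t\<bar> <= 1 / real (Suc k)" for k
  proof -
   let ?r = "real_of_int \<lfloor>real (Suc k) * t\<rfloor> / real (Suc k)"
   have "real (Suc k) * t - 1 <= real_of_int \<lfloor>real (Suc k) * t\<rfloor>" "real_of_int \<lfloor>real (Suc k) * t\<rfloor> <= real (Suc k) * t"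
    by linarith+
   then have "(real (Suc k) * t - 1) / real (Suc k) <= ?r" "?r <= (real (Suc k) * t) / real (Suc k)"
    by (intro divide_right_mono; simp)+
   then have "t - 1 / real (Suc k) <= ?r" "?r <= t" by (simp_all add: diff_divide_distrib del: of_nat_Suc)
   moreover have "0 <= 1 / real (Suc k)" by simp
   ultimately show ?thesis
    using t unfolding s_def node_def clamp_time_def by (auto simp: max_def min_def)
  qed
  have st: "s \<longlonglongrightarrow> t"
  proof (rule LIM_zero_cancel, rule Lim_null_comparison)
   show "\<forall>\<^sub>F k in sequentially. norm (s k - t) <= 1 / real (Suc k)" using close by simp
   show "(\<lambda>k. 1 / real (Suc k)) \<longlonglongrightarrow> 0" by real_asymp
  qed
  have N: "((\<lambda>r. Lp_norm p (\<lambda>x. h r x - h t x)) \<longlongrightarrow> 0) (at t within {0..T})"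
   using h t by (auto simp: C_Lp_def)
  have zero: "Lp_norm p (\<lambda>x. h t x - h t x) = 0" using p by (simp add: Lp_norm_def)
  have "continuous (at t within {0..T}) (\<lambda>r. Lp_norm p (\<lambda>x. h r x - h t x))"
   using N zero by (simp add: continuous_within)
  then have N0: "(\<lambda>k. Lp_norm p (\<lambda>x. h (s k) x - h t x)) \<longlonglongrightarrow> 0"
   using st s zero by (auto simp: continuous_within_sequentially o_def)
  have "(\<lambda>k. P (s k) t) \<longlonglongrightarrow> P t t"
  proof (rule LIM_zero_cancel, rule Lim_null_comparison)
   show "(\<lambda>k. M * K * Lp_norm p (\<lambda>x. h (s k) x - h t x)) \<longlonglongrightarrow> 0"
    using tendsto_mult[OF tendsto_const N0, of "M * K"] by simp
   show "\<forall>\<^sub>F k in sequentially. norm (P (s k) t - P t t) <= M * K * Lp_norm p (\<lambda>x. h (s k) x - h t x)"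
   proof (rule always_eventually, rule allI)
    fix k
    note hs = hL[OF s[of k]] and ht = hL[OF t]
    have d: "(\<lambda>x. h (s k) x - h t x) \<in> Lp p" by (rule Lp_diff(1)[OF p hs ht])
    have "P (s k) t - P t t = (LINT x|leb01. (h (s k) x - h t x) * (a' t x * c x))"
     unfolding P_def
     using integral_mult_bound_leb01(1)[OF Lp_integrable(1)[OF p hs] acm acAE, of t]
      integral_mult_bound_leb01(1)[OF Lp_integrable(1)[OF p ht] acm acAE, of t]
     by (simp add: left_diff_distrib)
    also have "\<bar>...\<bar> <= M * K * (LINT x|leb01. \<bar>h (s k) x - h t x\<bar>)"
     by (rule integral_mult_bound_leb01(2)[OF Lp_integrable(1)[OF p d] acm acAE])
    also have "... <= M * K * Lp_norm p (\<lambda>x. h (s k) x - h t x)"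
     using M0 K0 by (intro mult_left_mono Lp_integrable(2)[OF p d]) auto
    finally show "norm (P (s k) t - P t t) <= M * K * Lp_norm p (\<lambda>x. h (s k) x - h t x)" by simp
   qed
  qed
  then show ?thesis using True by (simp add: Qk_def Q_def s_def)
 next
  case False
  then have "(\<lambda>k. Qk k t) = (\<lambda>k. Q t)" unfolding Qk_def Q_def by (simp only: if_False)
  then show ?thesis by simp
 qed
 have Qm: "Q \<in> borel_fun"
  by (rule borel_measurable_LIMSEQ_real[OF lim Qkm])
 have "compact ((\<lambda>s. LINT x|leb01. \<bar>h s x\<bar>) ` {0..T})"
  by (intro compact_continuous_image L1_norm_continuous[OF p h]) simp
 then have "bounded ((\<lambda>s. LINT x|leb01. \<bar>h s x\<bar>) ` {0..T})" by (rule compact_imp_bounded)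
 then obtain B where B: "\<forall>s\<in>{0..T}. \<bar>LINT x|leb01. \<bar>h s x\<bar>\<bar> <= B" unfolding bounded_iff by auto
 have "\<bar>Q t\<bar> <= M * K * B" for t
 proof (cases "t \<in> {0<..<T}")
  case True
  then have t: "t \<in> {0..T}" by auto
  have "\<bar>Q t\<bar> <= M * K * (LINT x|leb01. \<bar>h t x\<bar>)"
   using True integral_mult_bound_leb01(2)[OF Lp_integrable(1)[OF p hL[OF t]] acm acAE] by (simp add: Q_def P_def)
  also have "... <= M * K * B" using B t M0 K0 by (intro mult_left_mono) auto
  finally show ?thesis .
 next
  case False
  have "\<bar>LINT x|leb01. \<bar>h 0 x\<bar>\<bar> <= B" using B T0 by simp
  then have "0 <= B" by (rule order_trans[OF abs_ge_zero])
  then show ?thesis using False M0 K0 by (auto simp: Q_def)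
 qed
 then have "\<exists>B. \<forall>t. \<bar>Q t\<bar> <= B" by blast
 moreover have "\<forall>t\<in>{0<..<T}. Q t = (LINT x|leb01. h t x * (a' t x * c x))" by (auto simp: Q_def P_def)
 ultimately show ?thesis using Qm by blast
qed

lemma clamp_continuous_measurable:
 fixes f :: "real => real"
 assumes "continuous_on {0..T} f" "0 <= T"
 shows "(\<lambda>t. f (clamp_time T t)) \<in> borel_fun"
 by (intro borel_measurable_continuous_onI clamped_continuous assms)

lemma AC_on_clamped:
 assumes D: "!!t. t \<in> {0..T} ==> (m has_real_derivative m1 t) (at t within {0..T})"
  and m1: "continuous_on {0..T} m1" and T: "0 <= T"
 shows "AC_on 0 T (\<lambda>t. m (clamp_time T t)) (\<lambda>t. m1 (clamp_time T t))"
proof (rule AC_on_C1)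
 have m: "continuous_on {0..T} m" by (rule DERIV_continuous_on[OF D])
 fix t assume t: "t \<in> {0..T}"
 have "((\<lambda>t. m (clamp_time T t)) has_real_derivative m1 t) (at t within {0..T})"
  by (rule has_field_derivative_transform_within[OF D[OF t], of 1]) (use t clamp_time(2) in auto)
 then show "((\<lambda>t. m (clamp_time T t)) has_real_derivative m1 (clamp_time T t)) (at t within {0..T})"
  using t by (simp add: clamp_time(2))
next
 have m: "continuous_on {0..T} m" by (rule DERIV_continuous_on[OF D])
 show "(\<lambda>t. m (clamp_time T t)) \<in> borel_fun" "(\<lambda>t. m1 (clamp_time T t)) \<in> borel_fun"
  by (intro clamp_continuous_measurable m m1 T)+
 show "continuous_on {0..T} (\<lambda>t. m1 (clamp_time T t))"
  by (rule continuous_on_subset[OF clamped_continuous[OF m1 T]]) simp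
qed

lemma AC_on_test_function:
 assumes "\<phi> \<in> test_functions U"
 shows "AC_on 0 T \<phi> (deriv \<phi>)"
proof (rule AC_on_C1)
 note s = test_function_smooth[OF assms]
 show "(\<phi> has_real_derivative deriv \<phi> t) (at t within {0..T})" for t
  by (rule has_field_derivative_at_within[OF smooth_DERIV[OF s]])
 show "continuous_on {0..T} (deriv \<phi>)"
  by (rule continuous_on_subset[of UNIV, OF smooth_continuous[OF smooth_deriv[OF s]]]) simp
 show "\<phi> \<in> borel_fun" "deriv \<phi> \<in> borel_fun"
  by (intro borel_measurable_continuous_onI smooth_continuous smooth_deriv s)+
qed

lemma indefinite_integral_AC:
 assumes R: "integrable (lb {0..T}) R" and T: "0 <= T"
 defines "F \<equiv> \<lambda>t. LINT s|lb {0..clamp_time T t}. R s"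
 shows "continuous_on UNIV F" "F 0 = 0" "AC_on 0 T F R"
proof -
 have R': "integrable (lb {0..t}) R" if "t \<in> {0..T}" for t
  by (rule integrable_lb_subset[OF R]) (use that in auto)
 have "continuous_on {0..T} (\<lambda>t. LINT s|lb {0..t}. R s)"
  by (rule continuous_on_eq[OF indefinite_integral_continuous_1[OF integral_lb_HK(1)[OF R]]])
   (simp add: integral_lb_HK(2)[OF R'])
 then show c: "continuous_on UNIV F" unfolding F_def by (rule clamped_continuous[OF _ T])
 have "clamp_time T 0 = 0" using T by (simp add: clamp_time_def)
 then show F0: "F 0 = 0" unfolding F_def by (simp only:) (rule integral_lb_empty, simp)
 show "AC_on 0 T F R"
  unfolding AC_on_def
 proof (intro conjI ballI R borel_measurable_continuous_onI[OF c])
  show "F t = F 0 + (LINT s|lb {0..t}. R s)" if "t \<in> {0..T}" for t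
   using F0 that by (simp add: F_def clamp_time(2))
 qed
qed

lemma integrable_lb_continuous:
 fixes f :: "real => real"
 assumes "continuous_on UNIV f"
 shows "integrable (lb {0<..<T}) f"
proof -
 have "compact (f ` {0..T})" by (intro compact_continuous_image continuous_on_subset[OF assms]) auto
 then have "bounded (f ` {0..T})" by (rule compact_imp_bounded)
 then obtain K where "\<forall>s\<in>{0..T}. \<bar>f s\<bar> <= K" unfolding bounded_iff by auto
 then show ?thesis
  by (intro integrable_lb_bounded[of _ _ K] borel_measurable_continuous_onI assms) auto
qed

lemma integrable_test_function_mult:
 assumes \<phi>: "\<phi> \<in> test_functions {0<..<T}" and f: "integrable (lb {0<..<T}) f"
 shows "integrable (lb {0<..<T}) (\<lambda>t. \<phi> t * f t)"
proof -
 obtain K where "!!x. \<bar>\<phi> x\<bar> <= K" using test_function_bounded[OF \<phi>] by blast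
 then show ?thesis by (intro integrable_lb_mult_bounded[OF f] test_function_measurable[OF \<phi>]) auto
qed

lemma AC_on_integrate_test:
 assumes \<phi>: "\<phi> \<in> test_functions {0<..<T}" and T: "0 < T" and F: "AC_on 0 T F k" "continuous_on UNIV F"
 shows "(LINT t|lb {0<..<T}. deriv \<phi> t * F t) = - (LINT t|lb {0<..<T}. \<phi> t * k t)"
proof -
 have k: "integrable (lb {0<..<T}) k" using AC_onD(2)[OF F(1)] by (simp add: lb_Icc)
 obtain c d where "0 < c" "d < T" "!!x. x \<notin> {c..d} ==> \<phi> x = 0"
  using test_function_support[OF \<phi> T] by metis
 then have "\<phi> 0 = 0" "\<phi> T = 0" by auto
 moreover have "\<phi> T * F T - \<phi> 0 * F 0 = (LINT t|lb {0<..<T}. deriv \<phi> t * F t + \<phi> t * k t)"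
  using AC_on_mult(2)[OF AC_on_test_function[OF \<phi>] F(1)] T by (simp add: lb_Icc)
 ultimately show ?thesis
  using integrable_test_function_mult[OF test_function_deriv[OF \<phi> T] integrable_lb_continuous[OF F(2)]]
   integrable_test_function_mult[OF \<phi> k] by simp
qed

text \<open>The primitive of \<open>R\<close> plus the first derivative of \<open>m\<close> has vanishing weak derivative, hence is constant.\<close>

lemma weak_second_derivative:
 assumes D: "!!t. t \<in> {0..T} ==> (m has_real_derivative m1 t) (at t within {0..T})"
  and m1: "continuous_on {0..T} m1" and T: "0 < T"
  and R: "R \<in> borel_fun" "!!t. \<bar>R t\<bar> <= B"
  and weak: "!!\<phi>. \<phi> \<in> test_functions {0<..<T} ==>
   (LINT t|lb {0<..<T}. deriv (deriv \<phi>) t * m (clamp_time T t)) + (LINT t|lb {0<..<T}. \<phi> t * R t) = 0"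
 shows "AC_on 0 T (\<lambda>t. m1 (clamp_time T t)) (\<lambda>s. - R s)"
proof -
 have T0: "0 <= T" using T by simp
 define mb m1b where "mb t = m (clamp_time T t)" and "m1b t = m1 (clamp_time T t)" for t
 have ACm: "AC_on 0 T mb m1b" unfolding mb_def [abs_def] m1b_def [abs_def] by (rule AC_on_clamped[OF D m1 T0])
 have mc: "continuous_on UNIV mb" "continuous_on UNIV m1b"
  unfolding mb_def [abs_def] m1b_def [abs_def]
  using clamped_continuous[OF DERIV_continuous_on[OF D] T0] clamped_continuous[OF m1 T0] by auto
 have Ri: "integrable (lb {0..T}) R" by (rule integrable_lb_bounded[of _ _ B]) (use R in auto)
 define RI where "RI t = (LINT s|lb {0..clamp_time T t}. R s)" for t
 note RI = indefinite_integral_AC[OF Ri T0, folded RI_def [abs_def]]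
 define c where "c t = m1b t + RI t" for t
 have cc: "continuous_on UNIV c" unfolding c_def by (intro continuous_intros mc RI)
 have "\<exists>k. AE t in lb {0<..<T}. c t = k"
 proof (rule weak_derivative_zero_imp_constant[OF T integrable_lb_continuous[OF cc]])
  fix \<phi> assume \<phi>: "\<phi> \<in> test_functions {0<..<T}"
  note \<phi>' = test_function_deriv[OF \<phi> T]
  note i = integrable_test_function_mult[OF \<phi>' integrable_lb_continuous]
  have "(LINT t|lb {0<..<T}. deriv \<phi> t * c t) = (LINT t|lb {0<..<T}. deriv \<phi> t * m1b t) + (LINT t|lb {0<..<T}. deriv \<phi> t * RI t)"
   using i[OF mc(2)] i[OF RI(1)] by (simp add: c_def distrib_left)
  then show "(LINT t|lb {0<..<T}. deriv \<phi> t * c t) = 0"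
   using AC_on_integrate_test[OF \<phi>' T ACm mc(1)] AC_on_integrate_test[OF \<phi> T RI(3,1)] weak[OF \<phi>]
   by (simp add: mb_def)
 qed
 then obtain k where "AE t in lb {0<..<T}. c t = k" by blast
 then have k: "AE t in lb {0..T}. c t - k = 0" unfolding lb_Icc by simp
 have ckc: "continuous_on UNIV (\<lambda>t. c t - k)" by (intro continuous_intros cc)
 note ck = AE_zero_continuous[OF continuous_on_subset[OF ckc subset_UNIV] borel_measurable_continuous_onI[OF ckc] T k]
 show ?thesis
  unfolding AC_on_def m1b_def [symmetric]
 proof (intro conjI ballI)
  show "m1b \<in> borel_fun" by (rule borel_measurable_continuous_onI[OF mc(2)])
  show "integrable (lb {0..T}) (\<lambda>s. - R s)" using Ri by simp
  fix t assume t: "t \<in> {0..T}"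
  have "c t = c 0" using ck[OF t] ck[of 0] T by simp
  then show "m1b t = m1b 0 + (LINT s|lb {0..t}. - R s)"
   using RI(2) t by (simp add: c_def RI_def clamp_time(2))
 qed
qed

text \<open>The sine has no compact support but vanishes at both end points. Up to a constant \<open>f\<close> is a primitive of \<open>g\<close>, and constants are orthogonal to \<open>cos (k x)\<close>.\<close>

lemma weak_dx_sine:
 assumes p: "1 < p" and f: "f \<in> Lp p" and g: "g \<in> Lp p" and w: "has_weak_dx f g" and sin1: "sin k = 0"
 shows "(LINT x|leb01. g x * sin (k * x)) = - k * (LINT x|leb01. f x * cos (k * x))"
proof -
 have rep: "\<exists>hb. hb \<in> borel_fun \<and> (AE x in lb I01. h x = hb x) \<and> integrable (lb I01) hb"
  if h: "h \<in> Lp p" for h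
 proof -
  have "\<exists>hb. hb \<in> borel_fun \<and> (AE x in lb I01. h x = hb x)"
   by (rule borel_representative[OF LpD(1)[OF h]]) auto
  then obtain hb where hb: "hb \<in> borel_fun" "AE x in lb I01. h x = hb x" by blast
  have "integrable (lb I01) hb"
   using lebesgue_on_cong_lb(1)[OF LpD(1)[OF h] hb(1) _ hb(2)] Lp_integrable(1)[OF p h] by simp
  with hb show ?thesis by blast
 qed
 obtain fb where fb [measurable]: "fb \<in> borel_fun" and fe: "AE x in lb I01. f x = fb x"
  and fi: "integrable (lb I01) fb" using rep[OF f] by blast
 obtain gb where gb [measurable]: "gb \<in> borel_fun" and ge: "AE x in lb I01. g x = gb x"
  and gi: "integrable (lb I01) gb" using rep[OF g] by blast
 have leb: "(LINT x|leb01. h x * c x) = (LINT x|lb I01. hb x * c x)"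
  if [measurable]: "hb \<in> borel_fun" "c \<in> borel_fun" and e: "AE x in lb I01. h x = hb x"
  for h hb c :: "real => real"
  by (rule lebesgue_on_AE_eq) (use e in \<open>auto elim!: eventually_mono\<close>)
 have gi': "integrable (lb {0..1}) gb" using gi by (simp add: lb_Icc)
 define F where "F x = (LINT s|lb {0..clamp_time 1 x}. gb s)" for x
 note F = indefinite_integral_AC[OF gi' zero_le_one, folded F_def [abs_def]]
 note Fi = integrable_lb_continuous[OF F(1), of 1] and [measurable] = borel_measurable_continuous_onI[OF F(1)]
 have "\<exists>k'. AE x in lb I01. fb x - F x = k'"
 proof (rule weak_derivative_zero_imp_constant)
  fix \<phi> :: "real => real" assume \<phi>: "\<phi> \<in> test_functions I01"
  note \<phi>' = test_function_deriv[OF \<phi> zero_less_one]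
  note [measurable] = test_function_measurable[OF \<phi>] test_function_measurable[OF \<phi>']
  have "(LINT x|lb I01. deriv \<phi> x * fb x) = - (LINT x|lb I01. \<phi> x * gb x)"
   using w \<phi> leb[OF fb _ fe, of "deriv \<phi>"] leb[OF gb _ ge, of \<phi>] by (auto simp: has_weak_dx_def mult.commute)
  then show "(LINT x|lb I01. deriv \<phi> x * (fb x - F x)) = 0"
   using AC_on_integrate_test[OF \<phi> zero_less_one F(3,1)]
    integrable_test_function_mult[OF \<phi>' fi] integrable_test_function_mult[OF \<phi>' Fi] by (simp add: right_diff_distrib)
 qed (use fi Fi in auto)
 then obtain k' where k': "AE x in lb I01. fb x - F x = k'" by blast
 have AS: "AC_on 0 1 (\<lambda>x. sin (k * x)) (\<lambda>x. k * cos (k * x))"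
  by (rule AC_on_C1) (auto intro!: derivative_eq_intros continuous_intros)
 have cos: "integrable (lb I01) (\<lambda>x. k * cos (k * x))" using AC_onD(2)[OF AS] by (simp add: lb_Icc)
 have cos0: "(LINT x|lb I01. k * cos (k * x)) = 0" using AC_onD(3)[OF AS, of 1] sin1 by (simp add: lb_Icc)
 have bi: "integrable (lb I01) (\<lambda>x. h x * c x)"
  if h: "integrable (lb I01) h" and c: "c \<in> borel_fun" "!!x. \<bar>c x\<bar> <= K" for h c :: "real => real" and K
  using integrable_lb_mult_bounded[OF h c(1) _ c(2)] by (simp add: mult.commute)
 have si: "integrable (lb I01) (\<lambda>x. gb x * sin (k * x))" by (rule bi[OF gi, of _ 1]) auto
 have ic: "integrable (lb I01) (\<lambda>x. F x * (k * cos (k * x)))"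
  by (rule bi[OF Fi, of _ "\<bar>k\<bar>"]) (auto simp: abs_mult mult_left_le)
 have "0 = (LINT x|lb I01. gb x * sin (k * x) + F x * (k * cos (k * x)))"
  using AC_on_mult(2)[OF F(3) AS zero_le_one] sin1 by (simp add: lb_Icc)
 also have "... = (LINT x|lb I01. gb x * sin (k * x)) + (LINT x|lb I01. F x * (k * cos (k * x)))"
  by (rule Bochner_Integration.integral_add[OF si ic])
 also have "(LINT x|lb I01. F x * (k * cos (k * x))) = (LINT x|lb I01. F x * (k * cos (k * x)) + k' * (k * cos (k * x)))"
  using ic cos cos0 by simp
 also have "... = (LINT x|lb I01. fb x * (k * cos (k * x)))"
  by (rule integral_cong_AE) (use k' in \<open>auto elim!: eventually_mono simp: algebra_simps\<close>)
 also have "... = k * (LINT x|lb I01. fb x * cos (k * x))" by (simp add: mult.left_commute)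
 finally show ?thesis using leb[OF gb _ ge, of "\<lambda>x. sin (k * x)"] leb[OF fb _ fe, of "\<lambda>x. cos (k * x)"] by simp
qed

text \<open>Variation of constants, as the product rule for the derivative with \<open>cos\<close> and for the function with \<open>\<kappa> sin\<close>; the terms with \<open>\<kappa>\<close> cancel, so \<open>\<kappa> = 0\<close> is no exception.\<close>

lemma duhamel:
 assumes D: "AC_on 0 T D D1" and D1: "AC_on 0 T D1 (\<lambda>s. - (\<kappa>\<^sup>2 * D s + Q s))"
  and init: "D 0 = 0" "D1 0 = 0" and t: "t \<in> {0..T}"
  and Q: "integrable (lb {0..T}) Q"
 shows "D1 t = - (LINT s|lb {0..t}. cos (\<kappa> * (t - s)) * Q s)"
proof -
 have t0: "0 <= t" and tT: "t <= T" using t by auto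
 have C: "AC_on 0 t (\<lambda>s. cos (\<kappa> * (t - s))) (\<lambda>s. \<kappa> * sin (\<kappa> * (t - s)))"
  by (rule AC_on_C1) (auto intro!: derivative_eq_intros continuous_intros)
 have S: "AC_on 0 t (\<lambda>s. \<kappa> * sin (\<kappa> * (t - s))) (\<lambda>s. - \<kappa>\<^sup>2 * cos (\<kappa> * (t - s)))"
  by (rule AC_on_C1) (auto intro!: derivative_eq_intros continuous_intros simp: power2_eq_square)
 note F = AC_on_mult[OF AC_on_subinterval[OF D1 tT] C t0]
 note G = AC_on_mult[OF AC_on_subinterval[OF D tT] S t0]
 have "D1 t = (LINT s|lb {0..t}. - (\<kappa>\<^sup>2 * D s + Q s) * cos (\<kappa> * (t - s)) + D1 s * (\<kappa> * sin (\<kappa> * (t - s))))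
   - (LINT s|lb {0..t}. D1 s * (\<kappa> * sin (\<kappa> * (t - s))) + D s * (- \<kappa>\<^sup>2 * cos (\<kappa> * (t - s))))"
  using F(2) G(2) init by simp
 also have "... = (LINT s|lb {0..t}. (- (\<kappa>\<^sup>2 * D s + Q s) * cos (\<kappa> * (t - s)) + D1 s * (\<kappa> * sin (\<kappa> * (t - s))))
   - (D1 s * (\<kappa> * sin (\<kappa> * (t - s))) + D s * (- \<kappa>\<^sup>2 * cos (\<kappa> * (t - s)))))"
  by (rule Bochner_Integration.integral_diff[symmetric, OF F(1) G(1)])
 also have "... = (LINT s|lb {0..t}. - (cos (\<kappa> * (t - s)) * Q s))"
  by (intro Bochner_Integration.integral_cong) (auto simp: algebra_simps)
 finally show ?thesis by simp
qed

lemma C_Lp_diff: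
 assumes p: "1 < p" and h: "h \<in> C_Lp p I" and k: "k \<in> C_Lp p I"
 shows "(\<lambda>t x. h t x - k t x) \<in> C_Lp p I"
 unfolding C_Lp_def
proof (intro CollectI conjI ballI)
 note L = h[unfolded C_Lp_def, THEN CollectD, THEN conjunct1, rule_format]
  k[unfolded C_Lp_def, THEN CollectD, THEN conjunct1, rule_format]
 fix t assume t: "t \<in> I"
 show "(\<lambda>x. h t x - k t x) \<in> Lp p" by (intro Lp_diff(1)[OF p] L t)
 have hl: "((\<lambda>s. LINT x|leb01. \<bar>h s x - h t x\<bar> powr p) \<longlongrightarrow> 0) (at t within I)"
  and kl: "((\<lambda>s. LINT x|leb01. \<bar>k s x - k t x\<bar> powr p) \<longlongrightarrow> 0) (at t within I)"
  using h k t unfolding C_Lp_def Lp_norm_tendsto_iff[OF p] by auto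
 have "((\<lambda>s. LINT x|leb01. \<bar>h s x - k s x - (h t x - k t x)\<bar> powr p) \<longlongrightarrow> 0) (at t within I)"
 proof (rule Lim_null_comparison)
  show "((\<lambda>s. 2 powr p * ((LINT x|leb01. \<bar>h s x - h t x\<bar> powr p) + (LINT x|leb01. \<bar>k s x - k t x\<bar> powr p))) \<longlongrightarrow> 0) (at t within I)"
   using tendsto_mult[OF tendsto_const tendsto_add[OF hl kl], of "2 powr p"] by simp
  show "\<forall>\<^sub>F s in at t within I. norm (LINT x|leb01. \<bar>h s x - k s x - (h t x - k t x)\<bar> powr p)
    <= 2 powr p * ((LINT x|leb01. \<bar>h s x - h t x\<bar> powr p) + (LINT x|leb01. \<bar>k s x - k t x\<bar> powr p))"
  proof (subst eventually_at_filter, rule always_eventually, intro allI impI)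
   fix s assume s: "s \<in> I"
   have "0 <= (LINT x|leb01. \<bar>h s x - k s x - (h t x - k t x)\<bar> powr p)"
    by (intro Bochner_Integration.integral_nonneg) simp
   moreover have "(LINT x|leb01. \<bar>h s x - k s x - (h t x - k t x)\<bar> powr p) = (LINT x|leb01. \<bar>(h s x - h t x) - (k s x - k t x)\<bar> powr p)"
    by (simp add: algebra_simps)
   moreover have "... <= 2 powr p * ((LINT x|leb01. \<bar>h s x - h t x\<bar> powr p) + (LINT x|leb01. \<bar>k s x - k t x\<bar> powr p))"
    by (intro Lp_diff(2)[OF p] Lp_diff(1)[OF p] L s t)
   ultimately show "norm (LINT x|leb01. \<bar>h s x - k s x - (h t x - k t x)\<bar> powr p)
    <= 2 powr p * ((LINT x|leb01. \<bar>h s x - h t x\<bar> powr p) + (LINT x|leb01. \<bar>k s x - k t x\<bar> powr p))" by simp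
  qed
 qed
 then show "((\<lambda>s. Lp_norm p (\<lambda>x. h s x - k s x - (h t x - k t x))) \<longlongrightarrow> 0) (at t within I)"
  unfolding Lp_norm_tendsto_iff[OF p] .
qed

lemma Lp_dt_C1:
 assumes p: "1 < p" and u: "u \<in> C1_Lp p I" and I: "!!t. t \<in> I ==> at t within I \<noteq> bot"
 shows "t \<in> I ==> has_Lp_dt p I u t (Lp_dt p I u t)" "Lp_dt p I u \<in> C_Lp p I"
proof -
 obtain w where w: "w \<in> C_Lp p I" "!!t. t \<in> I ==> has_Lp_dt p I u t (w t)"
  using u by (auto simp: C1_Lp_def)
 show d: "has_Lp_dt p I u t (Lp_dt p I u t)" if "t \<in> I" for t
  unfolding Lp_dt_def by (rule someI[of "has_Lp_dt p I u t", OF w(2)[OF that]])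
 have ae: "AE x in leb01. Lp_dt p I u t x = w t x" if "t \<in> I" for t
  by (rule has_Lp_dt_unique[OF p d[OF that] w(2)[OF that] that I[OF that]])
 have L: "Lp_dt p I u t \<in> Lp p" if "t \<in> I" for t by (rule has_Lp_dtD(1)[OF d[OF that]])
 have wL: "w t \<in> Lp p" if "t \<in> I" for t using w(1) that by (auto simp: C_Lp_def)
 show "Lp_dt p I u \<in> C_Lp p I"
  unfolding C_Lp_def
 proof (intro CollectI conjI ballI L)
  fix t assume t: "t \<in> I"
  have "((\<lambda>s. Lp_norm p (\<lambda>x. w s x - w t x)) \<longlongrightarrow> 0) (at t within I)" using w(1) t by (auto simp: C_Lp_def)
  moreover have "\<forall>\<^sub>F s in at t within I. Lp_norm p (\<lambda>x. w s x - w t x) = Lp_norm p (\<lambda>x. Lp_dt p I u s x - Lp_dt p I u t x)"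
  proof (subst eventually_at_filter, rule always_eventually, intro allI impI)
   fix s assume s: "s \<in> I"
   show "Lp_norm p (\<lambda>x. w s x - w t x) = Lp_norm p (\<lambda>x. Lp_dt p I u s x - Lp_dt p I u t x)"
   proof (rule Lp_norm_cong_AE(1))
    show "AE x in leb01. w s x - w t x = Lp_dt p I u s x - Lp_dt p I u t x"
     using ae[OF s] ae[OF t] by eventually_elim simp
   qed (use LpD(1)[OF Lp_diff(1)[OF p wL[OF s] wL[OF t]]] LpD(1)[OF Lp_diff(1)[OF p L[OF s] L[OF t]]] in auto)
  qed
  ultimately show "((\<lambda>s. Lp_norm p (\<lambda>x. Lp_dt p I u s x - Lp_dt p I u t x)) \<longlongrightarrow> 0) (at t within I)"
   by (rule Lim_transform_eventually)
 qed
qed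

lemma Lp_dt_C1_interval:
 assumes "1 < p" "u \<in> C1_Lp p {0..T}" "0 < T"
 shows "t \<in> {0..T} ==> has_Lp_dt p {0..T} u t (Lp_dt p {0..T} u t)" "Lp_dt p {0..T} u \<in> C_Lp p {0..T}"
 using Lp_dt_C1[OF assms(1,2)] at_within_interval_nontrivial(2)[OF _ _ assms(3)] by auto

text \<open>The cosines satisfy the Neumann condition and are admissible in the weak form; the stiffness term becomes \<open>\<kappa>\<^sup>2 m\<close>.\<close>

lemma mode_equation:
 fixes a' :: "real => real => real"
 assumes p: "1 < p" and T: "0 < T" and u: "weak_solution_upto p a u0 u1 T u"
  and a': "case_prod a' \<in> joint_borel" "!!t x. \<bar>a' t x\<bar> <= M"
  and ae: "AE t in lb {0<..<T}. AE x in lb I01. a (t, x) = a' t x"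
  and \<kappa>: "sin \<kappa> = 0"
 defines "ud \<equiv> Lp_dt p {0..T} u"
 defines "m \<equiv> \<lambda>t. LINT x|leb01. u (clamp_time T t) x * cos (\<kappa> * x)"
 defines "m1 \<equiv> \<lambda>t. LINT x|leb01. ud (clamp_time T t) x * cos (\<kappa> * x)"
 shows "AC_on 0 T m m1"
  and "\<exists>Q. Q \<in> borel_fun \<and> (\<exists>B. \<forall>t. \<bar>Q t\<bar> <= B) \<and>
   (\<forall>t\<in>{0<..<T}. Q t = (LINT x|leb01. ud t x * (a' t x * cos (\<kappa> * x)))) \<and>
   AC_on 0 T m1 (\<lambda>s. - (\<kappa>\<^sup>2 * m s + Q s))"
proof -
 have T0: "0 <= T" using T by simp
 have uW: "u t \<in> W1p p" if "t \<in> {0..T}" for t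
  using u that by (auto simp: weak_solution_upto_def C_W1p_def)
 have uC1: "u \<in> C1_Lp p {0..T}" using u by (simp add: weak_solution_upto_def)
 note ud = Lp_dt_C1_interval[OF p uC1 T, folded ud_def]
 define f where "f t = (LINT x|leb01. u t x * cos (\<kappa> * x))" for t
 define f1 where "f1 t = (LINT x|leb01. ud t x * cos (\<kappa> * x))" for t
 have cm: "(\<lambda>x. cos (\<kappa> * x)) \<in> borel_measurable leb01" by (rule borel_imp_lebesgue_on) simp
 have D: "(f has_real_derivative f1 t) (at t within {0..T})" if "t \<in> {0..T}" for t
  unfolding f_def [abs_def] f1_def by (rule pairing_DERIV[OF p ud(1)[OF that] that cm, of 1]) simp
 have f1c: "continuous_on {0..T} f1"
  unfolding f1_def [abs_def] by (rule pairing_continuous[OF p ud(2) cm, of 1]) simp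
 have meq: "m = (\<lambda>t. f (clamp_time T t))" "m1 = (\<lambda>t. f1 (clamp_time T t))"
  unfolding m_def m1_def f_def f1_def by auto
 show AC: "AC_on 0 T m m1" unfolding meq by (rule AC_on_clamped[OF D f1c T0])
 obtain Q B where Q: "Q \<in> borel_fun" "!!t. \<bar>Q t\<bar> <= B"
  "!!t. t \<in> {0<..<T} ==> Q t = (LINT x|leb01. ud t x * (a' t x * cos (\<kappa> * x)))"
  using damping_pairing_measurable[OF p T ud(2) a', of "\<lambda>x. cos (\<kappa> * x)" 1] by (auto simp del: greaterThanLessThan_iff)
 have fc: "continuous_on {0..T} f" by (rule DERIV_continuous_on[OF D])
 have mm [measurable]: "m \<in> borel_fun" unfolding meq by (rule clamp_continuous_measurable[OF fc T0])
 have "bounded (f ` {0..T})" by (intro compact_imp_bounded compact_continuous_image fc) simp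
 then obtain K where K: "\<forall>s\<in>{0..T}. \<bar>f s\<bar> <= K" unfolding bounded_iff by auto
 have mK: "\<bar>m t\<bar> <= K" for t unfolding meq using K clamp_time(1)[OF T0] by blast
 have "AC_on 0 T m1 (\<lambda>s. - (\<kappa>\<^sup>2 * m s + Q s))"
  unfolding meq(2)
 proof (rule weak_second_derivative[OF D f1c T])
  show "(\<lambda>s. \<kappa>\<^sup>2 * m s + Q s) \<in> borel_fun" using Q(1) by measurable
  show "\<bar>\<kappa>\<^sup>2 * m t + Q t\<bar> <= \<kappa>\<^sup>2 * K + B" for t
  proof -
   have "\<bar>\<kappa>\<^sup>2 * m t\<bar> <= \<kappa>\<^sup>2 * K" using mK[of t] by (simp add: abs_mult mult_left_mono)
   then show ?thesis using Q(2)[of t] by linarith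
  qed
  fix \<phi> assume \<phi>: "\<phi> \<in> test_functions {0<..<T}"
  note [measurable] = test_function_measurable[OF \<phi>] test_function_measurable[OF test_function_deriv[OF test_function_deriv[OF \<phi> T] T]] Q(1)
  have W: "(LINT t|lebesgue_on {0<..<T}. deriv (deriv \<phi>) t * f t)
    + (LINT t|lebesgue_on {0<..<T}. \<phi> t * (LINT x|leb01. weak_dx (u t) x * (- \<kappa> * sin (\<kappa> * x))))
    + (LINT t|lebesgue_on {0<..<T}. \<phi> t * (LINT x|leb01. a (t, x) * ud t x * cos (\<kappa> * x))) = 0"
   unfolding f_def ud_def
  proof (rule u[unfolded weak_solution_upto_def, THEN conjunct2, THEN conjunct2, THEN conjunct2, rule_format, OF _ _ \<phi>])
   show "((\<lambda>x. cos (\<kappa> * x)) has_real_derivative - \<kappa> * sin (\<kappa> * x)) (at x within {0..1})" for x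
    by (auto intro!: derivative_eq_intros)
  qed (intro continuous_intros)
  have "(LINT t|lebesgue_on {0<..<T}. deriv (deriv \<phi>) t * f t) = (LINT t|lb {0<..<T}. deriv (deriv \<phi>) t * m t)"
   by (rule lebesgue_on_AE_eq, simp, measurable, rule AE_lbI) (auto simp: meq clamp_time(2))
  moreover have "(LINT t|lebesgue_on {0<..<T}. \<phi> t * (LINT x|leb01. weak_dx (u t) x * (- \<kappa> * sin (\<kappa> * x)))) = (LINT t|lb {0<..<T}. \<phi> t * (\<kappa>\<^sup>2 * m t))"
  proof (rule lebesgue_on_AE_eq, simp, measurable, rule AE_lbI)
   fix t assume "t \<in> {0<..<T}"
   then have t: "t \<in> {0..T}" by auto
   note W = W1p_weak_dx[OF uW[OF t]]
   have "(LINT x|leb01. weak_dx (u t) x * (- \<kappa> * sin (\<kappa> * x))) = - \<kappa> * (LINT x|leb01. weak_dx (u t) x * sin (\<kappa> * x))"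
    by (simp add: mult.left_commute)
   also have "... = \<kappa>\<^sup>2 * m t"
    unfolding weak_dx_sine[OF p W(1,3,2) \<kappa>] using t by (simp add: meq f_def clamp_time(2) power2_eq_square)
   finally show "\<phi> t * (LINT x|leb01. weak_dx (u t) x * (- \<kappa> * sin (\<kappa> * x))) = \<phi> t * (\<kappa>\<^sup>2 * m t)" by simp
  qed simp
  moreover have "(LINT t|lebesgue_on {0<..<T}. \<phi> t * (LINT x|leb01. a (t, x) * ud t x * cos (\<kappa> * x))) = (LINT t|lb {0<..<T}. \<phi> t * Q t)"
  proof (rule lebesgue_on_AE_eq, simp, measurable)
   have in0T: "AE t in lb {0<..<T}. t \<in> {0<..<T}" by (rule AE_lbI) auto
   show "AE t in lb {0<..<T}. \<phi> t * (LINT x|leb01. a (t, x) * ud t x * cos (\<kappa> * x)) = \<phi> t * Q t"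
    using ae in0T
   proof eventually_elim
    case (elim t)
    then have t: "t \<in> {0..T}" by auto
    have udm: "ud t \<in> borel_measurable leb01" by (rule LpD(1)[OF has_Lp_dtD(1)[OF ud(1)[OF t]]])
    have "\<exists>k. k \<in> borel_fun \<and> (AE x in lb I01. ud t x = k x)"
     by (rule borel_representative[OF udm]) auto
    then obtain k where k: "k \<in> borel_fun" "AE x in lb I01. ud t x = k x" by blast
    have am [measurable]: "(\<lambda>x. a' t x) \<in> borel_fun" by (rule measurable_compose2[OF a'(1)]) auto
    let ?h = "\<lambda>x. k x * (a' t x * cos (\<kappa> * x))"
    note [measurable] = k(1)
    have h: "?h \<in> borel_fun" by measurable
    have e1: "AE x in lb I01. a (t, x) * ud t x * cos (\<kappa> * x) = ?h x"
     using elim(1) k(2) by eventually_elim simp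
    have e2: "AE x in lb I01. ud t x * (a' t x * cos (\<kappa> * x)) = ?h x"
     using k(2) by eventually_elim simp
    have "(LINT x|leb01. a (t, x) * ud t x * cos (\<kappa> * x)) = (LINT x|lb I01. ?h x)"
     by (rule lebesgue_on_AE_eq[OF _ h e1]) simp
    also have "... = (LINT x|leb01. ud t x * (a' t x * cos (\<kappa> * x)))"
     by (rule lebesgue_on_AE_eq[OF _ h e2, symmetric]) simp
    also have "... = Q t" using Q(3) elim(2) by simp
    finally show ?case by simp
   qed
  qed
  moreover have "integrable (lb {0<..<T}) (\<lambda>t. \<phi> t * (\<kappa>\<^sup>2 * m t))" "integrable (lb {0<..<T}) (\<lambda>t. \<phi> t * Q t)"
  proof -
   obtain L where L: "!!x. \<bar>\<phi> x\<bar> <= L" using test_function_bounded[OF \<phi>] by blast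
   have L0: "0 <= L" using L[of 0] by linarith
   show "integrable (lb {0<..<T}) (\<lambda>t. \<phi> t * (\<kappa>\<^sup>2 * m t))"
   proof (rule integrable_lb_bounded[of _ _ "L * (\<kappa>\<^sup>2 * K)"])
    show "\<bar>\<phi> t * (\<kappa>\<^sup>2 * m t)\<bar> <= L * (\<kappa>\<^sup>2 * K)" for t
     unfolding abs_mult using L[of t] L0 mK[of t] by (intro mult_mono) auto
   qed auto
   show "integrable (lb {0<..<T}) (\<lambda>t. \<phi> t * Q t)"
   proof (rule integrable_lb_bounded[of _ _ "L * B"])
    show "\<bar>\<phi> t * Q t\<bar> <= L * B" for t
     unfolding abs_mult using L[of t] L0 Q(2)[of t] by (intro mult_mono) auto
   qed auto
  qed
  ultimately show "(LINT t|lb {0<..<T}. deriv (deriv \<phi>) t * f (clamp_time T t)) + (LINT t|lb {0<..<T}. \<phi> t * (\<kappa>\<^sup>2 * m t + Q t)) = 0"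
   using W by (simp add: distrib_left meq(1))
 qed
 then show "\<exists>Q. Q \<in> borel_fun \<and> (\<exists>B. \<forall>t. \<bar>Q t\<bar> <= B) \<and>
   (\<forall>t\<in>{0<..<T}. Q t = (LINT x|leb01. ud t x * (a' t x * cos (\<kappa> * x)))) \<and>
   AC_on 0 T m1 (\<lambda>s. - (\<kappa>\<^sup>2 * m s + Q s))"
  using Q by (intro exI[of _ Q]) auto
qed

text \<open>Even trigonometric polynomials.\<close>

inductive cos_poly :: "(real => real) => bool" where
 cos: "cos_poly (\<lambda>\<theta>. cos (of_int n * \<theta>))"
| add: "cos_poly V ==> cos_poly W ==> cos_poly (\<lambda>\<theta>. V \<theta> + W \<theta>)"
| scale: "cos_poly V ==> cos_poly (\<lambda>\<theta>. c * V \<theta>)"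

lemma cos_poly_mult_cos: "cos_poly V ==> cos_poly (\<lambda>\<theta>. V \<theta> * cos (of_int n * \<theta>))"
proof (induction rule: cos_poly.induct)
 case (cos m)
 have "(\<lambda>\<theta>::real. cos (of_int m * \<theta>) * cos (of_int n * \<theta>)) =
   (\<lambda>\<theta>. 1 / 2 * (cos (of_int (m - n) * \<theta>) + cos (of_int (m + n) * \<theta>)))"
  by (rule ext) (simp add: cos_times_cos algebra_simps)
 then show ?case by (simp only:) (intro cos_poly.intros)
next
 case (add V W)
 then show ?case using cos_poly.add[OF add.IH] by (simp add: distrib_right)
next
 case (scale V c)
 then show ?case using cos_poly.scale[OF scale.IH, of c] by (simp add: mult.assoc)
qed

lemma cos_poly_mult: "cos_poly W ==> cos_poly V ==> cos_poly (\<lambda>\<theta>. V \<theta> * W \<theta>)"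
proof (induction rule: cos_poly.induct)
 case (add W1 W2)
 then show ?case using cos_poly.add[OF add.IH] by (simp add: distrib_left)
next
 case (scale W c)
 then show ?case using cos_poly.scale[OF scale.IH, of c] by (simp add: mult.left_commute)
qed (rule cos_poly_mult_cos)

lemma cos_poly_polynomial:
 fixes q :: "real => real"
 shows "real_polynomial_function q ==> cos_poly (\<lambda>\<theta>. q (cos \<theta>))"
proof (induction rule: real_polynomial_function.induct)
 case (linear f)
 then obtain c where "f = (\<lambda>x. x * c)" by (auto simp: real_bounded_linear)
 then show ?case using cos_poly.scale[OF cos_poly.cos[of 1], of c] by (simp add: mult.commute)
next
 case (const c)
 then show ?case using cos_poly.scale[OF cos_poly.cos[of 0], of c] by simp
next
 case (add f g)
 show ?case by (rule cos_poly.add[OF add.IH])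
next
 case (mult f g)
 show ?case by (rule cos_poly_mult[OF mult.IH(2,1)])
qed

lemma cos_poly_regular:
 assumes "cos_poly V"
 shows "continuous_on UNIV V" "\<exists>B. \<forall>\<theta>. \<bar>V \<theta>\<bar> <= B"
proof -
 have "continuous_on UNIV V \<and> (\<exists>B. \<forall>\<theta>. \<bar>V \<theta>\<bar> <= B)"
  using assms
 proof (induction rule: cos_poly.induct)
  case (cos n)
  show ?case by (intro conjI exI[of _ 1] allI) (auto intro!: continuous_intros)
 next
  case (add V W)
  then obtain B C where B: "!!\<theta>. \<bar>V \<theta>\<bar> <= B" "!!\<theta>. \<bar>W \<theta>\<bar> <= C" by blast
  have "\<bar>V \<theta> + W \<theta>\<bar> <= B + C" for \<theta> using B(1)[of \<theta>] B(2)[of \<theta>] by linarith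
  moreover have "continuous_on UNIV (\<lambda>\<theta>. V \<theta> + W \<theta>)" using add.IH by (intro continuous_intros) auto
  ultimately show ?case by blast
 next
  case (scale V c)
  then obtain B where B: "!!\<theta>. \<bar>V \<theta>\<bar> <= B" by blast
  have "\<bar>c * V \<theta>\<bar> <= \<bar>c\<bar> * B" for \<theta> unfolding abs_mult using B[of \<theta>] by (intro mult_left_mono) auto
  moreover have "continuous_on UNIV (\<lambda>\<theta>. c * V \<theta>)" using scale.IH by (intro continuous_intros) auto
  ultimately show ?case by blast
 qed
 then show "continuous_on UNIV V" "\<exists>B. \<forall>\<theta>. \<bar>V \<theta>\<bar> <= B" by blast+
qed

lemma Gronwall_zero:
 fixes N :: "real => real"
 assumes N: "continuous_on {0..T} N" "!!t. t \<in> {0..T} ==> 0 <= N t"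
  and le: "!!t. t \<in> {0..T} ==> N t <= M * integral {0..t} N" and t: "t \<in> {0..T}" and M: "0 <= M"
 shows "N t = 0"
proof -
 define y where "y s = integral {0..s} N" for s
 have Dy: "(y has_real_derivative N s) (at s within {0..T})" if "s \<in> {0..T}" for s
  unfolding y_def by (rule integral_has_real_derivative[OF N(1) that])
 have yc: "continuous_on {0..T} y" by (rule DERIV_continuous_on[OF Dy])
 have "y t * exp (- (M * t)) <= y 0 * exp (- (M * 0))"
 proof (rule DERIV_nonpos_imp_decreasing_open[of 0 t "\<lambda>s. y s * exp (- (M * s))"])
  show "0 <= t" using t by simp
  fix s assume s: "0 < s" "s < t"
  have "(y has_real_derivative N s) (at s)"
   using Dy[of s] s t at_within_Icc_at[of 0 s T] by auto
  then have D: "((\<lambda>s. y s * exp (- (M * s))) has_real_derivative (N s - M * y s) * exp (- (M * s))) (at s)"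
   by (auto intro!: derivative_eq_intros simp: algebra_simps)
  have "(N s - M * y s) * exp (- (M * s)) <= 0"
   using le[of s] s t by (intro mult_nonpos_nonneg) (auto simp: y_def)
  with D show "\<exists>y'. ((\<lambda>s. y s * exp (- (M * s))) has_real_derivative y') (at s) \<and> y' <= 0" by blast
 next
  show "continuous_on {0..t} (\<lambda>s. y s * exp (- (M * s)))"
   by (intro continuous_intros continuous_on_subset[OF yc]) (use t in auto)
 qed
 then have "y t * exp (- (M * t)) <= 0" by (simp add: y_def)
 then have "y t <= 0" by (simp add: mult_le_0_iff)
 then have "M * y t <= 0" using M by (simp add: mult_nonneg_nonpos)
 then show ?thesis using le[OF t] N(2)[OF t] unfolding y_def by linarith
qed

text \<open>The coefficient \<open>a'\<close> is a jointly Borel version of \<open>a\<close>.\<close>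

locale two_solutions =
 fixes p T M :: real and a :: "real \<times> real => real" and a' :: "real => real => real" and u0 u1 :: "real => real"
  and u w :: "real => real => real"
 assumes p: "1 < p" and T: "0 < T"
  and u: "weak_solution_upto p a u0 u1 T u" and w: "weak_solution_upto p a u0 u1 T w"
  and a'_joint: "case_prod a' \<in> joint_borel" and a'_le: "!!t x. \<bar>a' t x\<bar> <= M"
  and a_eq: "AE t in lb {0<..<T}. AE x in lb I01. a (t, x) = a' t x"
begin

definition rate :: "real => real => real" where
 "rate t x = Lp_dt p {0..T} u t x - Lp_dt p {0..T} w t x"

lemma M_nonneg: "0 <= M"
 using a'_le[of 0 0] by linarith

lemma C1: "u \<in> C1_Lp p {0..T}" "w \<in> C1_Lp p {0..T}"
 using u w by (auto simp: weak_solution_upto_def)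

lemmas dt_u = Lp_dt_C1_interval[OF p C1(1) T]
lemmas dt_w = Lp_dt_C1_interval[OF p C1(2) T]

lemma rate_C_Lp: "rate \<in> C_Lp p {0..T}"
 using C_Lp_diff[OF p dt_u(2) dt_w(2)] by (simp add: rate_def [abs_def])

lemma rate_Lp: "t \<in> {0..T} ==> rate t \<in> Lp p"
 using rate_C_Lp by (auto simp: C_Lp_def)

lemma rate_integrable: "t \<in> {0..T} ==> integrable leb01 (rate t)"
 by (rule Lp_integrable(1)[OF p rate_Lp])

lemma rate_pairing_integrable:
 assumes t: "t \<in> {0..T}" and c: "c \<in> borel_fun" "!!x. \<bar>c x\<bar> <= K"
 shows "integrable leb01 (\<lambda>x. rate t x * c x)" "\<bar>LINT x|leb01. rate t x * c x\<bar> <= K * (LINT x|leb01. \<bar>rate t x\<bar>)"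
proof -
 have ae: "AE x in leb01. \<bar>c x\<bar> <= K" using c(2) by simp
 show "integrable leb01 (\<lambda>x. rate t x * c x)" "\<bar>LINT x|leb01. rate t x * c x\<bar> <= K * (LINT x|leb01. \<bar>rate t x\<bar>)"
  by (rule integral_mult_bound_leb01[OF rate_integrable[OF t] borel_imp_lebesgue_on[OF c(1)] ae])+
qed

lemma duhamel_mode:
 fixes n :: int
 defines "\<kappa> \<equiv> of_int n * pi"
 shows "\<exists>Q. Q \<in> borel_fun \<and> (\<exists>B. \<forall>t. \<bar>Q t\<bar> <= B) \<and>
  (\<forall>s\<in>{0<..<T}. Q s = (LINT x|leb01. rate s x * (a' s x * cos (\<kappa> * x)))) \<and>
  (\<forall>t\<in>{0..T}. (LINT x|leb01. rate t x * cos (\<kappa> * x)) = - (LINT s|lb {0..t}. cos (\<kappa> * (t - s)) * Q s))"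
proof -
 define k where "k = \<kappa>"
 have k: "sin k = 0" unfolding sin_zero_iff_int2 by (auto simp: k_def \<kappa>_def)
 have even: "cos (\<kappa> * x) = cos (k * x)" for x by (simp add: k_def)
 note Mu = mode_equation[OF p T u a'_joint a'_le a_eq k]
 note Mw = mode_equation[OF p T w a'_joint a'_le a_eq k]
 define mu mw nu nw where "mu t = (LINT x|leb01. u (clamp_time T t) x * cos (k * x))"
  and "mw t = (LINT x|leb01. w (clamp_time T t) x * cos (k * x))"
  and "nu t = (LINT x|leb01. Lp_dt p {0..T} u (clamp_time T t) x * cos (k * x))"
  and "nw t = (LINT x|leb01. Lp_dt p {0..T} w (clamp_time T t) x * cos (k * x))" for t
 have "\<exists>Qu. Qu \<in> borel_fun \<and> (\<exists>B. \<forall>t. \<bar>Qu t\<bar> <= B) \<and>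
   (\<forall>t\<in>{0<..<T}. Qu t = (LINT x|leb01. Lp_dt p {0..T} u t x * (a' t x * cos (k * x)))) \<and>
   AC_on 0 T nu (\<lambda>s. - (k\<^sup>2 * mu s + Qu s))"
  unfolding nu_def [abs_def] mu_def [abs_def] by (rule Mu(2))
 then obtain Qu where Qu_all: "Qu \<in> borel_fun \<and> (\<exists>B. \<forall>t. \<bar>Qu t\<bar> <= B) \<and>
   (\<forall>t\<in>{0<..<T}. Qu t = (LINT x|leb01. Lp_dt p {0..T} u t x * (a' t x * cos (k * x)))) \<and>
   AC_on 0 T nu (\<lambda>s. - (k\<^sup>2 * mu s + Qu s))" by (rule exE)
 note Qum = Qu_all[THEN conjunct1] and Que = Qu_all[THEN conjunct2, THEN conjunct2, THEN conjunct1]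
  and Qu = Qu_all[THEN conjunct2, THEN conjunct2, THEN conjunct2]
 obtain Bu where QuB: "!!t. \<bar>Qu t\<bar> <= Bu" using Qu_all[THEN conjunct2, THEN conjunct1] by blast
 have "\<exists>Qw. Qw \<in> borel_fun \<and> (\<exists>B. \<forall>t. \<bar>Qw t\<bar> <= B) \<and>
   (\<forall>t\<in>{0<..<T}. Qw t = (LINT x|leb01. Lp_dt p {0..T} w t x * (a' t x * cos (k * x)))) \<and>
   AC_on 0 T nw (\<lambda>s. - (k\<^sup>2 * mw s + Qw s))"
  unfolding nw_def [abs_def] mw_def [abs_def] by (rule Mw(2))
 then obtain Qw where Qw_all: "Qw \<in> borel_fun \<and> (\<exists>B. \<forall>t. \<bar>Qw t\<bar> <= B) \<and>
   (\<forall>t\<in>{0<..<T}. Qw t = (LINT x|leb01. Lp_dt p {0..T} w t x * (a' t x * cos (k * x)))) \<and>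
   AC_on 0 T nw (\<lambda>s. - (k\<^sup>2 * mw s + Qw s))" by (rule exE)
 note Qwm = Qw_all[THEN conjunct1] and Qwe = Qw_all[THEN conjunct2, THEN conjunct2, THEN conjunct1]
  and Qw = Qw_all[THEN conjunct2, THEN conjunct2, THEN conjunct2]
 obtain Bw where QwB: "!!t. \<bar>Qw t\<bar> <= Bw" using Qw_all[THEN conjunct2, THEN conjunct1] by blast
 define Q where "Q t = Qu t - Qw t" for t
 have Qm: "Q \<in> borel_fun" unfolding Q_def [abs_def] using Qum Qwm by measurable
 have QB: "\<bar>Q t\<bar> <= Bu + Bw" for t unfolding Q_def using QuB[of t] QwB[of t] by linarith
 have Qi: "integrable (lb {0..T}) Q" by (rule integrable_lb_bounded[OF _ _ Qm QB]) auto
 have cm: "(\<lambda>x. cos (k * x)) \<in> borel_measurable leb01" by (rule borel_imp_lebesgue_on) simp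
 have ci: "integrable leb01 (\<lambda>x. f x * cos (k * x))" if "f \<in> Lp p" for f
  by (rule integral_mult_bound_leb01(1)[OF Lp_integrable(1)[OF p that] cm, of 1]) simp
 have uL: "Lp_dt p {0..T} u t \<in> Lp p" and wL: "Lp_dt p {0..T} w t \<in> Lp p" if "t \<in> {0..T}" for t
  using has_Lp_dtD(1)[OF dt_u(1)[OF that]] has_Lp_dtD(1)[OF dt_w(1)[OF that]] by auto
 have T0: "0 \<in> {0..T}" using T by simp
 have c0: "clamp_time T 0 = 0" by (rule clamp_time(2)[OF T0])
 have "AE x in leb01. u 0 x * cos (k * x) = w 0 x * cos (k * x)"
  using u[unfolded weak_solution_upto_def, THEN conjunct2, THEN conjunct1]
   w[unfolded weak_solution_upto_def, THEN conjunct2, THEN conjunct1] by eventually_elim simp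
 then have "mu 0 = mw 0" unfolding mu_def mw_def c0
  by (intro integral_cong_AE borel_measurable_integrable ci has_Lp_dtD(2)[OF dt_u(1)[OF T0] T0] has_Lp_dtD(2)[OF dt_w(1)[OF T0] T0])
 moreover
 have "AE x in leb01. Lp_dt p {0..T} u 0 x * cos (k * x) = Lp_dt p {0..T} w 0 x * cos (k * x)"
  using u[unfolded weak_solution_upto_def, THEN conjunct2, THEN conjunct2, THEN conjunct1]
   w[unfolded weak_solution_upto_def, THEN conjunct2, THEN conjunct2, THEN conjunct1] by eventually_elim simp
 then have "nu 0 = nw 0" unfolding nu_def nw_def c0
  by (intro integral_cong_AE borel_measurable_integrable ci uL wL T0)
 moreover have A1: "AC_on 0 T (\<lambda>t. mu t + - 1 * mw t) (\<lambda>t. nu t + - 1 * nw t)"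
  using Mu(1) Mw(1) unfolding mu_def mw_def nu_def nw_def by (intro AC_on_add AC_on_cmult)
 moreover have A2: "AC_on 0 T (\<lambda>t. nu t + - 1 * nw t) (\<lambda>s. - (k\<^sup>2 * (mu s + - 1 * mw s) + Q s))"
 proof -
  have "(\<lambda>s. - (k\<^sup>2 * (mu s + - 1 * mw s) + Q s)) = (\<lambda>s. - (k\<^sup>2 * mu s + Qu s) + - 1 * - (k\<^sup>2 * mw s + Qw s))"
   by (auto simp: Q_def algebra_simps)
  then show ?thesis using AC_on_add[OF Qu AC_on_cmult[OF Qw, of "- 1"]] by simp
 qed
 ultimately have D: "nu t + - 1 * nw t = - (LINT s|lb {0..t}. cos (k * (t - s)) * Q s)" if "t \<in> {0..T}" for t
  by (intro duhamel[OF A1 A2 _ _ that Qi]) auto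
 have "(LINT x|leb01. rate t x * cos (\<kappa> * x)) = - (LINT s|lb {0..t}. cos (\<kappa> * (t - s)) * Q s)" if t: "t \<in> {0..T}" for t
 proof -
  have "(LINT x|leb01. rate t x * cos (\<kappa> * x)) = nu t - nw t"
   unfolding even nu_def nw_def clamp_time(2)[OF t]
   using ci[OF uL[OF t]] ci[OF wL[OF t]] by (simp add: rate_def left_diff_distrib)
  then show ?thesis using D[OF t] by (simp add: even)
 qed
 moreover have "Q s = (LINT x|leb01. rate s x * (a' s x * cos (\<kappa> * x)))" if s: "s \<in> {0<..<T}" for s
 proof -
  have sT: "s \<in> {0..T}" using s by auto
  have am: "(\<lambda>x. a' s x * cos (k * x)) \<in> borel_measurable leb01"
   by (rule borel_imp_lebesgue_on) (use measurable_compose2[OF a'_joint, of "\<lambda>_. s" borel "\<lambda>x. x"] in measurable)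
  have aB: "AE x in leb01. \<bar>a' s x * cos (k * x)\<bar> <= M * 1"
   unfolding abs_mult by (intro AE_I2 mult_mono a'_le M_nonneg) auto
  note i = integral_mult_bound_leb01(1)[OF Lp_integrable(1)[OF p _] am aB]
  show ?thesis unfolding Q_def even Que[rule_format, OF s] Qwe[rule_format, OF s]
   using i[OF uL[OF sT]] i[OF wL[OF sT]] by (simp add: rate_def left_diff_distrib)
 qed
 ultimately show ?thesis using Qm QB by (intro exI[of _ Q]) blast
qed

lemma spread_measurable:
 fixes V :: "real => real"
 assumes "continuous_on UNIV V"
 shows "(\<lambda>x. a' s x * ((V (pi * (x + r)) + V (pi * (x - r))) / 2)) \<in> borel_fun"
proof -
 have [measurable]: "V \<in> borel_fun" by (rule borel_measurable_continuous_onI[OF assms])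
 have [measurable]: "(\<lambda>x. a' s x) \<in> borel_fun" by (rule measurable_compose2[OF a'_joint]) auto
 show ?thesis by measurable
qed

lemma spread_bound:
 fixes V :: "real => real"
 assumes V: "!!\<theta>. \<bar>V \<theta>\<bar> <= B"
 shows "\<bar>a' s x * ((V (pi * (x + r)) + V (pi * (x - r))) / 2)\<bar> <= M * B"
proof -
 have "\<bar>(V (pi * (x + r)) + V (pi * (x - r))) / 2\<bar> <= B"
  using V[of "pi * (x + r)"] V[of "pi * (x - r)"] abs_triangle_ineq[of "V (pi * (x + r))" "V (pi * (x - r))"]
  by simp
 then show ?thesis unfolding abs_mult by (intro mult_mono a'_le M_nonneg) auto
qed

text \<open>The addition theorem turns \<open>cos (n\<pi>(t-s)) cos (n\<pi>x)\<close> into a mean of two translates of the same cosine, so Duhamel's formula becomes linear in \<open>V\<close> and no longer mentions frequencies. This is d'Alembert's formula in dual form.\<close>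

lemma duhamel_cos_poly:
 assumes "cos_poly V" and t: "t \<in> {0..T}"
 shows "\<exists>G. integrable (lb {0..t}) G \<and>
  (\<forall>s\<in>{0<..<t}. G s = (LINT x|leb01. rate s x * (a' s x * ((V (pi * (x + (t - s))) + V (pi * (x - (t - s)))) / 2)))) \<and>
  (LINT x|leb01. rate t x * V (pi * x)) = - (LINT s|lb {0..t}. G s)"
 using assms(1)
proof (induction rule: cos_poly.induct)
 case (cos n)
 define \<kappa> where "\<kappa> = of_int n * pi"
 obtain Q B where Q: "Q \<in> borel_fun" "!!s. \<bar>Q s\<bar> <= B"
  "!!s. s \<in> {0<..<T} ==> Q s = (LINT x|leb01. rate s x * (a' s x * cos (\<kappa> * x)))"
  "(LINT x|leb01. rate t x * cos (\<kappa> * x)) = - (LINT s|lb {0..t}. cos (\<kappa> * (t - s)) * Q s)"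
  using duhamel_mode[of n] t unfolding \<kappa>_def [symmetric] by blast
 note [measurable] = Q(1)
 show ?case
 proof (intro exI[of _ "\<lambda>s. cos (\<kappa> * (t - s)) * Q s"] conjI ballI)
  show "integrable (lb {0..t}) (\<lambda>s. cos (\<kappa> * (t - s)) * Q s)"
  proof (rule integrable_lb_bounded[of _ _ "1 * B"])
   show "\<bar>cos (\<kappa> * (t - s)) * Q s\<bar> <= 1 * B" for s
    unfolding abs_mult by (intro mult_mono Q(2)) auto
  qed auto
  show "(LINT x|leb01. rate t x * cos (of_int n * (pi * x))) = - (LINT s|lb {0..t}. cos (\<kappa> * (t - s)) * Q s)"
   using Q(4) by (simp add: \<kappa>_def mult.assoc)
  fix s assume "s \<in> {0<..<t}"
  then have s: "s \<in> {0<..<T}" using t by auto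
  have "cos (\<kappa> * (t - s)) * Q s = (LINT x|leb01. cos (\<kappa> * (t - s)) * (rate s x * (a' s x * cos (\<kappa> * x))))"
   unfolding Q(3)[OF s] by simp
  also have "... = (LINT x|leb01. rate s x * (a' s x * ((cos (of_int n * (pi * (x + (t - s)))) + cos (of_int n * (pi * (x - (t - s))))) / 2)))"
  proof (rule Bochner_Integration.integral_cong[OF refl])
   fix x
   have "cos (\<kappa> * x) * cos (\<kappa> * (t - s)) = (cos (\<kappa> * x - \<kappa> * (t - s)) + cos (\<kappa> * x + \<kappa> * (t - s))) / 2"
    by (rule cos_times_cos)
   also have "... = (cos (of_int n * (pi * (x + (t - s)))) + cos (of_int n * (pi * (x - (t - s))))) / 2"
    by (simp add: \<kappa>_def algebra_simps)
   finally have eq: "cos (\<kappa> * x) * cos (\<kappa> * (t - s)) = ..." .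
   show "cos (\<kappa> * (t - s)) * (rate s x * (a' s x * cos (\<kappa> * x))) =
     rate s x * (a' s x * ((cos (of_int n * (pi * (x + (t - s)))) + cos (of_int n * (pi * (x - (t - s))))) / 2))"
    unfolding eq [symmetric] by (simp only: ac_simps)
  qed
  finally show "cos (\<kappa> * (t - s)) * Q s = ..." .
 qed
next
 case (add V W)
 obtain G H where G: "integrable (lb {0..t}) G"
  "!!s. s \<in> {0<..<t} ==> G s = (LINT x|leb01. rate s x * (a' s x * ((V (pi * (x + (t - s))) + V (pi * (x - (t - s)))) / 2)))"
  "(LINT x|leb01. rate t x * V (pi * x)) = - (LINT s|lb {0..t}. G s)"
  and H: "integrable (lb {0..t}) H"
  "!!s. s \<in> {0<..<t} ==> H s = (LINT x|leb01. rate s x * (a' s x * ((W (pi * (x + (t - s))) + W (pi * (x - (t - s)))) / 2)))"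
  "(LINT x|leb01. rate t x * W (pi * x)) = - (LINT s|lb {0..t}. H s)"
  using add.IH by blast
 obtain B C where B: "!!\<theta>. \<bar>V \<theta>\<bar> <= B" and C: "!!\<theta>. \<bar>W \<theta>\<bar> <= C"
  using cos_poly_regular(2)[OF add.hyps(1)] cos_poly_regular(2)[OF add.hyps(2)] by blast
 note c = cos_poly_regular(1)[OF add.hyps(1)] cos_poly_regular(1)[OF add.hyps(2)]
 have [measurable]: "V \<in> borel_fun" "W \<in> borel_fun"
  by (intro borel_measurable_continuous_onI c)+
 show ?case
 proof (intro exI[of _ "\<lambda>s. G s + H s"] conjI ballI)
  show "integrable (lb {0..t}) (\<lambda>s. G s + H s)" using G(1) H(1) by simp
  have iV: "integrable leb01 (\<lambda>x. rate t x * V (pi * x))" by (rule rate_pairing_integrable(1)[OF t, of _ B]) (use B in auto)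
  have iW: "integrable leb01 (\<lambda>x. rate t x * W (pi * x))" by (rule rate_pairing_integrable(1)[OF t, of _ C]) (use C in auto)
  show "(LINT x|leb01. rate t x * (V (pi * x) + W (pi * x))) = - (LINT s|lb {0..t}. G s + H s)"
   using iV iW G(1,3) H(1,3) by (simp add: distrib_left)
  fix s assume s: "s \<in> {0<..<t}"
  then have sT: "s \<in> {0..T}" using t by auto
  note i = rate_pairing_integrable(1)[OF sT spread_measurable[OF c(1)] spread_bound[OF B]]
   rate_pairing_integrable(1)[OF sT spread_measurable[OF c(2)] spread_bound[OF C]]
  show "G s + H s = (LINT x|leb01. rate s x * (a' s x * ((V (pi * (x + (t - s))) + W (pi * (x + (t - s))) + (V (pi * (x - (t - s))) + W (pi * (x - (t - s))))) / 2)))"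
   unfolding G(2)[OF s] H(2)[OF s] Bochner_Integration.integral_add[OF i, symmetric]
   by (intro Bochner_Integration.integral_cong) (simp_all add: algebra_simps add_divide_distrib)
 qed
next
 case (scale V c)
 obtain G where G: "integrable (lb {0..t}) G"
  "!!s. s \<in> {0<..<t} ==> G s = (LINT x|leb01. rate s x * (a' s x * ((V (pi * (x + (t - s))) + V (pi * (x - (t - s)))) / 2)))"
  "(LINT x|leb01. rate t x * V (pi * x)) = - (LINT s|lb {0..t}. G s)"
  using scale.IH by blast
 show ?case
 proof (intro exI[of _ "\<lambda>s. c * G s"] conjI ballI)
  show "integrable (lb {0..t}) (\<lambda>s. c * G s)" using G(1) by simp
  show "(LINT x|leb01. rate t x * (c * V (pi * x))) = - (LINT s|lb {0..t}. c * G s)"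
   using G(3) by (simp add: mult.left_commute)
  fix s assume s: "s \<in> {0<..<t}"
  show "c * G s = (LINT x|leb01. rate s x * (a' s x * ((c * V (pi * (x + (t - s))) + c * V (pi * (x - (t - s)))) / 2)))"
   unfolding G(2)[OF s] integral_mult_right_zero[symmetric]
   by (intro Bochner_Integration.integral_cong) (simp_all add: algebra_simps add_divide_distrib)
 qed
qed

definition rate_norm :: "real => real" where
 "rate_norm t = (LINT x|leb01. \<bar>rate t x\<bar>)"

lemma rate_norm_continuous: "continuous_on {0..T} rate_norm"
 unfolding rate_norm_def [abs_def] by (rule L1_norm_continuous[OF p rate_C_Lp])

lemma rate_norm_nonneg: "0 <= rate_norm t"
 unfolding rate_norm_def by (intro Bochner_Integration.integral_nonneg) simp

text \<open>The translates have the same bound as \<open>V\<close>, so only the \<open>L\<^sup>1\<close> norms of the rates remain.\<close>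

lemma cos_poly_pairing_bound:
 assumes V: "cos_poly V" "!!\<theta>. \<bar>V \<theta>\<bar> <= B" and t: "t \<in> {0..T}"
 shows "\<bar>LINT x|leb01. rate t x * V (pi * x)\<bar> <= M * B * integral {0..t} rate_norm"
proof -
 obtain G where G: "integrable (lb {0..t}) G"
  "!!s. s \<in> {0<..<t} ==> G s = (LINT x|leb01. rate s x * (a' s x * ((V (pi * (x + (t - s))) + V (pi * (x - (t - s)))) / 2)))"
  "(LINT x|leb01. rate t x * V (pi * x)) = - (LINT s|lb {0..t}. G s)"
  using duhamel_cos_poly[OF V(1) t] by blast
 have T0: "0 <= T" using T by simp
 define N where "N s = rate_norm (clamp_time T s)" for s
 have Nc: "continuous_on UNIV N" unfolding N_def [abs_def] by (rule clamped_continuous[OF rate_norm_continuous T0])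
 have "bounded (N ` {0..t})" by (intro compact_imp_bounded compact_continuous_image continuous_on_subset[OF Nc]) auto
 then obtain K where K: "\<forall>s\<in>{0..t}. \<bar>N s\<bar> <= K" unfolding bounded_iff by auto
 have Ni: "integrable (lb {0..t}) N"
  by (rule integrable_lb_bounded[of _ _ K]) (use K in \<open>auto intro: borel_measurable_continuous_onI[OF Nc]\<close>)
 have "AE s in lborel. s \<noteq> 0" "AE s in lborel. s \<noteq> t" by (rule AE_lborel_singleton)+
 then have ins: "AE s in lb {0..t}. s \<in> {0<..<t}" by (subst AE_lb) (auto elim!: eventually_elim2)
 have le: "AE s in lb {0..t}. \<bar>G s\<bar> <= M * B * N s"
  using ins
 proof eventually_elim
  case (elim s)
  then have sT: "s \<in> {0..T}" using t by auto
  show ?case unfolding G(2)[OF elim] N_def clamp_time(2)[OF sT] rate_norm_def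
   by (rule rate_pairing_integrable(2)[OF sT spread_measurable[OF cos_poly_regular(1)[OF V(1)]] spread_bound[OF V(2)]])
 qed
 have "\<bar>LINT x|leb01. rate t x * V (pi * x)\<bar> = \<bar>LINT s|lb {0..t}. G s\<bar>" unfolding G(3) by simp
 also have "... <= (LINT s|lb {0..t}. \<bar>G s\<bar>)" using integral_norm_bound[of "lb {0..t}" G] by simp
 also have "... <= (LINT s|lb {0..t}. M * B * N s)"
  using G(1) Ni by (intro integral_mono_AE le) auto
 also have "... = M * B * integral {0..t} N" using integral_lb_HK(2)[OF Ni] by simp
 also have "integral {0..t} N = integral {0..t} rate_norm"
  by (rule integral_cong) (use t in \<open>auto simp: N_def clamp_time(2)\<close>)
 finally show ?thesis .
qed

text \<open>A continuous function of \<open>x\<close> is a continuous function of \<open>cos (\<pi>x)\<close>, to which the Weierstrass theorem applies.\<close>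

lemma continuous_pairing_bound:
 assumes c: "continuous_on UNIV c" "!!x. \<bar>c x\<bar> <= 1" and t: "t \<in> {0..T}"
 shows "\<bar>LINT x|leb01. rate t x * c x\<bar> <= M * integral {0..t} rate_norm"
proof (rule field_le_epsilon)
 let ?I = "integral {0..t} rate_norm"
 fix e :: real assume e: "0 < e"
 have I0: "0 <= ?I" by (intro integral_nonneg integrable_continuous_interval continuous_on_subset[OF rate_norm_continuous])
   (use t rate_norm_nonneg in auto)
 (* the summand 1 only keeps the denominator positive *)
 define \<delta> where "\<delta> = e / (M * ?I + rate_norm t + 1)"
 have den: "0 < M * ?I + rate_norm t + 1" using M_nonneg I0 rate_norm_nonneg[of t] by (intro add_nonneg_pos) auto
 have \<delta>: "0 < \<delta>" using e den by (simp add: \<delta>_def)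
 have "continuous_on {-1..1} (\<lambda>y. c (arccos y / pi))"
  by (rule continuous_on_compose2[OF c(1)]) (auto intro!: continuous_intros continuous_on_arccos')
 then obtain q where q: "real_polynomial_function q" "!!y. y \<in> {-1..1} ==> \<bar>c (arccos y / pi) - q y\<bar> < \<delta>"
  by (rule Stone_Weierstrass_real_polynomial_function[OF compact_Icc _ \<delta>]) auto
 define V where "V \<theta> = q (cos \<theta>)" for \<theta>
 have V: "cos_poly V" unfolding V_def [abs_def] by (rule cos_poly_polynomial[OF q(1)])
 have VB: "\<bar>V \<theta>\<bar> <= 1 + \<delta>" for \<theta>
  using q(2)[of "cos \<theta>"] c(2)[of "arccos (cos \<theta>) / pi"] unfolding V_def by auto
 have close: "AE x in leb01. \<bar>c x - V (pi * x)\<bar> <= \<delta>"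
 proof -
  have "AE x in leb01. 0 < x \<and> x < 1" by (subst AE_restrict_space_iff) auto
  then show ?thesis
  proof eventually_elim
   case (elim x)
   then have "arccos (cos (pi * x)) / pi = x" using tent_id[of x] by (simp add: tent_def)
   then show ?case using q(2)[of "cos (pi * x)"] unfolding V_def by auto
  qed
 qed
 have [measurable]: "V \<in> borel_fun" "c \<in> borel_fun"
  by (intro borel_measurable_continuous_onI c cos_poly_regular(1)[OF V])+
 have i1: "integrable leb01 (\<lambda>x. rate t x * V (pi * x))" by (rule rate_pairing_integrable(1)[OF t, of _ "1 + \<delta>"]) (use VB in auto)
 have i2: "integrable leb01 (\<lambda>x. rate t x * c x)" by (rule rate_pairing_integrable(1)[OF t, of _ 1]) (use c in auto)
 have "(LINT x|leb01. rate t x * c x) = (LINT x|leb01. rate t x * V (pi * x)) + (LINT x|leb01. rate t x * (c x - V (pi * x)))"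
  using i1 i2 by (simp add: right_diff_distrib)
 moreover have "\<bar>LINT x|leb01. rate t x * (c x - V (pi * x))\<bar> <= \<delta> * rate_norm t"
  unfolding rate_norm_def by (rule integral_mult_bound_leb01(2)[OF rate_integrable[OF t] _ close]) (rule borel_imp_lebesgue_on, measurable)
 moreover have "\<bar>LINT x|leb01. rate t x * V (pi * x)\<bar> <= M * (1 + \<delta>) * ?I" by (rule cos_poly_pairing_bound[OF V VB t])
 ultimately have "\<bar>LINT x|leb01. rate t x * c x\<bar> <= M * (1 + \<delta>) * ?I + \<delta> * rate_norm t" by linarith
 also have "... = M * ?I + \<delta> * (M * ?I + rate_norm t)" by (simp add: algebra_simps)
 also have "... <= M * ?I + \<delta> * (M * ?I + rate_norm t + 1)" using \<delta> by simp
 also have "... = M * ?I + e" using den by (simp add: \<delta>_def)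
 finally show "\<bar>LINT x|leb01. rate t x * c x\<bar> <= M * ?I + e" .
qed

text \<open>Continuous functions bounded by 1 approximate the sign of the rate.\<close>

lemma rate_norm_le:
 assumes t: "t \<in> {0..T}"
 shows "rate_norm t <= M * integral {0..t} rate_norm"
proof -
 have "\<exists>k. k \<in> borel_fun \<and> (AE x in lb I01. rate t x = k x)"
  by (rule borel_representative[OF LpD(1)[OF rate_Lp[OF t]]]) auto
 then obtain k where k [measurable]: "k \<in> borel_fun" and rk: "AE x in lb I01. rate t x = k x" by blast
 have "(\<lambda>x. sgn (k x)) \<in> borel_fun" by measurable
 then obtain g where g: "!!n. continuous_on UNIV (g n)" "AE x in lborel. (\<lambda>n. g n x) \<longlonglongrightarrow> sgn (k x)"
  by (rule continuous_approximation_AE) blast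
 define c where "c n x = cut 1 (g n x)" for n :: nat and x
 have cc: "continuous_on UNIV (c n)" for n
  unfolding c_def [abs_def] cut_def by (intro continuous_intros g)
 have cB: "\<bar>c n x\<bar> <= 1" for n x unfolding c_def by (rule abs_cut_le) simp
 have [measurable]: "c n \<in> borel_fun" for n by (rule borel_measurable_continuous_onI[OF cc])
 have lim: "AE x in leb01. (\<lambda>n. rate t x * c n x) \<longlonglongrightarrow> \<bar>rate t x\<bar>"
 proof -
  have "AE x in lb I01. (\<lambda>n. g n x) \<longlonglongrightarrow> sgn (k x)" using g(2) by (auto simp: AE_lb)
  then have "AE x in lb I01. (\<lambda>n. rate t x * c n x) \<longlonglongrightarrow> \<bar>rate t x\<bar>"
   using rk
  proof eventually_elim
   case (elim x)
   have "(\<lambda>n. rate t x * c n x) \<longlonglongrightarrow> rate t x * cut 1 (sgn (k x))"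
    unfolding c_def cut_def by (intro tendsto_intros elim(1))
   moreover have "rate t x * cut 1 (sgn (k x)) = \<bar>rate t x\<bar>" using elim(2) by (auto simp: cut_def sgn_if)
   ultimately show ?case by simp
  qed
  then show ?thesis by (simp add: AE_lebesgue_on_lb)
 qed
 have "(\<lambda>n. LINT x|leb01. rate t x * c n x) \<longlonglongrightarrow> (LINT x|leb01. \<bar>rate t x\<bar>)"
 proof (rule integral_dominated_convergence[where w = "\<lambda>x. \<bar>rate t x\<bar>"])
  show "(\<lambda>x. rate t x * c n x) \<in> borel_measurable leb01" for n
   by (rule borel_measurable_integrable[OF rate_pairing_integrable(1)[OF t _ cB]]) simp
  show "AE x in leb01. norm (rate t x * c n x) <= \<bar>rate t x\<bar>" for n
   by (rule AE_I2) (simp add: abs_mult mult_left_le cB)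
 qed (use lim rate_integrable[OF t] in auto)
 then show ?thesis
  unfolding rate_norm_def [of t]
 proof (rule LIMSEQ_le_const2)
  have "(LINT x|leb01. rate t x * c n x) <= M * integral {0..t} rate_norm" for n
   using continuous_pairing_bound[OF cc[of n] cB t] by linarith
  then show "\<exists>N. \<forall>n\<ge>N. (LINT x|leb01. rate t x * c n x) <= M * integral {0..t} rate_norm" by blast
 qed
qed

lemma rate_zero:
 assumes t: "t \<in> {0..T}"
 shows "AE x in leb01. rate t x = 0"
proof -
 have "rate_norm t = 0"
  by (rule Gronwall_zero[OF rate_norm_continuous rate_norm_nonneg rate_norm_le t M_nonneg])
 then have "(LINT x|leb01. \<bar>rate t x\<bar>) = 0" by (simp add: rate_norm_def)
 then have "AE x in leb01. \<bar>rate t x\<bar> = 0"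
  by (subst (asm) integral_nonneg_eq_0_iff_AE) (use rate_integrable[OF t] in auto)
 then show ?thesis by simp
qed

text \<open>The pairing of the difference with its sign at time \<open>t\<close> has zero time derivative and vanishes initially.\<close>

lemma solutions_equal:
 assumes t: "t \<in> {0..T}"
 shows "AE x in leb01. u t x = w t x"
proof -
 have T0: "0 \<in> {0..T}" using T by simp
 note uL = has_Lp_dtD(2)[OF dt_u(1)[OF T0]] and wL = has_Lp_dtD(2)[OF dt_w(1)[OF T0]]
 have dm: "(\<lambda>x. u t x - w t x) \<in> borel_measurable leb01" by (rule LpD(1)[OF Lp_diff(1)[OF p uL[OF t] wL[OF t]]])
 define c where "c x = sgn (u t x - w t x)" for x
 have cm: "c \<in> borel_measurable leb01" unfolding c_def [abs_def] using dm by measurable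
 have cB: "\<bar>c x\<bar> <= 1" for x by (simp add: c_def sgn_if)
 have cAE: "AE x in leb01. \<bar>c x\<bar> <= 1" using cB by simp
 note i = integral_mult_bound_leb01(1)[OF Lp_integrable(1)[OF p _] cm cAE]
 define f where "f s = (LINT x|leb01. u s x * c x) - (LINT x|leb01. w s x * c x)" for s
 have D: "(f has_real_derivative 0) (at s within {0..T})" if s: "s \<in> {0..T}" for s
 proof -
  have "(f has_real_derivative (LINT x|leb01. Lp_dt p {0..T} u s x * c x) - (LINT x|leb01. Lp_dt p {0..T} w s x * c x)) (at s within {0..T})"
   unfolding f_def [abs_def] by (intro DERIV_diff pairing_DERIV[OF p _ s cm cB] dt_u(1) dt_w(1) s)
  moreover have "(LINT x|leb01. Lp_dt p {0..T} u s x * c x) = (LINT x|leb01. Lp_dt p {0..T} w s x * c x)"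
  proof (rule integral_cong_AE)
   show "AE x in leb01. Lp_dt p {0..T} u s x * c x = Lp_dt p {0..T} w s x * c x"
    using rate_zero[OF s] by eventually_elim (simp add: rate_def)
  qed (intro borel_measurable_integrable i has_Lp_dtD(1)[OF dt_u(1)[OF s]] has_Lp_dtD(1)[OF dt_w(1)[OF s]])+
  ultimately show ?thesis by simp
 qed
 have "\<exists>k. \<forall>s\<in>{0..T}. f s = k"
  by (rule has_field_derivative_zero_constant) (use D in auto)
 then have "f t = f 0" using t T0 by auto
 moreover have "f 0 = 0"
 proof -
  have "AE x in leb01. u 0 x * c x = w 0 x * c x"
   using u[unfolded weak_solution_upto_def, THEN conjunct2, THEN conjunct1]
    w[unfolded weak_solution_upto_def, THEN conjunct2, THEN conjunct1] by eventually_elim simp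
  then have "(LINT x|leb01. u 0 x * c x) = (LINT x|leb01. w 0 x * c x)"
   by (intro integral_cong_AE borel_measurable_integrable i uL wL T0)
  then show ?thesis by (simp add: f_def)
 qed
 moreover have "f t = (LINT x|leb01. \<bar>u t x - w t x\<bar>)"
 proof -
  have "f t = (LINT x|leb01. u t x * c x - w t x * c x)"
   unfolding f_def using i[OF uL[OF t]] i[OF wL[OF t]] by simp
  also have "... = (LINT x|leb01. \<bar>u t x - w t x\<bar>)"
   by (intro Bochner_Integration.integral_cong refl) (auto simp: c_def sgn_if)
  finally show ?thesis .
 qed
 ultimately have "(LINT x|leb01. \<bar>u t x - w t x\<bar>) = 0" by simp
 then have "AE x in leb01. \<bar>u t x - w t x\<bar> = 0"
  by (subst (asm) integral_nonneg_eq_0_iff_AE)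
   (use Lp_integrable(1)[OF p Lp_diff(1)[OF p uL[OF t] wL[OF t]]] in auto)
 then show ?thesis by simp
qed

end

section \<open>The displacement is a weak solution\<close>

lemma Lp_of_nn_integral:
 assumes p: "1 < p" and f: "f \<in> borel_fun"
  and fin: "(NINT x|I01. epow p (f x)) < \<infinity>"
 shows "f \<in> Lp p" "ennreal (LINT x|leb01. \<bar>f x\<bar> powr p) = (NINT x|I01. epow p (f x))"
proof -
 have m: "(\<lambda>x. \<bar>f x\<bar> powr p) \<in> borel_fun" using f by measurable
 have i: "integrable (lb I01) (\<lambda>x. \<bar>f x\<bar> powr p)"
  by (rule integrable_lb_of_powr(1)[OF p _ _ f fin]) auto
 then show "f \<in> Lp p"
  using lebesgue_on_lb(1)[OF _ m, of "I01"] borel_imp_lebesgue_on[OF f] by (simp add: Lp_def)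
 have "(LINT x|leb01. \<bar>f x\<bar> powr p) = (LINT x|lb I01. \<bar>f x\<bar> powr p)"
  by (rule lebesgue_on_lb(2)[OF _ m]) simp
 then show "ennreal (LINT x|leb01. \<bar>f x\<bar> powr p) = (NINT x|I01. epow p (f x))"
  using nn_integral_eq_integral[OF i] by simp
qed

lemma Lp_nn_integral:
 assumes p: "1 < p" and f: "f \<in> Lp p" and h: "h \<in> borel_fun" "AE x in lb I01. f x = h x"
 shows "(NINT x|I01. epow p (h x)) = ennreal (Lp_norm p f powr p)"
proof -
 have hm: "(\<lambda>x. \<bar>h x\<bar> powr p) \<in> borel_fun" using h(1) by measurable
 have fm: "(\<lambda>x. \<bar>f x\<bar> powr p) \<in> borel_measurable leb01" by (rule borel_measurable_integrable[OF LpD(2)[OF f]])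
 have ae: "AE x in lb I01. \<bar>f x\<bar> powr p = \<bar>h x\<bar> powr p" using h(2) by eventually_elim simp
 note c = lebesgue_on_cong_lb[OF fm hm _ ae]
 have i: "integrable (lb I01) (\<lambda>x. \<bar>h x\<bar> powr p)" using c(1) LpD(2)[OF f] by simp
 show ?thesis
  unfolding Lp_norm_powr[OF p] using nn_integral_eq_integral[OF i] c(2) by simp
qed

lemma has_Lp_dt_continuous:
 assumes p: "1 < p" and w: "has_Lp_dt p I u t w" and t: "t \<in> I"
 shows "((\<lambda>s. Lp_norm p (\<lambda>x. u s x - u t x)) \<longlongrightarrow> 0) (at t within I)"
 unfolding Lp_norm_tendsto_iff[OF p]
proof (rule Lim_null_comparison)
 let ?q = "\<lambda>s x. (u s x - u t x) / (s - t) - w x"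
 let ?W = "LINT x|leb01. \<bar>w x\<bar> powr p"
 note L = has_Lp_dtD(1,2)[OF w]
 have q: "((\<lambda>s. LINT x|leb01. \<bar>?q s x\<bar> powr p) \<longlongrightarrow> 0) (at t within I)"
  using has_Lp_dtD(3)[OF w] unfolding Lp_norm_tendsto_iff[OF p] .
 have st: "((\<lambda>s. \<bar>s - t\<bar> powr p) \<longlongrightarrow> 0) (at t within I)"
 proof -
  have "((\<lambda>s. \<bar>s - t\<bar>) \<longlongrightarrow> \<bar>t - t\<bar>) (at t within I)" by (intro tendsto_intros)
  then have "((\<lambda>s. \<bar>s - t\<bar>) \<longlongrightarrow> 0) (at t within I)" by simp
  then show ?thesis by (rule tendsto_zero_powrI[OF _ tendsto_const]) (use p in auto)
 qed
 have "((\<lambda>s. 2 powr p * (\<bar>s - t\<bar> powr p * (LINT x|leb01. \<bar>?q s x\<bar> powr p) + \<bar>s - t\<bar> powr p * ?W)) \<longlongrightarrow> 2 powr p * (0 * 0 + 0 * ?W)) (at t within I)"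
  by (intro tendsto_mult tendsto_add tendsto_const st q)
 then show "((\<lambda>s. 2 powr p * (\<bar>s - t\<bar> powr p * (LINT x|leb01. \<bar>?q s x\<bar> powr p) + \<bar>s - t\<bar> powr p * ?W)) \<longlongrightarrow> 0) (at t within I)"
  by simp
 show "\<forall>\<^sub>F s in at t within I. norm (LINT x|leb01. \<bar>u s x - u t x\<bar> powr p)
   <= 2 powr p * (\<bar>s - t\<bar> powr p * (LINT x|leb01. \<bar>?q s x\<bar> powr p) + \<bar>s - t\<bar> powr p * ?W)"
 proof (subst eventually_at_filter, rule always_eventually, intro allI impI)
  fix s assume s: "s \<noteq> t" "s \<in> I"
  have "(\<lambda>x. inverse (s - t) * (u s x - u t x)) \<in> Lp p" by (intro Lp_cmult Lp_diff(1)[OF p] L s t)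
  then have "(\<lambda>x. inverse (s - t) * (u s x - u t x) - w x) \<in> Lp p" by (intro Lp_diff(1)[OF p] L)
  then have qL: "?q s \<in> Lp p" by (simp add: divide_inverse mult.commute)
  have "u s x - u t x = (s - t) * ?q s x + (s - t) * w x" for x
   unfolding distrib_left [symmetric] using s(1) by simp
  then have "(LINT x|leb01. \<bar>u s x - u t x\<bar> powr p) = (LINT x|leb01. \<bar>(s - t) * ?q s x + (s - t) * w x\<bar> powr p)"
   by (simp only:)
  also have "... <= 2 powr p * ((LINT x|leb01. \<bar>(s - t) * ?q s x\<bar> powr p) + (LINT x|leb01. \<bar>(s - t) * w x\<bar> powr p))"
   by (intro Lp_add(2)[OF p] Lp_cmult qL L)
  also have "... = 2 powr p * (\<bar>s - t\<bar> powr p * (LINT x|leb01. \<bar>?q s x\<bar> powr p) + \<bar>s - t\<bar> powr p * ?W)"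
   by (simp add: abs_mult powr_mult)
  finally have "(LINT x|leb01. \<bar>u s x - u t x\<bar> powr p) <= ..." .
  moreover have "0 <= (LINT x|leb01. \<bar>u s x - u t x\<bar> powr p)"
   by (intro Bochner_Integration.integral_nonneg) simp
  ultimately show "norm (LINT x|leb01. \<bar>u s x - u t x\<bar> powr p)
   <= 2 powr p * (\<bar>s - t\<bar> powr p * (LINT x|leb01. \<bar>?q s x\<bar> powr p) + \<bar>s - t\<bar> powr p * ?W)" by simp
 qed
qed

lemma Lp_norm_tendsto_zeroI:
 fixes f :: "real => real => real"
 assumes p: "1 < p" and f: "!!s. s \<in> I ==> s \<noteq> t ==> f s \<in> borel_fun"
  and small: "!!e. 0 < e ==> \<exists>d>0. \<forall>s\<in>I. s \<noteq> t --> \<bar>s - t\<bar> < d \<longrightarrow>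
   (NINT x|I01. epow p (f s x)) <= ennreal e"
 shows "((\<lambda>s. Lp_norm p (f s)) \<longlongrightarrow> 0) (at t within I)"
 unfolding Lp_norm_tendsto_iff[OF p]
proof (rule tendstoI)
 fix e :: real assume e: "0 < e"
 then obtain d where d: "0 < d" "\<forall>s\<in>I. s \<noteq> t --> \<bar>s - t\<bar> < d \<longrightarrow>
   (NINT x|I01. epow p (f s x)) <= ennreal (e / 2)"
  using small[of "e / 2"] by auto
 show "\<forall>\<^sub>F s in at t within I. dist (LINT x|leb01. \<bar>f s x\<bar> powr p) 0 < e"
  unfolding eventually_at
 proof (intro exI[of _ d] conjI d(1) ballI impI)
  fix s assume sI: "s \<in> I" and s: "s \<noteq> t \<and> dist s t < d"
  have le: "(NINT x|I01. epow p (f s x)) <= ennreal (e / 2)"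
   using d(2) sI s by (auto simp: dist_real_def)
  have fs: "f s \<in> borel_fun" using f sI s by blast
  have fin: "(NINT x|I01. epow p (f s x)) < \<infinity>"
   by (rule le_less_trans[OF le]) simp
  have "ennreal (LINT x|leb01. \<bar>f s x\<bar> powr p) <= ennreal (e / 2)"
   unfolding Lp_of_nn_integral(2)[OF p fs fin] by (rule le)
  then have "(LINT x|leb01. \<bar>f s x\<bar> powr p) <= e / 2" using e by (subst (asm) ennreal_le_iff) auto
  moreover have "0 <= (LINT x|leb01. \<bar>f s x\<bar> powr p)" by (intro Bochner_Integration.integral_nonneg) simp
  ultimately show "dist (LINT x|leb01. \<bar>f s x\<bar> powr p) 0 < e" using e by (simp add: dist_real_def)
 qed
qed

lemma has_weak_dx_cong_AE:
 assumes p: "1 < p" and w: "has_weak_dx f1 g1" and f: "f1 \<in> Lp p" "f2 \<in> Lp p" and g: "g1 \<in> Lp p" "g2 \<in> Lp p"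
  and ae: "AE x in leb01. f1 x = f2 x" "AE x in leb01. g1 x = g2 x"
 shows "has_weak_dx f2 g2"
 unfolding has_weak_dx_def
proof (intro conjI ballI Lp_loc_integrable[OF p f(2)] Lp_loc_integrable[OF p g(2)])
 fix \<phi> :: "real => real" assume \<phi>: "\<phi> \<in> test_functions I01"
 have m: "\<phi> \<in> borel_measurable leb01" "deriv \<phi> \<in> borel_measurable leb01"
  using test_function_measurable[OF \<phi>] test_function_measurable[OF test_function_deriv[OF \<phi>]]
  by (auto intro: borel_imp_lebesgue_on)
 note L = LpD(1)[OF f(1)] LpD(1)[OF f(2)] LpD(1)[OF g(1)] LpD(1)[OF g(2)]
 have "(LINT x|leb01. f1 x * deriv \<phi> x) = (LINT x|leb01. f2 x * deriv \<phi> x)"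
  by (rule integral_cong_AE) (use m L ae(1) in \<open>auto elim!: eventually_mono\<close>)
 moreover have "(LINT x|leb01. g1 x * \<phi> x) = (LINT x|leb01. g2 x * \<phi> x)"
  by (rule integral_cong_AE) (use m L ae(2) in \<open>auto elim!: eventually_mono\<close>)
 ultimately show "(LINT x|leb01. f2 x * deriv \<phi> x) = - (LINT x|leb01. g2 x * \<phi> x)"
  using w \<phi> by (auto simp: has_weak_dx_def)
qed

context damped_evolution
begin

lemma vel_slope_borel: "vel g t \<in> borel_fun" "slope g t \<in> borel_fun"
 "displacement t \<in> borel_fun"
 by (rule vel_measurable'[of "\<lambda>_. t" borel "\<lambda>x. x"] slope_measurable'[of "\<lambda>_. t" borel "\<lambda>x. x"]
  displacement_measurable[of "\<lambda>_. t" borel "\<lambda>x. x"]; simp)+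

lemma vel_slope_Lp:
 assumes "0 <= t"
 shows "vel g t \<in> Lp p" "slope g t \<in> Lp p" "displacement t \<in> Lp p"
  "ennreal (Lp_norm p (vel g t) powr p) <= energy g t" "ennreal (Lp_norm p (slope g t) powr p) <= energy g t"
proof -
 have v: "(NINT x|I01. epow p (vel g t x)) < \<infinity>"
  by (rule le_less_trans[OF vel_energy[OF assms] fin])
 have s: "(NINT x|I01. epow p (slope g t x)) < \<infinity>"
  by (rule le_less_trans[OF slope_energy[OF assms] fin])
 note V = Lp_of_nn_integral[OF p vel_slope_borel(1) v] and S = Lp_of_nn_integral[OF p vel_slope_borel(2) s]
 show "vel g t \<in> Lp p" "slope g t \<in> Lp p" by (rule V(1), rule S(1))
 show "displacement t \<in> Lp p" by (rule Lp_of_nn_integral(1)[OF p vel_slope_borel(3) displacement_fin[OF assms]])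
 show "ennreal (Lp_norm p (vel g t) powr p) <= energy g t" "ennreal (Lp_norm p (slope g t) powr p) <= energy g t"
  unfolding Lp_norm_powr[OF p] V(2) S(2) by (intro vel_slope_energy[OF ev])+
qed

lemma vel_slope_C_Lp:
 assumes I: "I \<subseteq> {0..}"
 shows "vel g \<in> C_Lp p I" "slope g \<in> C_Lp p I"
proof -
 have "((\<lambda>s. Lp_norm p (\<lambda>x. vel g s x - vel g t x)) \<longlongrightarrow> 0) (at t within I) \<and>
   ((\<lambda>s. Lp_norm p (\<lambda>x. slope g s x - slope g t x)) \<longlongrightarrow> 0) (at t within I)" if t: "t \<in> I" for t
 proof (intro conjI Lp_norm_tendsto_zeroI[OF p])
  have t0: "0 <= t" using I t by auto
  fix e :: real assume e: "0 < e"
  obtain d where d: "0 < d" "\<forall>s\<ge>0. \<bar>s - t\<bar> < d \<longrightarrow>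
   (NINT x|I01. epow p (vel g s x - vel g t x)) <= ennreal e \<and>
   (NINT x|I01. epow p (slope g s x - slope g t x)) <= ennreal e"
   using vel_slope_continuity[OF ev fin t0 e] by (elim exE conjE) (rule that)
  show "\<exists>d>0. \<forall>s\<in>I. s \<noteq> t --> \<bar>s - t\<bar> < d --> (NINT x|I01. epow p (vel g s x - vel g t x)) <= ennreal e"
   "\<exists>d>0. \<forall>s\<in>I. s \<noteq> t --> \<bar>s - t\<bar> < d --> (NINT x|I01. epow p (slope g s x - slope g t x)) <= ennreal e"
   using d I by (intro exI[of _ d]; auto)+
 next
  show "(\<lambda>x. vel g s x - vel g t x) \<in> borel_fun" "(\<lambda>x. slope g s x - slope g t x) \<in> borel_fun" for s
   using vel_slope_borel by (intro borel_measurable_diff; simp)+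
 qed
 then show "vel g \<in> C_Lp p I" "slope g \<in> C_Lp p I"
  using I vel_slope_Lp(1,2) unfolding C_Lp_def by auto
qed

lemma displacement_has_Lp_dt:
 assumes I: "I \<subseteq> {0..}" and t: "t \<in> I"
 shows "has_Lp_dt p I displacement t (vel g t)"
 unfolding has_Lp_dt_def
proof (intro conjI ballI Lp_norm_tendsto_zeroI[OF p])
 have t0: "0 <= t" using I t by auto
 show "vel g t \<in> Lp p" by (rule vel_slope_Lp(1)[OF t0])
 show "displacement s \<in> Lp p" if "s \<in> I" for s using I that by (intro vel_slope_Lp(3)) auto
 show "(\<lambda>x. (displacement s x - displacement t x) / (s - t) - vel g t x) \<in> borel_fun" for s
  using vel_slope_borel by (intro borel_measurable_diff borel_measurable_divide borel_measurable_const; simp)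
 fix e :: real assume e: "0 < e"
 obtain d where d: "0 < d" "\<forall>s\<ge>0. \<bar>s - t\<bar> < d \<longrightarrow>
   (NINT x|I01. epow p (vel g s x - vel g t x)) <= ennreal e \<and>
   (NINT x|I01. epow p (slope g s x - slope g t x)) <= ennreal e"
  using vel_slope_continuity[OF ev fin t0 e] by (elim exE conjE) (rule that)
 show "\<exists>d>0. \<forall>s\<in>I. s \<noteq> t --> \<bar>s - t\<bar> < d \<longrightarrow>
   (NINT x|I01. epow p ((displacement s x - displacement t x) / (s - t) - vel g t x)) <= ennreal e"
 proof (intro exI[of _ d] conjI d(1) ballI impI)
  fix s assume s: "s \<in> I" "s \<noteq> t" "\<bar>s - t\<bar> < d"
  have s0: "0 <= s" using I s by auto
  show "(NINT x|I01. epow p ((displacement s x - displacement t x) / (s - t) - vel g t x)) <= ennreal e"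
  proof (rule displacement_quotient[OF s0 t0 s(2)])
   fix \<sigma> assume "\<sigma> \<in> {min s t..max s t}"
   then have "0 <= \<sigma>" "\<bar>\<sigma> - t\<bar> < d" using s0 t0 s(3) by (auto simp: min_def max_def split: if_splits)
   then show "(NINT x|I01. epow p (vel g \<sigma> x - vel g t x)) <= ennreal e" using d(2) by blast
  qed
 qed
qed

lemma displacement_C1_Lp: "I \<subseteq> {0..} ==> displacement \<in> C1_Lp p I"
 using vel_slope_C_Lp(1) displacement_has_Lp_dt unfolding C1_Lp_def by blast

lemma displacement_initial: "displacement 0 x = u0 x"
 using integral_lb_empty[of 0 0 "\<lambda>s. vel g s x"] unfolding displacement_def by linarith

lemma displacement_has_weak_dx:
 assumes init: "has_weak_dx u0 (slope g 0)" and t: "0 <= t"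
 shows "has_weak_dx (displacement t) (slope g t)"
 unfolding has_weak_dx_def
proof (intro conjI ballI Lp_loc_integrable[OF p] vel_slope_Lp t)
 fix \<psi> :: "real => real" assume \<psi>: "\<psi> \<in> test_functions I01"
 note [measurable] = test_function_measurable[OF \<psi>] test_function_measurable[OF test_function_deriv[OF \<psi> zero_less_one]]
  vel_slope_borel
 have c: "(LINT x|leb01. f x) = (LINT x|lb I01. f x)" if "f \<in> borel_fun" for f :: "real => real"
  by (rule lebesgue_on_lb(2)[OF _ that]) simp
 have "(LINT x|lb I01. u0 x * deriv \<psi> x) = - (LINT x|lb I01. slope g 0 x * \<psi> x)"
  using init \<psi> by (auto simp: has_weak_dx_def c[symmetric])
 from displacement_weak_dx[OF t \<psi> this]
 show "(LINT x|leb01. displacement t x * deriv \<psi> x) = - (LINT x|leb01. slope g t x * \<psi> x)"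
  by (subst (1 2) c) measurable
qed

lemma displacement_C_W1p:
 assumes init: "has_weak_dx u0 (slope g 0)" and I: "I \<subseteq> {0..}"
 shows "displacement \<in> C_W1p p I"
 unfolding C_W1p_def
proof (intro CollectI conjI ballI)
 fix t assume t: "t \<in> I"
 then have t0: "0 <= t" using I by auto
 note w = displacement_has_weak_dx[OF init]
 show "displacement t \<in> W1p p" using w[OF t0] vel_slope_Lp[OF t0] by (auto simp: W1p_def)
 have "((\<lambda>s. Lp_norm p (\<lambda>x. displacement s x - displacement t x) + Lp_norm p (\<lambda>x. slope g s x - slope g t x)) \<longlongrightarrow> 0 + 0) (at t within I)"
  using vel_slope_C_Lp(2)[OF I] t
  by (intro tendsto_add has_Lp_dt_continuous[OF p displacement_has_Lp_dt[OF I t] t]) (auto simp: C_Lp_def)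
 moreover have "\<forall>\<^sub>F s in at t within I. Lp_norm p (\<lambda>x. displacement s x - displacement t x) + Lp_norm p (\<lambda>x. slope g s x - slope g t x)
   = W1p_norm p (\<lambda>x. displacement s x - displacement t x)"
 proof (subst eventually_at_filter, rule always_eventually, intro allI impI)
  fix s assume "s \<in> I"
  then have s0: "0 <= s" using I by auto
  have "has_weak_dx (\<lambda>x. displacement s x - displacement t x) (\<lambda>x. slope g s x - slope g t x)"
   by (intro has_weak_dx_diff[OF p] w vel_slope_Lp s0 t0)
  from weak_dx_Lp(2)[OF this Lp_diff(1)[OF p vel_slope_Lp(2)[OF s0] vel_slope_Lp(2)[OF t0]]]
  show "Lp_norm p (\<lambda>x. displacement s x - displacement t x) + Lp_norm p (\<lambda>x. slope g s x - slope g t x)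
   = W1p_norm p (\<lambda>x. displacement s x - displacement t x)" by (simp add: W1p_norm_def)
 qed
 ultimately have "((\<lambda>s. W1p_norm p (\<lambda>x. displacement s x - displacement t x)) \<longlongrightarrow> 0 + 0) (at t within I)"
  by (rule Lim_transform_eventually)
 then show "((\<lambda>s. W1p_norm p (\<lambda>x. displacement s x - displacement t x)) \<longlongrightarrow> 0) (at t within I)" by simp
qed

lemma displacement_Lp_dt:
 assumes I: "I \<subseteq> {0..}" "t \<in> I" "at t within I \<noteq> bot"
 shows "AE x in leb01. Lp_dt p I displacement t x = vel g t x" "Lp_norm p (Lp_dt p I displacement t) = Lp_norm p (vel g t)"
proof -
 note d = displacement_has_Lp_dt[OF I(1,2)]
 have d': "has_Lp_dt p I displacement t (Lp_dt p I displacement t)"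
  unfolding Lp_dt_def by (rule someI[of "has_Lp_dt p I displacement t", OF d])
 show ae: "AE x in leb01. Lp_dt p I displacement t x = vel g t x"
  by (rule has_Lp_dt_unique[OF p d' d I(2,3)])
 show "Lp_norm p (Lp_dt p I displacement t) = Lp_norm p (vel g t)"
  by (rule Lp_norm_cong_AE(1)[OF LpD(1)[OF has_Lp_dtD(1)[OF d']] LpD(1)[OF has_Lp_dtD(1)[OF d]] ae])
qed

lemma displacement_weak_solution:
 assumes init: "has_weak_dx u0 (slope g 0)" and T: "0 < T"
  and u0': "AE x in leb01. u0 x = u0' x" and u1': "AE x in leb01. vel g 0 x = u1' x"
  and a: "AE t in lb {0<..<T}. AE x in lb I01. a (t, x) = b t x"
 shows "weak_solution_upto p a u0' u1' T displacement"
 unfolding weak_solution_upto_def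
proof (intro conjI IntI allI impI ballI)
 have I: "{0..T} \<subseteq> {0..}" by auto
 have dt: "AE x in leb01. Lp_dt p {0..T} displacement t x = vel g t x" if "t \<in> {0..T}" for t
  using displacement_Lp_dt(1)[OF I that] at_within_interval_nontrivial(2)[of t T] that T by auto
 show "displacement \<in> C_W1p p {0..T}" "displacement \<in> C1_Lp p {0..T}"
  by (intro displacement_C_W1p[OF init] displacement_C1_Lp I)+
 show "AE x in leb01. displacement 0 x = u0' x" using u0' by (simp add: displacement_initial)
 have "0 \<in> {0..T}" using T by simp
 from dt[OF this] u1' show "AE x in leb01. Lp_dt p {0..T} displacement 0 x = u1' x" by eventually_elim simp
 fix v v' \<phi> :: "real => real"
 assume v: "\<forall>x\<in>{0..1}. (v has_real_derivative v' x) (at x within {0..1})" and v': "continuous_on {0..1} v'"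
  and \<phi>: "\<phi> \<in> test_functions {0<..<T}"
 have v1: "!!x. x \<in> {0..1} ==> (v has_real_derivative v' x) (at x within {0..1})" using v by blast
 have [measurable]: "(\<lambda>x. v (tent x)) \<in> borel_fun" "(\<lambda>x. side x * v' (tent x)) \<in> borel_fun"
  "\<phi> \<in> borel_fun" "deriv (deriv \<phi>) \<in> borel_fun"
  by (rule borel_measurable_continuous_onI[OF even_extension(1)[OF v1 v']], assumption)
    (rule even_extension(2)[OF v1 v'], assumption,
    rule test_function_measurable[OF \<phi>],
    rule test_function_measurable[OF test_function_deriv[OF test_function_deriv[OF \<phi> T] T]])
 have in01: "AE x in lb I01. 0 < x \<and> x < 1" by (rule AE_lbI) auto
 have in0T: "AE t in lb {0<..<T}. t \<in> {0<..<T}" by (rule AE_lbI) auto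
 have "(LINT t|lebesgue_on {0<..<T}. deriv (deriv \<phi>) t * (LINT x|leb01. displacement t x * v x))
   = (LINT t|lb {0<..<T}. deriv (deriv \<phi>) t * (LINT x|lb I01. displacement t x * v (tent x)))"
 proof (rule lebesgue_on_AE_eq)
  have "(LINT x|leb01. displacement t x * v x) = (LINT x|lb I01. displacement t x * v (tent x))" for t
  proof (rule lebesgue_on_AE_eq)
   show "AE x in lb I01. displacement t x * v x = displacement t x * v (tent x)"
    using in01 by eventually_elim (simp add: tent_id)
  qed measurable
  then show "AE t in lb {0<..<T}. deriv (deriv \<phi>) t * (LINT x|leb01. displacement t x * v x)
    = deriv (deriv \<phi>) t * (LINT x|lb I01. displacement t x * v (tent x))" by simp
 qed measurable
 moreover have "(LINT t|lebesgue_on {0<..<T}. \<phi> t * (LINT x|leb01. weak_dx (displacement t) x * v' x))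
   = (LINT t|lb {0<..<T}. \<phi> t * (LINT x|lb I01. slope g t x * (side x * v' (tent x))))"
 proof (rule lebesgue_on_AE_eq)
  have "(LINT x|leb01. weak_dx (displacement t) x * v' x) = (LINT x|lb I01. slope g t x * (side x * v' (tent x)))"
   if t: "t \<in> {0<..<T}" for t
  proof (rule lebesgue_on_AE_eq)
   have "AE x in lb I01. weak_dx (displacement t) x = slope g t x"
    using weak_dx_AE(1)[OF displacement_has_weak_dx[OF init, of t]] t by (simp add: AE_lebesgue_on_lb)
   then show "AE x in lb I01. weak_dx (displacement t) x * v' x = slope g t x * (side x * v' (tent x))"
    using in01 by eventually_elim (simp add: tent_id side_pos)
  qed measurable
  then show "AE t in lb {0<..<T}. \<phi> t * (LINT x|leb01. weak_dx (displacement t) x * v' x)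
    = \<phi> t * (LINT x|lb I01. slope g t x * (side x * v' (tent x)))"
   by (intro AE_lbI) auto
 qed measurable
 moreover have "(LINT t|lebesgue_on {0<..<T}. \<phi> t * (LINT x|leb01. a (t, x) * Lp_dt p {0..T} displacement t x * v x))
   = (LINT t|lb {0<..<T}. \<phi> t * (LINT x|lb I01. b t x * vel g t x * v (tent x)))"
 proof (rule lebesgue_on_AE_eq)
  show "AE t in lb {0<..<T}. \<phi> t * (LINT x|leb01. a (t, x) * Lp_dt p {0..T} displacement t x * v x)
    = \<phi> t * (LINT x|lb I01. b t x * vel g t x * v (tent x))"
   using a in0T
  proof eventually_elim
   case (elim t)
   have "(LINT x|leb01. a (t, x) * Lp_dt p {0..T} displacement t x * v x) = (LINT x|lb I01. b t x * vel g t x * v (tent x))"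
   proof (rule lebesgue_on_AE_eq)
    have "AE x in lb I01. Lp_dt p {0..T} displacement t x = vel g t x"
     using dt[of t] elim(2) by (simp add: AE_lebesgue_on_lb)
    then show "AE x in lb I01. a (t, x) * Lp_dt p {0..T} displacement t x * v x = b t x * vel g t x * v (tent x)"
     using elim(1) in01 by eventually_elim (simp add: tent_id)
   qed measurable
   then show ?case by simp
  qed
 qed measurable
 ultimately show "(LINT t|lebesgue_on {0<..<T}. deriv (deriv \<phi>) t * (LINT x|leb01. displacement t x * v x))
    + (LINT t|lebesgue_on {0<..<T}. \<phi> t * (LINT x|leb01. weak_dx (displacement t) x * v' x))
    + (LINT t|lebesgue_on {0<..<T}. \<phi> t * (LINT x|leb01. a (t, x) * Lp_dt p {0..T} displacement t x * v x)) = 0"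
  using displacement_weak_form[OF T v1 v' \<phi>] by simp
qed

end

section \<open>The damping coefficient\<close>

lemma AE_lebesgue_on_lborel:
 "S \<in> sets borel ==> (AE x in lebesgue_on S. P x) \<longleftrightarrow> (AE x in lborel. x \<in> S --> P x)"
 by (subst AE_restrict_space_iff) (auto simp: AE_completion_iff)

lemma Linf_AE_le:
 assumes a: "a \<in> Linf Q"
 shows "AE z in lebesgue_on Q. \<bar>a z\<bar> <= \<bar>Linf_norm Q a\<bar>"
proof -
 have "esssup (lebesgue_on Q) (\<lambda>z. ereal \<bar>a z\<bar>) < \<infinity>" using a by (simp add: Linf_def)
 then have "ereal \<bar>a z\<bar> <= esssup (lebesgue_on Q) (\<lambda>z. ereal \<bar>a z\<bar>) ==> \<bar>a z\<bar> <= \<bar>Linf_norm Q a\<bar>" for z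
  unfolding Linf_norm_def by (cases "esssup (lebesgue_on Q) (\<lambda>z. ereal \<bar>a z\<bar>)") auto
 then show ?thesis using esssup_AE[of "\<lambda>z. ereal \<bar>a z\<bar>" "lebesgue_on Q"] by (auto elim!: eventually_mono)
qed

text \<open>A Borel version of \<open>a\<close> is clamped so that the bounds hold everywhere, and reflected. The upper bound is enlarged by \<open>lam\<close> so that clamping from below respects it.\<close>

lemma damping_representative:
 fixes a :: "real \<times> real => real"
 assumes p: "1 < p" and lam: "0 < lam" and a: "a \<in> Linf ({0<..} \<times> I01)" "Linf_norm ({0<..} \<times> I01) a = M"
  and nonneg: "AE z in lebesgue_on ({0<..} \<times> I01). 0 <= a z"
  and sub: "{c<..<d} \<subseteq> I01" and low: "AE z in lebesgue_on ({0<..} \<times> {c<..<d}). lam <= a z"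
 shows "\<exists>b. circle_damping b (\<bar>M\<bar> + lam) p \<and> (\<forall>s. \<forall>x\<in>{c<..<d}. lam <= b s x) \<and>
  (AE t in lb {0<..}. AE x in lb I01. a (t, x) = b t x)"
proof -
 let ?Q = "{0<..} \<times> I01 :: (real \<times> real) set"
 let ?M = "\<bar>M\<bar> + lam"
 have Q: "?Q \<in> sets borel" "({0<..} \<times> {c<..<d} :: (real \<times> real) set) \<in> sets borel"
  by (intro borel_open open_Times; simp)+
 have "a \<in> borel_measurable (lebesgue_on ?Q)" using a(1) by (simp add: Linf_def)
 then have "(\<lambda>z. indicator ?Q z *\<^sub>R a z) \<in> borel_measurable lebesgue"
  using Q(1) by (subst (asm) borel_measurable_restrict_space_iff) auto
 then obtain r where r: "r \<in> borel_measurable lborel" "AE z in lborel. indicator ?Q z *\<^sub>R a z = r z"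
  using completion_ex_borel_measurable_real by blast
 have rb: "r \<in> joint_borel" using r(1) by (simp add: borel_prod)
 define b0 where "b0 t x = (if x \<in> {c<..<d} then max lam (min ?M (r (t, x))) else max 0 (min ?M (r (t, x))))" for t x
 define b where "b t x = b0 t (tent x)" for t x
 have rm [measurable]: "(\<lambda>z. r (f z, h z)) \<in> borel_measurable N"
  if "f \<in> borel_measurable N" "h \<in> borel_measurable N" for f h :: "_ => real" and N
  by (rule measurable_compose[OF measurable_Pair[OF that] rb])
 have cd: "circle_damping b ?M p"
 proof
  show "case_prod b \<in> joint_borel" unfolding b_def b0_def by measurable
 qed (use p lam in \<open>auto simp: b_def b0_def\<close>)
 have b_low: "lam <= b s x" if "x \<in> {c<..<d}" for s x
 proof -
  have "tent x = x" using that sub by (intro tent_id) auto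
  then show ?thesis using that by (simp add: b_def b0_def)
 qed
 have "AE z in lborel. z \<in> ?Q --> a z = b (fst z) (snd z)"
  using r(2) Linf_AE_le[OF a(1), unfolded AE_lebesgue_on_lborel[OF Q(1)]]
   nonneg[unfolded AE_lebesgue_on_lborel[OF Q(1)]] low[unfolded AE_lebesgue_on_lborel[OF Q(2)]]
 proof eventually_elim
  case (elim z)
  show ?case
  proof
   assume z: "z \<in> ?Q"
   then have zz: "z = (fst z, snd z)" "0 < fst z" "snd z \<in> {0..1}" "tent (snd z) = snd z"
    by (auto intro: tent_id)
   have "r z = a z" "0 <= a z" "a z <= ?M" "snd z \<in> {c<..<d} ==> lam <= a z"
    using elim z zz lam a(2) by auto
   then show "a z = b (fst z) (snd z)" unfolding b_def b0_def zz(4) using zz(1) by auto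
  qed
 qed
 then have "AE z in lborel \<Otimes>\<^sub>M lborel. z \<in> ?Q --> a z = b (fst z) (snd z)" unfolding lborel_prod .
 then have "AE t in lborel. AE x in lborel. (t, x) \<in> ?Q --> a (t, x) = b t x"
  using lborel_pair.AE_pair by fastforce
 then have "AE t in lb {0<..}. AE x in lb I01. a (t, x) = b t x"
  by (auto simp: AE_lb elim!: eventually_mono)
 then show ?thesis using cd b_low by blast
qed

section \<open>Exponential decay\<close>

text \<open>The initial value of \<open>g\<close> is the velocity plus the slope on the interval, and the velocity minus the slope on its mirror image.\<close>

lemma riemann_datum_bound:
 assumes p: "1 < p" and u1: "u1 \<in> Lp p" and w0: "w0 \<in> Lp p"
  and u1b [measurable]: "u1b \<in> borel_fun" and u1_eq: "AE x in lb I01. u1 x = u1b x"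
  and w0b [measurable]: "w0b \<in> borel_fun" and w0_eq: "AE x in lb I01. w0 x = w0b x"
 defines "g0 \<equiv> \<lambda>z. u1b (tent z) + side z * w0b (tent z)"
 shows "(NINT y|circ. epow p (g0 y))
  <= ennreal (4 * 2 powr p * (Lp_norm p u1 + Lp_norm p w0) powr p)"
proof -
 let ?A = "Lp_norm p u1" and ?B = "Lp_norm p w0"
 let ?c = "2 * 2 powr p :: real"
 have g0m [measurable]: "g0 \<in> borel_fun" unfolding g0_def by measurable
 have "(NINT y|circ. epow p (g0 y))
   = (NINT y|I01. epow p (g0 y) + epow p (g0 (- y)))"
  by (rule circle_split) (simp_all add: g0_def)
 also have "... <= (NINT y|I01. ennreal ?c * (epow p (u1b y) + epow p (w0b y)))"
 proof (rule nn_integral_lb_mono)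
  fix y :: real assume "y \<in> I01"
  then have "g0 y = u1b y + w0b y" "g0 (- y) = u1b y - w0b y"
   by (auto simp: g0_def tent_id side_pos)
  then have "\<bar>g0 y\<bar> powr p + \<bar>g0 (- y)\<bar> powr p <= ?c * (\<bar>u1b y\<bar> powr p + \<bar>w0b y\<bar> powr p)"
   using abs_add_powr_le[OF p, of "u1b y" "w0b y"] abs_diff_powr_le[OF p, of "u1b y" "w0b y"] by simp
  then have "ennreal (\<bar>g0 y\<bar> powr p + \<bar>g0 (- y)\<bar> powr p) <= ennreal (?c * (\<bar>u1b y\<bar> powr p + \<bar>w0b y\<bar> powr p))"
   by (rule ennreal_leI)
  then show "epow p (g0 y) + epow p (g0 (- y))
    <= ennreal ?c * (epow p (u1b y) + epow p (w0b y))"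
   by (simp only: ennreal_plus[symmetric] powr_ge_zero ennreal_mult[symmetric] mult_nonneg_nonneg zero_le_numeral add_nonneg_nonneg)
 qed simp
 also have "... = ennreal ?c * ((NINT y|I01. epow p (u1b y)) + (NINT y|I01. epow p (w0b y)))"
  by (subst nn_integral_cmult, measurable, subst nn_integral_add) auto
 also have "... = ennreal ?c * (ennreal (?A powr p) + ennreal (?B powr p))"
  by (simp only: Lp_nn_integral[OF p u1 u1b u1_eq] Lp_nn_integral[OF p w0 w0b w0_eq])
 also have "... = ennreal (?c * (?A powr p + ?B powr p))"
  by (simp only: ennreal_plus[symmetric] powr_ge_zero ennreal_mult[symmetric] mult_nonneg_nonneg zero_le_numeral add_nonneg_nonneg)
 also have "... <= ennreal (?c * (2 * (?A + ?B) powr p))"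
 proof (intro ennreal_leI mult_left_mono)
  have "?A powr p <= (?A + ?B) powr p" "?B powr p <= (?A + ?B) powr p"
   using p by (auto intro!: powr_mono2 simp: Lp_norm_nonneg)
  then show "?A powr p + ?B powr p <= 2 * (?A + ?B) powr p" by linarith
 qed simp
 finally show ?thesis by (simp add: mult.assoc mult.left_commute)
qed

lemma powr_root_bound:
 fixes X K S :: real
 assumes p: "1 < p" and "0 <= X" "0 <= K" "0 <= S" and le: "X powr p <= K * S powr p"
 shows "X <= K powr (1 / p) * S"
proof -
 have "X = (X powr p) powr (1 / p)" using p assms(2) by (simp add: powr_powr)
 also have "... <= (K * S powr p) powr (1 / p)" using p by (intro powr_mono2 le) auto
 also have "... = K powr (1 / p) * S" using p assms by (simp add: powr_mult powr_powr)
 finally show ?thesis .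
qed

theorem theorem5p1:
 fixes p \<epsilon>\<^sub>0 lam M :: real
 assumes "1 < p" and "0 < \<epsilon>\<^sub>0" and "0 < lam"
 shows "\<exists>C>0. \<exists>\<gamma>>0.
  \<forall>(a :: real \<times> real \<Rightarrow> real) x\<^sub>0.
   a \<in> Linf ({0<..} \<times> {0<..<1}) \<and> Linf_norm ({0<..} \<times> {0<..<1}) a = M \<and>
   (AE z in lebesgue_on ({0<..} \<times> {0<..<1}). 0 \<le> a z) \<and>
   x\<^sub>0 \<in> {0<..<1} \<and> {x\<^sub>0 - \<epsilon>\<^sub>0<..<x\<^sub>0 + \<epsilon>\<^sub>0} \<subseteq> {0<..<1} \<and>
   (AE z in lebesgue_on ({0<..} \<times> {x\<^sub>0 - \<epsilon>\<^sub>0<..<x\<^sub>0 + \<epsilon>\<^sub>0}). lam \<le> a z) \<longrightarrow>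
   (\<forall>u\<^sub>0\<in>W1p p. \<forall>u\<^sub>1\<in>Lp p.
    \<exists>u. u \<in> C_W1p p {0..} \<inter> C1_Lp p {0..} \<and> weak_solution p a u\<^sub>0 u\<^sub>1 u \<and>
     (\<forall>w. weak_solution p a u\<^sub>0 u\<^sub>1 w \<longrightarrow> (\<forall>t\<ge>0. AE x in leb01. w t x = u t x)) \<and>
     (\<forall>t\<ge>0. Lp_norm p (Lp_dt p {0..} u t) + Lp_norm p (weak_dx (u t))
       \<le> C * exp (- \<gamma> * t) * (Lp_norm p u\<^sub>1 + Lp_norm p (weak_dx u\<^sub>0))))"
proof -
 note p = \<open>1 < p\<close>
 let ?M = "\<bar>M\<bar> + lam"
 have "0 <= ?M" using \<open>0 < lam\<close> by simp
 from energy_decay[OF p \<open>0 < lam\<close> \<open>0 < \<epsilon>\<^sub>0\<close> this]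
 obtain C0 \<gamma>0 where C0: "0 < C0" and \<gamma>0: "0 < \<gamma>0"
  and decay: "!!b x0 g t. circle_damping b ?M p ==> {x0 - \<epsilon>\<^sub>0<..<x0 + \<epsilon>\<^sub>0} \<subseteq> I01 ==>
   \<forall>s. \<forall>x\<in>{x0 - \<epsilon>\<^sub>0<..<x0 + \<epsilon>\<^sub>0}. lam <= b s x ==> circle_damping.evolution b g ==> 0 <= t ==>
   circle_damping.energy p g 0 < \<infinity> ==>
   circle_damping.energy p g t <= ennreal (C0 * exp (- \<gamma>0 * t)) * circle_damping.energy p g 0"
  by blast
 define K where "K = C0 * (4 * 2 powr p)"
 have K: "0 < K" using C0 by (simp add: K_def)
 (* the power is undone by a p-th root; the factor 2 is for the two norms *)
 define C \<gamma> where "C = 2 * K powr (1 / p)" and "\<gamma> = \<gamma>0 / p"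
 have C: "0 < C" and \<gamma>: "0 < \<gamma>" using K \<gamma>0 p by (auto simp: C_def \<gamma>_def)
 show ?thesis
 proof (rule exI[of _ C], rule conjI[OF C], rule exI[of _ \<gamma>], rule conjI[OF \<gamma>], intro allI impI ballI, elim conjE)
  fix a :: "real \<times> real => real" and x0 :: real and u0 u1
  assume a: "a \<in> Linf ({0<..} \<times> I01)" "Linf_norm ({0<..} \<times> I01) a = M"
   and nonneg: "AE z in lebesgue_on ({0<..} \<times> I01). 0 <= a z"
   and sub: "{x0 - \<epsilon>\<^sub>0<..<x0 + \<epsilon>\<^sub>0} \<subseteq> I01"
   and low: "AE z in lebesgue_on ({0<..} \<times> {x0 - \<epsilon>\<^sub>0<..<x0 + \<epsilon>\<^sub>0}). lam <= a z"
   and u0: "u0 \<in> W1p p" and u1: "u1 \<in> Lp p"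
  obtain b where cd: "circle_damping b ?M p" and b_low: "\<forall>s. \<forall>x\<in>{x0 - \<epsilon>\<^sub>0<..<x0 + \<epsilon>\<^sub>0}. lam <= b s x"
   and ab: "AE t in lb {0<..}. AE x in lb I01. a (t, x) = b t x"
   using damping_representative[OF p \<open>0 < lam\<close> a nonneg sub low] by blast
  interpret circle_damping b ?M p by (rule cd)
  define w0 where "w0 = weak_dx u0"
  note W = W1p_weak_dx[OF u0, folded w0_def]
  have rep: "\<exists>h. h \<in> borel_fun \<and> (AE x in lb I01. f x = h x)" if "f \<in> Lp p" for f
   by (rule borel_representative[OF LpD(1)[OF that]]) auto
  obtain u0b where u0b: "u0b \<in> borel_fun" "AE x in lb I01. u0 x = u0b x" using rep[OF W(1)] by blast
  obtain u1b where u1b: "u1b \<in> borel_fun" "AE x in lb I01. u1 x = u1b x" using rep[OF u1] by blast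
  obtain w0b where w0b: "w0b \<in> borel_fun" "AE x in lb I01. w0 x = w0b x" using rep[OF W(3)] by blast
  define S where "S = Lp_norm p u1 + Lp_norm p w0"
  have S: "0 <= S" by (simp add: S_def Lp_norm_nonneg)
  define g0 where "g0 z = u1b (tent z) + side z * w0b (tent z)" for z
  have g0m [measurable]: "g0 \<in> borel_fun" unfolding g0_def [abs_def] using u1b(1) w0b(1) by measurable
  have g0_powr: "(NINT y|circ. epow p (g0 y)) <= ennreal (4 * 2 powr p * S powr p)"
   using riemann_datum_bound[OF p u1 W(3) u1b w0b] by (simp add: g0_def [abs_def] S_def)
  have "(NINT y|circ. ennreal \<bar>g0 y\<bar>) <= (NINT y|circ. 1 + epow p (g0 y))"
  proof (rule nn_integral_mono)
   fix y
   have "ennreal \<bar>g0 y\<bar> <= ennreal (1 + \<bar>g0 y\<bar> powr p)" by (rule ennreal_leI[OF abs_le_one_plus_powr[OF p]])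
   then show "ennreal \<bar>g0 y\<bar> <= 1 + epow p (g0 y)" by (simp add: ennreal_plus)
  qed
  also have "... = 2 + (NINT y|circ. epow p (g0 y))"
   by (subst nn_integral_add) (auto simp: emeasure_lb)
  also have "... <= 2 + ennreal (4 * 2 powr p * S powr p)" by (rule add_left_mono[OF g0_powr])
  also have "... < \<infinity>" by simp
  finally have g0_fin: "(NINT y|circ. ennreal \<bar>g0 y\<bar>) < \<infinity>" .
  have "g0 (y + 2) = g0 y" for y by (simp add: g0_def)
  then obtain g where ev: "evolution g" and g_init: "!!y. g 0 y = g0 y"
   using evolution_exists[OF g0m _ g0_fin] by blast
  have E0: "energy g 0 <= ennreal (4 * 2 powr p * S powr p)"
   using g0_powr by (simp add: energy_def g_init)
  have fin: "energy g 0 < \<infinity>" by (rule le_less_trans[OF E0]) simp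
  have u0b_fin: "(NINT x|I01. epow p (u0b x)) < \<infinity>"
   unfolding Lp_nn_integral[OF p W(1) u0b] by simp
  interpret damped_evolution b ?M p g u0b by unfold_locales (use ev fin u0b(1) u0b_fin in auto)
  have in01: "AE x in lb I01. 0 < x \<and> x < 1" by (rule AE_lbI) auto
  have "AE x in lb I01. vel g 0 x = u1 x"
   using in01 u1b(2) by eventually_elim (simp add: vel_def g_init g0_def tent_id side_pos)
  then have vel0: "AE x in leb01. vel g 0 x = u1 x" by (simp add: AE_lebesgue_on_lb)
  have "AE x in lb I01. w0 x = slope g 0 x"
   using in01 w0b(2) by eventually_elim (simp add: slope_def g_init g0_def tent_id side_pos)
  then have slope0: "AE x in leb01. w0 x = slope g 0 x" by (simp add: AE_lebesgue_on_lb)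
  have u0_eq: "AE x in leb01. u0b x = u0 x" "AE x in leb01. u0 x = u0b x"
   using u0b(2) by (auto simp: AE_lebesgue_on_lb eq_commute)
  have "u0b \<in> Lp p" by (rule Lp_of_nn_integral(1)[OF p u0b(1) u0b_fin])
  then have init: "has_weak_dx u0b (slope g 0)"
   by (intro has_weak_dx_cong_AE[OF p W(2) W(1) _ W(3) vel_slope_Lp(2)[OF order_refl] u0_eq(2) slope0])
  have aT: "AE t in lb {0<..<T}. AE x in lb I01. a (t, x) = b t x" for T
   by (rule AE_lb_subset[OF ab]) auto
  have solT: "weak_solution_upto p a u0 u1 T displacement" if "0 < T" for T
   by (rule displacement_weak_solution[OF init that u0_eq(1) vel0 aT])
  have "\<forall>t\<ge>0. AE x in leb01. w t x = displacement t x" if w: "weak_solution p a u0 u1 w" for w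
  proof (intro allI impI)
   fix t :: real assume t: "0 <= t"
   have T: "0 < t + 1" using t by simp
   interpret two_solutions p "t + 1" ?M a b u0 u1 w displacement
   proof
    show "weak_solution_upto p a u0 u1 (t + 1) w" using w T by (simp add: weak_solution_def)
    show "\<bar>b s x\<bar> <= ?M" for s x using b_nonneg[of s x] b_le[of s x] by simp
   qed (use p T b_joint aT solT in auto)
   show "AE x in leb01. w t x = displacement t x" by (rule solutions_equal) (use t in auto)
  qed
  moreover have "Lp_norm p (Lp_dt p {0..} displacement t) + Lp_norm p (weak_dx (displacement t))
    <= C * exp (- \<gamma> * t) * (Lp_norm p u1 + Lp_norm p (weak_dx u0))" if t: "0 <= t" for t
  proof -
   let ?e = "exp (- \<gamma>0 * t)"
   have "energy g t <= ennreal (C0 * ?e) * energy g 0" by (rule decay[OF cd sub b_low ev t fin])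
   also have "... <= ennreal (C0 * ?e) * ennreal (4 * 2 powr p * S powr p)" by (rule mult_left_mono[OF E0]) simp
   also have "... = ennreal (C0 * ?e * (4 * 2 powr p * S powr p))"
    by (rule ennreal_mult[symmetric]) (use C0 in auto)
   also have "C0 * ?e * (4 * 2 powr p * S powr p) = K * ?e * S powr p" by (simp add: K_def)
   finally have E: "energy g t <= ennreal (K * ?e * S powr p)" .
   have Ke: "0 <= K * ?e" using K by simp
   have root: "(K * ?e) powr (1 / p) = K powr (1 / p) * exp (- \<gamma> * t)"
    using K p by (simp add: powr_mult exp_powr_real \<gamma>_def)
   have bound: "X <= K powr (1 / p) * exp (- \<gamma> * t) * S" if X: "0 <= X" "ennreal (X powr p) <= energy g t" for X
   proof -
    have "ennreal (X powr p) <= ennreal (K * ?e * S powr p)" by (rule order_trans[OF X(2) E])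
    then have "X powr p <= K * ?e * S powr p" using Ke by (subst (asm) ennreal_le_iff) auto
    from powr_root_bound[OF p X(1) Ke S this] show ?thesis unfolding root .
   qed
   have "Lp_norm p (Lp_dt p {0..} displacement t) = Lp_norm p (vel g t)"
    by (rule displacement_Lp_dt(2)) (use t at_within_interval_nontrivial(1)[OF t] in auto)
   moreover have "Lp_norm p (weak_dx (displacement t)) = Lp_norm p (slope g t)"
    by (rule weak_dx_Lp(2)[OF displacement_has_weak_dx[OF init t] vel_slope_Lp(2)[OF t]])
   moreover have "C * exp (- \<gamma> * t) * S = 2 * (K powr (1 / p) * exp (- \<gamma> * t) * S)" by (simp add: C_def)
   ultimately show ?thesis
    using bound[OF Lp_norm_nonneg vel_slope_Lp(4)[OF t]] bound[OF Lp_norm_nonneg vel_slope_Lp(5)[OF t]]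
    unfolding S_def w0_def by linarith
  qed
  moreover have "displacement \<in> C_W1p p {0..} \<inter> C1_Lp p {0..}"
   by (intro IntI displacement_C_W1p[OF init] displacement_C1_Lp order_refl)
  moreover have "weak_solution p a u0 u1 displacement" using solT by (simp add: weak_solution_def)
  ultimately show "\<exists>u. u \<in> C_W1p p {0..} \<inter> C1_Lp p {0..} \<and> weak_solution p a u0 u1 u \<and>
     (\<forall>w. weak_solution p a u0 u1 w --> (\<forall>t\<ge>0. AE x in leb01. w t x = u t x)) \<and>
     (\<forall>t\<ge>0. Lp_norm p (Lp_dt p {0..} u t) + Lp_norm p (weak_dx (u t))
       <= C * exp (- \<gamma> * t) * (Lp_norm p u1 + Lp_norm p (weak_dx u0)))"
   by (intro exI[of _ displacement]) blast
 qed
qed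

end
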